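(* Let $n\ge 2$, let $B_1\subset\mathbb{R}^n$ be the open unit ball, and let $U\subset S^{n\times n}$ be a convex neighborhood. Suppose that $u\in W^{2,\infty}(B_1)$ satisfies $$\int_{B_1}F^{ij}(D^2u)\,\eta_{ij}\,dx=0\qquad\text{for all }\eta\in C_0^\infty(B_1),$$ with $D^2u(x)\in U$ for almost every $x\in B_1$, where $F^{ij}=\frac{\partial F}{\partial u_{ij}}$ and $F$ is smooth and either uniformly convex or uniformly concave on $U$ with constant $\Lambda>0$. Then there exists $p_0\in(2,\infty)$ such that for any open set $\Omega'$ compactly contained in $B_1$, $u\in W^{3,p_0}(\Omega')$ and $$\|u\|_{W^{3,p_0}(\Omega')}\le C\left(\Lambda,\|b^{ij,kl}\|_{L^\infty(U)},d(\Omega',\partial B_1)\right)\|u\|_{W^{2,2}(B_1)},$$ where $d(\Omega',\partial B_1)=\inf_{x\in\Omega'}\mathrm{dist}(x,\partial B_1)$.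
   Context: $S^{n\times n}$ is the space of real symmetric $n\times n$ matrices with the Hilbert--Schmidt norm $|\cdot|$. Subscripts on functions denote partial derivatives and repeated indices are summed. Smooth and uniformly convex on $U$ with constant $\Lambda>0$: $F$ is a smooth function of the matrix entries on $U$ and $\frac{\partial F^{ij}}{\partial u_{kl}}(\xi)\,\sigma_{ij}\sigma_{kl}\ge\Lambda|\sigma|^2$ for all $\sigma\in S^{n\times n}$ and all $\xi\in U$. Uniformly concave on $U$: $-F$ is uniformly convex on $U$. The coefficients $b^{ij,kl}$ are those of the linearized equation satisfied by the difference quotients of $u$: for $m\in\{1,\dots,n\}$, $h>0$ small and $h_m=he_m$, $$b^{ij,kl}(D^2u(x))=\int_0^1\frac{\partial F^{ij}}{\partial u_{kl}}\big(D^2u(x)+t[D^2u(x+h_m)-D^2u(x)]\big)\,dt,$$ and $\|b^{ij,kl}\|_{L^\infty(U)}$ denotes the supremum bound for these coefficients as the Hessian arguments range over $U$. *)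

theory Defs
  imports "HOL-Analysis.Analysis"
begin

section \<open>Classical derivatives and smooth functions\<close>

text \<open>\<open>dderivs [v\<^sub>1, \<dots>, v\<^sub>k] f\<close> is the iterated directional derivative; \<open>v\<^sub>k\<close> is applied first.\<close>

fun dderivs :: "'a::real_normed_vector list \<Rightarrow> ('a \<Rightarrow> real) \<Rightarrow> 'a \<Rightarrow> real" where
  "dderivs [] f = f"
| "dderivs (v # vs) f = (\<lambda>x. deriv (\<lambda>t::real. dderivs vs f (x + t *\<^sub>R v)) 0)"

text \<open>Smoothness on a set \<open>U\<close> that is relatively open in the subspace \<open>V\<close>. Only directions in \<open>V\<close>
  are used, so the values of \<open>f\<close> outside \<open>U\<close> are irrelevant.\<close>

definition smooth_on :: "'a::real_normed_vector set \<Rightarrow> 'a set \<Rightarrow> ('a \<Rightarrow> real) \<Rightarrow> bool" where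
  "smooth_on V U f \<longleftrightarrow>
     (\<forall>vs. set vs \<subseteq> V \<longrightarrow>
        continuous_on U (dderivs vs f) \<and>
        (\<forall>x\<in>U. \<forall>v\<in>V. (\<lambda>t::real. dderivs vs f (x + t *\<^sub>R v)) field_differentiable at 0))"

definition partials :: "'n::finite list \<Rightarrow> (real^'n \<Rightarrow> real) \<Rightarrow> real^'n \<Rightarrow> real" where
  "partials is f = dderivs (map (\<lambda>i. axis i 1) is) f"

definition test_functions :: "(real^'n::finite) set \<Rightarrow> (real^'n \<Rightarrow> real) set" where
  "test_functions \<Omega> =
     {\<phi>. smooth_on UNIV UNIV \<phi> \<and> compact (closure {x. \<phi> x \<noteq> 0}) \<and> closure {x. \<phi> x \<noteq> 0} \<subseteq> \<Omega>}"

section \<open>Lebesgue and Sobolev spaces\<close>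

definition Lp_space :: "ennreal \<Rightarrow> (real^'n::finite) set \<Rightarrow> (real^'n \<Rightarrow> real) set" where
  "Lp_space p \<Omega> =
     {f \<in> borel_measurable (lebesgue_on \<Omega>).
        if p = \<infinity> then \<exists>M. AE x in lebesgue_on \<Omega>. \<bar>f x\<bar> \<le> M
        else integrable (lebesgue_on \<Omega>) (\<lambda>x. \<bar>f x\<bar> powr enn2real p)}"

definition locally_integrable :: "(real^'n::finite) set \<Rightarrow> (real^'n \<Rightarrow> real) \<Rightarrow> bool" where
  "locally_integrable \<Omega> f \<longleftrightarrow> (\<forall>K. compact K \<and> K \<subseteq> \<Omega> \<longrightarrow> integrable (lebesgue_on K) f)"

definition is_weak_deriv ::
  "(real^'n::finite) set \<Rightarrow> 'n list \<Rightarrow> (real^'n \<Rightarrow> real) \<Rightarrow> (real^'n \<Rightarrow> real) \<Rightarrow> bool" where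
  "is_weak_deriv \<Omega> is f g \<longleftrightarrow>
     locally_integrable \<Omega> f \<and> locally_integrable \<Omega> g \<and>
     (\<forall>\<phi>\<in>test_functions \<Omega>.
        (LINT x|lebesgue_on \<Omega>. f x * partials is \<phi> x) =
          (- 1) ^ length is * (LINT x|lebesgue_on \<Omega>. g x * \<phi> x))"

text \<open>For open \<open>\<Omega>\<close> the weak derivative is unique up to null sets, so that
  the choice of a representative is immaterial below.\<close>

definition weak_deriv ::
  "(real^'n::finite) set \<Rightarrow> 'n list \<Rightarrow> (real^'n \<Rightarrow> real) \<Rightarrow> real^'n \<Rightarrow> real" where
  "weak_deriv \<Omega> is f = (SOME g. is_weak_deriv \<Omega> is f g)"

definition weak_hessian :: "(real^'n::finite) set \<Rightarrow> (real^'n \<Rightarrow> real) \<Rightarrow> real^'n \<Rightarrow> real^'n^'n" where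
  "weak_hessian \<Omega> u x = (\<chi> i j. weak_deriv \<Omega> [i, j] u x)"

definition sobolev :: "nat \<Rightarrow> ennreal \<Rightarrow> (real^'n::finite) set \<Rightarrow> (real^'n \<Rightarrow> real) set" where
  "sobolev k p \<Omega> =
     {f. \<forall>is. length is \<le> k \<longrightarrow> (\<exists>g\<in>Lp_space p \<Omega>. is_weak_deriv \<Omega> is f g)}"

text \<open>Finite exponents only. The sum runs over all index tuples \<open>(i\<^sub>1, \<dots>, i\<^sub>j)\<close>, \<open>j \<le> k\<close>, so a mixed
  derivative is counted once for each order of differentiation.\<close>

definition sobolev_norm :: "nat \<Rightarrow> real \<Rightarrow> (real^'n::finite) set \<Rightarrow> (real^'n \<Rightarrow> real) \<Rightarrow> real" where
  "sobolev_norm k p \<Omega> f =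
     (\<Sum>is | length is \<le> k. LINT x|lebesgue_on \<Omega>. \<bar>weak_deriv \<Omega> is f x\<bar> powr p) powr (1 / p)"

section \<open>Functions of symmetric matrices\<close>

text \<open>On \<^typ>\<open>real^'n^'n\<close> the library norm is the Hilbert--Schmidt norm.\<close>

definition sym_mats :: "(real^'n::finite^'n) set" where
  "sym_mats = {A. transpose A = A}"

text \<open>The direction \<open>(E\<^sub>i\<^sub>j + E\<^sub>j\<^sub>i) / 2\<close>.\<close>

definition sym_unit :: "'n::finite \<Rightarrow> 'n \<Rightarrow> real^'n^'n" where
  "sym_unit i j = (1 / 2) *\<^sub>R (axis i (axis j 1) + axis j (axis i 1))"

text \<open>\<open>F\<^sup>i\<^sup>j = \<partial>F/\<partial>u\<^sub>i\<^sub>j\<close> for a function on symmetric matrices. The entries \<open>u\<^sub>i\<^sub>j\<close> and \<open>u\<^sub>j\<^sub>i\<close> are treated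
  symmetrically, which is the convention under which the sum of \<open>F\<^sup>i\<^sup>j \<sigma>\<^sub>i\<^sub>j\<close> over all \<open>i, j\<close> is the
  derivative of \<open>F\<close> in the symmetric direction \<open>\<sigma>\<close>. It is what entrywise differentiation gives for
  the extension of \<open>F\<close> to all matrices that is invariant under transposition.\<close>

definition F1 :: "(real^'n^'n \<Rightarrow> real) \<Rightarrow> 'n::finite \<Rightarrow> 'n \<Rightarrow> real^'n^'n \<Rightarrow> real" where
  "F1 F i j = dderivs [sym_unit i j] F"

definition F2 :: "(real^'n^'n \<Rightarrow> real) \<Rightarrow> 'n::finite \<Rightarrow> 'n \<Rightarrow> 'n \<Rightarrow> 'n \<Rightarrow> real^'n^'n \<Rightarrow> real" where
  "F2 F i j k l = dderivs [sym_unit k l] (F1 F i j)"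

definition uniformly_convex_on :: "real \<Rightarrow> (real^'n::finite^'n) set \<Rightarrow> (real^'n^'n \<Rightarrow> real) \<Rightarrow> bool" where
  "uniformly_convex_on \<Lambda> U F \<longleftrightarrow>
     (\<forall>\<xi>\<in>U. \<forall>\<sigma>\<in>sym_mats.
        (\<Sum>i\<in>UNIV. \<Sum>j\<in>UNIV. \<Sum>k\<in>UNIV. \<Sum>l\<in>UNIV. F2 F i j k l \<xi> * \<sigma> $ i $ j * \<sigma> $ k $ l)
          \<ge> \<Lambda> * (norm \<sigma>)\<^sup>2)"

definition uniformly_concave_on :: "real \<Rightarrow> (real^'n::finite^'n) set \<Rightarrow> (real^'n^'n \<Rightarrow> real) \<Rightarrow> bool" where
  "uniformly_concave_on \<Lambda> U F \<longleftrightarrow> uniformly_convex_on \<Lambda> U (\<lambda>\<xi>. - F \<xi>)"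

text \<open>The coefficient of the equation for difference quotients, as a function of
  the two Hessian arguments \<open>\<xi> = D\<^sup>2u(x)\<close> and \<open>\<zeta> = D\<^sup>2u(x + h\<^sub>m)\<close>.\<close>

definition b_coeff ::
  "(real^'n^'n \<Rightarrow> real) \<Rightarrow> 'n::finite \<Rightarrow> 'n \<Rightarrow> 'n \<Rightarrow> 'n \<Rightarrow> real^'n^'n \<Rightarrow> real^'n^'n \<Rightarrow> real" where
  "b_coeff F i j k l \<xi> \<zeta> = integral {0..1} (\<lambda>t. F2 F i j k l (\<xi> + t *\<^sub>R (\<zeta> - \<xi>)))"

definition b_values :: "(real^'n::finite^'n) set \<Rightarrow> (real^'n^'n \<Rightarrow> real) \<Rightarrow> real set" where
  "b_values U F = {\<bar>b_coeff F i j k l \<xi> \<zeta>\<bar> | i j k l \<xi> \<zeta>. \<xi> \<in> U \<and> \<zeta> \<in> U}"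

text \<open>Meaningful only if \<^term>\<open>b_values U F\<close> is bounded above.\<close>

definition b_sup :: "(real^'n::finite^'n) set \<Rightarrow> (real^'n^'n \<Rightarrow> real) \<Rightarrow> real" where
  "b_sup U F = Sup (b_values U F)"

end

theory Submission
 imports Defs
begin

text \<open>Write \<open>V\<^sup>i\<^sup>j = F\<^sup>i\<^sup>j(D\<^sup>2u)\<close>, or \<open>V\<^sup>i\<^sup>j = -F\<^sup>i\<^sup>j(D\<^sup>2u)\<close> in the concave case. By the mean value theorem on
 the convex set \<open>U\<close>, \<open>V\<close> is a Lipschitz function of the Hessian and is strongly monotone in it; the two
 constants are the bound on the coefficients and \<open>\<Lambda>\<close>. These facts (\<open>F1_Lipschitz\<close>, \<open>monotone_field\<close>)
 are all that the regularity theory sees of \<open>F\<close>; they are collected, for Borel representatives that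
 vanish outside the unit ball, in the locale \<open>double_divergence\<close>.

 The double divergence equation \<open>\<integral> V\<^sup>i\<^sup>j \<eta>\<^sub>i\<^sub>j = 0\<close> is translated by \<open>h e\<^sub>m\<close> and subtracted from itself. Testing
 with the difference quotient of \<open>u\<close>, minus an affine function and times a cut-off, gives a Caccioppoli
 inequality (\<open>caccioppoli_diffquot\<close>): the difference quotients of \<open>D\<^sup>2u\<close> are bounded in \<open>L\<^sup>2\<close>, locally, by
 the deviation of \<open>D\<^sub>mDu\<close> from a constant vector and of \<open>D\<^sub>mu\<close> from an affine function. A weak limit
 yields third derivatives in \<open>L\<^sup>2\<close> that inherit this inequality (\<open>third_derivatives\<close>).

 Fitting the affine function by the Poincare inequality turns the Caccioppoli inequality into a reverse
 Hoelder inequality for \<open>T\<close>, the sum of the absolute values of all derivatives of order at most three. The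
 Poincare inequality is used in a form that bounds an oscillation in \<open>L\<^sup>2\<close> by the square of the \<open>L\<^sup>1\<close> norm of the
 gradient up to a small multiple of its \<open>L\<^sup>2\<close> norm (\<open>poincare_weak\<close>); it needs no Sobolev embedding, and
 the small term is harmless in Gehring's lemma (\<open>gehring\<close>), which raises the integrability of \<open>T\<close>
 from \<open>2\<close> to \<open>2 + \<delta>\<close>.

 The proof of Gehring's lemma uses stopping balls, Vitali's covering lemma and integration over level sets.
 The exponent \<open>\<delta>\<close> depends on \<open>\<Lambda>\<close>, the bound on the coefficients and \<open>n\<close>. The whole argument takes place
 on \<open>ball 0 (1 - d/3)\<close>, and the estimate holds on \<open>ball 0 (1 - 2d/3)\<close>, where \<open>d\<close> is the distance of
 \<open>\<Omega>'\<close> from the boundary.\<close>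

text \<open>The names otherwise refer to the gauge integral.\<close>

lemmas integrable_add = Bochner_Integration.integrable_add and
 integrable_bound = Bochner_Integration.integrable_bound and
 integrable_diff = Bochner_Integration.integrable_diff and
 integrable_sum = Bochner_Integration.integrable_sum and
 integral_add = Bochner_Integration.integral_add and
 integral_cong = Bochner_Integration.integral_cong and
 integral_diff = Bochner_Integration.integral_diff and
 integral_mono = Bochner_Integration.integral_mono and
 integral_nonneg = Bochner_Integration.integral_nonneg and
 integral_sum = Bochner_Integration.integral_sum

abbreviation lborel_nn_integral :: "('a::euclidean_space => ennreal) => ennreal" (binder "NNINT " 10) where
 "lborel_nn_integral f \<equiv> integral\<^sup>N lborel f"

abbreviation in_ball :: "'a::metric_space => real => 'a => 'b::zero_neq_one" where
 "in_ball x r \<equiv> indicator (ball x r)"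

notation scaleR (infixr "*R" 75)

abbreviation borel_fns :: "('a::topological_space => 'b::topological_space) set" where
 "borel_fns \<equiv> borel_measurable borel"

section \<open>Calculus of smooth functions\<close>

abbreviation smooth :: "('a::real_normed_vector => real) => bool" where
 "smooth \<equiv> smooth_on UNIV UNIV"

abbreviation dd :: "'a::real_normed_vector => ('a => real) => 'a => real" where
 "dd v \<equiv> dderivs [v]"

text \<open>Smoothness by coinduction: it suffices to find a set of continuous functions that is closed under
 directional derivatives.\<close>

lemma smooth_coinduct:
 assumes "f \<in> S"
  and cont: "!!f. f \<in> S ==> continuous_on UNIV f"
  and diff: "!!f v. f \<in> S ==>
   \<exists>g\<in>S. \<forall>x. ((%t. f (x + t *R v)) has_field_derivative g x) (at 0)"
 shows "smooth f"
proof -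
 have "dderivs vs f \<in> S" for vs
 proof (induction vs)
  case (Cons v vs)
  obtain g where g: "g \<in> S"
   "!!x. ((%t. dderivs vs f (x + t *R v)) has_field_derivative g x) (at 0)"
   using diff[OF Cons.IH, of v] by blast
  have "dderivs (v # vs) f = g" using g(2) by (auto simp: DERIV_imp_deriv)
  then show ?case using g(1) by simp
 qed (simp add: assms)
 then show ?thesis
  unfolding smooth_on_def field_differentiable_def using cont diff by blast
qed

lemma smooth_continuous: "smooth f ==> continuous_on UNIV f"
 unfolding smooth_on_def using dderivs.simps(1) by (metis list.set(1) empty_subsetI)

lemma smooth_DERIV:
 "smooth f ==> ((%t. f (x + t *R v)) has_field_derivative dd v f x) (at 0)"
 unfolding smooth_on_def
 using field_differentiable_derivI[of "%t. f (x + t *R v)" 0]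
 by (metis UNIV_I dderivs.simps empty_subsetI list.set(1))

lemma smooth_DERIV_at:
 assumes "smooth f"
 shows "((%t. f (x + t *R v)) has_field_derivative dd v f (x + s *R v)) (at s)"
proof -
 have "((%t. f ((x + s *R v) + t *R v)) has_field_derivative dd v f (x + s *R v)) (at 0)"
  by (rule smooth_DERIV[OF assms])
 then have "((%t. f ((x + s *R v) + t *R v)) has_field_derivative dd v f (x + s *R v)) (at (s + - s))"
  by simp
 then show ?thesis
  unfolding DERIV_shift by (simp add: algebra_simps)
qed

lemma dderivs_dd: "dderivs vs (dd v f) = dderivs (vs @ [v]) f"
 by (induction vs) auto

lemma smooth_dd: "smooth f ==> smooth (dd v f)"
 unfolding smooth_on_def dderivs_dd by auto

lemma smooth_ddI:
 assumes "!!x. ((%t. f (x + t *R v)) has_field_derivative g x) (at 0)"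
 shows "dd v f = g"
 using assms by (auto simp: DERIV_imp_deriv)

inductive_set alg_hull :: "('a::real_normed_vector => real) set => ('a => real) set"
 for A where
 base: "f \<in> A ==> f \<in> alg_hull A"
| const: "(%_. c) \<in> alg_hull A"
| add: "f \<in> alg_hull A ==> g \<in> alg_hull A ==> (%x. f x + g x) \<in> alg_hull A"
| mult: "f \<in> alg_hull A ==> g \<in> alg_hull A ==> (%x. f x * g x) \<in> alg_hull A"

text \<open>Smoothness has to be checked on generators only: the product rule keeps derivatives of
 algebraic combinations of generators inside the generated algebra.\<close>

lemma smooth_alg_hull:
 assumes f: "f \<in> alg_hull A"
  and cont: "!!f. f \<in> A ==> continuous_on UNIV f"
  and diff: "!!f v. f \<in> A ==>
   \<exists>g\<in>alg_hull A. \<forall>x. ((%t. f (x + t *R v)) has_field_derivative g x) (at 0)"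
 shows "smooth f"
proof (rule smooth_coinduct[OF f])
 fix f assume "f \<in> alg_hull A"
 then show "continuous_on UNIV f"
  by induction (blast intro: cont continuous_on_const continuous_on_add continuous_on_mult)+
next
 fix f v assume "f \<in> alg_hull A"
 then show "\<exists>g\<in>alg_hull A. \<forall>x. ((%t. f (x + t *R v)) has_field_derivative g x) (at 0)"
 proof induction
  case (base f) then show ?case by (rule diff)
 next
  case (const c)
  show ?case by (rule bexI[of _ "%_. 0"]) (auto intro: alg_hull.const)
 next
  case (add f g)
  then obtain f' g' where *: "f' \<in> alg_hull A" "g' \<in> alg_hull A"
   "!!x. ((%t. f (x + t *R v)) has_field_derivative f' x) (at 0)"
   "!!x. ((%t. g (x + t *R v)) has_field_derivative g' x) (at 0)" by blast
  show ?case
   by (rule bexI[of _ "%x. f' x + g' x"])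
    (use * in \<open>auto intro!: alg_hull.add derivative_eq_intros\<close>)
 next
  case (mult f g)
  then obtain f' g' where *: "f' \<in> alg_hull A" "g' \<in> alg_hull A"
   "!!x. ((%t. f (x + t *R v)) has_field_derivative f' x) (at 0)"
   "!!x. ((%t. g (x + t *R v)) has_field_derivative g' x) (at 0)" by blast
  show ?case
   by (rule bexI[of _ "%x. f x * g' x + f' x * g x"])
    (use * mult in \<open>auto intro!: alg_hull.add alg_hull.mult DERIV_cong[OF DERIV_mult]\<close>)
 qed
qed

lemma smooth_alg:
 assumes "f \<in> alg_hull (Collect smooth)" shows "smooth f"
 by (rule smooth_alg_hull[OF assms])
  (use smooth_continuous smooth_DERIV smooth_dd alg_hull.base in \<open>blast+\<close>)

lemma smooth_const: "smooth (%_. c)"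
 by (rule smooth_alg) (rule alg_hull.const)

lemma smooth_add: "smooth f ==> smooth g ==> smooth (%x. f x + g x)"
 by (rule smooth_alg) (intro alg_hull.add alg_hull.base CollectI)

lemma smooth_mult: "smooth f ==> smooth g ==> smooth (%x. f x * g x)"
 by (rule smooth_alg) (intro alg_hull.mult alg_hull.base CollectI)

lemma smooth_cmult: "smooth f ==> smooth (%x. c * f x)"
 by (intro smooth_mult smooth_const)

lemma smooth_uminus: "smooth f ==> smooth (%x. - f x)"
 using smooth_cmult[of f "-1"] by simp

lemma smooth_diff: "smooth f ==> smooth g ==> smooth (%x. f x - g x)"
 using smooth_add[of f "%x. - g x"] smooth_uminus[of g] by simp

lemma smooth_power: "smooth f ==> smooth (%x. f x ^ k)"
 by (induction k) (auto intro: smooth_const smooth_mult)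

lemma smooth_affine:
 fixes f :: "'a::real_normed_vector => real"
 assumes "smooth f"
 shows "smooth (%x. f (a + s *R x))"
proof (rule smooth_coinduct[of _ "{%x. c * f (a + s *R x) | c f. smooth f}"])
 show "(%x. f (a + s *R x)) \<in> {%x. c * f (a + s *R x) | c f. smooth f}"
  using assms by (auto intro!: exI[of _ 1])
next
 fix g :: "'a => real" assume "g \<in> {%x. c * f (a + s *R x) | c f. smooth f}"
 then obtain c f where g: "g = (%x. c * f (a + s *R x))" and f: "smooth f" by blast
 show "continuous_on UNIV g"
  unfolding g by (intro continuous_intros continuous_on_compose2[OF smooth_continuous[OF f]]) auto
next
 fix g :: "'a => real" and v assume "g \<in> {%x. c * f (a + s *R x) | c f. smooth f}"
 then obtain c f where g: "g = (%x. c * f (a + s *R x))" and f: "smooth f" by blast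
 have "((%t. g (x + t *R v)) has_field_derivative (c * s) * dd v f (a + s *R x)) (at 0)" for x
 proof -
  have "((%t. f ((a + s *R x) + t *R v)) has_field_derivative dd v f (a + s *R x)) (at (s * 0))"
   using smooth_DERIV[OF f, of "a + s *R x" v] by simp
  then have "((%t. f ((a + s *R x) + t *R v)) has_field_derivative dd v f (a + s *R x))
   (at (s * 0) within range (%t. s * t))"
   using has_field_derivative_subset by blast
  from DERIV_image_chain[OF this DERIV_cmult[OF DERIV_ident]]
  have "((%t. f ((a + s *R x) + (s * t) *R v)) has_field_derivative dd v f (a + s *R x) * (s * 1)) (at 0)"
   by (simp add: o_def)
  from DERIV_cmult[OF this, of c] show ?thesis
   unfolding g by (simp add: algebra_simps)
 qed
 then show "\<exists>h\<in>{%x. c * f (a + s *R x) | c f. smooth f}.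
   \<forall>x. ((%t. g (x + t *R v)) has_field_derivative h x) (at 0)"
  using smooth_dd[OF f, of v] by (intro bexI[of _ "%x. (c * s) * dd v f (a + s *R x)"]) auto
qed

lemma dd_affine:
 fixes f :: "'a::real_normed_vector => real"
 assumes f: "smooth f"
 shows "dd v (%x. f (a + s *R x)) = (%x. s * dd v f (a + s *R x))"
proof (rule smooth_ddI)
 fix x
 have "((%t. f ((a + s *R x) + t *R v)) has_field_derivative dd v f (a + s *R x)) (at (s * 0))"
  using smooth_DERIV[OF f, of "a + s *R x" v] by simp
 then have "((%t. f ((a + s *R x) + t *R v)) has_field_derivative dd v f (a + s *R x))
  (at (s * 0) within range (%t. s * t))"
  using has_field_derivative_subset by blast
 from DERIV_image_chain[OF this DERIV_cmult[OF DERIV_ident]]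
 have "((%t. f ((a + s *R x) + (s * t) *R v)) has_field_derivative dd v f (a + s *R x) * (s * 1)) (at 0)"
  by (simp add: o_def)
 then show "((%t. f (a + s *R (x + t *R v))) has_field_derivative s * dd v f (a + s *R x)) (at 0)"
  by (simp add: algebra_simps)
qed

lemma dd_add: "smooth f ==> smooth g ==> dd v (%x. f x + g x) = (%x. dd v f x + dd v g x)"
 by (rule smooth_ddI) (auto intro!: DERIV_add smooth_DERIV[simplified])

lemma dd_mult: "smooth f ==> smooth g ==> dd v (%x. f x * g x) = (%x. dd v f x * g x + dd v g x * f x)"
 by (rule smooth_ddI)
  (use smooth_DERIV in \<open>fastforce intro!: DERIV_cong[OF DERIV_mult]\<close>)

lemma dd_diff: "smooth f ==> smooth g ==> dd v (%x. f x - g x) = (%x. dd v f x - dd v g x)"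
 by (rule smooth_ddI) (auto intro!: DERIV_diff smooth_DERIV[simplified])

lemma dd_const: "dd v (%_. c) = (%_. 0)"
 by (rule smooth_ddI) auto

lemma smooth_inner: "smooth (%x::'a::real_inner. a \<bullet> x)"
proof (rule smooth_alg_hull)
 show "(%x. a \<bullet> x) \<in> alg_hull {%x. a \<bullet> x}"
  by (rule alg_hull.base) simp
 fix f :: "'a => real" assume f: "f \<in> {%x. a \<bullet> x}"
 then show "continuous_on UNIV f" by (auto intro!: continuous_intros)
 show "\<exists>g\<in>alg_hull {%x. a \<bullet> x}. \<forall>x. ((%t. f (x + t *R v)) has_field_derivative g x) (at 0)" for v
  by (rule bexI[OF _ alg_hull.const[of "a \<bullet> v"]])
   (use f in \<open>auto simp: inner_simps intro!: derivative_eq_intros\<close>)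
qed

lemma dd_inner: "dd v (%x::'a::real_inner. a \<bullet> x) = (%_. a \<bullet> v)"
 by (rule smooth_ddI) (auto intro!: derivative_eq_intros simp: inner_simps)

section \<open>A smooth bump\<close>

text \<open>The functions \<open>t\<^sup>-\<^sup>k e\<^bsup>-1/t\<^esup>\<close>, extended by zero. Their derivatives are combinations of functions of the same
 kind, which is why the whole family is treated at once.\<close>

definition flat :: "nat => real => real" where
 "flat k t = (if t > 0 then inverse t ^ k * exp (- inverse t) else 0)"

lemma power_le_fact_exp: "0 <= (s::real) ==> s ^ m <= fact m * exp s"
proof -
 assume s: "0 <= s"
 have "(%n. inverse (fact n) * s ^ n) sums exp s"
  using exp_converges[of s] by simp
 then have "(\<Sum>n\<in>{m}. inverse (fact n) * s ^ n) <= exp s"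
  using s sum_le_suminf[of "%n. inverse (fact n) * s ^ n" "{m}"] by (auto simp: sums_iff)
 then show ?thesis by (simp add: field_simps)
qed

lemma flat_le: "\<bar>flat k t\<bar> <= fact (k + 2) * t^2"
proof (cases "t > 0")
 case True
 have "inverse t ^ (k + 2) <= fact (k + 2) * exp (inverse t)"
  using True by (intro power_le_fact_exp) auto
 then have "inverse t ^ (k + 2) * t^2 <= fact (k + 2) * exp (inverse t) * t^2"
  by (intro mult_right_mono) auto
 moreover have "inverse t ^ (k + 2) * t^2 = inverse t ^ k * (inverse t * t)^2"
  by (simp only: power_add power_mult_distrib mult.assoc)
 moreover have "(inverse t * t)^2 = 1" using True by simp
 ultimately have "inverse t ^ k <= fact (k + 2) * exp (inverse t) * t^2"
  by (metis mult.right_neutral)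
 then have "inverse t ^ k * exp (- inverse t) <= fact (k + 2) * exp (inverse t) * t^2 * exp (- inverse t)"
  by (intro mult_right_mono) auto
 also have "... = fact (k + 2) * t^2"
  by (simp add: exp_minus)
 finally show ?thesis using True by (simp add: flat_def)
qed (simp add: flat_def)

lemma DERIV_flat: "(flat k has_field_derivative (flat (k+2) t - real k * flat (k+1) t)) (at t)"
proof -
 consider "t > 0" | "t < 0" | "t = 0" by linarith
 then show ?thesis
 proof cases
  case 1
  have "((%t. inverse t ^ k * exp (- inverse t)) has_field_derivative
    (flat (k+2) t - real k * flat (k+1) t)) (at t)"
  proof -
   have "((%t. inverse t ^ k) has_field_derivative - (real k * inverse t ^ (k + 1))) (at t)"
    by (rule DERIV_cong[OF DERIV_power[OF DERIV_inverse]])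
     (use 1 in \<open>cases k; simp\<close>)+
   moreover have "((%t. exp (- inverse t)) has_field_derivative exp (- inverse t) * (inverse t)^2) (at t)"
    using 1 by (auto intro!: derivative_eq_intros simp: power2_eq_square)
   ultimately have "((%t. inverse t ^ k * exp (- inverse t)) has_field_derivative
    - (real k * inverse t ^ (k + 1)) * exp (- inverse t)
     + exp (- inverse t) * (inverse t)^2 * inverse t ^ k) (at t)"
    by (rule DERIV_mult)
   then show ?thesis
    by (rule DERIV_cong) (use 1 in \<open>simp add: flat_def power2_eq_square\<close>)
  qed
  then show ?thesis
   by (rule has_field_derivative_transform_within_open[where S="{0<..}"])
    (use 1 in \<open>auto simp: flat_def\<close>)
 next
  case 2
  have "((%t. 0) has_field_derivative (flat (k+2) t - real k * flat (k+1) t)) (at t)"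
   using 2 by (simp add: flat_def)
  then show ?thesis
   by (rule has_field_derivative_transform_within_open[where S="{..<0}"])
    (use 2 in \<open>auto simp: flat_def\<close>)
 next
  case 3
  have "((%h. flat k h / h) \<longlongrightarrow> 0) (at 0)"
  proof (rule Lim_null_comparison)
   show "\<forall>\<^sub>F h in at 0. norm (flat k h / h) <= fact (k + 2) * \<bar>h\<bar>"
   proof (intro eventually_at_leftI[THEN eventually_mono] always_eventually allI)
    fix h :: real
    have "\<bar>flat k h\<bar> / \<bar>h\<bar> <= (fact (k + 2) * \<bar>h\<bar>) * \<bar>h\<bar> / \<bar>h\<bar>"
     using flat_le[of k h] by (intro divide_right_mono) (simp_all only: power2_eq_square mult.assoc abs_mult_self_eq abs_ge_zero)
    also have "... <= fact (k + 2) * \<bar>h\<bar>" by simp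
    finally show "norm (flat k h / h) <= fact (k + 2) * \<bar>h\<bar>" by simp
   qed
   show "((%h. fact (k + 2) * \<bar>h\<bar>) \<longlongrightarrow> 0) (at (0::real))"
    by (rule tendsto_eq_intros refl | simp)+
  qed
  then show ?thesis
   unfolding 3 DERIV_def by (simp add: flat_def)
 qed
qed

definition bump :: "'a::real_inner => real" where
 "bump x = flat 0 (1 - x \<bullet> x)"

lemma smooth_bump: "smooth (bump :: 'a::real_inner => real)"
proof (rule smooth_alg_hull)
 let ?A = "{%x::'a. flat k (1 - x \<bullet> x) | k. True} \<union> {%x. x \<bullet> w | w. True}"
 show "bump \<in> alg_hull ?A"
  by (rule alg_hull.base) (auto simp: bump_def[abs_def])
 fix f :: "'a => real" assume f: "f \<in> ?A"
 have cf: "continuous_on UNIV (flat k)" for k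
  by (rule DERIV_continuous_on) (rule has_field_derivative_at_within[OF DERIV_flat])
 show "continuous_on UNIV f"
  using f by (auto intro!: continuous_intros continuous_on_compose2[OF cf])
 fix v
 from f consider k where "f = (%x. flat k (1 - x \<bullet> x))" | w where "f = (%x. x \<bullet> w)" by auto
 then show "\<exists>g\<in>alg_hull ?A. \<forall>x. ((%t. f (x + t *R v)) has_field_derivative g x) (at 0)"
 proof cases
  case 1
  let ?g = "%x. (flat (k+2) (1 - x \<bullet> x) + (- real k) * flat (k+1) (1 - x \<bullet> x)) * ((-2) * (x \<bullet> v))"
  have "?g \<in> alg_hull ?A"
   by (intro alg_hull.mult alg_hull.add alg_hull.const alg_hull.base UnI1 UnI2) auto
  moreover have "((%t. f (x + t *R v)) has_field_derivative ?g x) (at 0)" for x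
  proof -
   have "((%t. 1 - (x + t *R v) \<bullet> (x + t *R v)) has_field_derivative (-2) * (x \<bullet> v)) (at 0)"
    by (auto intro!: derivative_eq_intros simp: inner_simps inner_commute)
   from DERIV_chain2[OF DERIV_flat this]
   show ?thesis unfolding 1 by (simp add: algebra_simps)
  qed
  ultimately show ?thesis by (intro bexI[of _ ?g]) auto
 next
  case 2
  show ?thesis
   by (rule bexI[of _ "%_. v \<bullet> w"])
    (auto simp: 2 inner_simps intro!: alg_hull.const derivative_eq_intros)
 qed
qed

lemma bump_nonneg: "0 <= bump x"
 by (simp add: bump_def flat_def)

lemma bump_pos_iff: "0 < bump x \<longleftrightarrow> norm x < 1"
proof -
 have "x \<bullet> x < 1 \<longleftrightarrow> norm x < 1"
  by (metis norm_lt_square inner_commute power2_norm_eq_inner abs_norm_cancel abs_square_less_1)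
 then show ?thesis by (auto simp: bump_def flat_def)
qed

lemma bump_eq_0_iff: "bump x = 0 \<longleftrightarrow> norm x >= 1"
 using bump_pos_iff[of x] bump_nonneg[of x] by linarith

declare dderivs.simps(2) [simp del]

section \<open>Test functions and convolution\<close>

abbreviation pd :: "'n::finite => (real^'n => real) => real^'n => real" where
 "pd i \<equiv> dd (axis i 1)"

lemma partials_1: "partials [i] f = pd i f"
 and partials_2: "partials [i, j] f = pd i (pd j f)"
 by (simp_all add: partials_def dderivs.simps)

lemma test_functionsD:
 assumes "\<phi> \<in> test_functions \<Omega>"
 shows "smooth \<phi>" "compact (closure {x. \<phi> x ~= 0})" "closure {x. \<phi> x ~= 0} \<subseteq> \<Omega>"
 using assms by (auto simp: test_functions_def)

lemma test_functionsI:
 assumes "smooth \<phi>" "compact K" "K \<subseteq> \<Omega>" "!!x. x \<notin> K ==> \<phi> x = 0"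
 shows "\<phi> \<in> test_functions \<Omega>"
proof -
 have "closure {x. \<phi> x ~= 0} \<subseteq> K"
  using assms by (intro closure_minimal compact_imp_closed) auto
 then show ?thesis
  using assms bounded_subset[OF compact_imp_bounded[OF assms(2)], of "{x. \<phi> x ~= 0}"]
  by (auto simp: test_functions_def)
qed

lemma test_functions_mono: "\<phi> \<in> test_functions \<Omega> ==> \<Omega> \<subseteq> \<Omega>' ==> \<phi> \<in> test_functions \<Omega>'"
 by (auto simp: test_functions_def)

lemma dd_eq_0_outside:
 assumes "closed K" "x \<notin> K" "!!x. x \<notin> K ==> f x = 0"
 shows "dd v f x = 0"
proof -
 have "((%t. 0) has_field_derivative 0) (at (0::real))" by simp
 moreover have "open ((%t. x + t *R v) -` (- K))"
  using assms(1) by (intro open_vimage continuous_intros) auto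
 ultimately have "((%t. f (x + t *R v)) has_field_derivative 0) (at 0)"
  by (rule has_field_derivative_transform_within_open) (use assms in auto)
 then show ?thesis by (simp add: DERIV_imp_deriv dderivs.simps)
qed

lemma dd_eq_0_outside_support: "x \<notin> closure {x. f x ~= 0} ==> dd v f x = 0"
 using closure_subset[of "{x. f x ~= 0}"] by (intro dd_eq_0_outside[OF closed_closure]) auto

lemma test_functions_dd:
 assumes "\<phi> \<in> test_functions \<Omega>" shows "dd v \<phi> \<in> test_functions \<Omega>"
 using test_functionsD[OF assms]
 by (intro test_functionsI[of _ "closure {x. \<phi> x ~= 0}"] smooth_dd dd_eq_0_outside_support)

lemma test_functions_mult:
 assumes "\<phi> \<in> test_functions \<Omega>" "smooth f" shows "(%x. \<phi> x * f x) \<in> test_functions \<Omega>"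
 using test_functionsD[OF assms(1)] closure_subset[of "{x. \<phi> x ~= 0}"]
 by (intro test_functionsI[of _ "closure {x. \<phi> x ~= 0}"] smooth_mult assms(2)) auto

lemma test_functions_bounded:
 assumes "\<phi> \<in> test_functions \<Omega>"
 obtains M where "M >= 0" "!!x. \<bar>\<phi> x\<bar> <= M"
proof -
 note * = test_functionsD[OF assms]
 have "bounded (\<phi> ` closure {x. \<phi> x ~= 0})"
  using *(2) smooth_continuous[OF *(1)]
  by (intro compact_imp_bounded compact_continuous_image) (auto intro: continuous_on_subset)
 then obtain M where M: "!!x. x \<in> closure {x. \<phi> x ~= 0} ==> \<bar>\<phi> x\<bar> <= M"
  unfolding bounded_iff by auto
 have "\<bar>\<phi> x\<bar> <= max M 0" for x
  using M[of x] closure_subset[of "{x. \<phi> x ~= 0}"] by (cases "\<phi> x = 0") auto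
 then show ?thesis by (intro that[of "max M 0"]) auto
qed

lemma smooth_borel_measurable[measurable_dest]: "smooth f ==> f \<in> borel_fns"
 by (intro borel_measurable_continuous_onI smooth_continuous)

lemma test_functions_borel[measurable_dest]: "f \<in> test_functions \<Omega> ==> f \<in> borel_fns"
 by (intro smooth_borel_measurable test_functionsD)

lemma integrable_mult_bounded:
 fixes f g :: "'a => real"
 assumes "integrable M f" "g \<in> borel_measurable M" "!!x. \<bar>g x\<bar> <= B"
 shows "integrable M (%x. f x * g x)"
proof (rule integrable_bound)
 show "integrable M (%x. B * f x)" using assms by simp
 have "\<bar>f x\<bar> * \<bar>g x\<bar> <= \<bar>B\<bar> * \<bar>f x\<bar>" for x
  using assms(3)[of x] by (subst mult.commute) (intro mult_right_mono, auto)
 then show "AE x in M. norm (f x * g x) <= norm (B * f x)"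
  by (auto simp: abs_mult)
qed (use assms in auto)

lemma integrable_mult_test:
 assumes "integrable lborel f" "\<phi> \<in> test_functions \<Omega>"
 shows "integrable lborel (%x. f x * \<phi> x)"
proof -
 obtain M where "M >= 0" "!!x. \<bar>\<phi> x\<bar> <= M" by (rule test_functions_bounded[OF assms(2)]) (rule that)
 then show ?thesis
  using assms test_functions_borel[OF assms(2)] by (intro integrable_mult_bounded) auto
qed

lemma lborel_nn_integral_affine:
 fixes f :: "'a::euclidean_space => ennreal"
 assumes [measurable]: "f \<in> borel_fns" and c: "c ~= 0"
 shows "(NNINT x. f x) = ennreal (\<bar>c\<bar> ^ DIM('a)) * (NNINT x. f (t + c *R x))"
 by (subst lborel_affine[OF c, of t])
  (simp add: nn_integral_density nn_integral_distr nn_integral_cmult)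

lemma lborel_integral_affine:
 fixes f :: "'a::euclidean_space => real"
 assumes [measurable]: "f \<in> borel_fns" and c: "c ~= 0"
 shows "(LBINT x. f x) = \<bar>c\<bar> ^ DIM('a) * (LBINT x. f (t + c *R x))"
 by (subst lborel_affine[OF c, of t])
  (simp add: integral_density integral_distr)

lemma lborel_integrable_affine:
 fixes f :: "'a::euclidean_space => real"
 assumes f: "integrable lborel f" and c: "c ~= 0"
 shows "integrable lborel (%x. f (t + c *R x))"
proof -
 have "integrable (density (distr lborel borel (%x. t + c *R x)) (%_. ennreal (\<bar>c\<bar>^DIM('a)))) f"
  unfolding lborel_affine[OF c, of t, symmetric] by (rule f)
 then have "integrable (distr lborel borel (%x. t + c *R x)) (%x. \<bar>c\<bar>^DIM('a) * f x)"
  using f by (subst (asm) integrable_density) (auto dest: borel_measurable_integrable)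
 then show ?thesis
  using f c by (subst (asm) integrable_distr_eq) (auto dest: borel_measurable_integrable)
qed

lemma lborel_integral_translate:
 fixes f :: "'a::euclidean_space => real"
 assumes "f \<in> borel_fns"
 shows "(LBINT x. f (x + t)) = (LBINT x. f x)"
  and "(LBINT x. f (x - t)) = (LBINT x. f x)"
 using lborel_integral_affine[OF assms, of 1 t] lborel_integral_affine[OF assms, of 1 "-t"]
 by (simp_all add: add.commute)

lemma lborel_integrable_translate:
 fixes f :: "'a::euclidean_space => real"
 assumes "integrable lborel f"
 shows "integrable lborel (%x. f (x + t))" "integrable lborel (%x. f (x - t))"
 using lborel_integrable_affine[OF assms, of 1 t] lborel_integrable_affine[OF assms, of 1 "-t"]
 by (simp_all add: add.commute)

lemma lborel_integral_reflect:
 fixes f :: "'a::euclidean_space => real"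
 assumes "f \<in> borel_fns"
 shows "(LBINT x. f (t - x)) = (LBINT x. f x)"
 using lborel_integral_affine[OF assms, of "-1" t] by simp

lemma lborel_integrable_reflect:
 fixes f :: "'a::euclidean_space => real"
 assumes "integrable lborel f"
 shows "integrable lborel (%x. f (t - x))"
 using lborel_integrable_affine[OF assms, of "-1" t] by simp

definition conv :: "('a::euclidean_space => real) => ('a => real) => 'a => real" where
 "conv f k x = (LBINT y. f y * k (x - y))"

lemma conv_commute:
 assumes [measurable]: "f \<in> borel_fns" "k \<in> borel_fns"
 shows "conv f k x = (LBINT z. f (x - z) * k z)"
proof -
 have "(LBINT z. f (x - z) * k z) = (LBINT z. (%y. f y * k (x - y)) (x - z))"
  by simp
 also have "... = conv f k x"
  unfolding conv_def by (rule lborel_integral_reflect) measurable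
 finally show ?thesis by simp
qed

lemma conv_measurable[measurable]:
 assumes [measurable]: "f \<in> borel_fns" "k \<in> borel_fns"
 shows "conv f k \<in> borel_fns"
 unfolding conv_def[abs_def] by measurable

lemma conv_continuous:
 fixes f :: "'a::euclidean_space => real"
 assumes f: "integrable lborel f" and k: "continuous_on UNIV k" "!!x. \<bar>k x\<bar> <= M"
 shows "continuous_on UNIV (conv f k)"
 unfolding continuous_on_sequentially
proof (intro allI ballI impI, elim conjE)
 fix X :: "nat => 'a" and x assume X: "\<forall>n. X n \<in> UNIV" "X \<longlonglongrightarrow> x"
 have [measurable]: "f \<in> borel_fns" "k \<in> borel_fns"
  using borel_measurable_integrable[OF f] borel_measurable_continuous_onI[OF k(1)] by auto
 have "(%n. LBINT y. f y * k (X n - y)) \<longlonglongrightarrow> (LBINT y. f y * k (x - y))"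
 proof (rule integral_dominated_convergence[where w="%y. M * \<bar>f y\<bar>"])
  have "(%n. k (X n - y)) \<longlonglongrightarrow> k (x - y)" for y
   using k(1) by (intro continuous_on_tendsto_compose[OF k(1)] tendsto_intros X) auto
  then show "AE y in lborel. (%n. f y * k (X n - y)) \<longlonglongrightarrow> f y * k (x - y)"
   by (auto intro!: tendsto_intros)
  have "\<bar>f y\<bar> * \<bar>k z\<bar> <= M * \<bar>f y\<bar>" for y z
   using k(2)[of z] by (subst mult.commute) (intro mult_right_mono, auto)
  then show "AE y in lborel. norm (f y * k (X n - y)) <= M * \<bar>f y\<bar>" for n
   by (auto simp: abs_mult)
 qed (use f in auto)
 then show "(conv f k \<circ> X) \<longlonglongrightarrow> conv f k x"
  by (simp add: conv_def o_def)
qed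

lemma smooth_difference_bound:
 assumes "smooth k" "!!x. \<bar>dd v k x\<bar> <= M"
 shows "\<bar>k (x + t *R v) - k x\<bar> <= M * \<bar>t\<bar>"
proof -
 have "norm (k (x + t *R v) - k (x + 0 *R v)) <= M * norm (t - 0)"
  by (rule field_differentiable_bound[where S=UNIV and f'="%s. dd v k (x + s *R v)"])
   (use assms smooth_DERIV_at in auto)
 then show ?thesis by simp
qed

text \<open>Differentiation under the integral falls on the smooth factor.\<close>

lemma conv_DERIV:
 fixes k :: "real^'n::finite => real"
 assumes f: "integrable lborel f" and k: "k \<in> test_functions \<Omega>"
 shows "((%t. conv f k (x + t *R v)) has_field_derivative conv f (dd v k) x) (at 0)"
proof -
 note sk = test_functionsD(1)[OF k]
 have [measurable]: "f \<in> borel_fns"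
  using borel_measurable_integrable[OF f] by simp
 have [measurable]: "k \<in> borel_fns" "dd v k \<in> borel_fns"
  by (rule test_functions_borel[OF k], rule test_functions_borel[OF test_functions_dd[OF k]])
 obtain M where M: "M >= 0" "!!x. \<bar>dd v k x\<bar> <= M"
  by (rule test_functions_bounded[OF test_functions_dd[OF k]]) (rule that)
 obtain M0 where M0: "M0 >= 0" "!!x. \<bar>k x\<bar> <= M0"
  by (rule test_functions_bounded[OF k]) (rule that)
 have int: "integrable lborel (%y. f y * k (z - y))" for z
  by (rule integrable_mult_bounded[OF f _ M0(2)]) simp
 show ?thesis
  unfolding DERIV_def tendsto_at_iff_sequentially
 proof (intro allI impI)
  fix X :: "nat => real" assume X: "\<forall>i. X i \<in> UNIV - {0}" "X \<longlonglongrightarrow> 0"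
  have lim1: "(%n. LBINT y. f y * ((k ((x - y) + X n *R v) - k (x - y)) / X n)) \<longlonglongrightarrow>
    (LBINT y. f y * dd v k (x - y))"
  proof (rule integral_dominated_convergence[where w="%y. M * \<bar>f y\<bar>"])
   have lim: "(%n. (k ((x - y) + X n *R v) - k (x - y)) / X n) \<longlonglongrightarrow> dd v k (x - y)" for y
    using smooth_DERIV[OF sk, of "x - y" v] X
    unfolding DERIV_def tendsto_at_iff_sequentially by (auto simp: o_def)
   show "AE y in lborel. (%n. f y * ((k ((x - y) + X n *R v) - k (x - y)) / X n))
     \<longlonglongrightarrow> f y * dd v k (x - y)"
    by (intro AE_I2 tendsto_mult tendsto_const lim)
   have "\<bar>(k (z + X n *R v) - k z) / X n\<bar> <= M" for z n
    using smooth_difference_bound[OF sk M(2), where x=z and t="X n"] X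
    by (simp add: pos_divide_le_eq)
   then have "\<bar>f y\<bar> * \<bar>(k (z + X n *R v) - k z) / X n\<bar> <= M * \<bar>f y\<bar>" for y z n
    by (subst mult.commute) (intro mult_right_mono, auto)
   then show "AE y in lborel. norm (f y * ((k ((x - y) + X n *R v) - k (x - y)) / X n)) <= M * \<bar>f y\<bar>" for n
    by (auto simp: abs_mult)
  qed (use f in auto)
  have eq: "(LBINT y. f y * ((k ((x - y) + X n *R v) - k (x - y)) / X n))
    = (conv f k (x + X n *R v) - conv f k x) / X n" for n
  proof -
   have "(LBINT y. f y * ((k ((x - y) + X n *R v) - k (x - y)) / X n))
    = (LBINT y. (f y * k ((x + X n *R v) - y) - f y * k (x - y)) / X n)"
    by (simp add: algebra_simps diff_divide_distrib)
   also have "... = (conv f k (x + X n *R v) - conv f k x) / X n"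
    unfolding conv_def using int by (simp add: integral_diff)
   finally show ?thesis .
  qed
  show "((%h. (conv f k (x + (0 + h) *R v) - conv f k (x + 0 *R v)) / h) \<circ> X)
    \<longlonglongrightarrow> conv f (dd v k) x"
   using lim1 unfolding eq by (simp add: o_def conv_def[of f "dd v k"])
 qed
qed

lemma dd_conv:
 fixes k :: "real^'n::finite => real"
 assumes "integrable lborel f" "k \<in> test_functions \<Omega>"
 shows "dd v (conv f k) = conv f (dd v k)"
 by (rule smooth_ddI) (rule conv_DERIV[OF assms])

lemma smooth_conv:
 fixes k :: "real^'n::finite => real"
 assumes f: "integrable lborel f" and k: "k \<in> test_functions UNIV"
 shows "smooth (conv f k)"
proof (rule smooth_coinduct[of _ "conv f ` test_functions UNIV"])
 show "conv f k \<in> conv f ` test_functions UNIV" using k by blast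
next
 fix g assume "g \<in> conv f ` test_functions UNIV"
 then obtain k where k: "g = conv f k" "k \<in> test_functions UNIV" by blast
 obtain M where M: "M >= 0" "!!x. \<bar>k x\<bar> <= M"
  by (rule test_functions_bounded[OF k(2)]) (rule that)
 show "continuous_on UNIV g"
  unfolding k(1) by (rule conv_continuous[OF f _ M(2)]) (rule smooth_continuous[OF test_functionsD(1)[OF k(2)]])
 show "\<exists>h\<in>conv f ` test_functions UNIV. \<forall>x. ((%t. g (x + t *R v)) has_field_derivative h x) (at 0)" for v
  unfolding k(1)
  by (rule bexI[OF _ imageI[OF test_functions_dd[OF k(2), of v]]]) (use conv_DERIV[OF f k(2)] in blast)
qed

section \<open>Continuity of translations in \<open>L\<^sup>1\<close> and approximate identities\<close>

lemma integrable_bounded_ball: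
 fixes f :: "'a::euclidean_space => real"
 assumes "f \<in> borel_fns" "!!x. \<bar>f x\<bar> <= M" "!!x. x \<notin> cball a R ==> f x = 0"
 shows "integrable lborel f"
proof (rule integrable_bound)
 show "integrable lborel (%x. M * indicator (cball a R) x)"
  by (intro integrable_mult_right integrable_real_indicator emeasure_lborel_cball_finite) simp
 show "AE x in lborel. norm (f x) <= norm (M * indicator (cball a R) x)"
 proof (rule AE_I2)
  fix x show "norm (f x) <= norm (M * indicator (cball a R) x)"
   using assms(2)[of x] assms(3)[of x] by (cases "x \<in> cball a R") auto
 qed
qed (use assms in simp)

lemma integrable_test:
 fixes \<phi> :: "real^'n::finite => real"
 assumes "\<phi> \<in> test_functions \<Omega>" shows "integrable lborel \<phi>"
proof -
 obtain M where M: "M >= 0" "!!x. \<bar>\<phi> x\<bar> <= M" by (rule test_functions_bounded[OF assms]) (rule that)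
 obtain R where R: "closure {x. \<phi> x ~= 0} \<subseteq> cball 0 R"
  using bounded_subset_ballD[OF compact_imp_bounded[OF test_functionsD(2)[OF assms]], of 0] ball_subset_cball by blast
 have 0: "\<phi> x = 0" if "x \<notin> cball 0 R" for x
  using that R closure_subset[of "{x. \<phi> x ~= 0}"] by blast
 show ?thesis
  by (rule integrable_bounded_ball[where a=0 and R=R, OF test_functions_borel[OF assms] M(2) 0])
qed

text \<open>After truncation \<open>f\<close> is bounded and vanishes outside a ball. Measurable functions are limits almost everywhere of
 continuous ones; cut off in the same way, these converge in \<open>L\<^sup>1\<close> by dominated convergence.\<close>

lemma continuous_dense_L1:
 fixes f :: "'a::euclidean_space => real"
 assumes f: "integrable lborel f" and "\<delta> > 0"
 obtains g R M where "continuous_on UNIV g" "!!x. \<bar>g x\<bar> <= M" "!!x. x \<notin> cball 0 R ==> g x = 0"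
  "(LBINT x. \<bar>f x - g x\<bar>) < \<delta>"
proof -
 have [measurable]: "f \<in> borel_fns" using borel_measurable_integrable[OF f] by simp
 define T where "T n x = (if norm x < real n then max (- real n) (min (real n) (f x)) else 0)" for n x
 have [measurable]: "T n \<in> borel_fns" for n unfolding T_def[abs_def] by measurable
 have "(%n. LBINT x. \<bar>f x - T n x\<bar>) \<longlonglongrightarrow> integral\<^sup>L lborel (%x::'a. 0)"
 proof (rule integral_dominated_convergence[where w="%y. \<bar>f y\<bar>"])
  show "AE x in lborel. (%n. \<bar>f x - T n x\<bar>) \<longlonglongrightarrow> 0"
  proof (rule AE_I2, rule tendsto_eventually)
   fix x
   obtain N where N: "max (norm x) \<bar>f x\<bar> < real N" using reals_Archimedean2 by blast
   show "\<forall>\<^sub>F n in sequentially. \<bar>f x - T n x\<bar> = 0"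
    using eventually_ge_at_top[of N] by eventually_elim (use N in \<open>auto simp: T_def\<close>)
  qed
  show "AE x in lborel. norm \<bar>f x - T n x\<bar> <= \<bar>f x\<bar>" for n
   by (rule AE_I2) (auto simp: T_def)
 qed (use f in auto)
 then have "\<forall>\<^sub>F n in sequentially. (LBINT x. \<bar>f x - T n x\<bar>) < \<delta> / 2"
  using \<open>\<delta> > 0\<close> by (intro order_tendstoD(2)) auto
 then obtain n where n: "(LBINT x. \<bar>f x - T n x\<bar>) < \<delta> / 2"
  by (meson eventually_sequentially order_refl)
 have Tint: "integrable lborel (T n)"
  by (rule integrable_bounded_ball[of _ "real n" 0 "real n"]) (auto simp: T_def)
 have "T n measurable_on UNIV"
  by (intro lebesgue_measurable_imp_measurable_on) (auto intro: measurable_completion)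
 then obtain N g where N: "negligible N" "!!k. continuous_on UNIV (g k)"
  "!!x. x \<notin> N ==> (%k. g k x) \<longlonglongrightarrow> T n x"
  unfolding measurable_on_def by auto
 define h where "h k x = max (- real n) (min (real n) (g k x)) * max 0 (min 1 (real n + 1 - norm x))" for k x
 have hc: "continuous_on UNIV (h k)" for k
  unfolding h_def by (intro continuous_intros N)
 then have [measurable]: "h k \<in> borel_fns" for k
  by (intro borel_measurable_continuous_onI)
 have hb: "\<bar>h k x\<bar> <= real n" for k x
 proof -
  have "\<bar>h k x\<bar> <= real n * 1"
   unfolding h_def abs_mult by (intro mult_mono) auto
  then show ?thesis by simp
 qed
 have h0: "h k x = 0" if "x \<notin> cball 0 (real n + 1)" for k x
  using that by (auto simp: h_def)
 have "AE x in lborel. x \<notin> N"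
  using N(1) by (metis AE_not_in completion.complete2 negligible_iff_null_sets null_sets_completion_iff2 AE_completion_iff)
 have "(%k. LBINT x. \<bar>T n x - h k x\<bar>) \<longlonglongrightarrow> integral\<^sup>L lborel (%x::'a. 0)"
 proof (rule integral_dominated_convergence[where w="%x. 2 * real n * indicator (cball 0 (real n + 1)) x"])
  show "AE x in lborel. (%k. \<bar>T n x - h k x\<bar>) \<longlonglongrightarrow> 0"
   using \<open>AE x in lborel. x \<notin> N\<close>
  proof eventually_elim
   case (elim x)
   have "(%k. h k x) \<longlonglongrightarrow> max (- real n) (min (real n) (T n x)) * max 0 (min 1 (real n + 1 - norm x))"
    unfolding h_def by (intro tendsto_intros N(3) elim)
   moreover have "max (- real n) (min (real n) (T n x)) * max 0 (min 1 (real n + 1 - norm x)) = T n x"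
    by (auto simp: T_def)
   ultimately have "(%k. T n x - h k x) \<longlonglongrightarrow> T n x - T n x"
    by (intro tendsto_intros) simp
   then show ?case by (intro tendsto_rabs_zero) simp
  qed
  show "integrable lborel (%x. 2 * real n * indicator (cball 0 (real n + 1)) x)"
   by (intro integrable_mult_right integrable_real_indicator emeasure_lborel_cball_finite) simp
  show "AE x in lborel. norm \<bar>T n x - h k x\<bar> <= 2 * real n * indicator (cball 0 (real n + 1)) x" for k
  proof (rule AE_I2)
   fix x
   have "\<bar>T n x\<bar> <= real n" by (auto simp: T_def)
   moreover have "T n x = 0" if "x \<notin> cball 0 (real n + 1)" using that by (auto simp: T_def)
   ultimately show "norm \<bar>T n x - h k x\<bar> <= 2 * real n * indicator (cball 0 (real n + 1)) x"
    using hb[of k x] h0[of x k] by (cases "x \<in> cball 0 (real n + 1)") auto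
  qed
 qed auto
 then have "\<forall>\<^sub>F k in sequentially. (LBINT x. \<bar>T n x - h k x\<bar>) < \<delta> / 2"
  using \<open>\<delta> > 0\<close> by (intro order_tendstoD(2)) auto
 then obtain k where k: "(LBINT x. \<bar>T n x - h k x\<bar>) < \<delta> / 2"
  by (meson eventually_sequentially order_refl)
 have hint: "integrable lborel (h k)"
  by (rule integrable_bounded_ball[where a=0 and R="real n + 1", OF _ hb h0]) simp_all
 have "(LBINT x. \<bar>f x - h k x\<bar>) <= (LBINT x. \<bar>f x - T n x\<bar> + \<bar>T n x - h k x\<bar>)"
  using f Tint hint by (intro integral_mono) auto
 also have "... = (LBINT x. \<bar>f x - T n x\<bar>) + (LBINT x. \<bar>T n x - h k x\<bar>)"
  using f Tint hint by (intro integral_add) auto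
 also have "... < \<delta>" using n k by simp
 finally show ?thesis
  by (intro that[OF hc hb h0]) auto
qed

text \<open>Clear for continuous functions of compact support by dominated convergence; the general case follows since
 translation is an \<open>L\<^sup>1\<close> isometry.\<close>

lemma L1_translation_continuous:
 fixes f :: "'a::euclidean_space => real"
 assumes f: "integrable lborel f" and "\<delta> > 0"
 obtains e where "e > 0" "!!z. norm z < e ==> (LBINT x. \<bar>f (x - z) - f x\<bar>) < \<delta>"
proof -
 obtain g R M where g: "continuous_on UNIV g" "!!x. \<bar>g x\<bar> <= M" "!!x. x \<notin> cball 0 R ==> g x = 0"
  and fg: "(LBINT x. \<bar>f x - g x\<bar>) < \<delta> / 3"
  by (rule continuous_dense_L1[OF f, of "\<delta> / 3"]) (use \<open>\<delta> > 0\<close> in simp, rule that)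
 have [measurable]: "f \<in> borel_fns" "g \<in> borel_fns"
  using borel_measurable_integrable[OF f] borel_measurable_continuous_onI[OF g(1)] by auto
 have gint: "integrable lborel g" by (rule integrable_bounded_ball[where a=0 and R=R, OF _ g(2,3)]) simp_all
 have "\<exists>e>0. \<forall>z. norm z < e --> (LBINT x. \<bar>g (x - z) - g x\<bar>) < \<delta> / 3"
 proof (rule ccontr)
  assume "\<not> ?thesis"
  then have "\<forall>n. \<exists>z. norm z < inverse (real (Suc n)) \<and> (LBINT x. \<bar>g (x - z) - g x\<bar>) >= \<delta> / 3"
   by (force simp: not_less)
  then obtain Z where Z: "!!n. norm (Z n) < inverse (real (Suc n))"
   "!!n. (LBINT x. \<bar>g (x - Z n) - g x\<bar>) >= \<delta> / 3" by metis
  have Z0: "Z \<longlonglongrightarrow> 0"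
   by (rule Lim_null_comparison[OF _ LIMSEQ_inverse_real_of_nat]) (use Z(1) in \<open>auto intro!: always_eventually less_imp_le\<close>)
  have Z1: "norm (Z n) < 1" for n
   using Z(1)[of n] by (rule less_le_trans) (simp add: field_simps)
  have "(%n. LBINT x. \<bar>g (x - Z n) - g x\<bar>) \<longlonglongrightarrow> integral\<^sup>L lborel (%x::'a. 0)"
  proof (rule integral_dominated_convergence[where w="%x. 2 * M * indicator (cball 0 (R + 1)) x"])
   show "AE x in lborel. (%n. \<bar>g (x - Z n) - g x\<bar>) \<longlonglongrightarrow> 0"
   proof (rule AE_I2)
    fix x
    have "(%n. g (x - Z n)) \<longlonglongrightarrow> g (x - 0)"
     by (intro continuous_on_tendsto_compose[OF g(1)] tendsto_intros Z0) auto
    then have "(%n. g (x - Z n) - g x) \<longlonglongrightarrow> g (x - 0) - g x"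
     by (intro tendsto_intros)
    then show "(%n. \<bar>g (x - Z n) - g x\<bar>) \<longlonglongrightarrow> 0" by (intro tendsto_rabs_zero) simp
   qed
   show "integrable lborel (%x. 2 * M * indicator (cball 0 (R + 1)) x)"
    by (intro integrable_mult_right integrable_real_indicator emeasure_lborel_cball_finite) simp
   show "AE x in lborel. norm \<bar>g (x - Z n) - g x\<bar> <= 2 * M * indicator (cball 0 (R + 1)) x" for n
   proof (rule AE_I2)
    fix x
    show "norm \<bar>g (x - Z n) - g x\<bar> <= 2 * M * indicator (cball 0 (R + 1)) x"
    proof (cases "x \<in> cball 0 (R + 1)")
     case True
     then show ?thesis using g(2)[of x] g(2)[of "x - Z n"] by auto
    next
     case False
     then have "norm (x - Z n) > R" using Z1[of n] norm_triangle_ineq2[of x "Z n"] by auto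
     then show ?thesis using False Z1[of n] g(3)[of x] g(3)[of "x - Z n"] by auto
    qed
   qed
  qed auto
  then have "\<forall>\<^sub>F n in sequentially. (LBINT x. \<bar>g (x - Z n) - g x\<bar>) < \<delta> / 3"
   using \<open>\<delta> > 0\<close> by (intro order_tendstoD(2)) auto
  with Z(2) show False by (auto simp: eventually_sequentially not_less[symmetric])
 qed
 then obtain e where e: "e > 0" "!!z. norm z < e ==> (LBINT x. \<bar>g (x - z) - g x\<bar>) < \<delta> / 3" by blast
 show ?thesis
 proof (rule that[OF e(1)])
  fix z :: 'a assume z: "norm z < e"
  note i = f gint lborel_integrable_translate(2)[OF f] lborel_integrable_translate(2)[OF gint]
  have "(LBINT x. \<bar>f (x - z) - f x\<bar>)
   <= (LBINT x. (\<bar>f (x - z) - g (x - z)\<bar> + \<bar>g (x - z) - g x\<bar>) + \<bar>f x - g x\<bar>)"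
   using i by (intro integral_mono integrable_add integrable_abs integrable_diff) auto
  also have "... = (LBINT x. \<bar>f (x - z) - g (x - z)\<bar>) + (LBINT x. \<bar>g (x - z) - g x\<bar>)
    + (LBINT x. \<bar>f x - g x\<bar>)"
   using i by (subst integral_add, simp, simp)+ simp
  also have "(LBINT x. \<bar>f (x - z) - g (x - z)\<bar>) = (LBINT x. \<bar>f x - g x\<bar>)"
   by (rule lborel_integral_translate(2)[of "%x. \<bar>f x - g x\<bar>"]) measurable
  finally show "(LBINT x. \<bar>f (x - z) - f x\<bar>) < \<delta>"
   using fg e(2)[OF z] by simp
 qed
qed

lemma integrable_ind:
 fixes f :: "'a => real"
 assumes "integrable M f" "A \<in> sets M"
 shows "integrable M (%x. indicator A x * f x)"
proof -
 have "integrable M (%x. f x * indicator A x)"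
  using assms by (intro integrable_mult_bounded[where B=1]) (auto simp: indicator_def)
 then show ?thesis by (simp add: mult.commute)
qed

text \<open>The \<open>L\<^sup>1\<close> distance of \<open>f * k\<close> from \<open>f\<close> is at most the average of the \<open>L\<^sup>1\<close> distances of the translates of
 \<open>f\<close>, by Fubini. Kernels here are merely bounded, so that the lemma serves for mollifiers and for averages
 over balls.\<close>

lemma approx_identity_L1:
 fixes f k :: "'a::euclidean_space => real"
 assumes f: "integrable lborel f"
  and k: "k \<in> borel_fns" "!!z. 0 <= k z" "!!z. k z <= M" "(NNINT z. ennreal (k z)) = 1"
  and e: "!!z. k z ~= 0 ==> (LBINT x. \<bar>f (x - z) - f x\<bar>) <= \<delta>"
 shows "integrable lborel (conv f k)" "(LBINT x. \<bar>conv f k x - f x\<bar>) <= \<delta>"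
proof -
 have fb[measurable]: "f \<in> borel_fns" using borel_measurable_integrable[OF f] by simp
 note k(1)[measurable]
 have [measurable]: "conv f k \<in> borel_fns" by measurable
 have kint: "integrable lborel k"
  by (rule integrableI_nonneg) (use k in auto)
 have k1: "(LBINT z. k z) = 1"
  by (subst integral_eq_nn_integral) (use k in auto)
 have fk: "integrable lborel (%z. f (x - z) * k z)" for x
  by (rule integrable_mult_bounded[OF lborel_integrable_reflect[OF f], where B=M]) (use k in \<open>auto simp: abs_le_iff intro: order_trans[of _ 0]\<close>)
 have point: "ennreal \<bar>conv f k x - f x\<bar> <= (NNINT z. ennreal (\<bar>f (x - z) - f x\<bar> * k z))" for x
 proof -
  have "conv f k x - f x = (LBINT z. f (x - z) * k z) - (LBINT z. f x * k z)"
   using k1 by (simp add: conv_commute)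
  also have "... = (LBINT z. (f (x - z) - f x) * k z)"
   using fk kint by (subst integral_diff[symmetric]) (auto simp: algebra_simps)
  finally have eq: "conv f k x - f x = (LBINT z. (f (x - z) - f x) * k z)" .
  have "integrable lborel (%z. f (x - z) * k z - f x * k z)"
   using fk kint by (intro integrable_diff) auto
  then have "integrable lborel (%z. (f (x - z) - f x) * k z)" by (simp add: algebra_simps)
  from integral_norm_bound_ennreal[OF this] show ?thesis
   unfolding eq using k(2) by (simp add: abs_mult)
 qed
 have dpos: "0 <= \<delta>"
 proof -
  have "\<exists>z. k z ~= 0"
  proof (rule ccontr)
   assume "\<not> (\<exists>z. k z ~= 0)"
   then have "k = (%_. 0)" by auto
   with k(4) show False by simp
  qed
  then obtain z where "k z ~= 0" ..
  moreover have "0 <= (LBINT x. \<bar>f (x - z) - f x\<bar>)"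
   by (rule integral_nonneg) simp
  ultimately show ?thesis using e[of z] by linarith
 qed
 have "(NNINT x. ennreal \<bar>conv f k x - f x\<bar>)
   <= (NNINT x. (NNINT z. ennreal (\<bar>f (x - z) - f x\<bar> * k z)))"
  by (intro nn_integral_mono point)
 also have "... = (NNINT z. (NNINT x. ennreal (\<bar>f (x - z) - f x\<bar> * k z)))"
  by (rule lborel_pair.Fubini') measurable
 also have "... <= (NNINT z. ennreal \<delta> * ennreal (k z))"
 proof (rule nn_integral_mono)
  fix z
  have "(NNINT x. ennreal (\<bar>f (x - z) - f x\<bar> * k z))
    = (NNINT x. ennreal \<bar>f (x - z) - f x\<bar>) * ennreal (k z)"
   using k(2) by (simp add: ennreal_mult nn_integral_multc)
  also have "(NNINT x. ennreal \<bar>f (x - z) - f x\<bar>) = ennreal (LBINT x. \<bar>f (x - z) - f x\<bar>)"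
   using f lborel_integrable_translate(2)[OF f] by (intro nn_integral_eq_integral) auto
  also have "... * ennreal (k z) <= ennreal \<delta> * ennreal (k z)"
   using e[of z] by (cases "k z = 0") (auto intro!: mult_right_mono ennreal_leI)
  finally show "(NNINT x. ennreal (\<bar>f (x - z) - f x\<bar> * k z)) <= ennreal \<delta> * ennreal (k z)" .
 qed
 also have "... = ennreal \<delta>"
  using k by (simp add: nn_integral_cmult)
 finally have main: "(NNINT x. ennreal \<bar>conv f k x - f x\<bar>) <= ennreal \<delta>" .
 then have i: "integrable lborel (%x. conv f k x - f x)"
  by (intro integrableI_bounded) (auto intro: le_less_trans)
 then show "integrable lborel (conv f k)"
  using integrable_add[OF i f] by simp
 have "ennreal (LBINT x. \<bar>conv f k x - f x\<bar>) <= ennreal \<delta>"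
  using main i by (subst nn_integral_eq_integral[symmetric]) auto
 then show "(LBINT x. \<bar>conv f k x - f x\<bar>) <= \<delta>"
  using dpos by simp
qed

section \<open>Mollification\<close>

definition rho :: "real => real^'n::finite => real" where
 "rho e x = bump ((1 / e) *R x) / (LBINT y. bump ((1 / e) *R (y::real^'n)))"

lemma bump_scaled_test:
 assumes "e > 0"
 shows "(%x::real^'n::finite. bump ((1 / e) *R (x - a))) \<in> test_functions UNIV"
proof (rule test_functionsI)
 have "(%x. bump ((1 / e) *R (x - a))) = (%x. bump ((- (1 / e) *R a) + (1 / e) *R x))"
  by (simp add: algebra_simps)
 then show "smooth (%x. bump ((1 / e) *R (x - a)))"
  by (simp only: smooth_affine[OF smooth_bump])
 show "bump ((1 / e) *R (x - a)) = 0" if "x \<notin> cball a e" for x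
  unfolding bump_eq_0_iff norm_scaleR
  using that assms by (simp add: dist_norm norm_minus_commute field_simps)
qed auto

context fixes e :: real assumes e: "e > 0" begin

lemma bump_scaled_integral_pos: "(LBINT y. bump ((1 / e) *R (y::real^'n::finite))) > 0"
proof -
 let ?b = "%y::real^'n. bump ((1 / e) *R y)"
 have t: "?b \<in> test_functions UNIV" using bump_scaled_test[OF e, of 0] by simp
 have i: "integrable lborel ?b" by (rule integrable_test[OF t])
 have "\<not> (AE y in lborel. ?b y = 0)"
 proof
  assume "AE y in lborel. ?b y = 0"
  then have "AE y in lborel. y \<notin> ball (0::real^'n) e"
   by eventually_elim (use e in \<open>auto simp: bump_eq_0_iff field_simps\<close>)
  then have "emeasure lborel (ball (0::real^'n) e) = 0"
   by (subst (asm) AE_iff_measurable[OF _ refl]) (auto simp: ball_def)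
  then show False using e content_ball_gt_0_iff[of "0::real^'n" e] by (simp add: measure_def)
 qed
 then have "(LBINT y. ?b y) ~= 0"
  using integral_nonneg_eq_0_iff_AE[OF i] by (auto simp: bump_nonneg)
 moreover have "(LBINT y. ?b y) >= 0" by (intro integral_nonneg) (auto simp: bump_nonneg)
 ultimately show ?thesis by linarith
qed

lemma rho_nonneg: "0 <= rho e x"
 unfolding rho_def by (intro divide_nonneg_pos bump_nonneg bump_scaled_integral_pos)

lemma rho_test: "(rho e :: real^'n::finite => real) \<in> test_functions UNIV"
proof -
 have "(rho e :: real^'n => real)
   = (%x. bump ((1 / e) *R (x - 0)) * (1 / (LBINT y. bump ((1 / e) *R (y::real^'n)))))"
  unfolding rho_def[abs_def] by simp
 then show ?thesis
  by (simp only: test_functions_mult[OF bump_scaled_test[OF e] smooth_const])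
qed

lemma rho_eq_0: "norm x >= e ==> rho e x = 0"
 using e by (simp add: rho_def bump_eq_0_iff)

lemma rho_integrable: "integrable lborel (rho e :: real^'n::finite => real)"
 by (rule integrable_test[OF rho_test])

lemma rho_borel[measurable]: "rho e \<in> borel_fns"
 by (rule test_functions_borel[OF rho_test])

lemma rho_integral: "(LBINT x. rho e x) = 1"
 unfolding rho_def using less_imp_neq[OF bump_scaled_integral_pos, symmetric] by simp

lemma rho_nn_integral: "(NNINT x. ennreal (rho e x)) = 1"
 by (subst nn_integral_eq_integral) (auto simp: rho_nonneg rho_integrable rho_integral)

lemma rho_le:
 obtains M where "!!x::real^'n::finite. rho e x <= M" "M > 0"
proof -
 obtain M where "M >= 0" "!!x::real^'n. \<bar>rho e x\<bar> <= M" by (rule test_functions_bounded[OF rho_test]) (rule that)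
 moreover have "rho e x <= M + 1" for x :: "real^'n"
  using calculation(2)[of x] by linarith
 ultimately show ?thesis by (intro that[of "M + 1"]) auto
qed

lemma smooth_mol: "integrable lborel f ==> smooth (conv f (rho e))"
 by (rule smooth_conv[OF _ rho_test])

lemma conv_rho_integrable:
 fixes f :: "real^'n::finite => real"
 assumes "integrable lborel f"
 shows "integrable lborel (%y. f y * rho e (x - y))" "integrable lborel (%z. f (x - z) * rho e z)"
proof -
 obtain M where M: "!!x::real^'n. rho e x <= M" "M > 0" by (rule rho_le) (rule that)
 have M': "\<bar>rho e x\<bar> <= M" for x :: "real^'n" using M(1)[of x] rho_nonneg[of x] by simp
 show "integrable lborel (%y. f y * rho e (x - y))"
  by (rule integrable_mult_bounded[OF assms _ M']) simp
 show "integrable lborel (%z. f (x - z) * rho e z)"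
  by (rule integrable_mult_bounded[OF lborel_integrable_reflect[OF assms] _ M']) simp
qed

lemma mol_L1:
 fixes f :: "real^'n::finite => real"
 assumes "integrable lborel f"
 shows "integrable lborel (conv f (rho e))"
proof -
 obtain M where M: "!!x::real^'n. rho e x <= M" "M > 0" by (rule rho_le) (rule that)
 have fb: "f \<in> borel_fns" using borel_measurable_integrable[OF assms] by simp
 have "(LBINT x. \<bar>f (x - z) - f x\<bar>) <= 2 * (LBINT x. \<bar>f x\<bar>)" for z
 proof -
  have "(LBINT x. \<bar>f (x - z) - f x\<bar>) <= (LBINT x. \<bar>f (x - z)\<bar> + \<bar>f x\<bar>)"
   using assms lborel_integrable_translate(2)[OF assms] by (intro integral_mono) auto
  also have "... = (LBINT x. \<bar>f (x - z)\<bar>) + (LBINT x. \<bar>f x\<bar>)"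
   using assms lborel_integrable_translate(2)[OF assms] by (intro integral_add) auto
  also have "(LBINT x. \<bar>f (x - z)\<bar>) = (LBINT x. \<bar>f x\<bar>)"
   using fb by (intro lborel_integral_translate(2)[of "%x. \<bar>f x\<bar>"]) measurable
  finally show ?thesis by simp
 qed
 from approx_identity_L1(1)[OF assms rho_borel rho_nonneg M(1) rho_nn_integral this] show ?thesis .
qed

lemma mol_bounded:
 fixes f :: "real^'n::finite => real"
 assumes "integrable lborel f" "!!x. \<bar>f x\<bar> <= M"
 shows "\<bar>conv f (rho e) x\<bar> <= M"
proof -
 have fb[measurable]: "f \<in> borel_fns" using borel_measurable_integrable[OF assms(1)] by simp
 have "\<bar>conv f (rho e) x\<bar> <= (LBINT z. \<bar>f (x - z) * rho e z\<bar>)"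
  by (subst conv_commute) (auto intro: integral_abs_bound)
 also have "... <= (LBINT z. M * rho e (z::real^'n))"
 proof (rule integral_mono)
  show "\<bar>f (x - z) * rho e z\<bar> <= M * rho e z" for z :: "real^'n"
   by (simp add: abs_mult rho_nonneg mult_right_mono assms(2))
 qed (use rho_integrable conv_rho_integrable[OF assms(1)] in auto)
 finally show ?thesis by (simp add: rho_integral)
qed

text \<open>Jensen's inequality for the square and the probability density \<^term>\<open>rho e\<close>.\<close>

lemma mol_square_le:
 fixes f :: "real^'n::finite => real"
 assumes f: "integrable lborel f" and f2: "integrable lborel (%x. (f x)^2)"
 shows "(conv f (rho e) x)^2 <= conv (%x. (f x)^2) (rho e) x"
proof -
 have fb[measurable]: "f \<in> borel_fns" using borel_measurable_integrable[OF f] by simp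
 define c where "c = conv f (rho e) x"
 have c: "c = (LBINT z. f (x - z) * rho e z)" unfolding c_def by (rule conv_commute) measurable
 note i = conv_rho_integrable(2)[OF f, of x] conv_rho_integrable(2)[OF f2, of x] rho_integrable
 have "0 <= (LBINT z. (f (x - z) - c)^2 * rho e z)"
  by (intro integral_nonneg) (simp add: rho_nonneg)
 also have "... = (LBINT z. (f (x - z))^2 * rho e z - 2 * c * (f (x - z) * rho e z) + c^2 * rho e z)"
  by (simp add: power2_eq_square algebra_simps)
 also have "... = (LBINT z. (f (x - z))^2 * rho e z - 2 * c * (f (x - z) * rho e z))
   + (LBINT z. c^2 * rho e (z::real^'n))"
  by (intro integral_add integrable_diff integrable_mult_right i)
 also have "... = (LBINT z. (f (x - z))^2 * rho e z) - (LBINT z. 2 * c * (f (x - z) * rho e z))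
   + (LBINT z. c^2 * rho e (z::real^'n))"
  by (subst integral_diff) (intro integrable_mult_right i refl)+
 also have "... = (LBINT z. (f (x - z))^2 * rho e z) - 2 * c * c + c^2 * 1"
  by (simp only: integral_mult_right_zero rho_integral c[symmetric])
 also have "(LBINT z. (f (x - z))^2 * rho e z) = conv (%x. (f x)^2) (rho e) x"
  by (rule conv_commute[symmetric]) measurable
 finally show ?thesis unfolding c_def by (simp add: power2_eq_square)
qed

text \<open>By Fubini, mass at \<open>x\<close> is spread over the ball of radius \<open>e\<close> around \<open>x\<close> only.\<close>

lemma mol_integral_ball:
 fixes g :: "real^'n::finite => real"
 assumes g: "integrable lborel g" "!!x. 0 <= g x"
 shows "(LBINT x. in_ball x0 r x * conv g (rho e) x)
   <= (LBINT x. in_ball x0 (r + e) x * g x)"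
proof -
 have gb[measurable]: "g \<in> borel_fns" using borel_measurable_integrable[OF g(1)] by simp
 have cg: "0 <= conv g (rho e) x" for x unfolding conv_def by (intro integral_nonneg) (simp add: g rho_nonneg)
 have ig: "integrable lborel (%x. indicator A x * g x)" if "A \<in> sets borel" for A
  using that by (intro integrable_ind g) simp
 have [measurable]: "(rho e :: real^'n => real) \<in> borel_fns" "ball x0 r \<in> sets borel"
  by (rule rho_borel) simp
 have nn1: "(NNINT x. ennreal (rho e (x::real^'n))) = 1"
  by (rule rho_nn_integral)
 have ic: "integrable lborel (%x. in_ball x0 r x * conv g (rho e) x)"
  by (intro integrable_ind mol_L1 g) simp
 have "ennreal (LBINT x. in_ball x0 r x * conv g (rho e) x)
   = (NNINT x. ennreal (in_ball x0 r x * conv g (rho e) x))"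
  using ic by (intro nn_integral_eq_integral[symmetric]) (auto simp: cg)
 also have "... = (NNINT x. (NNINT y. in_ball x0 r x * ennreal (g y * rho e (x - y))))"
 proof (rule nn_integral_cong)
  fix x
  have "ennreal (conv g (rho e) x) = (NNINT y. ennreal (g y * rho e (x - y)))"
   unfolding conv_def using conv_rho_integrable(1)[OF g(1)]
   by (intro nn_integral_eq_integral[symmetric]) (auto simp: g rho_nonneg)
  then show "ennreal (in_ball x0 r x * conv g (rho e) x)
    = (NNINT y. in_ball x0 r x * ennreal (g y * rho e (x - y)))"
   by (simp add: nn_integral_cmult indicator_def)
 qed
 also have "... = (NNINT y. (NNINT x. in_ball x0 r x * ennreal (g y * rho e (x - y))))"
  by (rule lborel_pair.Fubini') measurable
 also have "... <= (NNINT y. ennreal (in_ball x0 (r + e) y * g y))"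
 proof (rule nn_integral_mono)
  fix y
  have "(NNINT x. in_ball x0 r x * ennreal (g y * rho e (x - y)))
   <= (NNINT x. ennreal (in_ball x0 (r + e) y * g y) * ennreal (rho e (x - y)))"
  proof (rule nn_integral_mono)
   fix x
   consider "norm (x - y) >= e" | "x \<notin> ball x0 r" | "norm (x - y) < e" "x \<in> ball x0 r" by linarith
   then show "in_ball x0 r x * ennreal (g y * rho e (x - y))
     <= ennreal (in_ball x0 (r + e) y * g y) * ennreal (rho e (x - y))"
   proof cases
    case 3
    then have "y \<in> ball x0 (r + e)"
     using norm_triangle_ineq[of "x0 - x" "x - y"] by (simp add: dist_norm)
    then show ?thesis using 3 by (simp add: ennreal_mult g rho_nonneg)
   qed (auto simp: rho_eq_0)
  qed
  also have "... = ennreal (in_ball x0 (r + e) y * g y) * (NNINT x. ennreal (rho e (x - y)))"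
   by (rule nn_integral_cmult) measurable
  also have "(NNINT x. ennreal (rho e (x - y))) = 1"
   using lborel_nn_integral_affine[of "%x. ennreal (rho e x)" 1 "- y"] nn1 by simp
  finally show "(NNINT x. in_ball x0 r x * ennreal (g y * rho e (x - y)))
    <= ennreal (in_ball x0 (r + e) y * g y)" by simp
 qed
 also have "... = ennreal (LBINT x. in_ball x0 (r + e) x * g x)"
  using ig by (intro nn_integral_eq_integral) (auto simp: g)
 finally show ?thesis
  by (subst (asm) ennreal_le_iff) (auto intro!: integral_nonneg simp: g)
qed

end

lemma mol_tendsto_L1:
 assumes f: "integrable lborel f" and "\<delta> > 0"
 obtains e0 where "e0 > 0" "!!e. 0 < e ==> e <= e0 ==> (LBINT x. \<bar>conv f (rho e) x - f x\<bar>) <= \<delta>"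
proof -
 obtain e0 where e0: "e0 > 0" "!!z. norm z < e0 ==> (LBINT x. \<bar>f (x - z) - f x\<bar>) < \<delta>"
  by (rule L1_translation_continuous[OF f \<open>\<delta> > 0\<close>]) (rule that)
 show ?thesis
 proof (rule that[OF e0(1)])
  fix e :: real assume e: "0 < e" "e <= e0"
  obtain M where M: "!!x::real^'a. rho e x <= M" "M > 0" by (rule rho_le[OF e(1)]) (rule that)
  show "(LBINT x. \<bar>conv f (rho e) x - f x\<bar>) <= \<delta>"
  proof (rule approx_identity_L1(2)[OF f rho_borel[OF e(1)] rho_nonneg[OF e(1)] M(1) rho_nn_integral[OF e(1)]])
   fix z :: "real^'a" assume "rho e z ~= 0"
   then have "norm z < e0" using rho_eq_0[OF e(1), of z] e(2) by force
   then show "(LBINT x. \<bar>f (x - z) - f x\<bar>) <= \<delta>" using e0(2) less_imp_le by blast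
  qed
 qed
qed

lemma mol_tendsto_L1_seq:
 assumes f: "integrable lborel f" and e: "!!k. e k > 0" "e \<longlonglongrightarrow> 0"
 shows "(%k. LBINT x. \<bar>conv f (rho (e k)) x - f x\<bar>) \<longlonglongrightarrow> 0"
proof (rule order_tendstoI)
 fix a :: real assume "a < 0"
 moreover have "0 <= (LBINT x. \<bar>conv f (rho (e k)) x - f x\<bar>)" for k
  by (rule integral_nonneg) simp
 ultimately show "\<forall>\<^sub>F k in sequentially. a < (LBINT x. \<bar>conv f (rho (e k)) x - f x\<bar>)"
  by (intro always_eventually allI) (rule less_le_trans)
next
 fix a :: real assume "0 < a"
 then have "0 < a / 2" by simp
 obtain e0 where e0: "e0 > 0"
  "!!e. 0 < e ==> e <= e0 ==> (LBINT x. \<bar>conv f (rho e) x - f x\<bar>) <= a / 2"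
  by (rule mol_tendsto_L1[OF f \<open>0 < a / 2\<close>]) (rule that)
 have "\<forall>\<^sub>F k in sequentially. e k < e0" using e(2) e0(1) by (rule order_tendstoD)
 then show "\<forall>\<^sub>F k in sequentially. (LBINT x. \<bar>conv f (rho (e k)) x - f x\<bar>) < a"
 proof eventually_elim
  case (elim k)
  then show ?case using e0(2)[OF e(1)[of k]] \<open>0 < a\<close> by simp
 qed
qed

section \<open>Weak derivatives of integrable functions\<close>

definition wpd :: "(real^'n::finite) set => 'n => (real^'n => real) => (real^'n => real) => bool" where
 "wpd \<Omega> i f g \<longleftrightarrow>
  (\<forall>\<phi>\<in>test_functions \<Omega>. (LBINT x. f x * pd i \<phi> x) = - (LBINT x. g x * \<phi> x))"

lemma rho_shift_test:
 assumes "e > 0" "cball x e \<subseteq> \<Omega>"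
 shows "(%y. rho e (x - y)) \<in> test_functions \<Omega>"
proof (rule test_functionsI[of _ "cball x e"])
 show "smooth (%y. rho e (x - y))"
  using smooth_affine[OF test_functionsD(1)[OF rho_test[OF assms(1)]], of x "-1"] by simp
 show "rho e (x - y) = 0" if "y \<notin> cball x e" for y
  using that by (intro rho_eq_0[OF assms(1)]) (simp add: dist_norm)
qed (use assms in auto)

text \<open>The mollifier centred at \<open>x\<close> is a test function as soon as its support lies in the domain, so the
 mollification turns a weak derivative into a classical one.\<close>

lemma pd_mol_weak:
 assumes e: "e > 0" and x: "cball x e \<subseteq> \<Omega>" and f: "integrable lborel f" and w: "wpd \<Omega> i f g"
 shows "pd i (conv f (rho e)) x = conv g (rho e) x"
proof -
 note s = test_functionsD(1)[OF rho_test[OF e]]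
 have "pd i (%y. rho e (x - y)) = (%y. - pd i (rho e) (x - y))"
  using dd_affine[OF s, of "axis i 1" x "-1"] by simp
 moreover have "(LBINT y. f y * pd i (%y. rho e (x - y)) y) = - (LBINT y. g y * rho e (x - y))"
  using w rho_shift_test[OF e x] unfolding wpd_def by blast
 ultimately have "conv f (pd i (rho e)) x = conv g (rho e) x" by (simp add: conv_def)
 then show ?thesis by (simp add: dd_conv[OF f rho_test[OF e]])
qed

text \<open>A function that is orthogonal to all test functions has vanishing mollifications, hence
 vanishes.\<close>

lemma fundamental_lemma:
 fixes h :: "real^'n::finite => real"
 assumes h: "integrable lborel h" and "open \<Omega>"
  and 0: "!!\<phi>. \<phi> \<in> test_functions \<Omega> ==> (LBINT x. h x * \<phi> x) = 0"
 shows "AE x in lborel. x \<in> \<Omega> --> h x = 0"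
proof -
 define A where "A k = - (\<Union>y\<in>-\<Omega>. ball y (1 / real (Suc k)))" for k
 have A[measurable]: "A k \<in> sets borel" for k
  unfolding A_def by (intro borel_closed closed_Compl open_UN) auto
 have Ae: "cball x e \<subseteq> \<Omega>" if "x \<in> A k" "e < 1 / real (Suc k)" for x k e
 proof
  fix y assume "y \<in> cball x e"
  then show "y \<in> \<Omega>" using that by (force simp: A_def dist_commute)
 qed
 have [measurable]: "h \<in> borel_fns" using borel_measurable_integrable[OF h] by simp
 have hA: "integrable lborel (%x. indicator (A k) x * \<bar>h x\<bar>)" for k
  by (intro integrable_ind integrable_abs h) simp
 have "(LBINT x. indicator (A k) x * \<bar>h x\<bar>) <= 0 + \<delta>" if "\<delta> > 0" for k \<delta>
 proof -
  obtain e0 where e0: "e0 > 0"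
   "!!e. 0 < e ==> e <= e0 ==> (LBINT x. \<bar>conv h (rho e) x - h x\<bar>) <= \<delta>"
   by (rule mol_tendsto_L1[OF h \<open>\<delta> > 0\<close>]) (rule that)
  define e where "e = min e0 (1 / (2 * real (Suc k)))"
  have e: "0 < e" "e <= e0" "e < 1 / real (Suc k)"
   using e0(1) by (auto simp: e_def min_less_iff_disj field_simps)
  have "indicator (A k) x * \<bar>h x\<bar> <= \<bar>conv h (rho e) x - h x\<bar>" for x
  proof (cases "x \<in> A k")
   case True
   have "conv h (rho e) x = 0"
    unfolding conv_def by (rule 0[OF rho_shift_test[OF e(1) Ae[OF True e(3)]]])
   then show ?thesis by (simp add: indicator_def)
  qed simp
  then have "(LBINT x. indicator (A k) x * \<bar>h x\<bar>) <= (LBINT x. \<bar>conv h (rho e) x - h x\<bar>)"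
   using hA h mol_L1[OF e(1) h] by (intro integral_mono) auto
  also have "... <= \<delta>" by (rule e0(2)[OF e(1,2)])
  finally show ?thesis by simp
 qed
 then have "(LBINT x. indicator (A k) x * \<bar>h x\<bar>) <= 0" for k by (rule field_le_epsilon)
 moreover have "(LBINT x. indicator (A k) x * \<bar>h x\<bar>) >= 0" for k by (intro integral_nonneg) simp
 ultimately have "(LBINT x. indicator (A k) x * \<bar>h x\<bar>) = 0" for k by (simp add: antisym)
 then have "AE x in lborel. indicator (A k) x * \<bar>h x\<bar> = 0" for k
  using integral_nonneg_eq_0_iff_AE[OF hA] by simp
 then have "AE x in lborel. \<forall>k. indicator (A k) x * \<bar>h x\<bar> = 0"
  by (subst AE_all_countable) blast
 then show ?thesis
 proof eventually_elim
  case (elim x)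
  show ?case
  proof
   assume "x \<in> \<Omega>"
   then obtain r where r: "r > 0" "ball x r \<subseteq> \<Omega>" using \<open>open \<Omega>\<close> openE by blast
   obtain k where k: "inverse (real (Suc k)) < r" using reals_Archimedean[OF r(1)] by blast
   have "x \<in> A k"
    using r(2) k by (force simp: A_def dist_commute inverse_eq_divide)
   then show "h x = 0" using elim[rule_format, of k] by simp
  qed
 qed
qed

section \<open>Testing with cut-off functions\<close>

lemma harmonic_fractions:
 assumes "(d::real) > 0"
 shows "d / real (k + 2) > 0" "d / real (k + 2) < d" "(%k. d / real (k + 2)) \<longlonglongrightarrow> 0"
proof -
 show "d / real (k + 2) > 0" using assms by simp
 have "d * 1 < d * real (k + 2)" using assms by (intro mult_strict_left_mono) auto
 then show "d / real (k + 2) < d" by (simp add: divide_less_eq)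
 show "(%k. d / real (k + 2)) \<longlonglongrightarrow> 0" by real_asymp
qed

lemma integrable_mult_bounded_left:
 fixes f g :: "'a => real"
 assumes "integrable M f" "g \<in> borel_measurable M" "!!x. \<bar>g x\<bar> <= B"
 shows "integrable M (%x. g x * f x)"
 using integrable_mult_bounded[OF assms] by (simp add: mult.commute)

text \<open>Bounded functions are dual to \<open>L\<^sup>1\<close>, where mollifications converge.\<close>

lemma mol_weak_lim:
 fixes f g :: "real^'n::finite => real"
 assumes f: "integrable lborel f" and g: "g \<in> borel_fns" "!!x. \<bar>g x\<bar> <= B"
  and e: "!!k. e k > 0" "e \<longlonglongrightarrow> 0"
 shows "(%k. LBINT x. g x * conv f (rho (e k)) x) \<longlonglongrightarrow> (LBINT x. g x * f x)"
proof -
 note fk = mol_L1[OF e(1) f]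
 have B: "B >= 0" using g(2)[of 0] by linarith
 have "(%k. (LBINT x. g x * conv f (rho (e k)) x) - (LBINT x. g x * f x)) \<longlonglongrightarrow> 0"
 proof (rule Lim_null_comparison)
  show "(%k. B * (LBINT x. \<bar>conv f (rho (e k)) x - f x\<bar>)) \<longlonglongrightarrow> 0"
   using tendsto_mult_left[OF mol_tendsto_L1_seq[OF f e], of B] by simp
  have "norm ((LBINT x. g x * conv f (rho (e k)) x) - (LBINT x. g x * f x))
    <= B * (LBINT x. \<bar>conv f (rho (e k)) x - f x\<bar>)" for k
  proof -
   have i: "integrable lborel (%x. g x * conv f (rho (e k)) x)" "integrable lborel (%x. g x * f x)"
    using g by (auto intro!: integrable_mult_bounded_left[OF _ _ g(2)] fk f)
   have "(LBINT x. g x * conv f (rho (e k)) x) - (LBINT x. g x * f x)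
     = (LBINT x. g x * conv f (rho (e k)) x - g x * f x)"
    by (rule integral_diff[OF i, symmetric])
   also have "norm ... <= (LBINT x. \<bar>g x * conv f (rho (e k)) x - g x * f x\<bar>)"
    unfolding real_norm_def by (rule integral_abs_bound)
   also have "... <= (LBINT x. B * \<bar>conv f (rho (e k)) x - f x\<bar>)"
   proof (rule integral_mono)
    show "\<bar>g x * conv f (rho (e k)) x - g x * f x\<bar> <= B * \<bar>conv f (rho (e k)) x - f x\<bar>" for x
     using g(2)[of x] by (simp add: right_diff_distrib[symmetric] abs_mult mult_right_mono)
   qed (use i fk[of k] f in auto)
   finally show ?thesis by simp
  qed
  then show "\<forall>\<^sub>F k in sequentially. norm ((LBINT x. g x * conv f (rho (e k)) x) - (LBINT x. g x * f x))
    <= B * (LBINT x. \<bar>conv f (rho (e k)) x - f x\<bar>)"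
   by (intro always_eventually allI)
 qed
 then show ?thesis by (subst (asm) LIM_zero_iff)
qed

lemma dd_cong_ball:
 assumes "smooth f" "smooth g" "r > 0" "!!y. y \<in> ball x r ==> f y = g y"
 shows "dd v f x = dd v g x"
proof -
 have "dd v (%y. f y - g y) x = 0"
  by (rule dd_eq_0_outside[of "- ball x r"]) (use assms(3,4) in auto)
 then show ?thesis by (simp add: dd_diff[OF assms(1,2)])
qed

lemma smooth_affine_fun: "smooth (%x::'a::real_inner. a \<bullet> x + c)"
 by (intro smooth_add smooth_inner smooth_const)

lemma dd_affine_fun: "dd v (%x::'a::real_inner. a \<bullet> x + c) = (%_. a \<bullet> v)"
 by (simp add: dd_add[OF smooth_inner smooth_const] dd_inner dd_const)

text \<open>Second derivatives of \<open>\<psi>(g - l)\<close> for a cut-off \<open>\<psi>\<close> and an affine \<open>l\<close>.\<close>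

lemma pd_pd_cutoff:
 fixes \<psi> g :: "real^'n::finite => real"
 assumes \<psi>: "smooth \<psi>" and g: "smooth g"
 shows "pd i (pd j (%x. \<psi> x * (g x - (a \<bullet> x + c)))) x =
  \<psi> x * pd i (pd j g) x + pd i \<psi> x * (pd j g x - a $ j) + pd j \<psi> x * (pd i g x - a $ i)
   + pd i (pd j \<psi>) x * (g x - (a \<bullet> x + c))"
proof -
 let ?g = "%x. g x - (a \<bullet> x + c)"
 have sg: "smooth ?g" by (intro smooth_diff g smooth_affine_fun)
 have ax: "a \<bullet> axis k 1 = a $ k" for k by (simp add: inner_axis)
 have dg: "pd k ?g = (%x. pd k g x - a $ k)" for k
  by (simp only: dd_diff[OF g smooth_affine_fun] dd_affine_fun ax)
 have sdg: "smooth (%x. pd k g x - a $ k)" for k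
  by (intro smooth_diff smooth_dd g smooth_const)
 have ddg: "pd i (%x. pd j g x - a $ j) = pd i (pd j g)"
  by (simp only: dd_diff[OF smooth_dd[OF g] smooth_const] dd_const diff_0_right)
 have "pd j (%x. \<psi> x * ?g x) = (%x. pd j \<psi> x * ?g x + (pd j g x - a $ j) * \<psi> x)"
  by (simp only: dd_mult[OF \<psi> sg] dg)
 then have "pd i (pd j (%x. \<psi> x * ?g x)) =
  (%x. (pd i (pd j \<psi>) x * ?g x + (pd i g x - a $ i) * pd j \<psi> x)
   + (pd i (pd j g) x * \<psi> x + pd i \<psi> x * (pd j g x - a $ j)))"
  by (simp only: dd_add[OF smooth_mult[OF smooth_dd[OF \<psi>] sg] smooth_mult[OF sdg \<psi>]]
    dd_mult[OF smooth_dd[OF \<psi>] sg] dd_mult[OF sdg \<psi>] dg ddg)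
 then show ?thesis by (simp add: algebra_simps)
qed

lemma integrable_mult2:
 fixes f :: "real^'n::finite => real"
 assumes "\<phi> \<in> test_functions \<Omega>" "K \<in> borel_fns" "!!x. \<bar>K x\<bar> <= M"
 obtains B where "(%x. K x * \<phi> x) \<in> borel_fns" "!!x. \<bar>K x * \<phi> x\<bar> <= B"
proof -
 obtain N where N: "N >= 0" "!!x. \<bar>\<phi> x\<bar> <= N" by (rule test_functions_bounded[OF assms(1)]) (rule that)
 show ?thesis
 proof (rule that)
  show "(%x. K x * \<phi> x) \<in> borel_fns"
   using assms(2) test_functions_borel[OF assms(1)] by measurable
  have "M >= 0" using assms(3)[of 0] by linarith
  then show "\<bar>K x * \<phi> x\<bar> <= M * N" for x
   unfolding abs_mult by (intro mult_mono assms(3) N) auto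
 qed
qed

text \<open>An equation \<open>\<integral> K\<^sub>i\<^sub>j \<eta>\<^sub>i\<^sub>j = 0\<close> that holds for test functions may be tested with
 \<open>\<psi>(f - l)\<close> where \<open>f\<close> has two weak derivatives only: mollify \<open>f\<close>.\<close>

lemma test_with_cutoff:
 fixes f :: "real^'n::finite => real" and q :: "'n => real^'n => real"
  and w K :: "'n => 'n => real^'n => real"
 assumes "open \<Omega>" and \<psi>: "\<psi> \<in> test_functions \<Omega>"
  and f: "integrable lborel f" "!!i. integrable lborel (q i)" "!!i j. integrable lborel (w i j)"
  and wd: "!!i. wpd \<Omega> i f (q i)" "!!i j. wpd \<Omega> j (q i) (w i j)"
  and sym: "!!i j x. w i j x = w j i x"
  and K: "!!i j. K i j \<in> borel_fns" "!!i j x. \<bar>K i j x\<bar> <= M"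
  and eq: "!!\<eta>. \<eta> \<in> test_functions \<Omega> ==>
   (LBINT x. (\<Sum>i\<in>UNIV. \<Sum>j\<in>UNIV. K i j x * pd i (pd j \<eta>) x)) = 0"
 shows "(LBINT x. (\<Sum>i\<in>UNIV. \<Sum>j\<in>UNIV. K i j x *
  (\<psi> x * w i j x + pd i \<psi> x * (q j x - a $ j) + pd j \<psi> x * (q i x - a $ i)
   + pd i (pd j \<psi>) x * (f x - (a \<bullet> x + c))))) = 0"
proof -
 define S where "S = closure {x. \<psi> x ~= 0}"
 have S: "compact S" "S \<subseteq> \<Omega>" "closed S" using test_functionsD[OF \<psi>] by (auto simp: S_def)
 note s\<psi> = test_functionsD(1)[OF \<psi>]
 note t1 = test_functions_dd[OF \<psi>]
 note t2 = test_functions_dd[OF t1]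
 have off: "\<psi> x = 0" "pd i \<psi> x = 0" "pd i (pd j \<psi>) x = 0" if "x \<notin> S" for x i j
 proof -
  have 0: "\<psi> x = 0" if "x \<notin> S" for x using that closure_subset[of "{x. \<psi> x ~= 0}"] by (auto simp: S_def)
  have 1: "pd i \<psi> x = 0" if "x \<notin> S" for x i by (rule dd_eq_0_outside[OF S(3) that 0])
  show "\<psi> x = 0" "pd i \<psi> x = 0" using 0 1 that by auto
  show "pd i (pd j \<psi>) x = 0" by (rule dd_eq_0_outside[OF S(3) that 1])
 qed
 obtain e0 where e0: "e0 > 0" "(\<Union>x\<in>S. cball x e0) \<subseteq> \<Omega>"
  by (rule compact_subset_open_imp_cball_epsilon_subset[OF S(1) \<open>open \<Omega>\<close> S(2)]) (rule that)
 define e where "e k = e0 / real (k + 2)" for k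
 have e: "!!k. e k > 0" "e \<longlonglongrightarrow> 0" "!!k. e k < e0"
  unfolding e_def by (rule harmonic_fractions[OF e0(1)])+
 define m where "m g k = conv g (rho (e k))" for g :: "real^'n => real" and k
 have sm: "smooth (m g k)" if "integrable lborel g" for g k unfolding m_def by (rule smooth_mol[OF e(1) that])
 have loc: "pd i (m g k) x = m h k x" if "integrable lborel g" "wpd \<Omega> i g h" "cball x (e k) \<subseteq> \<Omega>" for i g h k x
  unfolding m_def by (rule pd_mol_weak[OF e(1) that(3,1,2)])
 have SO: "cball y (e k) \<subseteq> \<Omega>" if "x \<in> S" "y \<in> ball x (e0 - e k)" for x y k
 proof -
  have "cball y (e k) \<subseteq> cball x e0" using that(2) by (intro subsetI) (simp, metis add.commute dist_commute dist_triangle_le less_imp_le add_mono diff_add_cancel le_diff_eq order_trans dist_triangle)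
  then show ?thesis using e0(2) that(1) by blast
 qed
 have p1: "pd i (m f k) x = m (q i) k x" if "x \<in> S" for x i k
  by (rule loc[OF f(1) wd(1) SO[OF that]]) (use e(3) in simp)
 have p2: "pd i (pd j (m f k)) x = m (w i j) k x" if x: "x \<in> S" for x i j k
 proof -
  have "pd i (pd j (m f k)) x = pd i (m (q j) k) x"
   by (rule dd_cong_ball[OF smooth_dd[OF sm[OF f(1)]] sm[OF f(2)], of "e0 - e k"])
    (use e(3) in \<open>auto intro!: loc[OF f(1) wd(1)] SO[OF x]\<close>)
  also have "... = m (w j i) k x"
   by (rule loc[OF f(2) wd(2) SO[OF x]]) (use e(3) in simp)
  also have "w j i = w i j" using sym by blast
  finally show ?thesis .
 qed
 define R where "R i j x = K i j x * (pd i \<psi> x * a $ j + pd j \<psi> x * a $ i + pd i (pd j \<psi>) x * (a \<bullet> x + c))" for i j x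
 have Rint: "integrable lborel (R i j)" for i j
 proof -
  have lb: "(%x. a \<bullet> x + c) \<in> borel_fns"
   by (rule smooth_borel_measurable[OF smooth_affine_fun])
  have "integrable lborel (%x. pd i (pd j \<psi>) x * (a \<bullet> x + c))"
   by (rule integrable_test[OF test_functions_mult[OF t2 smooth_affine_fun]])
  then have "integrable lborel (%x. pd i \<psi> x * a $ j + pd j \<psi> x * a $ i + pd i (pd j \<psi>) x * (a \<bullet> x + c))"
   by (intro integrable_add integrable_mult_left integrable_test[OF t1])
  then show ?thesis unfolding R_def
   by (rule integrable_mult_bounded_left[OF _ _ K(2)]) (simp add: K(1))
 qed
 define T where "T k i j x = (K i j x * \<psi> x) * m (w i j) k x + (K i j x * pd i \<psi> x) * m (q j) k x
  + (K i j x * pd j \<psi> x) * m (q i) k x + (K i j x * pd i (pd j \<psi>) x) * m f k x - R i j x" for k i j x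
 define T0 where "T0 i j x = (K i j x * \<psi> x) * w i j x + (K i j x * pd i \<psi> x) * q j x
  + (K i j x * pd j \<psi> x) * q i x + (K i j x * pd i (pd j \<psi>) x) * f x - R i j x" for i j x
 have T_eq: "K i j x * pd i (pd j (%x. \<psi> x * (m f k x - (a \<bullet> x + c)))) x = T k i j x" for i j k x
 proof (cases "x \<in> S")
  case True
  show ?thesis
   unfolding pd_pd_cutoff[OF s\<psi> sm[OF f(1)]] p1[OF True] p2[OF True] T_def R_def by (simp add: algebra_simps)
 next
  case False
  show ?thesis
   unfolding pd_pd_cutoff[OF s\<psi> sm[OF f(1)]] T_def R_def using off[OF False] by simp
 qed
 have z: "(LBINT x. (\<Sum>i\<in>UNIV. \<Sum>j\<in>UNIV. T k i j x)) = 0" for k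
 proof -
  have "(%x. \<psi> x * (m f k x - (a \<bullet> x + c))) \<in> test_functions \<Omega>"
   by (intro test_functions_mult \<psi> smooth_diff sm f smooth_affine_fun)
  from eq[OF this] show ?thesis unfolding T_eq .
 qed
 have mi: "integrable lborel (m g k)" if "integrable lborel g" for g k
  unfolding m_def by (rule mol_L1[OF e(1) that])
 have Kt: "integrable lborel (%x. (K i j x * \<phi> x) * g x)"
  if ph: "\<phi> \<in> test_functions \<Omega>" and gi: "integrable lborel g" for \<phi> g i j
 proof -
  obtain B where B: "(%x. K i j x * \<phi> x) \<in> borel_fns" "!!x. \<bar>K i j x * \<phi> x\<bar> <= B"
   by (rule integrable_mult2[OF ph K(1) K(2)]) (rule that)
  then show ?thesis using gi by (intro integrable_mult_bounded_left[OF _ _ B(2)]) auto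
 qed
 have Kl: "(%k. LBINT x. (K i j x * \<phi> x) * m g k x) \<longlonglongrightarrow> (LBINT x. (K i j x * \<phi> x) * g x)"
  if ph: "\<phi> \<in> test_functions \<Omega>" and gi: "integrable lborel g" for \<phi> g i j
 proof -
  obtain B where B: "(%x. K i j x * \<phi> x) \<in> borel_fns" "!!x. \<bar>K i j x * \<phi> x\<bar> <= B"
   by (rule integrable_mult2[OF ph K(1) K(2)]) (rule that)
  show ?thesis unfolding m_def by (rule mol_weak_lim[OF gi B e(1,2)])
 qed
 note ii = Kt[OF \<psi> mi[OF f(3)]] Kt[OF t1 mi[OF f(2)]] Kt[OF t2 mi[OF f(1)]] Rint
 note ii0 = Kt[OF \<psi> f(3)] Kt[OF t1 f(2)] Kt[OF t2 f(1)] Rint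
 have Ti: "integrable lborel (T k i j)" for k i j
  unfolding T_def by (intro integrable_add integrable_diff ii)
 have T0i: "integrable lborel (T0 i j)" for i j
  unfolding T0_def by (intro integrable_add integrable_diff ii0)
 have TI: "(LBINT x. T k i j x) = (LBINT x. (K i j x * \<psi> x) * m (w i j) k x)
   + (LBINT x. (K i j x * pd i \<psi> x) * m (q j) k x) + (LBINT x. (K i j x * pd j \<psi> x) * m (q i) k x)
   + (LBINT x. (K i j x * pd i (pd j \<psi>) x) * m f k x) - (LBINT x. R i j x)" for k i j
  unfolding T_def
  by (simp only: integral_add integral_diff
   integrable_add integrable_diff ii)
 have T0I: "(LBINT x. T0 i j x) = (LBINT x. (K i j x * \<psi> x) * w i j x)
   + (LBINT x. (K i j x * pd i \<psi> x) * q j x) + (LBINT x. (K i j x * pd j \<psi> x) * q i x)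
   + (LBINT x. (K i j x * pd i (pd j \<psi>) x) * f x) - (LBINT x. R i j x)" for i j
  unfolding T0_def
  by (simp only: integral_add integral_diff
   integrable_add integrable_diff ii0)
 have "(%k. LBINT x. T k i j x) \<longlonglongrightarrow> (LBINT x. T0 i j x)" for i j
  unfolding TI T0I by (intro tendsto_intros Kl \<psi> t1 t2 f)
 then have "(%k. \<Sum>i\<in>UNIV. \<Sum>j\<in>UNIV. LBINT x. T k i j x) \<longlonglongrightarrow> (\<Sum>i\<in>UNIV. \<Sum>j\<in>UNIV. LBINT x. T0 i j x)"
  by (intro tendsto_sum)
 moreover have "(\<Sum>i\<in>UNIV. \<Sum>j\<in>UNIV. LBINT x. T k i j x) = 0" for k
  using z[of k] by (simp add: integral_sum Ti integrable_sum)
 ultimately have "(\<Sum>i\<in>UNIV. \<Sum>j\<in>UNIV. LBINT x. T0 i j x) = 0"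
  by (simp add: LIMSEQ_const_iff)
 then have "(LBINT x. (\<Sum>i\<in>UNIV. \<Sum>j\<in>UNIV. T0 i j x)) = 0"
  by (simp add: integral_sum T0i integrable_sum)
 also have "(%x. \<Sum>i\<in>UNIV. \<Sum>j\<in>UNIV. T0 i j x) = (%x. \<Sum>i\<in>UNIV. \<Sum>j\<in>UNIV. K i j x *
  (\<psi> x * w i j x + pd i \<psi> x * (q j x - a $ j) + pd j \<psi> x * (q i x - a $ i)
   + pd i (pd j \<psi>) x * (f x - (a \<bullet> x + c))))"
  unfolding T0_def R_def by (intro ext sum.cong refl) (simp add: algebra_simps)
 finally show ?thesis .
qed

section \<open>Difference quotients\<close>

text \<open>Integrate \<open>0 \<le> (f - m)\<^sup>2 k\<close> for the mean \<open>m\<close> of \<open>f\<close>.\<close>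

lemma weighted_square_Jensen:
 fixes f k :: "'a => real"
 assumes k: "integrable M k" "!!x. 0 <= k x" "(\<integral>x. k x \<partial>M) = 1"
  and f: "integrable M (%x. f x * k x)" "integrable M (%x. (f x)^2 * k x)"
 shows "(\<integral>x. f x * k x \<partial>M)^2 <= (\<integral>x. (f x)^2 * k x \<partial>M)"
proof -
 define c where "c = (\<integral>x. f x * k x \<partial>M)"
 have "0 <= (\<integral>z. (f z - c)^2 * k z \<partial>M)"
  by (intro integral_nonneg) (simp add: k)
 also have "... = (\<integral>z. (f z)^2 * k z - 2 * c * (f z * k z) + c^2 * k z \<partial>M)"
  by (simp add: power2_eq_square algebra_simps)
 also have "... = (\<integral>z. (f z)^2 * k z - 2 * c * (f z * k z) \<partial>M) + (\<integral>z. c^2 * k z \<partial>M)"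
  by (intro integral_add integrable_diff integrable_mult_right f k)
 also have "... = (\<integral>z. (f z)^2 * k z \<partial>M) - (\<integral>z. 2 * c * (f z * k z) \<partial>M) + (\<integral>z. c^2 * k z \<partial>M)"
  by (subst integral_diff) (intro integrable_mult_right f k refl)+
 also have "... = (\<integral>z. (f z)^2 * k z \<partial>M) - 2 * c * c + c^2 * 1"
  by (simp only: integral_mult_right_zero k c_def[symmetric])
 finally show ?thesis unfolding c_def by (simp add: power2_eq_square)
qed

lemma integrable_ind_continuous:
 fixes D :: "real^'n::finite => real"
 assumes "continuous_on UNIV D"
 shows "integrable lborel (%x. in_ball x0 r x * D x)"
proof -
 have "bounded (D ` cball x0 r)"
  by (intro compact_imp_bounded compact_continuous_image continuous_on_subset[OF assms]) auto
 then obtain B where "\<forall>y\<in>D ` cball x0 r. norm y <= B" unfolding bounded_iff by blast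
 then have B: "!!x. x \<in> cball x0 r ==> \<bar>D x\<bar> <= B" by simp
 have "\<bar>in_ball x0 r x * D x\<bar> <= \<bar>B\<bar>" for x
  using B[of x] by (auto simp: indicator_def)
 moreover have "in_ball x0 r x * D x = 0" if "x \<notin> cball x0 r" for x
  using that by (auto simp: indicator_def)
 ultimately show ?thesis
  using borel_measurable_continuous_onI[OF assms]
  by (intro integrable_bounded_ball[where a=x0 and R=r and M="\<bar>B\<bar>"] borel_measurable_times
    borel_measurable_indicator) simp_all
qed

text \<open>The difference quotient is the mean of the derivative over a segment, so Jensen's inequality and Fubini
 apply. The term \<open>a\<^sub>m h/2\<close> arises as the mean of the affine function \<open>a \<bullet> x + c\<close> over that segment.\<close>

lemma diffquot_smooth:
 fixes F :: "real^'n::finite => real"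
 assumes F: "smooth F" and h: "h > 0"
 shows "(LBINT x. in_ball x0 s x * ((F (x + h *R axis m 1) - F x) / h - (a \<bullet> x + c + a $ m * h / 2))^2)
  <= (LBINT x. in_ball x0 (s + h) x * (pd m F x - (a \<bullet> x + c))^2)"
proof -
 let ?e = "h *R axis m (1::real) :: real^'n"
 define D where "D x = pd m F x - (a \<bullet> x + c)" for x
 define Q where "Q x = (F (x + ?e) - F x) / h - (a \<bullet> x + c + a $ m * h / 2)" for x
 have cF: "continuous_on UNIV F" by (rule smooth_continuous[OF F])
 have cpF: "continuous_on UNIV (pd m F)" by (rule smooth_continuous[OF smooth_dd[OF F]])
 have cD: "continuous_on UNIV D"
  unfolding D_def by (intro continuous_intros cpF)
 have cQ: "continuous_on UNIV Q"
  unfolding Q_def using h by (intro continuous_intros cF continuous_on_compose2[OF cF]) auto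
 have [measurable]: "D \<in> borel_fns" "Q \<in> borel_fns"
  by (intro borel_measurable_continuous_onI cD cQ)+
 let ?I = "indicator {0..1::real} :: real => real"
 have cDt: "isCont (%t. D (x + t *R ?e)) t" for x t
 proof -
  have "continuous_on UNIV (%t. D (x + t *R ?e))"
   by (intro continuous_on_compose2[OF cD] continuous_intros) auto
  then show ?thesis by (simp add: continuous_on_eq_continuous_at)
 qed
 have FTC: "has_bochner_integral lborel (%t. D (x + t *R ?e) * ?I t) (Q x)" for x
 proof -
  define P where "P t = F (x + t *R ?e) / h - ((a \<bullet> x + c) * t + a $ m * h * t^2 / 2)" for t
  have "(P has_field_derivative D (x + t *R ?e)) (at t)" for t
  proof -
   have "((%r. F (x + r *R axis m 1)) has_field_derivative pd m F (x + (t * h) *R axis m 1)) (at (t * h))"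
    by (rule smooth_DERIV_at[OF F])
   then have "((%t. F (x + (t * h) *R axis m 1)) has_field_derivative pd m F (x + (t * h) *R axis m 1) * h) (at t)"
    by (rule DERIV_chain2) (auto intro!: derivative_eq_intros)
   then have "((%t. F (x + t *R ?e) / h) has_field_derivative pd m F (x + t *R ?e)) (at t)"
    using h DERIV_cdivide[of "%t. F (x + t *R ?e)" "pd m F (x + (t * h) *R axis m 1) * h" t UNIV h] by simp
   moreover have "((%t. (a \<bullet> x + c) * t + a $ m * h * t^2 / 2) has_field_derivative (a \<bullet> (x + t *R ?e) + c)) (at t)"
    by (auto intro!: derivative_eq_intros simp: inner_simps inner_axis algebra_simps)
   ultimately show ?thesis unfolding P_def D_def by (rule DERIV_diff)
  qed
  from has_bochner_integral_FTC_Icc_real[OF zero_le_one this cDt]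
  have "has_bochner_integral lborel (%t. D (x + t *R ?e) * ?I t) (P 1 - P 0)" .
  also have "P 1 - P 0 = Q x"
   by (simp add: P_def Q_def diff_divide_distrib algebra_simps)
  finally show ?thesis .
 qed
 have D2: "integrable lborel (%t. (D (x + t *R ?e))^2 * ?I t)" for x
 proof -
  have "continuous_on {0..1} (%t. (D (x + t *R ?e))^2)"
   by (intro continuous_intros continuous_on_compose2[OF cD]) auto
  then have "set_integrable lborel {0..1} (%t. (D (x + t *R ?e))^2)"
   by (rule borel_integrable_atLeastAtMost')
  then show ?thesis by (simp add: set_integrable_def mult.commute)
 qed
 have Jen: "(Q x)^2 <= (LBINT t. (D (x + t *R ?e))^2 * ?I t)" for x
 proof -
  have "(LBINT t. D (x + t *R ?e) * ?I t) = Q x" using FTC by (rule has_bochner_integral_integral_eq)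
  moreover have "(LBINT t. D (x + t *R ?e) * ?I t)^2 <= (LBINT t. (D (x + t *R ?e))^2 * ?I t)"
   by (rule weighted_square_Jensen) (use FTC D2 in \<open>auto simp: has_bochner_integral_iff\<close>)
  ultimately show ?thesis by simp
 qed
 have iQ: "integrable lborel (%x. in_ball x0 s x * (Q x)^2)"
  by (intro integrable_ind_continuous continuous_intros cQ)
 have iD: "integrable lborel (%x. in_ball x0 (s + h) x * (D x)^2)"
  by (intro integrable_ind_continuous continuous_intros cD)
 have ballm[measurable]: "ball x0 s \<in> sets borel" "ball x0 (s + h) \<in> sets borel" by auto
 have "ennreal (LBINT x. in_ball x0 s x * (Q x)^2)
   = (NNINT x. ennreal (in_ball x0 s x * (Q x)^2))"
  by (rule nn_integral_eq_integral[OF iQ, symmetric]) simp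
 also have "... <= (NNINT x. (NNINT t. ennreal (in_ball x0 s x * ((D (x + t *R ?e))^2 * ?I t))))"
 proof (rule nn_integral_mono)
  fix x
  have "ennreal (in_ball x0 s x * (Q x)^2)
    <= ennreal (in_ball x0 s x * (LBINT t. (D (x + t *R ?e))^2 * ?I t))"
   by (intro ennreal_leI mult_left_mono Jen) simp
  also have "... = ennreal (LBINT t. in_ball x0 s x * ((D (x + t *R ?e))^2 * ?I t))"
   by (simp only: integral_mult_right_zero)
  also have "... = (NNINT t. ennreal (in_ball x0 s x * ((D (x + t *R ?e))^2 * ?I t)))"
   by (rule nn_integral_eq_integral[symmetric]) (intro integrable_mult_right D2, simp)
  finally show "ennreal (in_ball x0 s x * (Q x)^2) <= ..." .
 qed
 also have "... = (NNINT t. (NNINT x. ennreal (in_ball x0 s x * ((D (x + t *R ?e))^2 * ?I t))))"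
  by (rule lborel_pair.Fubini') measurable
 also have "... <= (NNINT t. indicator {0..1::real} t * ennreal (LBINT x. in_ball x0 (s + h) x * (D x)^2))"
 proof (rule nn_integral_mono)
  fix t :: real
  show "(NNINT x. ennreal (in_ball x0 s x * ((D (x + t *R ?e))^2 * ?I t)))
    <= indicator {0..1} t * ennreal (LBINT x. in_ball x0 (s + h) x * (D x)^2)"
  proof (cases "t \<in> {0..1}")
   case True
   have "(NNINT x. ennreal (in_ball x0 s x * ((D (x + t *R ?e))^2 * ?I t)))
     <= (NNINT x. ennreal (in_ball x0 (s + h) (t *R ?e + 1 *R x) * (D (t *R ?e + 1 *R x))^2))"
   proof (rule nn_integral_mono, rule ennreal_leI)
    fix x
    have "x + t *R ?e \<in> ball x0 (s + h)" if "x \<in> ball x0 s"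
    proof -
     have "norm (t *R ?e) <= h" using True h by (simp add: abs_mult mult_left_le_one_le)
     then show ?thesis using that dist_triangle[of x0 "x + t *R ?e" x] by (simp add: dist_norm)
    qed
    then show "in_ball x0 s x * ((D (x + t *R ?e))^2 * ?I t)
     <= in_ball x0 (s + h) (t *R ?e + 1 *R x) * (D (t *R ?e + 1 *R x))^2"
     using True by (cases "x \<in> ball x0 s") (auto simp: add.commute)
   qed
   also have "... = (NNINT x. ennreal (in_ball x0 (s + h) x * (D x)^2))"
    using lborel_nn_integral_affine[of "%x. ennreal (in_ball x0 (s + h) x * (D x)^2)" 1 "t *R ?e"] by simp
   also have "... = ennreal (LBINT x. in_ball x0 (s + h) x * (D x)^2)"
    by (rule nn_integral_eq_integral[OF iD]) simp
   finally show ?thesis using True by simp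
  qed simp
 qed
 also have "... = ennreal (LBINT x. in_ball x0 (s + h) x * (D x)^2)"
  by (simp add: nn_integral_multc)
 finally show ?thesis
  unfolding Q_def D_def by (subst (asm) ennreal_le_iff) (auto intro!: integral_nonneg)
qed

text \<open>The functions are bounded on \<open>A\<close> by the same constant, so their squares differ by a multiple of their
 difference.\<close>

lemma L1_to_L2:
 fixes f :: "nat => 'a => real"
 assumes lim: "(%k. \<integral>x. \<bar>f k x - g x\<bar> \<partial>M) \<longlonglongrightarrow> 0" and i: "!!k. integrable M (%x. f k x - g x)"
  and A: "A \<in> sets M" "!!x k. x \<in> A ==> \<bar>f k x\<bar> <= B" "!!x. x \<in> A ==> \<bar>g x\<bar> <= B"
  and fi: "!!k. integrable M (%x. indicator A x * (f k x)^2)" "integrable M (%x. indicator A x * (g x)^2)"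
 shows "(%k. \<integral>x. indicator A x * (f k x)^2 \<partial>M) \<longlonglongrightarrow> (\<integral>x. indicator A x * (g x)^2 \<partial>M)"
proof -
 have "(%k. (\<integral>x. indicator A x * (f k x)^2 \<partial>M) - (\<integral>x. indicator A x * (g x)^2 \<partial>M)) \<longlonglongrightarrow> 0"
 proof (rule Lim_null_comparison)
  show "(%k. 2 * \<bar>B\<bar> * (\<integral>x. \<bar>f k x - g x\<bar> \<partial>M)) \<longlonglongrightarrow> 0"
   using tendsto_mult_left[OF lim, of "2 * \<bar>B\<bar>"] by simp
  have "norm ((\<integral>x. indicator A x * (f k x)^2 \<partial>M) - (\<integral>x. indicator A x * (g x)^2 \<partial>M))
   <= 2 * \<bar>B\<bar> * (\<integral>x. \<bar>f k x - g x\<bar> \<partial>M)" if "A ~= {}" for k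
  proof -
   have "B >= 0" using that A(3) by force
   have "norm ((\<integral>x. indicator A x * (f k x)^2 \<partial>M) - (\<integral>x. indicator A x * (g x)^2 \<partial>M))
    = \<bar>\<integral>x. indicator A x * (f k x)^2 - indicator A x * (g x)^2 \<partial>M\<bar>"
    by (simp add: integral_diff[OF fi])
   also have "... <= (\<integral>x. \<bar>indicator A x * (f k x)^2 - indicator A x * (g x)^2\<bar> \<partial>M)"
    by (rule integral_abs_bound)
   also have "... <= (\<integral>x. 2 * B * \<bar>f k x - g x\<bar> \<partial>M)"
   proof (rule integral_mono)
    show "\<bar>indicator A x * (f k x)^2 - indicator A x * (g x)^2\<bar> <= 2 * B * \<bar>f k x - g x\<bar>" for x
    proof (cases "x \<in> A")
     case True
     have "\<bar>(f k x)^2 - (g x)^2\<bar> = \<bar>f k x + g x\<bar> * \<bar>f k x - g x\<bar>"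
      by (simp add: power2_eq_square abs_mult[symmetric] algebra_simps)
     also have "... <= (2 * B) * \<bar>f k x - g x\<bar>"
      using A(2)[OF True, of k] A(3)[OF True] by (intro mult_right_mono) auto
     finally show ?thesis using True by simp
    qed (use \<open>B >= 0\<close> in simp)
   qed (use fi i in auto)
   finally show ?thesis using \<open>B >= 0\<close> by simp
  qed
  moreover have "(\<integral>x. indicator A x * (f k x)^2 \<partial>M) = 0" "(\<integral>x. indicator A x * (g x)^2 \<partial>M) = 0"
   if "A = {}" for k using that by simp_all
  ultimately show "\<forall>\<^sub>F k in sequentially.
    norm ((\<integral>x. indicator A x * (f k x)^2 \<partial>M) - (\<integral>x. indicator A x * (g x)^2 \<partial>M))
    <= 2 * \<bar>B\<bar> * (\<integral>x. \<bar>f k x - g x\<bar> \<partial>M)"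
   by (intro always_eventually allI, cases "A = {}") auto
 qed
 then show ?thesis by (subst (asm) LIM_zero_iff)
qed

text \<open>The bound on a difference quotient by the derivative passes from mollifications to weakly
 differentiable bounded functions.\<close>

lemma diffquot_weak:
 fixes f g :: "real^'n::finite => real"
 assumes f: "integrable lborel f" "!!x. \<bar>f x\<bar> <= M" and g: "integrable lborel g" "!!x. \<bar>g x\<bar> <= M"
  and w: "wpd \<Omega> m f g" and h: "h > 0" and sub: "ball x0 s' \<subseteq> \<Omega>" "s + h < s'"
 shows "(LBINT x. in_ball x0 s x * ((f (x + h *R axis m 1) - f x) / h - (a \<bullet> x + c + a $ m * h / 2))^2)
  <= (LBINT x. in_ball x0 (s + h) x * (g x - (a \<bullet> x + c))^2)"
proof -
 let ?e = "h *R axis m (1::real) :: real^'n"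
 have M: "M >= 0" using f(2)[of 0] by linarith
 have [measurable]: "f \<in> borel_fns" "g \<in> borel_fns"
  using borel_measurable_integrable f(1) g(1) by auto
 define e where "e k = (s' - s - h) / real (k + 2)" for k
 have e: "!!k. e k > 0" "e \<longlonglongrightarrow> 0" "!!k. e k < s' - s - h"
  unfolding e_def using sub(2) by (intro harmonic_fractions; simp)+
 define fm where "fm k = conv f (rho (e k))" for k
 define gm where "gm k = conv g (rho (e k))" for k
 define l where "l x = a \<bullet> x + c" for x
 define L where "L x = a \<bullet> x + c + a $ m * h / 2" for x
 define Qm where "Qm k x = (fm k (x + ?e) - fm k x) / h - L x" for k x
 define Q where "Q x = (f (x + ?e) - f x) / h - L x" for x
 have fmi: "integrable lborel (fm k)" and gmi: "integrable lborel (gm k)" for k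
  unfolding fm_def gm_def by (rule mol_L1[OF e(1) f(1)], rule mol_L1[OF e(1) g(1)])
 have [measurable]: "fm k \<in> borel_fns" "gm k \<in> borel_fns" for k
  using borel_measurable_integrable fmi gmi by auto
 have lc: "continuous_on UNIV l" "continuous_on UNIV L" unfolding l_def L_def by (auto intro!: continuous_intros)
 have [measurable]: "l \<in> borel_fns" "L \<in> borel_fns"
  by (intro borel_measurable_continuous_onI lc)+
 have [measurable]: "Q \<in> borel_fns" "Qm k \<in> borel_fns" for k
  unfolding Q_def[abs_def] Qm_def[abs_def] by measurable
 have fmb: "\<bar>fm k x\<bar> <= M" "\<bar>gm k x\<bar> <= M" for k x
  unfolding fm_def gm_def by (rule mol_bounded[OF e(1) f], rule mol_bounded[OF e(1) g])
 obtain Bl where Bl: "!!x r. x \<in> ball x0 r ==> r <= s + h ==> \<bar>l x\<bar> <= Bl \<and> \<bar>L x\<bar> <= Bl"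
 proof -
  have "bounded (l ` cball x0 (s + h))" "bounded (L ` cball x0 (s + h))"
   by (intro compact_imp_bounded compact_continuous_image continuous_on_subset[OF lc(1)]
     continuous_on_subset[OF lc(2)]; simp)+
  then obtain B1 B2 where "\<forall>y\<in>l ` cball x0 (s + h). norm y <= B1" "\<forall>y\<in>L ` cball x0 (s + h). norm y <= B2"
   unfolding bounded_iff by blast
  then show ?thesis
   by (intro that[of "max B1 B2"]) (force simp: le_max_iff_disj)
 qed
 have step: "(LBINT x. in_ball x0 s x * (Qm k x)^2)
   <= (LBINT x. in_ball x0 (s + h) x * (gm k x - l x)^2)" for k
 proof -
  have "(LBINT x. in_ball x0 s x * (Qm k x)^2)
   <= (LBINT x. in_ball x0 (s + h) x * (pd m (fm k) x - l x)^2)"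
   unfolding Qm_def L_def l_def by (rule diffquot_smooth[OF _ h]) (simp add: fm_def smooth_mol[OF e(1) f(1)])
  also have "(%x. in_ball x0 (s + h) x * (pd m (fm k) x - l x)^2)
    = (%x. in_ball x0 (s + h) x * (gm k x - l x)^2)"
  proof
   fix x
   show "in_ball x0 (s + h) x * (pd m (fm k) x - l x)^2
    = in_ball x0 (s + h) x * (gm k x - l x)^2"
   proof (cases "x \<in> ball x0 (s + h)")
    case True
    have "cball x (e k) \<subseteq> ball x0 s'"
    proof
     fix y assume "y \<in> cball x (e k)"
     then show "y \<in> ball x0 s'" using True e(3)[of k] dist_triangle[of x0 y x] by simp
    qed
    then have "pd m (fm k) x = gm k x"
     unfolding fm_def gm_def using sub(1) by (intro pd_mol_weak[OF e(1) _ f(1) w]) auto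
    then show ?thesis by simp
   qed simp
  qed
  finally show ?thesis .
 qed
 have bQ: "\<bar>Qm k x\<bar> <= 2 * M / h + Bl" "\<bar>Q x\<bar> <= 2 * M / h + Bl" if "x \<in> ball x0 s" for k x
 proof -
  have L: "\<bar>L x\<bar> <= Bl" using Bl[OF that] h by simp
  have 1: "\<bar>(y - z) / h\<bar> <= 2 * M / h" if "\<bar>y\<bar> <= M" "\<bar>z\<bar> <= M" for y z
   using that h by (simp add: divide_right_mono)
  show "\<bar>Qm k x\<bar> <= 2 * M / h + Bl" "\<bar>Q x\<bar> <= 2 * M / h + Bl"
   unfolding Qm_def Q_def using L 1[OF fmb(1)[of k "x + ?e"] fmb(1)[of k x]] 1[OF f(2)[of "x + ?e"] f(2)[of x]]
   by linarith+
 qed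
 have bG: "\<bar>gm k x - l x\<bar> <= M + Bl" "\<bar>g x - l x\<bar> <= M + Bl" if "x \<in> ball x0 (s + h)" for k x
  using Bl[OF that] fmb(2)[of k x] g(2)[of x] by auto
 have indint: "integrable lborel (%x. in_ball x0 r x * (F x)^2)"
  if "F \<in> borel_fns" "!!x. x \<in> ball x0 r ==> \<bar>F x\<bar> <= B" for F :: "real^'n => real" and r B
 proof (rule integrable_bounded_ball[where a=x0 and R=r and M="B^2"])
  show "\<bar>in_ball x0 r x * (F x)^2\<bar> <= B^2" for x
   using power_mono[OF that(2), of x 2] by (cases "x \<in> ball x0 r") auto
  show "in_ball x0 r x * (F x)^2 = 0" if "x \<notin> cball x0 r" for x
   using that by (auto simp: indicator_def)
 qed (intro borel_measurable_times borel_measurable_indicator borel_measurable_power that(1); simp)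
 have limL: "(%k. LBINT x. in_ball x0 s x * (Qm k x)^2)
   \<longlonglongrightarrow> (LBINT x. in_ball x0 s x * (Q x)^2)"
 proof (rule L1_to_L2[where B="2 * M / h + Bl"])
  have eq: "Qm k x - Q x = (1 / h) * ((%y. fm k y - f y) (x + ?e) - (%y. fm k y - f y) x)" for k x
   unfolding Qm_def Q_def by (simp add: diff_divide_distrib algebra_simps)
  have i: "integrable lborel (%y. fm k y - f y)" for k using fmi f(1) by simp
  note i' = lborel_integrable_translate(1)[OF i, where t="?e"]
  show qi: "integrable lborel (%x. Qm k x - Q x)" for k
   unfolding eq by (intro integrable_mult_right integrable_diff i i')
  have bd: "(LBINT x. \<bar>Qm k x - Q x\<bar>) <= (2 / h) * (LBINT x. \<bar>fm k x - f x\<bar>)" for k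
  proof -
   have "(LBINT x. \<bar>Qm k x - Q x\<bar>)
    <= (LBINT x. (1 / h) * (\<bar>(%y. fm k y - f y) (x + ?e)\<bar> + \<bar>(%y. fm k y - f y) x\<bar>))"
   proof (rule integral_mono)
    show "\<bar>Qm k x - Q x\<bar> <= (1 / h) * (\<bar>(%y. fm k y - f y) (x + ?e)\<bar> + \<bar>(%y. fm k y - f y) x\<bar>)" for x
     unfolding eq abs_mult using h by (intro mult_mono) auto
    show "integrable lborel (%x. (1 / h) * (\<bar>(%y. fm k y - f y) (x + ?e)\<bar> + \<bar>(%y. fm k y - f y) x\<bar>))"
     by (intro integrable_mult_right integrable_add integrable_abs i i')
   qed (intro integrable_abs qi)
   also have "... = (1 / h) * ((LBINT x. \<bar>(%y. fm k y - f y) (x + ?e)\<bar>) + (LBINT x. \<bar>(%y. fm k y - f y) x\<bar>))"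
    by (subst integral_mult_right_zero, subst integral_add)
     (intro integrable_abs i i' refl)+
   also have "(LBINT x. \<bar>(%y. fm k y - f y) (x + ?e)\<bar>) = (LBINT x. \<bar>(%y. fm k y - f y) x\<bar>)"
    by (rule lborel_integral_translate(1)[of "%x. \<bar>fm k x - f x\<bar>"]) measurable
   finally show ?thesis by simp
  qed
  show "(%k. LBINT x. \<bar>Qm k x - Q x\<bar>) \<longlonglongrightarrow> 0"
  proof (rule Lim_null_comparison)
   show "\<forall>\<^sub>F k in sequentially. norm (LBINT x. \<bar>Qm k x - Q x\<bar>) <= (2 / h) * (LBINT x. \<bar>fm k x - f x\<bar>)"
    using bd by (intro always_eventually allI) simp
   show "(%k. (2 / h) * (LBINT x. \<bar>fm k x - f x\<bar>)) \<longlonglongrightarrow> 0"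
    unfolding fm_def using tendsto_mult_left[OF mol_tendsto_L1_seq[OF f(1) e(1,2)], of "2 / h"] by simp
  qed
  show "integrable lborel (%x. in_ball x0 s x * (Qm k x)^2)" for k
   by (rule indint) (use bQ in auto)
  show "integrable lborel (%x. in_ball x0 s x * (Q x)^2)"
   by (rule indint) (use bQ in auto)
 qed (use bQ in auto)
 have limR: "(%k. LBINT x. in_ball x0 (s + h) x * (gm k x - l x)^2)
   \<longlonglongrightarrow> (LBINT x. in_ball x0 (s + h) x * (g x - l x)^2)"
 proof (rule L1_to_L2[where B="M + Bl"])
  have eq: "(gm k x - l x) - (g x - l x) = gm k x - g x" for k x by simp
  show "integrable lborel (%x. (gm k x - l x) - (g x - l x))" for k
   unfolding eq using gmi g(1) by simp
  show "(%k. LBINT x. \<bar>(gm k x - l x) - (g x - l x)\<bar>) \<longlonglongrightarrow> 0"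
   unfolding eq unfolding gm_def by (rule mol_tendsto_L1_seq[OF g(1) e(1,2)])
  show "integrable lborel (%x. in_ball x0 (s + h) x * (gm k x - l x)^2)" for k
   by (rule indint) (use bG in auto)
  show "integrable lborel (%x. in_ball x0 (s + h) x * (g x - l x)^2)"
   by (rule indint) (use bG in auto)
 qed (use bG in auto)
 show ?thesis
  using LIMSEQ_le[OF limL limR] step unfolding Q_def L_def l_def by blast
qed

section \<open>The Caccioppoli inequality\<close>

definition cutoff :: "real^'n::finite => real => real^'n => real" where
 "cutoff x0 R x = bump ((1 / R) *R (x - x0)) ^ 4"

lemma cutoff_test:
 assumes "R > 0" "cball x0 R \<subseteq> \<Omega>" shows "cutoff x0 R \<in> test_functions \<Omega>"
proof (rule test_functionsI[of _ "cball x0 R"])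
 show "smooth (cutoff x0 R)"
  unfolding cutoff_def[abs_def]
  by (intro smooth_power test_functionsD(1)[OF bump_scaled_test[OF assms(1)]])
 show "cutoff x0 R x = 0" if "x \<notin> cball x0 R" for x
 proof -
  have "norm (x - x0) > R" using that by (simp add: dist_norm norm_minus_commute)
  then have "norm ((1 / R) *R (x - x0)) >= 1" unfolding norm_scaleR using assms(1) by (simp add: field_simps)
  then show ?thesis unfolding cutoff_def by (simp only: bump_eq_0_iff[THEN iffD2]) simp
 qed
qed (use assms in auto)

lemma bump_le_1: "bump x <= 1"
 by (auto simp: bump_def flat_def)

text \<open>The fourth power makes the derivatives of the cut-off small where the cut-off is small.\<close>

lemma cutoff_derivs:
 obtains c where "c > 0"
  "!!(x0 :: real^'n::finite) R x i. R > 0 ==> \<bar>pd i (cutoff x0 R) x\<bar> <= c / R * bump ((1 / R) *R (x - x0)) ^ 2"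
  "!!(x0 :: real^'n::finite) R x i j. R > 0 ==> \<bar>pd i (pd j (cutoff x0 R)) x\<bar> <= c / R^2 * bump ((1 / R) *R (x - x0)) ^ 2"
proof -
 let ?b = "bump :: real^'n => real"
 have bt: "?b \<in> test_functions UNIV" using bump_scaled_test[of 1 0] by simp
 have sb: "smooth ?b" by (rule smooth_bump)
 have "\<exists>B. \<forall>x. \<bar>pd i ?b x\<bar> <= B" for i
  by (rule test_functions_bounded[OF test_functions_dd[OF bt]]) blast
 then obtain B1 where B1: "!!i x. \<bar>pd i ?b x\<bar> <= B1 i" by metis
 have "\<exists>B. \<forall>x. \<bar>pd i (pd j ?b) x\<bar> <= B" for i j
  by (rule test_functions_bounded[OF test_functions_dd[OF test_functions_dd[OF bt]]]) blast
 then obtain B2 where B2: "!!i j x. \<bar>pd i (pd j ?b) x\<bar> <= B2 i j" by metis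
 define B where "B = (\<Sum>i\<in>UNIV. \<bar>B1 i\<bar>) + (\<Sum>i\<in>UNIV. \<Sum>j\<in>UNIV. \<bar>B2 i j\<bar>)"
 have B0: "B >= 0" unfolding B_def by (intro add_nonneg_nonneg sum_nonneg) auto
 have b1: "\<bar>pd i ?b x\<bar> <= B" for i x
 proof -
  have "\<bar>B1 i\<bar> <= (\<Sum>i\<in>UNIV. \<bar>B1 i\<bar>)" by (rule member_le_sum) auto
  moreover have "0 <= (\<Sum>i\<in>UNIV. \<Sum>j\<in>UNIV. \<bar>B2 i j\<bar>)" by (intro sum_nonneg) auto
  ultimately show ?thesis using B1[of i x] unfolding B_def by linarith
 qed
 have b2: "\<bar>pd i (pd j ?b) x\<bar> <= B" for i j x
 proof -
  have "\<bar>B2 i j\<bar> <= (\<Sum>j\<in>UNIV. \<bar>B2 i j\<bar>)" by (rule member_le_sum) auto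
  also have "... <= (\<Sum>i\<in>UNIV. \<Sum>j\<in>UNIV. \<bar>B2 i j\<bar>)"
   by (rule member_le_sum[of i UNIV "%i. \<Sum>j\<in>UNIV. \<bar>B2 i j\<bar>"]) (auto intro: sum_nonneg)
  moreover have "0 <= (\<Sum>i\<in>UNIV. \<bar>B1 i\<bar>)" by (intro sum_nonneg) auto
  ultimately show ?thesis using B2[of i j x] unfolding B_def by linarith
 qed
 define c where "c = 4 * B + 12 * B^2 + 1"
 have c0: "c > 0" using B0 unfolding c_def by (simp add: add_nonneg_pos)
 have main: "\<bar>pd i (cutoff x0 R) x\<bar> <= c / R * ?b ((1 / R) *R (x - x0)) ^ 2 \<and>
  \<bar>pd i (pd j (cutoff x0 R)) x\<bar> <= c / R^2 * ?b ((1 / R) *R (x - x0)) ^ 2"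
  if R: "R > 0" for x0 :: "real^'n" and R x i j
 proof -
  define \<beta> where "\<beta> x = ?b (- ((1 / R) *R x0) + (1 / R) *R x)" for x
  have be: "?b ((1 / R) *R (x - x0)) = \<beta> x" for x by (simp add: \<beta>_def algebra_simps)
  have s\<beta>: "smooth \<beta>" unfolding \<beta>_def by (rule smooth_affine[OF sb])
  have d\<beta>: "pd k \<beta> = (%x. (1 / R) * pd k ?b (- ((1 / R) *R x0) + (1 / R) *R x))" for k
   unfolding \<beta>_def by (rule dd_affine[OF sb])
  have dd\<beta>: "pd i (pd j \<beta>) x = (1 / R^2) * pd i (pd j ?b) (- ((1 / R) *R x0) + (1 / R) *R x)" for x
   unfolding d\<beta>
   by (subst dd_mult[OF smooth_const smooth_affine[OF smooth_dd[OF sb]]])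
    (simp only: dd_const dd_affine[OF smooth_dd[OF sb]], simp add: power2_eq_square)
  have d1: "\<bar>pd k \<beta> x\<bar> <= B / R" for k x
   unfolding d\<beta> abs_mult using b1[of k] R by (simp add: divide_right_mono)
  have d2: "\<bar>pd i (pd j \<beta>) x\<bar> <= B / R^2" for x
   unfolding dd\<beta> abs_mult using b2[of i j] R by (simp add: divide_right_mono)
  have \<beta>: "0 <= \<beta> x" "\<beta> x <= 1" for x unfolding \<beta>_def by (rule bump_nonneg, rule bump_le_1)
  have cut: "cutoff x0 R = (%x. (\<beta> x * \<beta> x) * (\<beta> x * \<beta> x))"
   unfolding cutoff_def[abs_def] be by (simp add: power4_eq_xxxx algebra_simps)
  have s2: "smooth (%x. \<beta> x * \<beta> x)" by (intro smooth_mult s\<beta>)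
  have p1: "pd k (cutoff x0 R) = (%x. 4 * ((\<beta> x * \<beta> x) * \<beta> x) * pd k \<beta> x)" for k
   unfolding cut dd_mult[OF s2 s2] dd_mult[OF s\<beta> s\<beta>] by (auto simp: algebra_simps)
  have s3: "smooth (%x. (\<beta> x * \<beta> x) * \<beta> x)" by (intro smooth_mult s\<beta>)
  have s4: "smooth (%x. 4 * ((\<beta> x * \<beta> x) * \<beta> x))" by (intro smooth_mult s\<beta> smooth_const)
  have p2: "pd i (pd j (cutoff x0 R)) = (%x. 12 * (\<beta> x * \<beta> x) * pd i \<beta> x * pd j \<beta> x + 4 * (\<beta> x * \<beta> x * \<beta> x) * pd i (pd j \<beta>) x)"
   unfolding p1 dd_mult[OF s4 smooth_dd[OF s\<beta>]] dd_mult[OF smooth_const s3] dd_const dd_mult[OF s2 s\<beta>] dd_mult[OF s\<beta> s\<beta>]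
   by (auto simp: algebra_simps)
  have b3: "\<beta> x ^ 3 <= \<beta> x ^ 2" using \<beta>[of x] by (intro power_decreasing) auto
  have "\<bar>pd i (cutoff x0 R) x\<bar> = 4 * \<beta> x ^ 3 * \<bar>pd i \<beta> x\<bar>"
   unfolding p1 using \<beta>(1)[of x] by (simp add: abs_mult power3_eq_cube)
  also have "... <= 4 * \<beta> x ^ 2 * (B / R)"
   using b3 d1 \<beta>(1)[of x] by (intro mult_mono) auto
  also have "... <= c / R * \<beta> x ^ 2"
  proof -
   have "4 * B <= c" unfolding c_def by simp
   then have "(4 * B) * (\<beta> x ^ 2 / R) <= c * (\<beta> x ^ 2 / R)" using R by (intro mult_right_mono) auto
   then show ?thesis by (simp add: field_simps)
  qed
  finally have r1: "\<bar>pd i (cutoff x0 R) x\<bar> <= c / R * \<beta> x ^ 2" .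
  have "\<bar>pd i (pd j (cutoff x0 R)) x\<bar> <= \<bar>12 * (\<beta> x * \<beta> x) * pd i \<beta> x * pd j \<beta> x\<bar> + \<bar>4 * (\<beta> x * \<beta> x * \<beta> x) * pd i (pd j \<beta>) x\<bar>"
   unfolding p2 by (rule abs_triangle_ineq)
  also have "... = 12 * \<beta> x ^ 2 * (\<bar>pd i \<beta> x\<bar> * \<bar>pd j \<beta> x\<bar>) + 4 * \<beta> x ^ 3 * \<bar>pd i (pd j \<beta>) x\<bar>"
   using \<beta>(1)[of x] by (simp add: abs_mult power3_eq_cube power2_eq_square)
  also have "... <= 12 * \<beta> x ^ 2 * ((B / R) * (B / R)) + 4 * \<beta> x ^ 2 * (B / R^2)"
   using b3 d1 d2 \<beta>(1)[of x] B0 R by (intro add_mono mult_mono) auto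
  also have "... = (12 * B^2 + 4 * B) * (\<beta> x ^ 2 / R^2)"
   by (simp add: power2_eq_square add_divide_distrib algebra_simps)
  also have "... <= c * (\<beta> x ^ 2 / R^2)"
   by (intro mult_right_mono) (auto simp: c_def)
  finally have r2: "\<bar>pd i (pd j (cutoff x0 R)) x\<bar> <= c / R^2 * \<beta> x ^ 2" by simp
  show ?thesis unfolding be using r1 r2 by blast
 qed
 show ?thesis by (rule that[OF c0]) (use main in blast)+
qed

lemma double_sum_square_le:
 fixes x :: "'n::finite => 'n => real"
 shows "(\<Sum>i\<in>UNIV. \<Sum>j\<in>UNIV. x i j)^2 <= (real CARD('n))^2 * (\<Sum>i\<in>UNIV. \<Sum>j\<in>UNIV. (x i j)^2)"
proof -
 have "(\<Sum>(i,j)\<in>UNIV\<times>UNIV. x i j)^2 <= (\<Sum>(i,j)\<in>UNIV\<times>UNIV. (x i j)^2) * real (card (UNIV \<times> (UNIV :: 'n set) :: ('n \<times> 'n) set))"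
  using sum_squared_le_sum_of_squares[of "%(i,j). x i j" "UNIV \<times> UNIV"]
  by (simp add: case_prod_beta)
 then show ?thesis
  by (simp add: sum.cartesian_product card_cartesian_product power2_eq_square mult.commute del: UNIV_Times_UNIV)
qed

text \<open>Pointwise form of the Caccioppoli argument: \<open>w\<close> stands for the difference quotient of the Hessian,
 \<open>K\<close> for that of \<open>V\<close>, \<open>q\<close> and \<open>z\<close> for lower order terms, and \<open>b\<close> for the bump whose fourth power is the
 cut-off. Since the derivatives of the cut-off are of order \<open>b\<^sup>2\<close>, Young's inequality absorbs the products
 of \<open>b\<^sup>2 w\<close> with lower order terms into the elliptic term.\<close>

lemma ellipticity_with_errors:
 fixes w K d2 :: "'n::finite => 'n => real" and q d1 :: "'n => real"
 assumes \<Lambda>: "\<Lambda> > 0" and L: "L >= 0" and c: "c >= 0" and R: "R > 0"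
  and lip: "!!i j. \<bar>K i j\<bar> <= L * (\<Sum>k\<in>UNIV. \<Sum>l\<in>UNIV. \<bar>w k l\<bar>)"
  and mono: "(\<Sum>i\<in>UNIV. \<Sum>j\<in>UNIV. K i j * w i j) >= \<Lambda> * (\<Sum>i\<in>UNIV. \<Sum>j\<in>UNIV. (w i j)^2)"
  and d: "!!i. \<bar>d1 i\<bar> <= c / R * b^2" "!!i j. \<bar>d2 i j\<bar> <= c / R^2 * b^2"
 shows "(\<Sum>i\<in>UNIV. \<Sum>j\<in>UNIV. K i j * (b ^ 4 * w i j + d1 i * q j + d1 j * q i + d2 i j * z))
  >= \<Lambda> / 2 * (b ^ 4 * (\<Sum>i\<in>UNIV. \<Sum>j\<in>UNIV. (w i j)^2))
   - 3 * real (CARD('n)) ^ 6 * L^2 * c^2 / \<Lambda> * ((\<Sum>i\<in>UNIV. (q i)^2) / R^2 + z^2 / R ^ 4)"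
proof -
 let ?n = "real (CARD('n))"
 define N where "N = ?n^2"
 have n1: "?n >= 1" by (simp add: Suc_leI)
 have N1: "N >= 1" "?n <= N" using n1 by (auto simp: N_def power2_eq_square intro: mult_mono[of 1 ?n 1 ?n, simplified])
 define T where "T = (\<Sum>k\<in>UNIV. \<Sum>l\<in>UNIV. \<bar>w k l\<bar>)"
 define S where "S = (\<Sum>i\<in>UNIV. \<Sum>j\<in>UNIV. (w i j)^2)"
 define y where "y i j = \<bar>q i\<bar> + \<bar>q j\<bar> + \<bar>z\<bar> / R" for i j
 define Y where "Y = (\<Sum>i\<in>UNIV. \<Sum>j\<in>UNIV. y i j)"
 define X where "X = (\<Sum>i\<in>UNIV. (q i)^2) + z^2 / R^2"
 have T0: "T >= 0" unfolding T_def by (intro sum_nonneg) auto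
 have y0: "y i j >= 0" for i j unfolding y_def using R by simp
 have TS: "T^2 <= N * S"
  unfolding T_def S_def N_def using double_sum_square_le[of "%i j. \<bar>w i j\<bar>"] by simp
 have YX: "Y^2 <= 6 * N^2 * X"
 proof -
  have "(y i j)^2 <= 3 * ((q i)^2 + (q j)^2 + z^2 / R^2)" for i j
  proof -
   have "(A + B + D)^2 <= 3 * (A^2 + B^2 + D^2)" for A B D :: real
   proof -
    have "0 <= (A - B)^2 + (A - D)^2 + (B - D)^2" by simp
    then show ?thesis by (simp add: power2_eq_square algebra_simps)
   qed
   from this[of "\<bar>q i\<bar>" "\<bar>q j\<bar>" "\<bar>z\<bar> / R"] show ?thesis by (simp add: y_def power_divide)
  qed
  then have "(\<Sum>i\<in>UNIV. \<Sum>j\<in>UNIV. (y i j)^2) <= (\<Sum>i\<in>UNIV. \<Sum>j\<in>UNIV. 3 * ((q i)^2 + (q j)^2 + z^2 / R^2))"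
   by (intro sum_mono)
  also have "... = 3 * (2 * ?n * (\<Sum>i\<in>UNIV. (q i)^2) + N * (z^2 / R^2))"
  proof -
   define A where "A = (\<Sum>i\<in>UNIV. (q i)^2)"
   have "(\<Sum>j\<in>UNIV. 3 * ((q i)^2 + (q j)^2 + z^2 / R^2)) = 3 * (?n * (q i)^2 + A + ?n * (z^2 / R^2))" for i
    by (simp add: sum.distrib sum_distrib_left[symmetric] A_def)
   moreover have "(\<Sum>i\<in>UNIV. 3 * (?n * (q i)^2 + A + ?n * (z^2 / R^2))) = 3 * (?n * A + ?n * A + ?n * (?n * (z^2 / R^2)))"
    by (simp add: sum.distrib sum_distrib_left[symmetric] A_def)
   ultimately have e: "(\<Sum>i\<in>UNIV. \<Sum>j\<in>UNIV. 3 * ((q i)^2 + (q j)^2 + z^2 / R^2))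
     = 3 * (?n * A + ?n * A + ?n * (?n * (z^2 / R^2)))" by (simp only:)
   show ?thesis unfolding e A_def[symmetric] N_def by (simp add: power2_eq_square algebra_simps)
  qed
  also have "... <= 3 * (2 * N * (\<Sum>i\<in>UNIV. (q i)^2) + 2 * N * (z^2 / R^2))"
   using N1 by (intro mult_left_mono add_mono mult_right_mono) (auto intro: sum_nonneg)
  also have "... = 6 * N * X" by (simp add: X_def algebra_simps)
  finally have "(\<Sum>i\<in>UNIV. \<Sum>j\<in>UNIV. (y i j)^2) <= 6 * N * X" .
  then have "N * (\<Sum>i\<in>UNIV. \<Sum>j\<in>UNIV. (y i j)^2) <= N * (6 * N * X)"
   using N1 by (intro mult_left_mono) auto
  then show ?thesis
   using double_sum_square_le[of y] unfolding Y_def N_def[symmetric] by (simp add: power2_eq_square algebra_simps)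
 qed
 define E where "E = (\<Sum>i\<in>UNIV. \<Sum>j\<in>UNIV. K i j * (d1 i * q j + d1 j * q i + d2 i j * z))"
 have "\<bar>E\<bar> <= (\<Sum>i\<in>UNIV. \<Sum>j\<in>UNIV. \<bar>K i j * (d1 i * q j + d1 j * q i + d2 i j * z)\<bar>)"
  unfolding E_def by (intro order_trans[OF sum_abs] sum_mono order_trans[OF sum_abs] order_refl)
 also have "... <= (\<Sum>i\<in>UNIV. \<Sum>j\<in>UNIV. (L * T) * ((c / R * b^2) * y i j))"
 proof (intro sum_mono)
  fix i j
  have "\<bar>d1 i * q j + d1 j * q i + d2 i j * z\<bar> <= \<bar>d1 i\<bar> * \<bar>q j\<bar> + \<bar>d1 j\<bar> * \<bar>q i\<bar> + \<bar>d2 i j\<bar> * \<bar>z\<bar>"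
   by (simp add: abs_mult[symmetric])
  also have "... <= (c / R * b^2) * \<bar>q j\<bar> + (c / R * b^2) * \<bar>q i\<bar> + (c / R^2 * b^2) * \<bar>z\<bar>"
   by (intro add_mono mult_right_mono d) auto
  also have "... = (c / R * b^2) * y i j"
   using R by (simp add: y_def power2_eq_square field_simps)
  finally show "\<bar>K i j * (d1 i * q j + d1 j * q i + d2 i j * z)\<bar> <= (L * T) * ((c / R * b^2) * y i j)"
   unfolding abs_mult using lip[of i j, folded T_def] by (intro mult_mono) (auto intro: mult_nonneg_nonneg L T0)
 qed
 also have "... = (b^2 * T) * (L * c / R * Y)"
  unfolding Y_def by (simp add: sum_distrib_left sum_divide_distrib mult_ac)
 also have "... <= \<Lambda> / (2 * N) * (b^2 * T)^2 + N / (2 * \<Lambda>) * (L * c / R * Y)^2"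
 proof -
  define A where "A = b^2 * T"
  define B where "B = L * c / R * Y"
  have "0 <= (\<Lambda> * A - N * B)^2 / (2 * \<Lambda> * N)"
   using \<Lambda> N1 by simp
  also have "(\<Lambda> * A - N * B)^2 / (2 * \<Lambda> * N) = \<Lambda> / (2 * N) * A^2 + N / (2 * \<Lambda>) * B^2 - A * B"
   using \<Lambda> N1 by (simp add: power2_eq_square field_simps)
  finally show ?thesis unfolding A_def[symmetric] B_def[symmetric] by linarith
 qed
 also have "... <= \<Lambda> / 2 * (b ^ 4 * S) + 3 * N ^ 3 * L^2 * c^2 / \<Lambda> * (X / R^2)"
 proof (rule add_mono)
  have "\<Lambda> / (2 * N) * (b^2 * T)^2 = \<Lambda> / (2 * N) * b ^ 4 * T^2"
   by (simp add: power_mult_distrib power2_eq_square power4_eq_xxxx)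
  also have "... <= \<Lambda> / (2 * N) * b ^ 4 * (N * S)"
   using \<Lambda> N1 by (intro mult_left_mono TS) auto
  also have "... = \<Lambda> / 2 * (b ^ 4 * S)" using N1 by (simp add: field_simps)
  finally show "\<Lambda> / (2 * N) * (b^2 * T)^2 <= \<Lambda> / 2 * (b ^ 4 * S)" .
  have "N / (2 * \<Lambda>) * (L * c / R * Y)^2 = N / (2 * \<Lambda>) * (L * c / R)^2 * Y^2"
   by (simp only: power_mult_distrib mult.assoc)
  also have "... <= N / (2 * \<Lambda>) * (L * c / R)^2 * (6 * N^2 * X)"
   using \<Lambda> N1 by (intro mult_left_mono YX) auto
  also have "... = 3 * N ^ 3 * L^2 * c^2 / \<Lambda> * (X / R^2)"
   by (simp add: power_mult_distrib power_divide power2_eq_square power3_eq_cube mult_ac)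
  finally show "N / (2 * \<Lambda>) * (L * c / R * Y)^2 <= 3 * N ^ 3 * L^2 * c^2 / \<Lambda> * (X / R^2)" .
 qed
 finally have E: "\<bar>E\<bar> <= \<Lambda> / 2 * (b ^ 4 * S) + 3 * N ^ 3 * L^2 * c^2 / \<Lambda> * (X / R^2)" .
 have "(\<Sum>i\<in>UNIV. \<Sum>j\<in>UNIV. K i j * (b ^ 4 * w i j + d1 i * q j + d1 j * q i + d2 i j * z))
   = b ^ 4 * (\<Sum>i\<in>UNIV. \<Sum>j\<in>UNIV. K i j * w i j) + E"
  unfolding E_def by (simp add: sum_distrib_left sum.distrib[symmetric] algebra_simps)
 moreover have "b ^ 4 * (\<Sum>i\<in>UNIV. \<Sum>j\<in>UNIV. K i j * w i j) >= b ^ 4 * (\<Lambda> * S)"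
  unfolding S_def by (intro mult_left_mono mono) simp
 moreover have "b ^ 4 * (\<Lambda> * S) = \<Lambda> * (b ^ 4 * S)" by simp
 moreover have "X / R^2 = (\<Sum>i\<in>UNIV. (q i)^2) / R^2 + z^2 / R ^ 4"
  by (simp add: X_def add_divide_distrib power2_eq_square power4_eq_xxxx)
 moreover have "N ^ 3 = ?n ^ 6" by (simp add: N_def power_mult[symmetric])
 ultimately show ?thesis using E unfolding S_def[symmetric] by (simp add: abs_le_iff)
qed

text \<open>The weak formulation in terms of Borel representatives that vanish outside the unit ball.
 The matrix field \<open>W\<close> stands for \<open>F\<^sup>i\<^sup>j(D^2u)\<close>. Convexity enters only through the fact that
 \<open>W\<close> is a Lipschitz and strongly monotone function of \<open>v = D^2u\<close>.\<close>

locale double_divergence =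
 fixes u :: "real^'n::finite => real" and p :: "'n => real^'n => real"
  and v W :: "'n => 'n => real^'n => real" and M \<Lambda> L :: real
 assumes borel: "u \<in> borel_fns" "!!i. p i \<in> borel_fns"
   "!!i j. v i j \<in> borel_fns" "!!i j. W i j \<in> borel_fns"
  and bound: "!!x. \<bar>u x\<bar> <= M" "!!i x. \<bar>p i x\<bar> <= M" "!!i j x. \<bar>v i j x\<bar> <= M" "!!i j x. \<bar>W i j x\<bar> <= M"
  and outside: "!!x. x \<notin> ball 0 1 ==> u x = 0" "!!i x. x \<notin> ball 0 1 ==> p i x = 0"
   "!!i j x. x \<notin> ball 0 1 ==> v i j x = 0" "!!i j x. x \<notin> ball 0 1 ==> W i j x = 0"
  and weak: "!!i. wpd (ball 0 1) i u (p i)" "!!i j. wpd (ball 0 1) j (p i) (v i j)"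
  and sym: "!!i j x. v i j x = v j i x"
  and eq: "!!\<eta>. \<eta> \<in> test_functions (ball 0 1) ==>
   (LBINT x. (\<Sum>i\<in>UNIV. \<Sum>j\<in>UNIV. W i j x * pd i (pd j \<eta>) x)) = 0"
  and lip: "!!x y i j. x \<in> ball 0 1 ==> y \<in> ball 0 1 ==>
   \<bar>W i j x - W i j y\<bar> <= L * (\<Sum>k\<in>UNIV. \<Sum>l\<in>UNIV. \<bar>v k l x - v k l y\<bar>)"
  and mono: "!!x y. x \<in> ball 0 1 ==> y \<in> ball 0 1 ==>
   (\<Sum>i\<in>UNIV. \<Sum>j\<in>UNIV. (W i j x - W i j y) * (v i j x - v i j y))
    >= \<Lambda> * (\<Sum>i\<in>UNIV. \<Sum>j\<in>UNIV. (v i j x - v i j y)^2)"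
begin

lemma integrable_all:
 "integrable lborel u" "integrable lborel (p i)" "integrable lborel (v i j)" "integrable lborel (W i j)"
proof -
 have *: "x \<notin> cball 0 1 ==> x \<notin> ball 0 1" for x :: "real^'n" by auto
 show "integrable lborel u"
  by (rule integrable_bounded_ball[where a=0 and R=1, OF borel(1) bound(1) outside(1)[OF *]])
 show "integrable lborel (p i)"
  by (rule integrable_bounded_ball[where a=0 and R=1, OF borel(2) bound(2) outside(2)[OF *]])
 show "integrable lborel (v i j)"
  by (rule integrable_bounded_ball[where a=0 and R=1, OF borel(3) bound(3) outside(3)[OF *]])
 show "integrable lborel (W i j)"
  by (rule integrable_bounded_ball[where a=0 and R=1, OF borel(4) bound(4) outside(4)[OF *]])
qed

end

text \<open>Discrete integration by parts.\<close>

lemma diffquot_shift: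
 fixes f :: "real^'n::finite => real"
 assumes f: "integrable lborel f" and \<phi>: "\<phi> \<in> test_functions \<Omega>"
 shows "(LBINT x. (f (x + e) - f x) / h * \<phi> x)
  = ((LBINT x. f x * \<phi> (x - e)) - (LBINT x. f x * \<phi> x)) / h"
proof -
 have [measurable]: "f \<in> borel_fns" using borel_measurable_integrable[OF f] by simp
 have [measurable]: "\<phi> \<in> borel_fns" by (rule test_functions_borel[OF \<phi>])
 note i = integrable_mult_test[OF lborel_integrable_translate(1)[OF f, of e] \<phi>] integrable_mult_test[OF f \<phi>]
 have "(LBINT x. (f (x + e) - f x) / h * \<phi> x) = (LBINT x. (f (x + e) * \<phi> x - f x * \<phi> x) / h)"
  by (simp add: algebra_simps diff_divide_distrib)
 also have "... = ((LBINT x. f (x + e) * \<phi> x) - (LBINT x. f x * \<phi> x)) / h"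
  by (simp add: integral_diff[OF i])
 also have "(LBINT x. f (x + e) * \<phi> x) = (LBINT x. (%x. f x * \<phi> (x - e)) (x + e))" by simp
 also have "... = (LBINT x. f x * \<phi> (x - e))"
  by (rule lborel_integral_translate(1)) measurable
 finally show ?thesis .
qed

lemma test_translate:
 fixes \<phi> :: "real^'n::finite => real"
 assumes \<phi>: "\<phi> \<in> test_functions \<Omega>" and sub: "(%x. x + e) ` \<Omega> \<subseteq> \<Omega>'"
 shows "(%x. \<phi> (x - e)) \<in> test_functions \<Omega>'" "dd d (%x. \<phi> (x - e)) = (%x. dd d \<phi> (x - e))"
proof -
 note * = test_functionsD[OF \<phi>]
 show "(%x. \<phi> (x - e)) \<in> test_functions \<Omega>'"
 proof (rule test_functionsI[of _ "(%x. x + e) ` closure {x. \<phi> x ~= 0}"])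
  show "smooth (%x. \<phi> (x - e))" using smooth_affine[OF *(1), of "-e" 1] by simp
  show "compact ((%x. x + e) ` closure {x. \<phi> x ~= 0})"
   by (intro compact_continuous_image continuous_intros *)
  show "(%x. x + e) ` closure {x. \<phi> x ~= 0} \<subseteq> \<Omega>'" using *(3) sub by blast
  show "\<phi> (x - e) = 0" if "x \<notin> (%x. x + e) ` closure {x. \<phi> x ~= 0}" for x
  proof (rule ccontr)
   assume "\<phi> (x - e) ~= 0"
   then have "x - e \<in> closure {x. \<phi> x ~= 0}" using closure_subset[of "{x. \<phi> x ~= 0}"] by auto
   then show False using that by (metis diff_add_cancel imageI)
  qed
 qed
 show "dd d (%x. \<phi> (x - e)) = (%x. dd d \<phi> (x - e))" using dd_affine[OF *(1), of d "-e" 1] by simp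
qed

lemma wpd_diffquot:
 fixes f g :: "real^'n::finite => real"
 assumes f: "integrable lborel f" "integrable lborel g" and w: "wpd \<Omega>' i f g"
  and sub: "\<Omega> \<subseteq> \<Omega>'" "(%x. x + e) ` \<Omega> \<subseteq> \<Omega>'"
 shows "wpd \<Omega> i (%x. (f (x + e) - f x) / h) (%x. (g (x + e) - g x) / h)"
 unfolding wpd_def
proof
 fix \<phi> :: "real^'n => real" assume \<phi>: "\<phi> \<in> test_functions \<Omega>"
 note t = test_translate[OF \<phi> sub(2)]
 have "(LBINT x. f x * pd i (%x. \<phi> (x - e)) x) = - (LBINT x. g x * \<phi> (x - e))"
  using w t(1) unfolding wpd_def by blast
 then have "(LBINT x. f x * pd i \<phi> (x - e)) = - (LBINT x. g x * \<phi> (x - e))"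
  unfolding t(2) .
 moreover have "(LBINT x. f x * pd i \<phi> x) = - (LBINT x. g x * \<phi> x)"
  using w test_functions_mono[OF \<phi> sub(1)] unfolding wpd_def by blast
 ultimately show "(LBINT x. (f (x + e) - f x) / h * pd i \<phi> x) = - (LBINT x. (g (x + e) - g x) / h * \<phi> x)"
  unfolding diffquot_shift[OF f(1) test_functions_dd[OF \<phi>]] diffquot_shift[OF f(2) \<phi>]
  by (simp add: diff_divide_distrib)
qed

text \<open>The difference quotients of \<open>u\<close> solve a linear elliptic equation; it is tested with the
 difference quotient itself, up to an affine function and a cut-off.\<close>

lemma caccioppoli_diffquot:
 assumes \<Lambda>: "\<Lambda> > 0" and L: "L >= 0"
 obtains C where "C >= 0" "!!(u :: real^'n::finite => real) p v W M x0 R R' h m a c.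
  double_divergence u p v W M \<Lambda> L ==> R > 0 ==> h > 0 ==> ball x0 R' \<subseteq> ball 0 1 ==> R + h < R' ==>
  (LBINT x. cutoff x0 R x * (\<Sum>i\<in>UNIV. \<Sum>j\<in>UNIV. ((v i j (x + h *R axis m 1) - v i j x) / h)^2))
  <= C * ((\<Sum>i\<in>UNIV. LBINT x. in_ball x0 (R + h) x * (v i m x - a $ i)^2) / R^2
    + (LBINT x. in_ball x0 (R + h) x * (p m x - (a \<bullet> x + c))^2) / R ^ 4)"
proof -
 obtain c where c: "c > 0"
  "!!(x0 :: real^'n) R x i. R > 0 ==> \<bar>pd i (cutoff x0 R) x\<bar> <= c / R * bump ((1 / R) *R (x - x0)) ^ 2"
  "!!(x0 :: real^'n) R x i j. R > 0 ==> \<bar>pd i (pd j (cutoff x0 R)) x\<bar> <= c / R^2 * bump ((1 / R) *R (x - x0)) ^ 2"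
  by (rule cutoff_derivs) (rule that)
 define C1 where "C1 = 3 * real (CARD('n)) ^ 6 * L^2 * c^2 / \<Lambda>"
 have C1: "C1 >= 0" unfolding C1_def using \<Lambda> by simp
 show ?thesis
 proof (rule that[of "2 * C1 / \<Lambda>"])
  show "2 * C1 / \<Lambda> >= 0" using C1 \<Lambda> by simp
  fix u :: "real^'n => real" and p v W M x0 R R' h m a b
  assume dd: "double_divergence u p v W M \<Lambda> L" and R: "R > 0" and h: "h > (0::real)"
   and sub: "ball x0 R' \<subseteq> ball (0::real^'n) 1" and RR: "R + h < R'"
  interpret double_divergence u p v W M \<Lambda> L by (rule dd)
  let ?e = "h *R axis m (1::real) :: real^'n"
  define \<Omega> where "\<Omega> = ball x0 (R' - h)"
  define \<psi> where "\<psi> = cutoff x0 R"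
  define w where "w i j x = (v i j (x + ?e) - v i j x) / h" for i j x
  define K where "K i j x = (W i j (x + ?e) - W i j x) / h" for i j x
  define q where "q i x = (p i (x + ?e) - p i x) / h" for i x
  define f where "f x = (u (x + ?e) - u x) / h" for x
  \<comment> \<open>the mean of \<open>a \<bullet> x + b\<close> over a step of length \<open>h\<close> adds \<open>a\<^sub>m h/2\<close>\<close>
  define b' where "b' = b + a $ m * h / 2"
  have sub1: "\<Omega> \<subseteq> ball 0 1"
  proof -
   have "\<Omega> \<subseteq> ball x0 R'" unfolding \<Omega>_def using h by (intro subset_ball) simp
   with sub show ?thesis by blast
  qed
  have sub2: "(%x. x + ?e) ` \<Omega> \<subseteq> ball 0 1"
  proof -
   have "(%x. x + ?e) ` \<Omega> \<subseteq> ball x0 R'"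
   proof clarify
    fix x assume "x \<in> \<Omega>"
    then show "x + ?e \<in> ball x0 R'"
     using dist_triangle[of x0 "x + ?e" x] h by (simp add: \<Omega>_def dist_norm)
   qed
   with sub show ?thesis by blast
  qed
  have \<psi>t: "\<psi> \<in> test_functions \<Omega>"
   unfolding \<psi>_def \<Omega>_def using RR by (intro cutoff_test[OF R] subsetI) auto
  have dqi: "integrable lborel (%x. (F (x + ?e) - F x) / h)" if "integrable lborel F" for F :: "real^'n => real"
   using lborel_integrable_translate(1)[OF that] that by simp
  have i: "integrable lborel f" "integrable lborel (q i)" "integrable lborel (w i j)" "integrable lborel (K i j)" for i j
   unfolding f_def q_def w_def K_def by (intro dqi integrable_all)+
  have meas: "f \<in> borel_fns" "q i \<in> borel_fns"
   "w i j \<in> borel_fns" "K i j \<in> borel_fns" for i j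
   using borel_measurable_integrable[OF i(1)] borel_measurable_integrable[OF i(2)]
    borel_measurable_integrable[OF i(3)] borel_measurable_integrable[OF i(4)] by auto
  have dqb: "\<bar>(F (x + ?e) - F x) / h\<bar> <= 2 * M / h" if "!!x. \<bar>F x\<bar> <= M" for F :: "real^'n => real" and x
   using that[of x] that[of "x + ?e"] h by (simp add: divide_right_mono)
  have bd: "\<bar>f x\<bar> <= 2 * M / h" "\<bar>q i x\<bar> <= 2 * M / h" "\<bar>w i j x\<bar> <= 2 * M / h" "\<bar>K i j x\<bar> <= 2 * M / h" for i j x
   unfolding f_def q_def w_def K_def by (intro dqb bound)+
  have Keq: "(LBINT x. (\<Sum>i\<in>UNIV. \<Sum>j\<in>UNIV. K i j x * pd i (pd j \<eta>) x)) = 0"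
   if \<eta>: "\<eta> \<in> test_functions \<Omega>" for \<eta>
  proof -
   note t = test_translate[OF \<eta> sub2]
   note ti = integrable_mult_test[OF integrable_all(4) test_functions_dd[OF test_functions_dd[OF t(1)]]]
   note ti' = integrable_mult_test[OF integrable_all(4) test_functions_dd[OF test_functions_dd[OF \<eta>]]]
   have d2: "pd i (pd j (%x. \<eta> (x - ?e))) = (%x. pd i (pd j \<eta>) (x - ?e))" for i j
    unfolding t(2) by (rule test_translate(2)[OF test_functions_dd[OF \<eta>] sub2])
   have "(LBINT x. (\<Sum>i\<in>UNIV. \<Sum>j\<in>UNIV. K i j x * pd i (pd j \<eta>) x))
    = (\<Sum>i\<in>UNIV. \<Sum>j\<in>UNIV. (LBINT x. K i j x * pd i (pd j \<eta>) x))"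
    by (simp add: integral_sum integrable_sum
      integrable_mult_test[OF i(4) test_functions_dd[OF test_functions_dd[OF \<eta>]]])
   also have "... = (\<Sum>i\<in>UNIV. \<Sum>j\<in>UNIV. ((LBINT x. W i j x * pd i (pd j (%x. \<eta> (x - ?e))) x)
     - (LBINT x. W i j x * pd i (pd j \<eta>) x)) / h)"
    unfolding K_def d2 by (simp only: diffquot_shift[OF integrable_all(4) test_functions_dd[OF test_functions_dd[OF \<eta>]]])
   also have "... = ((LBINT x. (\<Sum>i\<in>UNIV. \<Sum>j\<in>UNIV. W i j x * pd i (pd j (%x. \<eta> (x - ?e))) x))
     - (LBINT x. (\<Sum>i\<in>UNIV. \<Sum>j\<in>UNIV. W i j x * pd i (pd j \<eta>) x))) / h"
    by (simp add: integral_sum integrable_sum ti ti'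
      sum_divide_distrib[symmetric] sum_subtractf)
   also have "... = 0" using eq[OF t(1)] eq[OF test_functions_mono[OF \<eta> sub1]] by simp
   finally show ?thesis .
  qed
  have test: "(LBINT x. (\<Sum>i\<in>UNIV. \<Sum>j\<in>UNIV. K i j x *
  (\<psi> x * w i j x + pd i \<psi> x * (q j x - a $ j) + pd j \<psi> x * (q i x - a $ i)
   + pd i (pd j \<psi>) x * (f x - (a \<bullet> x + b'))))) = 0"
  proof (rule test_with_cutoff[OF _ \<psi>t i(1,2,3) _ _ _ meas(4) bd(4) Keq])
   show "open \<Omega>" by (simp add: \<Omega>_def)
   show "wpd \<Omega> i f (q i)" for i
    unfolding f_def q_def by (rule wpd_diffquot[OF integrable_all(1,2) weak(1) sub1 sub2])
   show "wpd \<Omega> j (q i) (w i j)" for i j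
    unfolding q_def w_def by (rule wpd_diffquot[OF integrable_all(2,3) weak(2) sub1 sub2])
   show "w i j x = w j i x" for i j x unfolding w_def by (simp only: sym[of i j])
  qed
  define S where "S x = (\<Sum>i\<in>UNIV. \<Sum>j\<in>UNIV. (w i j x)^2)" for x
  define z where "z x = f x - (a \<bullet> x + b')" for x
  define I where "I x = (\<Sum>i\<in>UNIV. \<Sum>j\<in>UNIV. K i j x * (\<psi> x * w i j x + pd i \<psi> x * (q j x - a $ j)
   + pd j \<psi> x * (q i x - a $ i) + pd i (pd j \<psi>) x * z x))" for x
  define Z where "Z x = (\<Sum>i\<in>UNIV. in_ball x0 R x * (q i x - a $ i)^2) / R^2
   + in_ball x0 R x * (z x)^2 / R ^ 4" for x
  have point: "\<Lambda> / 2 * (\<psi> x * S x) - C1 * Z x <= I x" for x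
  proof (cases "x \<in> ball x0 R")
   case True
   have x\<Omega>: "x \<in> \<Omega>" unfolding \<Omega>_def using True RR by simp
   then have x1: "x \<in> ball 0 1" "x + ?e \<in> ball 0 1" using sub1 sub2 by auto
   have "\<Lambda> / 2 * (bump ((1 / R) *R (x - x0)) ^ 4 * (\<Sum>i\<in>UNIV. \<Sum>j\<in>UNIV. (w i j x)^2))
    - 3 * real (CARD('n)) ^ 6 * L^2 * c^2 / \<Lambda> * ((\<Sum>i\<in>UNIV. (q i x - a $ i)^2) / R^2 + (z x)^2 / R ^ 4)
    <= (\<Sum>i\<in>UNIV. \<Sum>j\<in>UNIV. K i j x * (bump ((1 / R) *R (x - x0)) ^ 4 * w i j x + pd i \<psi> x * (q j x - a $ j)
      + pd j \<psi> x * (q i x - a $ i) + pd i (pd j \<psi>) x * z x))"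
   proof (rule ellipticity_with_errors[OF \<Lambda> L less_imp_le[OF c(1)] R])
    show "\<bar>K i j x\<bar> <= L * (\<Sum>k\<in>UNIV. \<Sum>l\<in>UNIV. \<bar>w k l x\<bar>)" for i j
     using divide_right_mono[OF lip[OF x1(2,1), of i j], of h] h
     by (simp add: K_def w_def sum_divide_distrib[symmetric])
    have "\<Lambda> * (\<Sum>i\<in>UNIV. \<Sum>j\<in>UNIV. (w i j x)^2)
     = \<Lambda> * (\<Sum>i\<in>UNIV. \<Sum>j\<in>UNIV. (v i j (x + ?e) - v i j x)^2) / h^2"
     by (simp add: w_def power_divide sum_divide_distrib[symmetric])
    also have "... <= (\<Sum>i\<in>UNIV. \<Sum>j\<in>UNIV. (W i j (x + ?e) - W i j x) * (v i j (x + ?e) - v i j x)) / h^2"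
     by (intro divide_right_mono mono x1) simp
    also have "... = (\<Sum>i\<in>UNIV. \<Sum>j\<in>UNIV. K i j x * w i j x)"
     by (simp add: K_def w_def sum_divide_distrib power2_eq_square)
    finally show "\<Lambda> * (\<Sum>i\<in>UNIV. \<Sum>j\<in>UNIV. (w i j x)^2) <= (\<Sum>i\<in>UNIV. \<Sum>j\<in>UNIV. K i j x * w i j x)" .
   qed (use c(2,3)[OF R] in \<open>auto simp: \<psi>_def\<close>)
   then show ?thesis
    using True unfolding I_def Z_def S_def C1_def \<psi>_def by (simp add: cutoff_def)
  next
   case False
   then have "norm (x - x0) >= R" by (simp add: dist_norm norm_minus_commute)
   then have b0: "bump ((1 / R) *R (x - x0)) = 0"
    unfolding bump_eq_0_iff norm_scaleR using R by (simp add: field_simps)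
   have cc: "\<bar>pd i (cutoff x0 R) x\<bar> <= c / R * bump ((1 / R) *R (x - x0)) ^ 2"
    "\<bar>pd i (pd j (cutoff x0 R)) x\<bar> <= c / R^2 * bump ((1 / R) *R (x - x0)) ^ 2" for i j
    by (rule c(2)[OF R], rule c(3)[OF R])
   then have "pd i \<psi> x = 0" "pd i (pd j \<psi>) x = 0" for i j
    using cc unfolding \<psi>_def b0 by auto
   moreover have "\<psi> x = 0" unfolding \<psi>_def cutoff_def b0 by simp
   ultimately have "\<psi> x = 0" "pd i \<psi> x = 0" "pd i (pd j \<psi>) x = 0" for i j by auto
   then show ?thesis using False by (simp add: I_def Z_def)
  qed
  have Ii: "integrable lborel I"
  proof -
   note t1 = test_functions_dd[OF \<psi>t]
   note t2 = test_functions_dd[OF t1]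
   have lt: "integrable lborel (%x. K i j x * (pd i (pd j \<psi>) x * (a \<bullet> x + b')))" for i j
    by (rule integrable_mult_bounded_left[OF _ _ bd(4)])
     (simp_all add: meas integrable_test[OF test_functions_mult[OF t2 smooth_affine_fun]])
   have KF: "integrable lborel (%x. K i j x * (\<phi> x * F x))" if "\<phi> \<in> test_functions \<Omega>" "integrable lborel F" for \<phi> F i j
   proof -
    have "integrable lborel (%x. K i j x * (F x * \<phi> x))"
     by (rule integrable_mult_bounded_left[OF integrable_mult_test[OF that(2,1)] _ bd(4)]) (simp add: meas)
    then show ?thesis by (simp add: mult_ac)
   qed
   have K0: "integrable lborel (%x. K i j x * (\<phi> x * k))" if "\<phi> \<in> test_functions \<Omega>" for \<phi> k i j
    by (rule integrable_mult_bounded_left[OF _ _ bd(4)])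
     (simp_all add: meas integrable_mult_left integrable_test[OF that])
   have "I = (%x. \<Sum>i\<in>UNIV. \<Sum>j\<in>UNIV. K i j x * (\<psi> x * w i j x)
    + (K i j x * (pd i \<psi> x * q j x) - K i j x * (pd i \<psi> x * a $ j))
    + (K i j x * (pd j \<psi> x * q i x) - K i j x * (pd j \<psi> x * a $ i))
    + (K i j x * (pd i (pd j \<psi>) x * f x) - K i j x * (pd i (pd j \<psi>) x * (a \<bullet> x + b'))))"
    unfolding I_def z_def by (intro ext sum.cong refl) (simp add: algebra_simps)
   then show ?thesis
    by (simp only:)
     (intro integrable_sum integrable_add integrable_diff
      lt KF K0 \<psi>t t1 t2 i)
  qed
  have Ri: "integrable lborel (%x. in_ball x0 R x * (F x)^2)"
   if F: "F \<in> borel_fns" "!!x. x \<in> ball x0 R ==> \<bar>F x\<bar> <= B" for F :: "real^'n => real" and B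
  proof (rule integrable_bounded_ball[where a=x0 and R=R and M="B^2"])
   show "\<bar>in_ball x0 R x * (F x)^2\<bar> <= B^2" for x
    using power_mono[OF F(2), of x 2] by (cases "x \<in> ball x0 R") auto
   show "in_ball x0 R x * (F x)^2 = 0" if "x \<notin> cball x0 R" for x
    using that by (auto simp: indicator_def)
  qed (intro borel_measurable_times borel_measurable_indicator borel_measurable_power F(1); simp)
  have \<psi>S: "integrable lborel (%x. \<psi> x * S x)"
  proof -
   have "integrable lborel (%x. w i j x * w i j x * \<psi> x)" for i j
    by (intro integrable_mult_test[OF _ \<psi>t] integrable_mult_bounded[OF i(3) _ bd(3)]) (simp add: meas)
   then have "integrable lborel (%x. \<Sum>i\<in>UNIV. \<Sum>j\<in>UNIV. w i j x * w i j x * \<psi> x)"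
    by (intro integrable_sum)
   then show ?thesis by (simp add: S_def sum_distrib_left power2_eq_square mult_ac)
  qed
  have bdd: "\<bar>a \<bullet> x + b'\<bar> <= norm a * (norm x0 + R) + \<bar>b'\<bar>" if "x \<in> ball x0 R" for x
  proof -
   have "norm x <= norm x0 + R" using that norm_triangle_ineq[of x0 "x - x0"] by (simp add: dist_norm norm_minus_commute)
   then have "\<bar>a \<bullet> x\<bar> <= norm a * (norm x0 + R)"
    using Cauchy_Schwarz_ineq2[of a x] by (meson mult_left_mono norm_ge_zero order_trans)
   then show ?thesis by linarith
  qed
  have qi: "integrable lborel (%x. in_ball x0 R x * (q i x - a $ i)^2)" for i
  proof (rule Ri)
   show "\<bar>q i x - a $ i\<bar> <= 2 * M / h + \<bar>a $ i\<bar>" for x using bd(2)[of i x] by linarith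
  qed (use meas in auto)
  have zm: "z \<in> borel_fns"
   unfolding z_def by (intro borel_measurable_diff meas smooth_borel_measurable smooth_affine_fun)
  have zi: "integrable lborel (%x. in_ball x0 R x * (z x)^2)"
  proof (rule Ri[OF zm])
   show "\<bar>z x\<bar> <= 2 * M / h + (norm a * (norm x0 + R) + \<bar>b'\<bar>)" if "x \<in> ball x0 R" for x
    using bdd[OF that] bd(1)[of x] unfolding z_def by linarith
  qed
  have Zi: "integrable lborel Z"
   unfolding Z_def by (intro integrable_add integrable_divide integrable_sum qi zi)
  have "(LBINT x. \<Lambda> / 2 * (\<psi> x * S x) - C1 * Z x) <= (LBINT x. I x)"
   by (intro integral_mono integrable_diff integrable_mult_right \<psi>S Zi Ii point)
  moreover have "(LBINT x. I x) = 0" using test unfolding I_def z_def .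
  moreover have "(LBINT x. \<Lambda> / 2 * (\<psi> x * S x) - C1 * Z x) = \<Lambda> / 2 * (LBINT x. \<psi> x * S x) - C1 * (LBINT x. Z x)"
   using \<psi>S Zi by simp
  ultimately have "\<Lambda> / 2 * (LBINT x. \<psi> x * S x) <= C1 * (LBINT x. Z x)" by simp
  then have main: "(LBINT x. \<psi> x * S x) <= 2 * C1 / \<Lambda> * (LBINT x. Z x)"
   using \<Lambda> by (simp add: field_simps)
  have ZI: "(LBINT x. Z x) = (\<Sum>i\<in>UNIV. LBINT x. in_ball x0 R x * (q i x - a $ i)^2) / R^2
    + (LBINT x. in_ball x0 R x * (z x)^2) / R ^ 4"
   unfolding Z_def
   by (simp only: integral_add integral_sum integrable_sum
     integrable_divide integral_divide_zero qi zi)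
  have q1: "(LBINT x. in_ball x0 R x * (q i x - a $ i)^2)
    <= (LBINT x. in_ball x0 (R + h) x * (v i m x - a $ i)^2)" for i
   using diffquot_weak[OF integrable_all(2) bound(2) integrable_all(3) bound(3) weak(2) h sub RR, of i m 0 "a $ i"]
   by (simp add: q_def)
  have z1: "(LBINT x. in_ball x0 R x * (z x)^2)
    <= (LBINT x. in_ball x0 (R + h) x * (p m x - (a \<bullet> x + b))^2)"
   using diffquot_weak[OF integrable_all(1) bound(1) integrable_all(2) bound(2) weak(1) h sub RR, of m a b]
   by (simp add: z_def f_def b'_def add.assoc)
  have "(LBINT x. Z x) <= (\<Sum>i\<in>UNIV. LBINT x. in_ball x0 (R + h) x * (v i m x - a $ i)^2) / R^2
    + (LBINT x. in_ball x0 (R + h) x * (p m x - (a \<bullet> x + b))^2) / R ^ 4"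
   unfolding ZI using R by (intro add_mono divide_right_mono sum_mono q1 z1) auto
  then have "2 * C1 / \<Lambda> * (LBINT x. Z x) <= 2 * C1 / \<Lambda> * ((\<Sum>i\<in>UNIV. LBINT x. in_ball x0 (R + h) x * (v i m x - a $ i)^2) / R^2
    + (LBINT x. in_ball x0 (R + h) x * (p m x - (a \<bullet> x + b))^2) / R ^ 4)"
   using C1 \<Lambda> by (intro mult_left_mono) auto
  with main show "(LBINT x. cutoff x0 R x * (\<Sum>i\<in>UNIV. \<Sum>j\<in>UNIV. ((v i j (x + ?e) - v i j x) / h)^2))
   <= 2 * C1 / \<Lambda> * ((\<Sum>i\<in>UNIV. LBINT x. in_ball x0 (R + h) x * (v i m x - a $ i)^2) / R^2
    + (LBINT x. in_ball x0 (R + h) x * (p m x - (a \<bullet> x + b))^2) / R ^ 4)"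
   unfolding \<psi>_def S_def w_def by linarith
 qed
qed

section \<open>Weak limits in \<open>L^2\<close>\<close>

text \<open>Convex combinations with dyadic weights: closure under midpoints is all that the parallelogram law needs.\<close>

inductive_set mid_hull :: "(nat => 'a => real) => nat => ('a => real) set"
 for f :: "nat => 'a => real" and k :: nat where
 base: "k <= j ==> f j \<in> mid_hull f k"
| mid: "g \<in> mid_hull f k ==> h \<in> mid_hull f k ==> (%x. (g x + h x) / 2) \<in> mid_hull f k"

lemma mid_hull_antimono: "g \<in> mid_hull f l ==> k <= l ==> g \<in> mid_hull f k"
 by (induction rule: mid_hull.induct) (auto intro: mid_hull.intros)

lemma square_integrable_prod:
 fixes f g :: "'a => real"
 assumes [measurable]: "f \<in> borel_measurable M" "g \<in> borel_measurable M"
  and "integrable M (%x. (f x)^2)" "integrable M (%x. (g x)^2)"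
 shows "integrable M (%x. f x * g x)"
proof (rule integrable_bound)
 show "integrable M (%x. (f x)^2 + (g x)^2)" using assms by simp
 have "\<bar>a * b\<bar> <= a^2 + b^2" for a b :: real
 proof -
  have "0 <= (\<bar>a\<bar> - \<bar>b\<bar>)^2" by simp
  then have "2 * (\<bar>a\<bar> * \<bar>b\<bar>) <= a^2 + b^2" by (simp add: power2_eq_square algebra_simps)
  moreover have "0 <= \<bar>a\<bar> * \<bar>b\<bar>" by simp
  ultimately show ?thesis unfolding abs_mult by linarith
 qed
 then show "AE x in M. norm (f x * g x) <= norm ((f x)^2 + (g x)^2)" by auto
qed measurable

lemma square_integrable_add:
 fixes f g :: "'a => real"
 assumes "f \<in> borel_measurable M" "g \<in> borel_measurable M"
  and "integrable M (%x. (f x)^2)" "integrable M (%x. (g x)^2)"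
 shows "integrable M (%x. (f x + g x)^2)" "integrable M (%x. (f x - g x)^2)"
proof -
 note i = square_integrable_prod[OF assms]
 have "integrable M (%x. (f x)^2 + 2 * (f x * g x) + (g x)^2)" "integrable M (%x. (f x)^2 - 2 * (f x * g x) + (g x)^2)"
  using i assms by (intro integrable_add integrable_diff integrable_mult_right; simp)+
 then show "integrable M (%x. (f x + g x)^2)" "integrable M (%x. (f x - g x)^2)"
  by (simp_all add: power2_eq_square algebra_simps)
qed

lemma abs_prod_le_Young: "t > 0 ==> \<bar>a * b\<bar> <= t * a^2 + b^2 / (t::real)"
proof -
 assume t: "t > 0"
 have "0 <= (t * \<bar>a\<bar> - \<bar>b\<bar>)^2 / t" using t by simp
 also have "... = t * a^2 + b^2 / t - 2 * \<bar>a * b\<bar>"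
  using t by (simp add: power2_eq_square field_simps abs_mult)
 finally show ?thesis using abs_ge_zero[of "a * b"] by linarith
qed

text \<open>A bounded sequence in \<open>L^2\<close> has convex combinations of its tails that converge strongly:
 take near-minimizers of the norm in the (midpoint-)convex hulls of the tails and use the
 parallelogram law. The limit inherits whatever is stable under convex combinations.\<close>

lemma L2_weak_limit:
 fixes f :: "nat => 'a => real"
 assumes fm: "!!k. f k \<in> borel_measurable M" and f2: "!!k. integrable M (%x. (f k x)^2)"
  and fK: "!!k. (\<integral>x. (f k x)^2 \<partial>M) <= K"
 obtains G where "G \<in> borel_measurable M" "integrable M (%x. (G x)^2)"
  "!!\<phi> c. \<phi> \<in> borel_measurable M ==> integrable M (%x. (\<phi> x)^2) ==>
   (%k. \<integral>x. f k x * \<phi> x \<partial>M) \<longlonglongrightarrow> c ==> (\<integral>x. G x * \<phi> x \<partial>M) = c"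
  "!!A c. A \<in> sets M ==> \<forall>\<^sub>F k in sequentially. (\<integral>x. indicator A x * (f k x)^2 \<partial>M) <= c ==>
   (\<integral>x. indicator A x * (G x)^2 \<partial>M) <= c"
proof -
 define N where "N g = (\<integral>x. (g x)^2 \<partial>M)" for g :: "'a => real"
 have N0: "N g >= 0" for g unfolding N_def by (rule integral_nonneg) simp
 have half: "integrable M (%x. ((g x + h x) / 2)^2)"
  if "g \<in> borel_measurable M" "h \<in> borel_measurable M" "integrable M (%x. (g x)^2)" "integrable M (%x. (h x)^2)" for g h :: "'a => real"
  using square_integrable_add(1)[OF that] by (simp add: power_divide)
 have hm: "g \<in> borel_measurable M \<and> integrable M (%x. (g x)^2)" if "g \<in> mid_hull f k" for g k
  using that by induction (auto intro: fm f2 half)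
 have mm: "g \<in> borel_measurable M" if "g \<in> mid_hull f k" for g k using hm[OF that] by simp
 have mi: "integrable M (%x. (g x)^2)" if "g \<in> mid_hull f k" for g k using hm[OF that] by simp
 define d where "d k = Inf (N ` mid_hull f k)" for k
 have bb: "bdd_below (N ` mid_hull f k)" for k using N0 by (intro bdd_belowI[of _ 0]) auto
 have ne: "N ` mid_hull f k ~= {}" for k using mid_hull.base[of k k f] by blast
 have d_le: "d k <= N g" if "g \<in> mid_hull f k" for g k
  unfolding d_def using that bb by (intro cInf_lower) auto
 have dK: "d k <= K" for k using d_le[OF mid_hull.base[of k k f]] fK[of k] unfolding N_def by simp
 have dmono: "incseq d"
  unfolding d_def by (intro monoI cInf_superset_mono ne bb image_mono) (auto intro: mid_hull_antimono)
 obtain dl where dl: "d \<longlonglongrightarrow> dl" by (rule incseq_convergent[OF dmono, of K]) (use dK in \<open>auto intro: that\<close>)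
 have "\<exists>g\<in>mid_hull f k. N g < d k + 1 / real (Suc k)" for k
  using cInf_lessD[OF ne, of k "d k + 1 / real (Suc k)"] unfolding d_def by auto
 then obtain g where g: "!!k. g k \<in> mid_hull f k" "!!k. N (g k) < d k + 1 / real (Suc k)" by metis
 note gm[measurable] = mm[OF g(1)]
 note g2 = mi[OF g(1)]
 have par: "N (%x. g l x - g k x) <= 2 * (d l - d k) + 4 / real (Suc k)" if "k <= l" for k l
 proof -
  have mid: "(%x. (g k x + g l x) / 2) \<in> mid_hull f k"
   by (intro mid_hull.mid g(1) mid_hull_antimono[OF g(1) that])
  have "N (%x. g l x - g k x) = (\<integral>x. 2 * (g k x)^2 + 2 * (g l x)^2 - 4 * ((g k x + g l x) / 2)^2 \<partial>M)"
   unfolding N_def by (intro integral_cong refl) (simp add: power2_eq_square field_simps)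
  also have "... = 2 * N (g k) + 2 * N (g l) - 4 * N (%x. (g k x + g l x) / 2)"
   unfolding N_def using g2[of k] g2[of l] mi[OF mid] by simp
  also have "... <= 2 * (d k + 1 / real (Suc k)) + 2 * (d l + 1 / real (Suc l)) - 4 * d k"
  proof -
   have "2 * A + 2 * B - 4 * m <= 2 * (D + p) + 2 * (E + q) - 4 * D"
    if "A < D + p" "B < E + q" "D <= m" for A B D E m p q :: real
   proof -
    have "2 * A + 2 * B <= 2 * (D + p) + 2 * (E + q)"
     by (intro add_mono mult_left_mono less_imp_le that) auto
    moreover have "4 * D <= 4 * m" using that(3) by simp
    ultimately show ?thesis by (rule diff_mono)
   qed
   from this[OF g(2) g(2) d_le[OF mid]] show ?thesis .
  qed
  also have "1 / real (Suc l) <= 1 / real (Suc k)" using that by (simp add: frac_le)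
  finally show ?thesis by simp
 qed
 have small: "\<exists>n0. \<forall>k\<ge>n0. \<forall>l\<ge>k. N (%x. g l x - g k x) <= \<epsilon>" if "\<epsilon> > 0" for \<epsilon>
 proof -
  have "\<forall>\<^sub>F k in sequentially. dl - \<epsilon> / 4 < d k" using dl that by (intro order_tendstoD) auto
  moreover have "(%k. 4 / real (Suc k)) \<longlonglongrightarrow> 0" by real_asymp
  then have "\<forall>\<^sub>F k in sequentially. 4 / real (Suc k) < \<epsilon> / 2" using that by (intro order_tendstoD) auto
  ultimately have "\<forall>\<^sub>F k in sequentially. \<forall>l\<ge>k. N (%x. g l x - g k x) <= \<epsilon>"
  proof eventually_elim
   case (elim k)
   show ?case
   proof (intro allI impI)
    fix l assume "k <= l"
    have "d l <= dl" by (rule incseq_le[OF dmono dl])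
    then show "N (%x. g l x - g k x) <= \<epsilon>" using par[OF \<open>k <= l\<close>] elim by argo
   qed
  qed
  then show ?thesis by (simp add: eventually_sequentially)
 qed
 have "\<exists>r. \<forall>n. (\<forall>l\<ge>r n. N (%x. g l x - g (r n) x) <= (1/4) ^ n) \<and> r n < r (Suc n)"
 proof (intro dependent_nat_choice)
  obtain n0 where "\<forall>k\<ge>n0. \<forall>l\<ge>k. N (%x. g l x - g k x) <= (1/4) ^ 0" using small[of "(1/4)^0"] by auto
  then show "\<exists>x. \<forall>l\<ge>x. N (%xa. g l xa - g x xa) <= (1 / 4) ^ 0" by blast
  fix x n :: nat
  obtain n0 where "\<forall>k\<ge>n0. \<forall>l\<ge>k. N (%x. g l x - g k x) <= (1/4) ^ Suc n" using small[of "(1/4)^Suc n"] by auto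
  then show "\<exists>y. (\<forall>l\<ge>y. N (%xa. g l xa - g y xa) <= (1 / 4) ^ Suc n) \<and> x < y"
   by (intro exI[of _ "max n0 (Suc x)"]) auto
 qed
 then obtain r where r: "!!n l. l >= r n ==> N (%x. g l x - g (r n) x) <= (1/4) ^ n" and rs: "!!n. r n < r (Suc n)"
  by blast
 have rmono: "strict_mono r" using rs by (rule strict_monoI_Suc)
 \<comment> \<open>a subsequence with summable increments converges almost everywhere\<close>
 define h where "h n = g (r n)" for n
 have hm[measurable]: "h n \<in> borel_measurable M" for n unfolding h_def by (rule gm)
 have h2: "integrable M (%x. (h n x)^2)" for n unfolding h_def by (rule g2)
 have hh: "h n \<in> mid_hull f n" for n
  unfolding h_def by (rule mid_hull_antimono[OF g(1) seq_suble[OF rmono]])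
 define \<Delta> where "\<Delta> n x = h (Suc n) x - h n x" for n x
 have [measurable]: "\<Delta> n \<in> borel_measurable M" for n unfolding \<Delta>_def[abs_def] by measurable
 have \<Delta>2: "integrable M (%x. (\<Delta> n x)^2)" for n
  unfolding \<Delta>_def by (rule square_integrable_add(2)[OF hm hm h2 h2])
 have \<Delta>N: "(\<integral>\<^sup>+x. ennreal (2 ^ n * (\<Delta> n x)^2) \<partial>M) <= ennreal ((1/2) ^ n)" for n
 proof -
  have "(\<integral>\<^sup>+x. ennreal (2 ^ n * (\<Delta> n x)^2) \<partial>M) = ennreal (\<integral>x. 2 ^ n * (\<Delta> n x)^2 \<partial>M)"
   by (rule nn_integral_eq_integral) (use \<Delta>2 in auto)
  also have "(\<integral>x. 2 ^ n * (\<Delta> n x)^2 \<partial>M) <= 2 ^ n * (1/4) ^ n"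
   using r[of n "r (Suc n)"] rs[of n] by (simp add: N_def \<Delta>_def h_def)
  also have "2 ^ n * (1/4) ^ n = ((1/2) ^ n :: real)" by (simp add: power_mult_distrib[symmetric])
  finally show ?thesis using ennreal_leI by blast
 qed
 have "(\<integral>\<^sup>+x. (\<Sum>n. ennreal (2 ^ n * (\<Delta> n x)^2)) \<partial>M) = (\<Sum>n. \<integral>\<^sup>+x. ennreal (2 ^ n * (\<Delta> n x)^2) \<partial>M)"
  by (rule nn_integral_suminf) measurable
 also have "... <= (\<Sum>n. ennreal ((1/2) ^ n))" by (intro suminf_le \<Delta>N) auto
 also have "... = ennreal (\<Sum>n. (1/2) ^ n)" by (rule suminf_ennreal2) (auto simp: summable_geometric)
 also have "... < \<infinity>" by simp
 finally have fin: "(\<integral>\<^sup>+x. (\<Sum>n. ennreal (2 ^ n * (\<Delta> n x)^2)) \<partial>M) ~= \<infinity>" by simp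
 have "AE x in M. (\<Sum>n. ennreal (2 ^ n * (\<Delta> n x)^2)) ~= \<infinity>"
  by (rule nn_integral_PInf_AE[OF _ fin]) measurable
 then have conv: "AE x in M. convergent (%n. h n x)"
 proof eventually_elim
  case (elim x)
  have s: "summable (%n. 2 ^ n * (\<Delta> n x)^2)"
   by (rule summable_suminf_not_top) (use elim in auto)
  have "summable (%n. 2 ^ n * (\<Delta> n x)^2 + (1/2) ^ n)"
   by (intro summable_add s) (simp add: summable_geometric)
  then have "summable (%n. \<Delta> n x)"
  proof (rule summable_comparison_test_ev[rotated])
   show "\<forall>\<^sub>F n in sequentially. norm (\<Delta> n x) <= 2 ^ n * (\<Delta> n x)^2 + (1/2) ^ n"
    using abs_prod_le_Young[of "2 ^ n" "\<Delta> n x" 1 for n] by (intro always_eventually allI) (simp add: power_divide)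
  qed
  then have "convergent (%n. \<Sum>i<n. \<Delta> i x)" by (simp add: summable_iff_convergent)
  then have "convergent (%n. h 0 x + (\<Sum>i<n. \<Delta> i x))" by (intro convergent_add convergent_const)
  moreover have "h 0 x + (\<Sum>i<n. \<Delta> i x) = h n x" for n
   unfolding \<Delta>_def by (induction n) auto
  ultimately show ?case by simp
 qed
 define G where "G x = lim (%n. h n x)" for x
 have Gm[measurable]: "G \<in> borel_measurable M"
  unfolding G_def[abs_def] by (rule borel_measurable_lim_metric) measurable
 have hG: "AE x in M. (%n. h n x) \<longlonglongrightarrow> G x"
  using conv by eventually_elim (simp add: G_def convergent_LIMSEQ_iff)
 have fatou: "(\<integral>\<^sup>+x. ennreal (indicator A x * (G x - b x)^2) \<partial>M) <= ennreal c"
  if A[measurable]: "A \<in> sets M" and b[measurable]: "b \<in> borel_measurable M"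
   and ev: "\<forall>\<^sub>F n in sequentially. (\<integral>\<^sup>+x. ennreal (indicator A x * (h n x - b x)^2) \<partial>M) <= ennreal c" for A b c
 proof -
  have "(\<integral>\<^sup>+x. ennreal (indicator A x * (G x - b x)^2) \<partial>M)
   = (\<integral>\<^sup>+x. liminf (%n. ennreal (indicator A x * (h n x - b x)^2)) \<partial>M)"
  proof (rule nn_integral_cong_AE)
   show "AE x in M. ennreal (indicator A x * (G x - b x)^2) = liminf (%n. ennreal (indicator A x * (h n x - b x)^2))"
    using hG
   proof eventually_elim
    case (elim x)
    have "(%n. ennreal (indicator A x * (h n x - b x)^2)) \<longlonglongrightarrow> ennreal (indicator A x * (G x - b x)^2)"
     by (intro tendsto_ennrealI tendsto_mult tendsto_const tendsto_power tendsto_diff elim)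
    from lim_imp_Liminf[OF _ this] show ?case by simp
   qed
  qed
  also have "... <= liminf (%n. \<integral>\<^sup>+x. ennreal (indicator A x * (h n x - b x)^2) \<partial>M)"
   by (rule nn_integral_liminf) measurable
  also have "... <= ennreal c"
   using ev by (intro Liminf_le) auto
  finally show ?thesis .
 qed
 have GH0: "(\<integral>\<^sup>+x. ennreal (indicator (space M) x * (G x - h k x)^2) \<partial>M) <= ennreal ((1/4) ^ k)" for k
 proof (rule fatou)
  show "\<forall>\<^sub>F n in sequentially. (\<integral>\<^sup>+x. ennreal (indicator (space M) x * (h n x - h k x)^2) \<partial>M) <= ennreal ((1/4) ^ k)"
   using eventually_ge_at_top[of k]
  proof eventually_elim
   case (elim n)
   have "(\<integral>\<^sup>+x. ennreal (indicator (space M) x * (h n x - h k x)^2) \<partial>M) = (\<integral>\<^sup>+x. ennreal ((h n x - h k x)^2) \<partial>M)"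
    by (intro nn_integral_cong) simp
   also have "... = ennreal (N (%x. h n x - h k x))"
    unfolding N_def by (rule nn_integral_eq_integral) (auto intro!: square_integrable_add(2) h2)
   also have "... <= ennreal ((1/4) ^ k)"
    unfolding h_def using elim rmono by (intro ennreal_leI r) (simp add: strict_mono_less_eq)
   finally show ?case .
  qed
 qed auto
 have GH: "(\<integral>\<^sup>+x. ennreal ((G x - h k x)^2) \<partial>M) <= ennreal ((1/4) ^ k)" for k
 proof -
  have "(\<integral>\<^sup>+x. ennreal ((G x - h k x)^2) \<partial>M) = (\<integral>\<^sup>+x. ennreal (indicator (space M) x * (G x - h k x)^2) \<partial>M)"
   by (intro nn_integral_cong) simp
  with GH0[of k] show ?thesis by simp
 qed
 have GHi: "integrable M (%x. (G x - h k x)^2)" for k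
  by (rule integrableI_bounded) (use GH[of k] in \<open>auto intro: le_less_trans\<close>)
 have GHN: "N (%x. G x - h k x) <= (1/4) ^ k" for k
  using GH[of k] GHi[of k] unfolding N_def by (subst (asm) nn_integral_eq_integral) auto
 have G2: "integrable M (%x. (G x)^2)"
  using square_integrable_add(1)[of "%x. G x - h 0 x" M "h 0"] GHi h2 by simp
 show ?thesis
 proof (rule that[OF Gm G2])
  fix \<phi> c assume \<phi>[measurable]: "\<phi> \<in> borel_measurable M" and \<phi>2: "integrable M (%x. (\<phi> x)^2)"
   and lim: "(%k. \<integral>x. f k x * \<phi> x \<partial>M) \<longlonglongrightarrow> c"
  have "\<bar>(\<integral>x. G x * \<phi> x \<partial>M) - c\<bar> <= 0 + \<epsilon>" if "\<epsilon> > 0" for \<epsilon>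
  proof -
   have "\<forall>\<^sub>F k in sequentially. dist (\<integral>x. f k x * \<phi> x \<partial>M) c < \<epsilon> / 3"
    using lim that by (intro tendstoD) auto
   then obtain k0 where k0: "!!j. j >= k0 ==> \<bar>(\<integral>x. f j x * \<phi> x \<partial>M) - c\<bar> <= \<epsilon> / 3"
    unfolding eventually_sequentially dist_real_def by (meson less_imp_le)
   have hull: "\<bar>(\<integral>x. b x * \<phi> x \<partial>M) - c\<bar> <= \<epsilon> / 3" if "b \<in> mid_hull f k" "k >= k0" for b k
    using that(1)
   proof induction
    case (base j) then show ?case using k0 that(2) by simp
   next
    case (mid b1 b2)
    note i1 = square_integrable_prod[OF mm[OF mid(1)] \<phi> mi[OF mid(1)] \<phi>2]
    note i2 = square_integrable_prod[OF mm[OF mid(2)] \<phi> mi[OF mid(2)] \<phi>2]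
    have "(\<integral>x. (b1 x + b2 x) / 2 * \<phi> x \<partial>M) = (\<integral>x. (b1 x * \<phi> x + b2 x * \<phi> x) / 2 \<partial>M)"
     by (simp add: algebra_simps add_divide_distrib)
    also have "... = ((\<integral>x. b1 x * \<phi> x \<partial>M) + (\<integral>x. b2 x * \<phi> x \<partial>M)) / 2" using i1 i2 by simp
    finally have e: "(\<integral>x. (b1 x + b2 x) / 2 * \<phi> x \<partial>M) = ((\<integral>x. b1 x * \<phi> x \<partial>M) + (\<integral>x. b2 x * \<phi> x \<partial>M)) / 2" .
    show ?case using mid.IH unfolding e by argo
   qed
   define t where "t = 3 * (N \<phi> + 1) / \<epsilon>"
   have t: "t > 0" using that N0[of \<phi>] by (simp add: t_def)
   have "(%k. t * (1/4) ^ k) \<longlonglongrightarrow> t * 0" by (intro tendsto_mult tendsto_const LIMSEQ_realpow_zero) auto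
   then have "\<forall>\<^sub>F k in sequentially. t * (1/4) ^ k < \<epsilon> / 3" using that by (intro order_tendstoD) auto
   then obtain k1 where k1: "!!k. k >= k1 ==> t * (1/4) ^ k < \<epsilon> / 3" unfolding eventually_sequentially by blast
   define k where "k = max k0 k1"
   have "\<bar>(\<integral>x. G x * \<phi> x \<partial>M) - (\<integral>x. h k x * \<phi> x \<partial>M)\<bar> = \<bar>\<integral>x. (G x - h k x) * \<phi> x \<partial>M\<bar>"
    using square_integrable_prod[OF Gm \<phi> G2 \<phi>2] square_integrable_prod[OF hm \<phi> h2 \<phi>2, of k]
    by (simp add: left_diff_distrib)
   also have "... <= (\<integral>x. \<bar>(G x - h k x) * \<phi> x\<bar> \<partial>M)" by (rule integral_abs_bound)
   also have "... <= (\<integral>x. t * (G x - h k x)^2 + (\<phi> x)^2 / t \<partial>M)"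
   proof (rule integral_mono)
    show "integrable M (%x. \<bar>(G x - h k x) * \<phi> x\<bar>)"
     by (intro integrable_abs square_integrable_prod \<phi>2 GHi) measurable
    show "\<bar>(G x - h k x) * \<phi> x\<bar> <= t * (G x - h k x)^2 + (\<phi> x)^2 / t" for x by (rule abs_prod_le_Young[OF t])
   qed (use GHi \<phi>2 in auto)
   also have "... = t * N (%x. G x - h k x) + N \<phi> / t" unfolding N_def using GHi \<phi>2 by simp
   also have "... <= t * (1/4) ^ k + \<epsilon> / 3"
   proof (intro add_mono mult_left_mono GHN)
    have "N \<phi> / t = \<epsilon> / 3 * (N \<phi> / (N \<phi> + 1))" unfolding t_def using that by (simp add: field_simps)
    also have "... <= \<epsilon> / 3 * 1" using that N0[of \<phi>] by (intro mult_left_mono) auto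
    finally show "N \<phi> / t <= \<epsilon> / 3" by simp
   qed (use t in auto)
   finally have "\<bar>(\<integral>x. G x * \<phi> x \<partial>M) - (\<integral>x. h k x * \<phi> x \<partial>M)\<bar> <= t * (1/4) ^ k + \<epsilon> / 3" .
   moreover have "t * (1/4) ^ k < \<epsilon> / 3" by (rule k1) (simp add: k_def)
   moreover have "\<bar>(\<integral>x. h k x * \<phi> x \<partial>M) - c\<bar> <= \<epsilon> / 3" by (rule hull[OF hh]) (simp add: k_def)
   ultimately show ?thesis by argo
  qed
  then have "\<bar>(\<integral>x. G x * \<phi> x \<partial>M) - c\<bar> <= 0" by (rule field_le_epsilon)
  then show "(\<integral>x. G x * \<phi> x \<partial>M) = c" by simp
 next
  fix A c assume A[measurable]: "A \<in> sets M"
   and ev: "\<forall>\<^sub>F k in sequentially. (\<integral>x. indicator A x * (f k x)^2 \<partial>M) <= c"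
  then obtain k0 where k0: "!!j. j >= k0 ==> (\<integral>x. indicator A x * (f j x)^2 \<partial>M) <= c"
   unfolding eventually_sequentially by blast
  have iA: "integrable M (%x. indicator A x * (b x)^2)" if "integrable M (%x. (b x)^2)" for b :: "'a => real"
   by (rule integrable_ind[OF that A])
  have hull: "(\<integral>x. indicator A x * (b x)^2 \<partial>M) <= c" if "b \<in> mid_hull f k" "k >= k0" for b k
   using that(1)
  proof induction
   case (base j) then show ?case using k0 that(2) by simp
  next
   case (mid b1 b2)
   note i1 = iA[OF mi[OF mid(1)]] and i2 = iA[OF mi[OF mid(2)]]
   have "(\<integral>x. indicator A x * ((b1 x + b2 x) / 2)^2 \<partial>M) <= (\<integral>x. (indicator A x * (b1 x)^2 + indicator A x * (b2 x)^2) / 2 \<partial>M)"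
   proof (rule integral_mono)
    show "integrable M (%x. indicator A x * ((b1 x + b2 x) / 2)^2)" by (rule iA[OF mi[OF mid_hull.mid[OF mid(1,2)]]])
    show "integrable M (%x. (indicator A x * (b1 x)^2 + indicator A x * (b2 x)^2) / 2)" using i1 i2 by simp
    show "indicator A x * ((b1 x + b2 x) / 2)^2 <= (indicator A x * (b1 x)^2 + indicator A x * (b2 x)^2) / 2" for x
    proof -
     have "0 <= (b1 x - b2 x)^2" by simp
     then have "((b1 x + b2 x) / 2)^2 <= ((b1 x)^2 + (b2 x)^2) / 2" by (simp add: power2_eq_square field_simps)
     then show ?thesis by (auto simp: indicator_def)
    qed
   qed
   also have "... = ((\<integral>x. indicator A x * (b1 x)^2 \<partial>M) + (\<integral>x. indicator A x * (b2 x)^2 \<partial>M)) / 2" using i1 i2 by simp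
   also have "... <= c" using mid.IH by simp
   finally show ?case .
  qed
  have c0: "c >= 0"
   by (rule order_trans[OF integral_nonneg k0[OF order_refl]]) simp
  have "(\<integral>\<^sup>+x. ennreal (indicator A x * (G x - 0)^2) \<partial>M) <= ennreal c"
  proof (rule fatou[OF A])
   show "\<forall>\<^sub>F n in sequentially. (\<integral>\<^sup>+x. ennreal (indicator A x * (h n x - 0)^2) \<partial>M) <= ennreal c"
    using eventually_ge_at_top[of k0]
   proof eventually_elim
    case (elim n)
    have "(\<integral>\<^sup>+x. ennreal (indicator A x * (h n x - 0)^2) \<partial>M) = ennreal (\<integral>x. indicator A x * (h n x)^2 \<partial>M)"
     by (simp, rule nn_integral_eq_integral) (auto intro!: iA h2)
    also have "... <= ennreal c" by (intro ennreal_leI hull[OF hh elim])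
    finally show ?case .
   qed
  qed simp
  also have "(\<integral>\<^sup>+x. ennreal (indicator A x * (G x - 0)^2) \<partial>M) = ennreal (\<integral>x. indicator A x * (G x)^2 \<partial>M)"
   by (simp, rule nn_integral_eq_integral) (auto intro!: iA G2)
  finally show "(\<integral>x. indicator A x * (G x)^2 \<partial>M) <= c" using c0 by simp
 qed
qed

section \<open>Third derivatives\<close>

lemma cutoff_nonneg: "0 <= cutoff x0 R x"
 unfolding cutoff_def by (intro zero_le_power bump_nonneg)

lemma cutoff_ge:
 assumes R: "R > 0" and x: "x \<in> ball x0 s" and s: "s <= \<theta> * R"
 shows "flat 0 (1 - \<theta>^2) ^ 4 <= cutoff x0 R x"
proof -
 have "norm (x - x0) <= \<theta> * R" using x s by (simp add: dist_norm norm_minus_commute)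
 then have n: "norm ((1 / R) *R (x - x0)) <= \<theta>"
  unfolding norm_scaleR using R by (simp add: field_simps)
 have "((1 / R) *R (x - x0)) \<bullet> ((1 / R) *R (x - x0)) <= \<theta>^2"
  unfolding power2_norm_eq_inner[symmetric] using n by (intro power_mono) auto
 then have "flat 0 (1 - \<theta>^2) <= bump ((1 / R) *R (x - x0))"
  unfolding bump_def flat_def by (auto simp: le_imp_inverse_le)
 then show ?thesis unfolding cutoff_def by (rule power_mono) (simp add: flat_def)
qed

text \<open>Difference quotients converge to the weak derivative when paired with test functions, so any weak \<open>L\<^sup>2\<close>
 limit of them is the weak derivative. Local bounds that hold eventually pass to the limit.\<close>

lemma wpd_square_integrable_limit:
 fixes v :: "real^'n::finite => real"
 assumes v: "integrable lborel v" "!!x. \<bar>v x\<bar> <= M"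
  and h: "!!k. h k > 0" "h \<longlonglongrightarrow> 0"
  and K: "\<forall>k. (LBINT x. in_ball x0 \<rho> x * ((v (x + h k *R axis m 1) - v x) / h k)^2) <= K"
 obtains G where "G \<in> borel_fns" "integrable lborel (%x. (G x)^2)" "!!x. x \<notin> ball x0 \<rho> ==> G x = 0"
  "wpd (ball x0 \<rho>) m v G"
  "!!A c. A \<in> sets borel ==> A \<subseteq> ball x0 \<rho> ==>
   \<forall>\<^sub>F k in sequentially. (LBINT x. indicator A x * ((v (x + h k *R axis m 1) - v x) / h k)^2) <= c ==>
   (LBINT x. indicator A x * (G x)^2) <= c"
proof -
 let ?B = "ball x0 \<rho>"
 let ?e = "%k. h k *R axis m (1::real) :: real^'n"
 have vm[measurable]: "v \<in> borel_fns" using borel_measurable_integrable[OF v(1)] by simp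
 define f where "f k x = indicator ?B x * ((v (x + ?e k) - v x) / h k)" for k x
 have fm: "f k \<in> borel_measurable lborel" for k
  unfolding f_def[abs_def]
  by (intro borel_measurable_times borel_measurable_indicator borel_measurable_divide borel_measurable_diff) measurable
 have fb: "\<bar>f k x\<bar> <= 2 * M / h k" for k x
 proof -
  have "\<bar>v (x + ?e k) - v x\<bar> <= 2 * M" using v(2)[of x] v(2)[of "x + ?e k"] by linarith
  moreover have "0 <= 2 * M" using v(2)[of x] by linarith
  ultimately show ?thesis using h(1)[of k] unfolding f_def by (auto simp: indicator_def divide_right_mono)
 qed
 have sq: "(f k x)^2 = indicator ?B x * ((v (x + ?e k) - v x) / h k)^2" for k x
  unfolding f_def by (simp add: indicator_def)
 have f2: "integrable lborel (%x. (f k x)^2)" for k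
 proof (rule integrable_bounded_ball[where a=x0 and R=\<rho> and M="(2 * M / h k)^2"])
  show "(%x. (f k x)^2) \<in> borel_fns" using fm[of k] by simp
  show "\<bar>(f k x)^2\<bar> <= (2 * M / h k)^2" for x
   using power_mono[OF fb, of k x 2] by simp
  show "(f k x)^2 = 0" if "x \<notin> cball x0 \<rho>" for x using that by (simp add: f_def indicator_def)
 qed
 have fK: "(LBINT x. (f k x)^2) <= K" for k unfolding sq using K by blast
 obtain G where G: "G \<in> borel_measurable lborel" "integrable lborel (%x. (G x)^2)"
  "!!\<phi> c. \<phi> \<in> borel_measurable lborel ==> integrable lborel (%x. (\<phi> x)^2) ==>
   (%k. LBINT x. f k x * \<phi> x) \<longlonglongrightarrow> c ==> (LBINT x. G x * \<phi> x) = c"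
  "!!A c. A \<in> sets lborel ==> \<forall>\<^sub>F k in sequentially. (LBINT x. indicator A x * (f k x)^2) <= c ==>
   (LBINT x. indicator A x * (G x)^2) <= c"
  by (rule L2_weak_limit[OF fm f2 fK]) (rule that)
 define G' where "G' x = indicator ?B x * G x" for x
 show ?thesis
 proof (rule that[of G'])
  show "G' \<in> borel_fns"
   unfolding G'_def using G(1) by (intro borel_measurable_times borel_measurable_indicator) simp_all
  have "(G' x)^2 = indicator ?B x * (G x)^2" for x by (simp add: G'_def indicator_def)
  then show "integrable lborel (%x. (G' x)^2)" by (simp add: integrable_ind[OF G(2)])
  show "G' x = 0" if "x \<notin> ball x0 \<rho>" for x using that by (simp add: G'_def)
 next
  fix A c assume A: "A \<in> sets borel" "A \<subseteq> ball x0 \<rho>"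
   and ev: "\<forall>\<^sub>F k in sequentially. (LBINT x. indicator A x * ((v (x + ?e k) - v x) / h k)^2) <= c"
  have 1: "indicator A x * (f k x)^2 = indicator A x * ((v (x + ?e k) - v x) / h k)^2" for k x
   unfolding sq using A(2) by (auto simp: indicator_def)
  have 2: "indicator A x * (G' x)^2 = indicator A x * (G x)^2" for x
   unfolding G'_def using A(2) by (auto simp: indicator_def)
  show "(LBINT x. indicator A x * (G' x)^2) <= c"
   unfolding 2 by (rule G(4)) (use A ev in \<open>simp_all add: 1\<close>)
 next
  show "wpd (ball x0 \<rho>) m v G'"
   unfolding wpd_def
  proof
   fix \<phi> assume \<phi>: "\<phi> \<in> test_functions ?B"
   note s\<phi> = test_functionsD(1)[OF \<phi>]
   have [measurable]: "\<phi> \<in> borel_fns" by (rule test_functions_borel[OF \<phi>])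
   have \<phi>0: "\<phi> x = 0" if "x \<notin> ?B" for x
    using that test_functionsD(3)[OF \<phi>] closure_subset[of "{x. \<phi> x ~= 0}"] by blast
   obtain N where N: "N >= 0" "!!x. \<bar>\<phi> x\<bar> <= N" by (rule test_functions_bounded[OF \<phi>]) (rule that)
   obtain N1 where N1: "N1 >= 0" "!!x. \<bar>pd m \<phi> x\<bar> <= N1"
    by (rule test_functions_bounded[OF test_functions_dd[OF \<phi>]]) (rule that)
   have \<phi>2: "integrable lborel (%x. (\<phi> x)^2)"
    unfolding power2_eq_square by (rule integrable_mult_test[OF integrable_test[OF \<phi>] \<phi>])
   have eq: "(LBINT x. f k x * \<phi> x) = (LBINT x. v x * ((\<phi> (x + (- h k) *R axis m 1) - \<phi> x) / h k))" for k
   proof -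
    have t: "(%x. \<phi> (x - ?e k)) \<in> test_functions UNIV"
     by (rule test_translate(1)[OF \<phi>]) simp
    have "(LBINT x. f k x * \<phi> x) = (LBINT x. (v (x + ?e k) - v x) / h k * \<phi> x)"
     unfolding f_def using \<phi>0 by (intro integral_cong refl) (auto simp: indicator_def)
    also have "... = ((LBINT x. v x * \<phi> (x - ?e k)) - (LBINT x. v x * \<phi> x)) / h k"
     by (rule diffquot_shift[OF v(1) \<phi>])
    also have "... = (LBINT x. (v x * \<phi> (x - ?e k) - v x * \<phi> x) / h k)"
     by (simp add: integral_diff[OF integrable_mult_test[OF v(1) t] integrable_mult_test[OF v(1) \<phi>]])
    finally show ?thesis by (simp add: algebra_simps diff_divide_distrib)
   qed
   have "(%k. LBINT x. v x * ((\<phi> (x + (- h k) *R axis m 1) - \<phi> x) / h k)) \<longlonglongrightarrow> (LBINT x. v x * (- pd m \<phi> x))"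
   proof (rule integral_dominated_convergence[where w="%x. N1 * \<bar>v x\<bar>"])
    have lim: "(%k. (\<phi> (x + (- h k) *R axis m 1) - \<phi> x) / h k) \<longlonglongrightarrow> - pd m \<phi> x" for x
    proof -
     have "- h k ~= 0" for k using h(1)[of k] by simp
     then have "filterlim (%k. - h k) (at 0) sequentially"
      using tendsto_minus[OF h(2)] by (intro filterlim_atI always_eventually allI) simp_all
     moreover have "((%t. (\<phi> (x + t *R axis m 1) - \<phi> x) / t) \<longlongrightarrow> pd m \<phi> x) (at 0)"
      using smooth_DERIV[OF s\<phi>, of x "axis m 1"] unfolding DERIV_def by simp
     ultimately have "(%k. (\<phi> (x + (- h k) *R axis m 1) - \<phi> x) / (- h k)) \<longlonglongrightarrow> pd m \<phi> x"
      by (rule filterlim_compose[rotated])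
     from tendsto_minus[OF this] show ?thesis by simp
    qed
    show "AE x in lborel. (%k. v x * ((\<phi> (x + (- h k) *R axis m 1) - \<phi> x) / h k)) \<longlonglongrightarrow> v x * (- pd m \<phi> x)"
     by (intro AE_I2 tendsto_mult tendsto_const lim)
    have "\<bar>(\<phi> (x + (- h k) *R axis m 1) - \<phi> x) / h k\<bar> <= N1" for x k
     using smooth_difference_bound[OF s\<phi> N1(2), where x=x and t="- h k"] h(1)[of k]
     by (simp add: pos_divide_le_eq)
    then have "\<bar>v x\<bar> * \<bar>(\<phi> (x + (- h k) *R axis m 1) - \<phi> x) / h k\<bar> <= \<bar>v x\<bar> * N1" for x k
     by (intro mult_left_mono) auto
    then show "AE x in lborel. norm (v x * ((\<phi> (x + (- h k) *R axis m 1) - \<phi> x) / h k)) <= N1 * \<bar>v x\<bar>" for k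
     unfolding real_norm_def abs_mult by (intro AE_I2) (simp add: mult.commute)
    have [measurable]: "pd m \<phi> \<in> borel_fns" by (rule test_functions_borel[OF test_functions_dd[OF \<phi>]])
    show "(%x. v x * (- pd m \<phi> x)) \<in> borel_measurable lborel" by measurable
   qed (use v(1) in auto)
   then have "(%k. LBINT x. f k x * \<phi> x) \<longlonglongrightarrow> (LBINT x. v x * (- pd m \<phi> x))" unfolding eq .
   from G(3)[OF _ \<phi>2 this] have "(LBINT x. G x * \<phi> x) = - (LBINT x. v x * pd m \<phi> x)" by simp
   moreover have "(LBINT x. G x * \<phi> x) = (LBINT x. G' x * \<phi> x)"
    unfolding G'_def using \<phi>0 by (intro integral_cong refl) (auto simp: indicator_def)
   ultimately show "(LBINT x. v x * pd m \<phi> x) = - (LBINT x. G' x * \<phi> x)" by simp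
  qed
 qed
qed

text \<open>The Caccioppoli inequality bounds the difference quotients of the Hessian in \<open>L^2\<close>, locally and
 uniformly in the step; in the limit it becomes a bound on third derivatives.\<close>

lemma third_derivatives:
 assumes \<Lambda>: "\<Lambda> > 0" and L: "L >= 0"
 obtains C and C' :: "real => real" where "C >= 0" "!!\<rho>. C' \<rho> >= 0"
  "!!(u :: real^'n::finite => real) p v W M \<rho>.
  double_divergence u p v W M \<Lambda> L ==> 0 < \<rho> ==> \<rho> < 1 ==>
  \<exists>G. \<forall>m i j. G m i j \<in> borel_fns \<and> integrable lborel (%x. (G m i j x)^2)
   \<and> (\<forall>x. x \<notin> ball 0 \<rho> --> G m i j x = 0) \<and> wpd (ball 0 \<rho>) m (v i j) (G m i j)
   \<and> (LBINT x. (G m i j x)^2) <= C' \<rho> * ((\<Sum>i\<in>UNIV. LBINT x. (v i m x)^2) + (LBINT x. (p m x)^2))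
   \<and> (\<forall>x0 r a c. r > 0 --> ball x0 (3 * r) \<subseteq> ball 0 \<rho> -->
     (LBINT x. in_ball x0 r x * (G m i j x)^2)
     <= C * ((\<Sum>i\<in>UNIV. LBINT x. in_ball x0 (3 * r) x * (v i m x - a $ i)^2) / r^2
      + (LBINT x. in_ball x0 (3 * r) x * (p m x - (a \<bullet> x + c))^2) / r ^ 4))"
proof -
 obtain C0 where C0: "C0 >= 0" "!!(u :: real^'n::finite => real) p v W M x0 R R' h m a c.
  double_divergence u p v W M \<Lambda> L ==> R > 0 ==> h > 0 ==> ball x0 R' \<subseteq> ball 0 1 ==> R + h < R' ==>
  (LBINT x. cutoff x0 R x * (\<Sum>i\<in>UNIV. \<Sum>j\<in>UNIV. ((v i j (x + h *R axis m 1) - v i j x) / h)^2))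
  <= C0 * ((\<Sum>i\<in>UNIV. LBINT x. in_ball x0 (R + h) x * (v i m x - a $ i)^2) / R^2
    + (LBINT x. in_ball x0 (R + h) x * (p m x - (a \<bullet> x + c))^2) / R ^ 4)"
  by (rule caccioppoli_diffquot[OF \<Lambda> L]) (rule that)
 \<comment> \<open>the value of the cut-off at relative radius \<open>\<theta>\<close>, a lower bound inside\<close>
 define \<kappa> where "\<kappa> \<theta> = flat 0 (1 - \<theta>^2) ^ 4" for \<theta> :: real
 have \<kappa>0: "\<kappa> \<theta> >= 0" for \<theta> by (simp add: \<kappa>_def flat_def)
 have \<kappa>: "\<kappa> \<theta> > 0" if "0 <= \<theta>" "\<theta> < 1" for \<theta>
 proof -
  have "\<theta>^2 < 1" using that by (simp add: abs_square_less_1)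
  then show ?thesis by (simp add: \<kappa>_def flat_def)
 qed
 define R1 where "R1 \<rho> = (1 + \<rho>) / 2" for \<rho> :: real
 define C' where "C' \<rho> = C0 / \<kappa> (\<rho> / R1 \<rho>) * (1 / (R1 \<rho>)^2 + 1 / (R1 \<rho>) ^ 4)" for \<rho>
 define C where "C = C0 / \<kappa> (1 / 2)"
 show ?thesis
 proof (rule that[of C C'])
  show "C >= 0" unfolding C_def using C0(1) \<kappa>0 by simp
  show "C' \<rho> >= 0" for \<rho> unfolding C'_def using C0(1) \<kappa>0 by simp
  fix u :: "real^'n => real" and p v W M \<rho>
  assume dd: "double_divergence u p v W M \<Lambda> L" and \<rho>: "0 < \<rho>" "\<rho> < (1::real)"
  interpret double_divergence u p v W M \<Lambda> L by (rule dd)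
  have R1: "R1 \<rho> > 0" "\<rho> < R1 \<rho>" "R1 \<rho> < 1" using \<rho> by (auto simp: R1_def)
  define h where "h k = (1 - R1 \<rho>) / real (k + 2)" for k
  have h: "!!k. h k > 0" "!!k. h k < 1 - R1 \<rho>" "h \<longlonglongrightarrow> 0"
   unfolding h_def using R1 by (intro harmonic_fractions; simp)+
  define dq where "dq m i j k x = (v i j (x + h k *R axis m 1) - v i j x) / h k" for m i j k x
  have sqv: "integrable lborel (%x. (v i j x)^2)" "integrable lborel (%x. (p i x)^2)" for i j
   unfolding power2_eq_square
   by (rule integrable_mult_bounded[OF integrable_all(3) _ bound(3)], simp add: borel,
     rule integrable_mult_bounded[OF integrable_all(2) _ bound(2)], simp add: borel)
  have local: "(LBINT x. in_ball x0 s x * (dq m i j k x)^2)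
   <= C0 / \<kappa> \<theta> * ((\<Sum>i\<in>UNIV. LBINT x. in_ball x0 R' x * (v i m x - a $ i)^2) / R^2
    + (LBINT x. in_ball x0 R' x * (p m x - (a \<bullet> x + c))^2) / R ^ 4)"
   if R: "R > 0" "ball x0 R' \<subseteq> ball 0 1" "R + h k < R'" and s: "s <= \<theta> * R" "0 <= \<theta>" "\<theta> < 1"
   for x0 s m i j k R R' a c \<theta>
  proof -
   let ?S = "%x. \<Sum>i\<in>UNIV. \<Sum>j\<in>UNIV. (dq m i j k x)^2"
   note \<kappa>p = \<kappa>[OF s(2,3)]
   have dqm: "dq m i j k \<in> borel_fns" for i j
    unfolding dq_def[abs_def] using borel(3) by measurable
   have dqi: "integrable lborel (dq m i j k)" for i j
    unfolding dq_def using lborel_integrable_translate(1)[OF integrable_all(3)] integrable_all(3) by simp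
   have dqb: "\<bar>dq m i j k x\<bar> <= 2 * M / h k" for i j x
    unfolding dq_def using bound(3)[of i j x] bound(3)[of i j "x + h k *R axis m 1"] h(1)[of k]
    by (simp add: divide_right_mono)
   have dq2: "integrable lborel (%x. (dq m i j k x)^2)" for i j
    unfolding power2_eq_square by (rule integrable_mult_bounded[OF dqi _ dqb]) (simp add: dqm)
   have ct: "cutoff x0 R \<in> test_functions UNIV" by (rule cutoff_test[OF R(1)]) simp
   have Si: "integrable lborel (%x. cutoff x0 R x * ?S x)"
   proof -
    have "integrable lborel (%x. ?S x * cutoff x0 R x)"
     by (intro integrable_mult_test[OF _ ct] integrable_sum dq2)
    then show ?thesis by (simp add: mult.commute)
   qed
   have vi: "integrable lborel (%x. in_ball x0 r x * (v i m x - b)^2)" for i r b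
   proof (rule integrable_bounded_ball[where a=x0 and R=r and M="(M + \<bar>b\<bar>)^2"])
    have "\<bar>v i m x - b\<bar>^2 <= (M + \<bar>b\<bar>)^2" for x using bound(3)[of i m x] by (intro power_mono) linarith+
    then show "\<bar>in_ball x0 r x * (v i m x - b)^2\<bar> <= (M + \<bar>b\<bar>)^2" for x by (auto simp: indicator_def)
    show "in_ball x0 r x * (v i m x - b)^2 = 0" if "x \<notin> cball x0 r" for x
     using that by (auto simp: indicator_def)
   qed (use borel(3)[of i m] in \<open>intro borel_measurable_times borel_measurable_indicator borel_measurable_power borel_measurable_diff; simp\<close>)
   have pi: "integrable lborel (%x. in_ball x0 r x * (p m x - (a \<bullet> x + c))^2)" for r
   proof -
    have 1: "integrable lborel (%x. in_ball x0 r x * ((p m x)^2))" by (intro integrable_ind sqv) simp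
    have lc: "continuous_on UNIV (%x. (a \<bullet> x + c))" by (intro continuous_intros)
    have 2: "integrable lborel (%x. in_ball x0 r x * (a \<bullet> x + c)^2)"
     by (intro integrable_ind_continuous continuous_intros)
    have 3: "integrable lborel (%x. (in_ball x0 r x * (a \<bullet> x + c)) * p m x)"
     by (rule integrable_mult_bounded[OF integrable_ind_continuous[OF lc] _ bound(2)]) (simp add: borel)
    have "integrable lborel (%x. in_ball x0 r x * ((p m x)^2)
     - 2 * ((in_ball x0 r x * (a \<bullet> x + c)) * p m x) + in_ball x0 r x * (a \<bullet> x + c)^2)"
     by (intro integrable_add integrable_diff integrable_mult_right 1 2 3)
    then show ?thesis by (simp add: power2_eq_square algebra_simps)
   qed
   have "\<kappa> \<theta> * (LBINT x. in_ball x0 s x * (dq m i j k x)^2)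
    = (LBINT x. \<kappa> \<theta> * (in_ball x0 s x * (dq m i j k x)^2))" by simp
   also have "... <= (LBINT x. cutoff x0 R x * ?S x)"
   proof (rule integral_mono)
    show "integrable lborel (%x. \<kappa> \<theta> * (in_ball x0 s x * (dq m i j k x)^2))"
     by (intro integrable_mult_right integrable_ind dq2) simp
    show "\<kappa> \<theta> * (in_ball x0 s x * (dq m i j k x)^2) <= cutoff x0 R x * ?S x" for x
    proof (cases "x \<in> ball x0 s")
     case True
     have "(dq m i j k x)^2 <= (\<Sum>j\<in>UNIV. (dq m i j k x)^2)" by (rule member_le_sum) auto
     also have "... <= ?S x"
      by (rule member_le_sum[of i UNIV "%i. \<Sum>j\<in>UNIV. (dq m i j k x)^2"]) (auto intro: sum_nonneg)
     finally have "\<kappa> \<theta> * (dq m i j k x)^2 <= cutoff x0 R x * ?S x"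
      using cutoff_ge[OF R(1) True s(1)] cutoff_nonneg unfolding \<kappa>_def by (intro mult_mono) auto
     then show ?thesis using True by simp
    next
     case False
     then show ?thesis using cutoff_nonneg[of x0 R x] by (auto intro!: mult_nonneg_nonneg sum_nonneg)
    qed
   qed (rule Si)
   also have "... <= C0 * ((\<Sum>i\<in>UNIV. LBINT x. in_ball x0 (R + h k) x * (v i m x - a $ i)^2) / R^2
    + (LBINT x. in_ball x0 (R + h k) x * (p m x - (a \<bullet> x + c))^2) / R ^ 4)"
    unfolding dq_def by (rule C0(2)[OF dd R(1) h(1) R(2,3)])
   also have "... <= C0 * ((\<Sum>i\<in>UNIV. LBINT x. in_ball x0 R' x * (v i m x - a $ i)^2) / R^2
    + (LBINT x. in_ball x0 R' x * (p m x - (a \<bullet> x + c))^2) / R ^ 4)"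
   proof (intro mult_left_mono[OF _ C0(1)] add_mono divide_right_mono sum_mono integral_mono vi pi)
    have "ball x0 (R + h k) \<subseteq> ball x0 R'" using R(3) by (intro subset_ball) simp
    then have ii: "in_ball x0 (R + h k) x <= (in_ball x0 R' x :: real)" for x
     by (auto simp: indicator_def)
    show "in_ball x0 (R + h k) x * (v i m x - a $ i)^2 <= in_ball x0 R' x * (v i m x - a $ i)^2" for i x
     by (intro mult_right_mono ii) simp
    show "in_ball x0 (R + h k) x * (p m x - (a \<bullet> x + c))^2 <= in_ball x0 R' x * (p m x - (a \<bullet> x + c))^2" for x
     by (intro mult_right_mono ii) simp
   qed auto
   finally show ?thesis using \<kappa>p by (simp add: field_simps)
  qed
  have glob: "(LBINT x. in_ball 0 \<rho> x * (dq m i j k x)^2)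
   <= C' \<rho> * ((\<Sum>i\<in>UNIV. LBINT x. (v i m x)^2) + (LBINT x. (p m x)^2))" for m i j k
  proof -
   have ind: "in_ball 0 1 x * (v i m x)^2 = (v i m x)^2" "in_ball 0 1 x * (p m x)^2 = (p m x)^2" for i x
    using outside(3)[of x i m] outside(2)[of x m] by (auto simp: indicator_def)
   define A where "A = (\<Sum>i\<in>UNIV. LBINT x. (v i m x)^2)"
   define B where "B = (LBINT x. (p m x)^2)"
   have AB: "A >= 0" "B >= 0" unfolding A_def B_def by (auto intro!: sum_nonneg)
   have "(LBINT x. in_ball 0 \<rho> x * (dq m i j k x)^2) <= C0 / \<kappa> (\<rho> / R1 \<rho>) *
    ((\<Sum>i\<in>UNIV. LBINT x. in_ball 0 1 x * (v i m x - (0::real^'n) $ i)^2) / (R1 \<rho>)^2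
    + (LBINT x. in_ball 0 1 x * (p m x - (0 \<bullet> x + 0))^2) / (R1 \<rho>) ^ 4)"
    by (rule local) (use R1 h(2)[of k] \<rho> in auto)
   also have "... = C0 / \<kappa> (\<rho> / R1 \<rho>) * (A / (R1 \<rho>)^2 + B / (R1 \<rho>) ^ 4)"
    by (simp add: ind A_def B_def)
   also have "... <= C0 / \<kappa> (\<rho> / R1 \<rho>) * ((1 / (R1 \<rho>)^2 + 1 / (R1 \<rho>) ^ 4) * (A + B))"
    using C0(1) \<kappa>0 AB R1(1) by (intro mult_left_mono) (auto simp: algebra_simps intro!: add_mono divide_right_mono)
   finally show ?thesis by (simp add: C'_def A_def B_def mult.assoc)
  qed
  have "\<exists>G. G \<in> borel_fns \<and> integrable lborel (%x. (G x)^2)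
   \<and> (\<forall>x. x \<notin> ball 0 \<rho> --> G x = 0) \<and> wpd (ball 0 \<rho>) m (v i j) G
   \<and> (LBINT x. (G x)^2) <= C' \<rho> * ((\<Sum>i\<in>UNIV. LBINT x. (v i m x)^2) + (LBINT x. (p m x)^2))
   \<and> (\<forall>x0 r a c. r > 0 --> ball x0 (3 * r) \<subseteq> ball 0 \<rho> -->
     (LBINT x. in_ball x0 r x * (G x)^2)
     <= C * ((\<Sum>i\<in>UNIV. LBINT x. in_ball x0 (3 * r) x * (v i m x - a $ i)^2) / r^2
      + (LBINT x. in_ball x0 (3 * r) x * (p m x - (a \<bullet> x + c))^2) / r ^ 4))" (is "\<exists>G. ?P G") for m i j
  proof -
   let ?K = "C' \<rho> * ((\<Sum>i\<in>UNIV. LBINT x. (v i m x)^2) + (LBINT x. (p m x)^2))"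
   have K: "\<forall>k. (LBINT x. in_ball 0 \<rho> x * ((v i j (x + h k *R axis m 1) - v i j x) / h k)^2) <= ?K"
    using glob unfolding dq_def by blast
   obtain G where G: "G \<in> borel_fns" "integrable lborel (%x. (G x)^2)" "!!x. x \<notin> ball 0 \<rho> ==> G x = 0"
    "wpd (ball 0 \<rho>) m (v i j) G"
    "!!A c. A \<in> sets borel ==> A \<subseteq> ball 0 \<rho> ==>
     \<forall>\<^sub>F k in sequentially. (LBINT x. indicator A x * ((v i j (x + h k *R axis m 1) - v i j x) / h k)^2) <= c ==>
     (LBINT x. indicator A x * (G x)^2) <= c"
    by (rule wpd_square_integrable_limit[OF integrable_all(3) bound(3) h(1) h(3) K]) (rule that)
   have "?P G"
   proof (intro conjI allI impI)
    show "G \<in> borel_fns" "integrable lborel (%x. (G x)^2)" "wpd (ball 0 \<rho>) m (v i j) G" by (rule G)+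
    show "G x = 0" if "x \<notin> ball 0 \<rho>" for x by (rule G(3)[OF that])
    have "(LBINT x. in_ball 0 \<rho> x * (G x)^2) <= ?K"
     by (rule G(5)) (use K in auto)
    moreover have "in_ball 0 \<rho> x * (G x)^2 = (G x)^2" for x using G(3)[of x] by (auto simp: indicator_def)
    ultimately show "(LBINT x. (G x)^2) <= ?K" by simp
    fix x0 :: "real^'n" and r :: real and a :: "real^'n" and c
    assume r: "r > 0" and sub: "ball x0 (3 * r) \<subseteq> ball 0 \<rho>"
    define X where "X = (\<Sum>i\<in>UNIV. LBINT x. in_ball x0 (3 * r) x * (v i m x - a $ i)^2)"
    define Y where "Y = (LBINT x. in_ball x0 (3 * r) x * (p m x - (a \<bullet> x + c))^2)"
    have XY: "X >= 0" "Y >= 0" unfolding X_def Y_def by (auto intro!: sum_nonneg integral_nonneg)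
    have "ball (0::real^'n) \<rho> \<subseteq> ball 0 1" using \<rho> by (intro subset_ball) simp
    then have sub1: "ball x0 (3 * r) \<subseteq> ball 0 1" using sub by blast
    have "(LBINT x. in_ball x0 r x * (G x)^2) <= C0 / \<kappa> (1 / 2) * (X / (2 * r)^2 + Y / (2 * r) ^ 4)"
    proof (rule G(5))
     have "ball x0 r \<subseteq> ball x0 (3 * r)" using r by (intro subset_ball) simp
     then show "ball x0 r \<subseteq> ball 0 \<rho>" using sub by blast
     have "\<forall>\<^sub>F k in sequentially. h k < r" using h(3) r by (intro order_tendstoD) auto
     then show "\<forall>\<^sub>F k in sequentially. (LBINT x. in_ball x0 r x * ((v i j (x + h k *R axis m 1) - v i j x) / h k)^2)
      <= C0 / \<kappa> (1 / 2) * (X / (2 * r)^2 + Y / (2 * r) ^ 4)"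
     proof eventually_elim
      case (elim k)
      show ?case unfolding dq_def[symmetric] X_def Y_def
       by (rule local) (use r elim sub1 in auto)
     qed
    qed simp
    also have "... <= C * (X / r^2 + Y / r ^ 4)"
     unfolding C_def using XY r C0(1) \<kappa>0
     by (intro mult_left_mono add_mono divide_left_mono) (auto simp: power_mult_distrib)
    finally show "(LBINT x. in_ball x0 r x * (G x)^2) <= C * (X / r^2 + Y / r ^ 4)" .
   qed
   then show ?thesis by blast
  qed
  note ex = this
  show "\<exists>G. \<forall>m i j. G m i j \<in> borel_fns \<and> integrable lborel (%x. (G m i j x)^2)
   \<and> (\<forall>x. x \<notin> ball 0 \<rho> --> G m i j x = 0) \<and> wpd (ball 0 \<rho>) m (v i j) (G m i j)
   \<and> (LBINT x. (G m i j x)^2) <= C' \<rho> * ((\<Sum>i\<in>UNIV. LBINT x. (v i m x)^2) + (LBINT x. (p m x)^2))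
   \<and> (\<forall>x0 r a c. r > 0 --> ball x0 (3 * r) \<subseteq> ball 0 \<rho> -->
     (LBINT x. in_ball x0 r x * (G m i j x)^2)
     <= C * ((\<Sum>i\<in>UNIV. LBINT x. in_ball x0 (3 * r) x * (v i m x - a $ i)^2) / r^2
      + (LBINT x. in_ball x0 (3 * r) x * (p m x - (a \<bullet> x + c))^2) / r ^ 4))"
   by (intro exI allI) (rule someI_ex[OF ex])
 qed
qed

section \<open>Linearity of directional derivatives\<close>

lemma smooth_on_DERIV:
 assumes "smooth_on V U f" "x \<in> U" "v \<in> V" "set vs \<subseteq> V"
 shows "((%t. dderivs vs f (x + t *R v)) has_field_derivative dderivs (v # vs) f x) (at 0)"
 using assms unfolding smooth_on_def dderivs.simps
 by (blast intro: field_differentiable_derivI[of _ "0::real", THEN DERIV_cong])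

lemma smooth_on_DERIV_at:
 assumes "smooth_on V U f" "x + s *R v \<in> U" "v \<in> V" "set vs \<subseteq> V"
 shows "((%t. dderivs vs f (x + t *R v)) has_field_derivative dderivs (v # vs) f (x + s *R v)) (at s)"
proof -
 have "((%t. dderivs vs f ((x + s *R v) + t *R v)) has_field_derivative dderivs (v # vs) f (x + s *R v)) (at (s + - s))"
  using smooth_on_DERIV[OF assms] by simp
 then show ?thesis
  unfolding DERIV_shift by (simp add: algebra_simps)
qed

lemma dd_scale:
 assumes "((%t. f (x + t *R a)) has_field_derivative dd a f x) (at 0)"
 shows "dd (c *R a) f x = c * dd a f x"
proof -
 have "((%t. f (x + (t * c) *R a)) has_field_derivative dd a f x * c) (at 0)"
  by (rule DERIV_chain2[of "%t. f (x + t *R a)"]) (use assms in \<open>auto intro!: derivative_eq_intros\<close>)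
 then have "((%t. f (x + t *R (c *R a))) has_field_derivative dd a f x * c) (at 0)" by simp
 then show ?thesis by (simp add: dderivs.simps DERIV_imp_deriv)
qed

text \<open>Directional derivatives that exist in all directions of a subspace and are continuous depend
 linearly on the direction.\<close>

lemma dd_add_direction:
 fixes f :: "'a::real_normed_vector => real"
 assumes sm: "smooth_on V U f" and V: "subspace V" and U: "openin (top_of_set V) U"
  and x: "x \<in> U" and a: "a \<in> V" and b: "b \<in> V"
 shows "dd (a + b) f x = dd a f x + dd b f x"
proof -
 obtain T where T: "open T" "U = V \<inter> T" using U by (auto simp: openin_open)
 have cont: "continuous_on U (dd b f)" using sm b unfolding smooth_on_def by auto
 have "((%t. (f (x + t *R (a + b)) - f (x + t *R a)) / t) \<longlongrightarrow> dd b f x) (at 0)"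
 proof (rule LIM_I)
  fix \<epsilon> :: real assume \<epsilon>: "\<epsilon> > 0"
  obtain d1 where d1: "d1 > 0" "!!y. y \<in> U ==> dist y x < d1 ==> \<bar>dd b f y - dd b f x\<bar> < \<epsilon>"
   using cont x \<epsilon> unfolding continuous_on_iff dist_real_def by blast
  obtain d2 where d2: "d2 > 0" "ball x d2 \<subseteq> T" using T x by (meson IntD2 openE)
  define d where "d = min d1 d2 / (norm a + norm b + 1)"
  have n: "norm a + norm b + 1 > 0" using norm_ge_zero[of a] norm_ge_zero[of b] by linarith
  have d: "d > 0" unfolding d_def using d1(1) d2(1) n by simp
  have close: "x + t *R a + s *R b \<in> U \<and> dist (x + t *R a + s *R b) x < d1" if "\<bar>t\<bar> < d" "\<bar>s\<bar> <= \<bar>t\<bar>" for s t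
  proof -
   have "norm (t *R a + s *R b) <= \<bar>t\<bar> * norm a + \<bar>s\<bar> * norm b"
    using norm_triangle_ineq[of "t *R a" "s *R b"] by simp
   also have "... <= \<bar>t\<bar> * (norm a + norm b + 1)"
    using mult_right_mono[OF that(2) norm_ge_zero[of b]] by (simp add: algebra_simps)
   also have "... < d * (norm a + norm b + 1)" using that(1) n by (intro mult_strict_right_mono)
   also have "... = min d1 d2" unfolding d_def using n by simp
   finally have *: "norm (t *R a + s *R b) < min d1 d2" .
   have "x + t *R a + s *R b \<in> V" using x T(2) a b V by (auto intro!: subspace_add subspace_scale)
   moreover have dist: "dist (x + t *R a + s *R b) x < min d1 d2" using * by (simp add: dist_norm add.assoc)
   then have "x + t *R a + s *R b \<in> T" using d2(2) by (auto simp: dist_commute)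
   ultimately show ?thesis using dist T(2) by simp
  qed
  show "\<exists>d>0. \<forall>t. t ~= 0 \<and> norm (t - 0) < d -->
    norm ((f (x + t *R (a + b)) - f (x + t *R a)) / t - dd b f x) < \<epsilon>"
  proof (intro exI[of _ d] conjI d allI impI)
   fix t :: real assume "t ~= 0 \<and> norm (t - 0) < d"
   then have t: "t ~= 0" "\<bar>t\<bar> < d" by auto
   have D: "((%s. f ((x + t *R a) + s *R b)) has_field_derivative dd b f ((x + t *R a) + s *R b)) (at s)" if "\<bar>s\<bar> <= \<bar>t\<bar>" for s
    using smooth_on_DERIV_at[OF sm _ b, of "x + t *R a" s "[]"] close[OF t(2) that] by simp
   have "\<exists>s. \<bar>s\<bar> <= \<bar>t\<bar> \<and> f ((x + t *R a) + t *R b) - f (x + t *R a) = t * dd b f ((x + t *R a) + s *R b)"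
   proof (cases "t > 0")
    case True
    obtain s where "0 < s" "s < t" "f ((x + t *R a) + t *R b) - f ((x + t *R a) + 0 *R b) = (t - 0) * dd b f ((x + t *R a) + s *R b)"
     using MVT2[OF True, of "%s. f ((x + t *R a) + s *R b)" "%s. dd b f ((x + t *R a) + s *R b)"] D by auto
    then show ?thesis by (intro exI[of _ s]) auto
   next
    case False
    then have "t < 0" using t by simp
    then obtain s where "t < s" "s < 0" "f ((x + t *R a) + 0 *R b) - f ((x + t *R a) + t *R b) = (0 - t) * dd b f ((x + t *R a) + s *R b)"
     using MVT2[of t 0 "%s. f ((x + t *R a) + s *R b)" "%s. dd b f ((x + t *R a) + s *R b)"] D by auto
    then show ?thesis by (intro exI[of _ s]) (auto simp: algebra_simps)
   qed
   then obtain s where s: "\<bar>s\<bar> <= \<bar>t\<bar>" "f ((x + t *R a) + t *R b) - f (x + t *R a) = t * dd b f ((x + t *R a) + s *R b)"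
    by blast
   have "(f (x + t *R (a + b)) - f (x + t *R a)) / t = dd b f ((x + t *R a) + s *R b)"
    using s(2) t(1) by (simp add: algebra_simps)
   then show "norm ((f (x + t *R (a + b)) - f (x + t *R a)) / t - dd b f x) < \<epsilon>"
    using d1(2) close[OF t(2) s(1)] by simp
  qed
 qed
 moreover have "((%t. (f (x + t *R a) - f x) / t) \<longlongrightarrow> dd a f x) (at 0)"
  using smooth_on_DERIV[OF sm x a, of "[]"] unfolding DERIV_def by simp
 ultimately have "((%t. (f (x + t *R (a + b)) - f (x + t *R a)) / t + (f (x + t *R a) - f x) / t) \<longlongrightarrow> dd b f x + dd a f x) (at 0)"
  by (rule tendsto_add)
 then have "((%t. f (x + t *R (a + b))) has_field_derivative dd b f x + dd a f x) (at 0)"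
  unfolding DERIV_def by (simp add: add_divide_distrib[symmetric])
 then show ?thesis by (simp add: dderivs.simps DERIV_imp_deriv)
qed

text \<open>Used to express the derivative of \<open>F\<^sup>i\<^sup>j\<close> in the direction of a symmetric matrix by its entries.\<close>

lemma dd_sum_direction:
 fixes f :: "'a::real_normed_vector => real"
 assumes sm: "smooth_on V U f" and V: "subspace V" and U: "openin (top_of_set V) U"
  and x: "x \<in> U" and a: "!!i. i \<in> I ==> a i \<in> V"
 shows "dd (\<Sum>i\<in>I. c i *R a i) f x = (\<Sum>i\<in>I. c i * dd (a i) f x)"
proof (cases "finite I")
 case True
 then show ?thesis using a
 proof induction
  case empty
  show ?case by (simp add: dderivs.simps)
 next
  case (insert i I)
  have "dd (\<Sum>i\<in>insert i I. c i *R a i) f x = dd (c i *R a i + (\<Sum>i\<in>I. c i *R a i)) f x"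
   using insert by simp
  also have "... = dd (c i *R a i) f x + dd (\<Sum>i\<in>I. c i *R a i) f x"
   using insert by (intro dd_add_direction[OF sm V U x] subspace_scale[OF V] subspace_sum[OF V]) auto
  also have "dd (c i *R a i) f x = c i * dd (a i) f x"
   by (rule dd_scale) (use smooth_on_DERIV[OF sm x, of "a i" "[]"] insert in auto)
  finally show ?case using insert by simp
 qed
qed (simp add: dderivs.simps)

lemma dd_gradient:
 fixes F :: "real^'n::finite => real"
 assumes "smooth F"
 shows "dd v F z = (\<Sum>i\<in>UNIV. v $ i * pd i F z)"
proof -
 have "v = (\<Sum>i\<in>UNIV. v $ i *R axis i 1)"
  using basis_expansion[of v] by (simp add: scalar_mult_eq_scaleR)
 then have "dd v F z = dd (\<Sum>i\<in>UNIV. v $ i *R axis i 1) F z" by simp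
 also have "... = (\<Sum>i\<in>UNIV. v $ i * pd i F z)"
  by (rule dd_sum_direction[OF assms]) auto
 finally show ?thesis .
qed

section \<open>A Poincare inequality\<close>

lemma ennreal_add_square_le: "(a + b)^2 <= 2 * (a^2 + b^2)" for a b :: ennreal
proof -
 have real: "(x + y)^2 <= 2 * (x^2 + y^2)" for x y :: real
 proof -
  have "0 <= (x - y)^2" by simp
  then show ?thesis by (simp add: power2_eq_square algebra_simps)
 qed
 show ?thesis
 proof (cases "a = top \<or> b = top")
  case True
  then have "2 * (a^2 + b^2) = top"
   by (auto simp: power2_eq_square ennreal_mult_eq_top_iff)
  then show ?thesis by (simp only: top_greatest)
 next
  case False
  then obtain x y where xy: "a = ennreal x" "b = ennreal y" "x >= 0" "y >= 0"
   by (metis ennreal_cases)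
  have "(a + b)^2 = ennreal ((x + y)^2)"
   unfolding xy using xy(3,4) by (simp add: ennreal_power flip: ennreal_plus)
  also have "... <= ennreal (2 * (x^2 + y^2))" by (intro ennreal_leI real)
  also have "... = 2 * (a^2 + b^2)"
   unfolding xy using xy(3,4) by (simp add: ennreal_mult ennreal_power)
  finally show ?thesis .
 qed
qed

lemma convex_comb_ball:
 assumes "x \<in> ball x0 r" "y \<in> ball x0 r" "0 <= t" "t <= 1"
 shows "x + t *R (y - x) \<in> ball (x0::'a::real_normed_vector) r"
proof -
 have "(1 - t) *R x + t *R y \<in> ball x0 r"
  using assms by (intro convexD_alt[OF convex_ball]) auto
 then show ?thesis by (simp add: algebra_simps)
qed

text \<open>Changes of variables along the segment from \<open>x\<close> to \<open>y\<close>: near \<open>x\<close> the end point \<open>x\<close> is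
 moved, away from \<open>x\<close> the end point \<open>y\<close>.\<close>

lemma nn_integral_segment_x:
 fixes g :: "real^'n::finite => ennreal"
 assumes [measurable]: "g \<in> borel_fns" and t: "0 <= t" "t <= 1/2"
 shows "(NNINT x. g (x + t *R (y - x))) <= 2 ^ CARD('n) * (NNINT x. g x)"
proof -
 have "(1/2) ^ CARD('n) <= (1 - t) ^ CARD('n)" using t by (intro power_mono) auto
 then have 1: "1 <= 2 ^ CARD('n) * (1 - t) ^ CARD('n)" by (simp add: power_one_over field_simps)
 have "(NNINT x. g x) = ennreal (\<bar>1 - t\<bar> ^ DIM(real^'n)) * (NNINT x. g (t *R y + (1 - t) *R x))"
  using t by (intro lborel_nn_integral_affine) auto
 also have "(%x. g (t *R y + (1 - t) *R x)) = (%x. g (x + t *R (y - x)))" by (simp add: algebra_simps)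
 finally have e: "(NNINT x. g x) = ennreal ((1 - t) ^ CARD('n)) * (NNINT x. g (x + t *R (y - x)))"
  using t by simp
 have "1 * (NNINT x. g (x + t *R (y - x))) <= ennreal (2 ^ CARD('n) * (1 - t) ^ CARD('n)) * (NNINT x. g (x + t *R (y - x)))"
  using 1 by (intro mult_right_mono) auto
 also have "... = 2 ^ CARD('n) * (NNINT x. g x)"
  unfolding e using t by (simp add: ennreal_mult ennreal_power[symmetric] mult.assoc)
 finally show ?thesis by simp
qed

lemma nn_integral_segment_y:
 fixes g :: "real^'n::finite => ennreal"
 assumes [measurable]: "g \<in> borel_fns" and t: "0 < \<tau>" "\<tau> <= t"
 shows "(NNINT y. g (x + t *R (y - x))) <= ennreal (1 / \<tau> ^ CARD('n)) * (NNINT x. g x)"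
proof -
 have "\<tau> ^ CARD('n) <= t ^ CARD('n)" using t by (intro power_mono) auto
 then have 1: "1 <= 1 / \<tau> ^ CARD('n) * t ^ CARD('n)" using t by (simp add: field_simps)
 have "(NNINT x. g x) = ennreal (\<bar>t\<bar> ^ DIM(real^'n)) * (NNINT y. g ((1 - t) *R x + t *R y))"
  using t by (intro lborel_nn_integral_affine) auto
 also have "(%y. g ((1 - t) *R x + t *R y)) = (%y. g (x + t *R (y - x)))" by (simp add: algebra_simps)
 finally have e: "(NNINT x. g x) = ennreal (t ^ CARD('n)) * (NNINT y. g (x + t *R (y - x)))"
  using t by simp
 have "1 * (NNINT y. g (x + t *R (y - x))) <= ennreal (1 / \<tau> ^ CARD('n) * t ^ CARD('n)) * (NNINT y. g (x + t *R (y - x)))"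
  using 1 by (intro mult_right_mono) (simp_all flip: ennreal_1 add: ennreal_leI)
 also have "... = ennreal (1 / \<tau> ^ CARD('n)) * (NNINT x. g x)"
 proof -
  have "ennreal (1 / \<tau> ^ CARD('n) * t ^ CARD('n)) = ennreal (1 / \<tau> ^ CARD('n)) * ennreal (t ^ CARD('n))"
   using t by (intro ennreal_mult) auto
  then show ?thesis unfolding e by (simp only: mult.assoc)
 qed
 finally show ?thesis by simp
qed

text \<open>The average of the gradient over the segments that join two points of a ball controls the oscillation.
 On the part \<open>t \<le> \<tau>\<close> of a segment Cauchy-Schwarz in \<open>t\<close> gains the factor \<open>\<tau>\<^sup>2\<close>, and moving the end point \<open>x\<close>
 is a change of variables with bounded Jacobian. On the part \<open>t \<ge> \<tau>\<close> moving \<open>y\<close> has Jacobian at least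
 \<open>\<tau>\<^sup>n\<close>, and the inner integral is bounded by the \<open>L\<^sup>1\<close> norm uniformly in \<open>x\<close>. Thus \<open>\<tau>\<close> trades a small
 multiple of the \<open>L\<^sup>2\<close> norm for a large multiple of the \<open>L\<^sup>1\<close> norm.\<close>

lemma segment_average_L2:
 fixes g :: "real^'n::finite => ennreal" and x0 :: "real^'n" and r :: real
 assumes [measurable]: "g \<in> borel_fns" and \<tau>: "0 < \<tau>" "\<tau> <= 1/2"
 defines "B \<equiv> ball x0 r"
 shows "(NNINT x. indicator B x * (NNINT y. indicator B y * (NNINT t. indicator {0..1} t * g (x + t *R (y - x))))^2)
  <= 2 * ((emeasure lborel B)^2 * ennreal (\<tau>^2) * 2 ^ CARD('n) * (NNINT x. indicator B x * (g x)^2)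
   + emeasure lborel B * (ennreal (1 / \<tau> ^ CARD('n)) * (NNINT x. indicator B x * g x))^2)"
proof -
 have Bm[measurable]: "B \<in> sets borel" unfolding B_def by simp
 have cvx: "x + t *R (y - x) \<in> B" if "x \<in> B" "y \<in> B" "0 <= t" "t <= 1" for x y t
  using that unfolding B_def by (rule convex_comb_ball)
 define G where "G x = indicator B x * g x" for x
 have [measurable]: "G \<in> borel_fns" unfolding G_def by simp
 define b where "b = emeasure lborel B"
 have b: "(NNINT y. indicator B y) = b" unfolding b_def by simp
 define I1 where "I1 x y = (NNINT t. indicator {0..\<tau>} t * G (x + t *R (y - x)))" for x y
 define I2 where "I2 x y = (NNINT t. indicator {\<tau>..1} t * G (x + t *R (y - x)))" for x y
 have [measurable]: "(%y. I1 x y) \<in> borel_fns" "(%y. I2 x y) \<in> borel_fns" for x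
  unfolding I1_def I2_def by measurable
 have [measurable]: "(%(x, y). I1 x y) \<in> borel_measurable (borel \<Otimes>\<^sub>M borel)" "(%(x, y). I2 x y) \<in> borel_measurable (borel \<Otimes>\<^sub>M borel)"
  unfolding I1_def I2_def by measurable
 define P1 where "P1 x = (NNINT y. indicator B y * I1 x y)" for x
 define P2 where "P2 x = (NNINT y. indicator B y * I2 x y)" for x
 have [measurable]: "P1 \<in> borel_fns" "P2 \<in> borel_fns"
  unfolding P1_def P2_def by measurable
 have split: "(NNINT y. indicator B y * (NNINT t. indicator {0..1} t * g (x + t *R (y - x)))) <= P1 x + P2 x"
  if x: "x \<in> B" for x
 proof -
  have "(NNINT y. indicator B y * (NNINT t. indicator {0..1} t * g (x + t *R (y - x))))
   <= (NNINT y. indicator B y * I1 x y + indicator B y * I2 x y)"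
  proof (rule nn_integral_mono)
   fix y
   have "(NNINT t. indicator {0..1} t * g (x + t *R (y - x))) <= I1 x y + I2 x y" if y: "y \<in> B"
   proof -
    have "(NNINT t. indicator {0..1} t * g (x + t *R (y - x)))
     <= (NNINT t. indicator {0..\<tau>} t * G (x + t *R (y - x)) + indicator {\<tau>..1} t * G (x + t *R (y - x)))"
    proof (rule nn_integral_mono)
     fix t :: real
     show "indicator {0..1} t * g (x + t *R (y - x))
      <= indicator {0..\<tau>} t * G (x + t *R (y - x)) + indicator {\<tau>..1} t * G (x + t *R (y - x))"
     proof (cases "t \<in> {0..1}")
      case True
      then have "G (x + t *R (y - x)) = g (x + t *R (y - x))" using cvx[OF x y, of t] by (simp add: G_def)
      then show ?thesis using True \<tau> by (cases "t <= \<tau>") (auto simp: indicator_def)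
     qed simp
    qed
    also have "... = I1 x y + I2 x y"
     unfolding I1_def I2_def by (rule nn_integral_add) measurable
    finally show ?thesis .
   qed
   then show "indicator B y * (NNINT t. indicator {0..1} t * g (x + t *R (y - x)))
    <= indicator B y * I1 x y + indicator B y * I2 x y"
    by (cases "y \<in> B") auto
  qed
  also have "... = P1 x + P2 x"
   unfolding P1_def P2_def by (rule nn_integral_add) measurable
  finally show ?thesis .
 qed
 have first: "(NNINT x. indicator B x * (P1 x)^2) <= b^2 * ennreal (\<tau>^2) * 2 ^ CARD('n) * (NNINT x. (G x)^2)"
 proof -
  have P1: "(P1 x)^2 <= b * ennreal \<tau> * (NNINT y. indicator B y * (NNINT t. indicator {0..\<tau>} t * (G (x + t *R (y - x)))^2))" for x
  proof -
   have I1: "(I1 x y)^2 <= ennreal \<tau> * (NNINT t. indicator {0..\<tau>} t * (G (x + t *R (y - x)))^2)" for y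
   proof -
    have "(I1 x y)^2 = (NNINT t. indicator {0..\<tau>} t * (indicator {0..\<tau>} t * G (x + t *R (y - x))))^2"
     unfolding I1_def by (intro arg_cong[where f="%x. x^2"] nn_integral_cong) (simp add: indicator_def)
    also have "... <= (NNINT t. (indicator {0..\<tau>} t)^2) * (NNINT t. (indicator {0..\<tau>} t * G (x + t *R (y - x)))^2)"
     by (rule Cauchy_Schwarz_nn_integral) measurable
    also have "(NNINT t. (indicator {0..\<tau>} t)^2) = (\<integral>\<^sup>+t. indicator {0..\<tau>} t \<partial>(lborel :: real measure))"
     by (intro nn_integral_cong) (simp add: indicator_def)
    also have "... = ennreal \<tau>" using \<tau> by simp
    also have "(NNINT t. (indicator {0..\<tau>} t * G (x + t *R (y - x)))^2) = (NNINT t. indicator {0..\<tau>} t * (G (x + t *R (y - x)))^2)"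
     by (intro nn_integral_cong) (simp add: indicator_def)
    finally show ?thesis .
   qed
   have "(P1 x)^2 = (NNINT y. indicator B y * (indicator B y * I1 x y))^2"
    unfolding P1_def by (intro arg_cong[where f="%x. x^2"] nn_integral_cong) (simp add: indicator_def)
   also have "... <= (NNINT y. (indicator B y)^2) * (NNINT y. (indicator B y * I1 x y)^2)"
    by (rule Cauchy_Schwarz_nn_integral) measurable
   also have "(NNINT y. (indicator B y)^2) = (NNINT y. indicator B y)"
    by (intro nn_integral_cong) (simp add: indicator_def)
   also have "(NNINT y. (indicator B y * I1 x y)^2)
    <= (NNINT y. ennreal \<tau> * (indicator B y * (NNINT t. indicator {0..\<tau>} t * (G (x + t *R (y - x)))^2)))"
    by (intro nn_integral_mono) (use I1 in \<open>simp add: indicator_def\<close>)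
   also have "... = ennreal \<tau> * (NNINT y. indicator B y * (NNINT t. indicator {0..\<tau>} t * (G (x + t *R (y - x)))^2))"
    by (rule nn_integral_cmult) measurable
   finally show ?thesis unfolding b by (simp add: mult.assoc mult_left_mono)
  qed
  have "(NNINT x. indicator B x * (P1 x)^2) <= (NNINT x. b * ennreal \<tau> *
    (NNINT y. indicator B y * (NNINT t. indicator {0..\<tau>} t * (G (x + t *R (y - x)))^2)))"
   by (intro nn_integral_mono) (use P1 in \<open>simp add: indicator_def\<close>)
  also have "... = b * ennreal \<tau> *
    (NNINT x. (NNINT y. indicator B y * (NNINT t. indicator {0..\<tau>} t * (G (x + t *R (y - x)))^2)))"
   by (rule nn_integral_cmult) measurable
  also have "(NNINT x. (NNINT y. indicator B y * (NNINT t. indicator {0..\<tau>} t * (G (x + t *R (y - x)))^2)))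
   = (NNINT y. (NNINT x. indicator B y * (NNINT t. indicator {0..\<tau>} t * (G (x + t *R (y - x)))^2)))"
   by (rule lborel_pair.Fubini') measurable
  also have "... <= (NNINT y. indicator B y * (ennreal \<tau> * (2 ^ CARD('n) * (NNINT x. (G x)^2))))"
  proof (rule nn_integral_mono)
   fix y
   have "(NNINT x. indicator B y * (NNINT t. indicator {0..\<tau>} t * (G (x + t *R (y - x)))^2))
    = indicator B y * (NNINT x. (NNINT t. indicator {0..\<tau>} t * (G (x + t *R (y - x)))^2))"
    by (rule nn_integral_cmult) measurable
   also have "(NNINT x. (NNINT t. indicator {0..\<tau>} t * (G (x + t *R (y - x)))^2))
    = (NNINT t. (NNINT x. indicator {0..\<tau>} t * (G (x + t *R (y - x)))^2))"
    by (rule lborel_pair.Fubini') measurable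
   also have "... <= (NNINT t. indicator {0..\<tau>} t * (2 ^ CARD('n) * (NNINT x. (G x)^2)))"
   proof (rule nn_integral_mono)
    fix t :: real
    have "(NNINT x. indicator {0..\<tau>} t * (G (x + t *R (y - x)))^2)
     = indicator {0..\<tau>} t * (NNINT x. (G (x + t *R (y - x)))^2)"
     by (rule nn_integral_cmult) measurable
    also have "... <= indicator {0..\<tau>} t * (2 ^ CARD('n) * (NNINT x. (G x)^2))"
     using nn_integral_segment_x[of "%x. (G x)^2" t y] \<tau> by (cases "t \<in> {0..\<tau>}") auto
    finally show "(NNINT x. indicator {0..\<tau>} t * (G (x + t *R (y - x)))^2)
     <= indicator {0..\<tau>} t * (2 ^ CARD('n) * (NNINT x. (G x)^2))" .
   qed
   also have "... = ennreal \<tau> * (2 ^ CARD('n) * (NNINT x. (G x)^2))"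
    using \<tau> by (subst nn_integral_multc) auto
   finally show "(NNINT x. indicator B y * (NNINT t. indicator {0..\<tau>} t * (G (x + t *R (y - x)))^2))
    <= indicator B y * (ennreal \<tau> * (2 ^ CARD('n) * (NNINT x. (G x)^2)))"
    by (simp add: mult_left_mono)
  qed
  also have "... = b * (ennreal \<tau> * (2 ^ CARD('n) * (NNINT x. (G x)^2)))"
   by (subst nn_integral_multc) (simp_all add: b)
  finally have "(NNINT x. indicator B x * (P1 x)^2)
    <= b * ennreal \<tau> * (b * (ennreal \<tau> * (2 ^ CARD('n) * (NNINT x. (G x)^2))))"
   by (simp add: mult_left_mono)
  also have "... = b^2 * ennreal (\<tau>^2) * 2 ^ CARD('n) * (NNINT x. (G x)^2)"
   using \<tau> by (simp add: power2_eq_square ennreal_mult mult_ac)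
  finally show ?thesis .
 qed
 have second: "(NNINT x. indicator B x * (P2 x)^2) <= b * (ennreal (1 / \<tau> ^ CARD('n)) * (NNINT x. G x))^2"
 proof -
  have P2: "P2 x <= ennreal (1 / \<tau> ^ CARD('n)) * (NNINT x. G x)" for x
  proof -
   have "P2 x <= (NNINT y. I2 x y)"
    unfolding P2_def by (intro nn_integral_mono) (simp add: indicator_def)
   also have "... = (NNINT t. (NNINT y. indicator {\<tau>..1} t * G (x + t *R (y - x))))"
    unfolding I2_def by (rule lborel_pair.Fubini') measurable
   also have "... <= (NNINT t. indicator {0..1::real} t * (ennreal (1 / \<tau> ^ CARD('n)) * (NNINT x. G x)))"
   proof (rule nn_integral_mono)
    fix t :: real
    have "(NNINT y. indicator {\<tau>..1} t * G (x + t *R (y - x)))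
     = indicator {\<tau>..1} t * (NNINT y. G (x + t *R (y - x)))"
     by (rule nn_integral_cmult) measurable
    also have "... <= indicator {0..1} t * (ennreal (1 / \<tau> ^ CARD('n)) * (NNINT x. G x))"
     using nn_integral_segment_y[of G \<tau> t x] \<tau> by (cases "t \<in> {\<tau>..1}") auto
    finally show "(NNINT y. indicator {\<tau>..1} t * G (x + t *R (y - x)))
     <= indicator {0..1} t * (ennreal (1 / \<tau> ^ CARD('n)) * (NNINT x. G x))" .
   qed
   also have "... = ennreal (1 / \<tau> ^ CARD('n)) * (NNINT x. G x)"
    by (subst nn_integral_multc) auto
   finally show ?thesis .
  qed
  have "(NNINT x. indicator B x * (P2 x)^2)
    <= (NNINT x. indicator B x * (ennreal (1 / \<tau> ^ CARD('n)) * (NNINT x. G x))^2)"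
   by (intro nn_integral_mono mult_left_mono power_mono P2) auto
  also have "... = b * (ennreal (1 / \<tau> ^ CARD('n)) * (NNINT x. G x))^2"
   by (subst nn_integral_multc) (simp_all add: b)
  finally show ?thesis .
 qed
 have "(NNINT x. indicator B x * (NNINT y. indicator B y * (NNINT t. indicator {0..1} t * g (x + t *R (y - x))))^2)
  <= (NNINT x. 2 * (indicator B x * (P1 x)^2 + indicator B x * (P2 x)^2))"
 proof (rule nn_integral_mono)
  fix x
  show "indicator B x * (NNINT y. indicator B y * (NNINT t. indicator {0..1} t * g (x + t *R (y - x))))^2
   <= 2 * (indicator B x * (P1 x)^2 + indicator B x * (P2 x)^2)"
   using order_trans[OF power_mono[OF split, of x 2] ennreal_add_square_le] by (cases "x \<in> B") auto
 qed
 also have "... = 2 * ((NNINT x. indicator B x * (P1 x)^2) + (NNINT x. indicator B x * (P2 x)^2))"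
  by (subst nn_integral_cmult) (measurable, subst nn_integral_add, measurable)
 also have "... <= 2 * (b^2 * ennreal (\<tau>^2) * 2 ^ CARD('n) * (NNINT x. (G x)^2) + b * (ennreal (1 / \<tau> ^ CARD('n)) * (NNINT x. G x))^2)"
  by (intro mult_left_mono add_mono first second) auto
 also have "(NNINT x. (G x)^2) = (NNINT x. indicator B x * (g x)^2)"
  by (intro nn_integral_cong) (simp add: G_def indicator_def)
 finally show ?thesis unfolding b_def G_def .
qed

text \<open>The difference \<open>F(x) - F(y)\<close> is an integral of the gradient over the segment from \<open>x\<close> to \<open>y\<close>, whose length
 is at most \<open>2r\<close>; averaging over \<open>y\<close> reduces the claim to the previous estimate.\<close>

lemma poincare_smooth:
 fixes F :: "real^'n::finite => real" and \<gamma> :: "real^'n => real"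
 assumes F: "smooth F" and r: "r > 0" and \<tau>: "0 < \<tau>" "\<tau> <= 1/2"
  and \<gamma>: "continuous_on UNIV \<gamma>" "!!x. x \<in> ball x0 r ==> (\<Sum>i\<in>UNIV. \<bar>pd i F x\<bar>) <= \<gamma> x" "!!x. 0 <= \<gamma> x"
 defines "b \<equiv> measure lborel (ball x0 r)"
 shows "(LBINT x. in_ball x0 r x * (F x - (LBINT y. in_ball x0 r y * F y) / b)^2)
  <= 8 * r^2 * (\<tau>^2 * 2 ^ CARD('n) * (LBINT x. in_ball x0 r x * (\<gamma> x)^2)
   + (LBINT x. in_ball x0 r x * \<gamma> x)^2 / (\<tau> ^ CARD('n))^2 / b)"
proof -
 let ?B = "ball x0 r"
 have b: "b > 0" unfolding b_def using r content_ball_gt_0_iff[of x0 r] by simp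
 have bm: "emeasure lborel ?B = ennreal b"
  unfolding b_def by (rule emeasure_eq_ennreal_measure) (use emeasure_lborel_ball_finite[of x0 r] in auto)
 have cF: "continuous_on UNIV F" by (rule smooth_continuous[OF F])
 have [measurable]: "F \<in> borel_fns" "\<gamma> \<in> borel_fns"
  by (intro borel_measurable_continuous_onI cF \<gamma>)+
 have Bm[measurable]: "?B \<in> sets borel" by simp
 have iF: "integrable lborel (%x. indicator ?B x * F x)" by (rule integrable_ind_continuous[OF cF])
 have iB: "integrable lborel (indicator ?B :: real^'n => real)"
  using bm by (intro integrable_real_indicator) auto
 have intB: "(LBINT x. indicator ?B x) = b" by (simp add: b_def)
 define A where "A = (LBINT y. indicator ?B y * F y) / b"
 have seg: "\<bar>F x - F y\<bar> <= 2 * r * (LBINT t. \<gamma> (x + t *R (y - x)) * indicator {0..1} t)"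
  and segi: "integrable lborel (%t. \<gamma> (x + t *R (y - x)) * indicator {0..1} t)"
  if xy: "x \<in> ?B" "y \<in> ?B" for x y
 proof -
  let ?v = "y - x"
  have nv: "norm ?v <= 2 * r" using xy dist_triangle[of x y x0] by (simp add: dist_norm norm_minus_commute) 
  have ct: "continuous_on {0..1} (%t. \<gamma> (x + t *R ?v))"
   by (intro continuous_on_compose2[OF \<gamma>(1)] continuous_intros) auto
  show si: "integrable lborel (%t. \<gamma> (x + t *R ?v) * indicator {0..1} t)"
   using borel_integrable_atLeastAtMost'[OF ct] by (simp add: set_integrable_def mult.commute)
  have dv: "dd ?v F z = (\<Sum>i\<in>UNIV. ?v $ i * pd i F z)" for z by (rule dd_gradient[OF F])
  have bound: "\<bar>dd ?v F z\<bar> <= 2 * r * \<gamma> z" if "z \<in> ?B" for z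
  proof -
   have "\<bar>dd ?v F z\<bar> <= (\<Sum>i\<in>UNIV. \<bar>?v $ i * pd i F z\<bar>)" unfolding dv by (rule sum_abs)
   also have "... <= (\<Sum>i\<in>UNIV. (2 * r) * \<bar>pd i F z\<bar>)"
    unfolding abs_mult using order_trans[OF component_le_norm_cart nv] by (intro sum_mono mult_right_mono) auto
   also have "... = 2 * r * (\<Sum>i\<in>UNIV. \<bar>pd i F z\<bar>)" by (simp add: sum_distrib_left)
   also have "... <= 2 * r * \<gamma> z" using r \<gamma>(2)[OF that] by (intro mult_left_mono) auto
   finally show ?thesis .
  qed
  have cdd: "continuous_on UNIV (dd ?v F)" by (rule smooth_continuous[OF smooth_dd[OF F]])
  have "has_bochner_integral lborel (%t. dd ?v F (x + t *R ?v) * indicator {0..1} t) (F (x + 1 *R ?v) - F (x + 0 *R ?v))"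
  proof (rule has_bochner_integral_FTC_Icc_real)
   show "((%t. F (x + t *R ?v)) has_real_derivative dd ?v F (x + t *R ?v)) (at t)" for t by (rule smooth_DERIV_at[OF F])
   have "continuous_on UNIV (%t. dd ?v F (x + t *R ?v))"
    by (intro continuous_on_compose2[OF cdd] continuous_intros) auto
   then show "isCont (%t. dd ?v F (x + t *R ?v)) t" for t by (simp add: continuous_on_eq_continuous_at)
  qed simp
  then have h: "has_bochner_integral lborel (%t. dd ?v F (x + t *R ?v) * indicator {0..1} t) (F y - F x)" by simp
  have "\<bar>F x - F y\<bar> = \<bar>(LBINT t. dd ?v F (x + t *R ?v) * indicator {0..1} t)\<bar>"
   using has_bochner_integral_integral_eq[OF h] by simp
  also have "... <= (LBINT t. \<bar>dd ?v F (x + t *R ?v) * indicator {0..1} t\<bar>)" by (rule integral_abs_bound)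
  also have "... <= (LBINT t. 2 * r * (\<gamma> (x + t *R ?v) * indicator {0..1} t))"
  proof (rule integral_mono)
   show "integrable lborel (%t. \<bar>dd ?v F (x + t *R ?v) * indicator {0..1} t\<bar>)" using h by (auto simp: has_bochner_integral_iff)
   show "integrable lborel (%t. 2 * r * (\<gamma> (x + t *R ?v) * indicator {0..1} t))" using si by simp
   show "\<bar>dd ?v F (x + t *R ?v) * indicator {0..1} t\<bar> <= 2 * r * (\<gamma> (x + t *R ?v) * indicator {0..1} t)" for t
    using bound[OF convex_comb_ball[OF xy, of t]] by (cases "t \<in> {0..1}") auto
  qed
  finally show "\<bar>F x - F y\<bar> <= 2 * r * (LBINT t. \<gamma> (x + t *R ?v) * indicator {0..1} t)" by simp
 qed
 define J where "J x = (NNINT y. indicator ?B y * (NNINT t. indicator {0..1} t * ennreal (\<gamma> (x + t *R (y - x)))))" for x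
 have point: "ennreal \<bar>F x - A\<bar> <= ennreal (2 * r / b) * J x" if x: "x \<in> ?B" for x
 proof -
  have i1: "integrable lborel (%y. indicator ?B y * (F x - F y))"
   using integrable_diff[OF integrable_mult_left[OF iB, of "F x"] iF] by (simp add: algebra_simps)
  have "F x - A = (LBINT y. indicator ?B y * (F x - F y)) / b"
  proof -
   have "(LBINT y. indicator ?B y * (F x - F y)) = (LBINT y. indicator ?B y * F x - indicator ?B y * F y)"
    by (simp add: algebra_simps)
   also have "... = (LBINT y. indicator ?B y * F x) - (LBINT y. indicator ?B y * F y)"
    by (rule integral_diff[OF integrable_mult_left[OF iB] iF])
   also have "(LBINT y. indicator ?B y * F x) = b * F x"
    by (simp only: integral_mult_left_zero intB)
   finally show ?thesis using b by (simp add: A_def field_simps)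
  qed
  then have "\<bar>F x - A\<bar> <= (LBINT y. \<bar>indicator ?B y * (F x - F y)\<bar>) / b"
   using b integral_abs_bound[of lborel "%y. indicator ?B y * (F x - F y)"] by (simp add: divide_right_mono)
  then have "ennreal \<bar>F x - A\<bar> <= ennreal ((1 / b) * (LBINT y. \<bar>indicator ?B y * (F x - F y)\<bar>))"
   by (intro ennreal_leI) simp
  also have "... = ennreal (1 / b) * (NNINT y. ennreal \<bar>indicator ?B y * (F x - F y)\<bar>)"
  proof (subst nn_integral_eq_integral)
   show "ennreal ((1 / b) * (LBINT y. \<bar>indicator ?B y * (F x - F y)\<bar>))
    = ennreal (1 / b) * ennreal (LBINT y. \<bar>indicator ?B y * (F x - F y)\<bar>)"
    using b by (intro ennreal_mult) (auto intro: integral_nonneg)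
  qed (use i1 in auto)
  also have "... <= ennreal (1 / b) * (NNINT y. ennreal (2 * r) * (indicator ?B y * (NNINT t. indicator {0..1} t * ennreal (\<gamma> (x + t *R (y - x))))))"
  proof (intro mult_left_mono nn_integral_mono)
   fix y
   show "ennreal \<bar>indicator ?B y * (F x - F y)\<bar>
    <= ennreal (2 * r) * (indicator ?B y * (NNINT t. indicator {0..1} t * ennreal (\<gamma> (x + t *R (y - x)))))"
   proof (cases "y \<in> ?B")
    case True
    have "ennreal \<bar>F x - F y\<bar> <= ennreal (2 * r * (LBINT t. \<gamma> (x + t *R (y - x)) * indicator {0..1} t))"
     by (intro ennreal_leI seg[OF x True])
    also have "... = ennreal (2 * r) * (NNINT t. ennreal (\<gamma> (x + t *R (y - x)) * indicator {0..1} t))"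
     using r by (subst nn_integral_eq_integral[OF segi[OF x True]]) (auto simp: ennreal_mult \<gamma>(3) integral_nonneg)
    also have "(NNINT t. ennreal (\<gamma> (x + t *R (y - x)) * indicator {0..1} t))
      = (NNINT t. indicator {0..1} t * ennreal (\<gamma> (x + t *R (y - x))))"
     by (intro nn_integral_cong) (simp add: indicator_def)
    finally show ?thesis using True by simp
   qed simp
  qed simp
  also have "... = ennreal (1 / b) * (ennreal (2 * r) * J x)"
   unfolding J_def by (subst nn_integral_cmult) measurable
  also have "... = ennreal (2 * r / b) * J x"
   using r b by (simp add: mult.assoc[symmetric] ennreal_mult[symmetric])
  finally show ?thesis .
 qed
 have J2: "(NNINT x. indicator ?B x * (J x)^2)
  <= 2 * ((emeasure lborel ?B)^2 * ennreal (\<tau>^2) * 2 ^ CARD('n) * (NNINT x. indicator ?B x * (ennreal (\<gamma> x))^2)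
   + emeasure lborel ?B * (ennreal (1 / \<tau> ^ CARD('n)) * (NNINT x. indicator ?B x * ennreal (\<gamma> x)))^2)"
  unfolding J_def by (rule segment_average_L2[OF _ \<tau>]) measurable
 have [measurable]: "J \<in> borel_fns" unfolding J_def by measurable
 define G1 where "G1 = (LBINT x. indicator ?B x * \<gamma> x)"
 define G2 where "G2 = (LBINT x. indicator ?B x * (\<gamma> x)^2)"
 have G0: "G1 >= 0" "G2 >= 0" unfolding G1_def G2_def by (auto intro!: integral_nonneg simp: \<gamma>(3))
 have e1: "(NNINT x. indicator ?B x * ennreal (\<gamma> x)) = ennreal G1"
 proof -
  have "(NNINT x. indicator ?B x * ennreal (\<gamma> x)) = (NNINT x. ennreal (indicator ?B x * \<gamma> x))"
   by (intro nn_integral_cong) (simp add: indicator_def)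
  also have "... = ennreal G1" unfolding G1_def
   by (rule nn_integral_eq_integral[OF integrable_ind_continuous[OF \<gamma>(1)]]) (simp add: \<gamma>(3))
  finally show ?thesis .
 qed
 have e2: "(NNINT x. indicator ?B x * (ennreal (\<gamma> x))^2) = ennreal G2"
 proof -
  have "(NNINT x. indicator ?B x * (ennreal (\<gamma> x))^2) = (NNINT x. ennreal (indicator ?B x * (\<gamma> x)^2))"
   by (intro nn_integral_cong) (simp add: indicator_def ennreal_power \<gamma>(3))
  also have "... = ennreal G2" unfolding G2_def
   by (rule nn_integral_eq_integral[OF integrable_ind_continuous]) (auto intro!: continuous_intros \<gamma>)
  finally show ?thesis .
 qed
 have "ennreal (LBINT x. indicator ?B x * (F x - A)^2) = (NNINT x. ennreal (indicator ?B x * (F x - A)^2))"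
  by (rule nn_integral_eq_integral[OF integrable_ind_continuous, symmetric]) (auto intro!: continuous_intros cF)
 also have "... <= (NNINT x. ennreal ((2 * r / b)^2) * (indicator ?B x * (J x)^2))"
 proof (rule nn_integral_mono)
  fix x
  show "ennreal (indicator ?B x * (F x - A)^2) <= ennreal ((2 * r / b)^2) * (indicator ?B x * (J x)^2)"
  proof (cases "x \<in> ?B")
   case True
   have "ennreal ((F x - A)^2) = (ennreal \<bar>F x - A\<bar>)^2" by (simp add: ennreal_power)
   also have "... <= (ennreal (2 * r / b) * J x)^2" by (intro power_mono point[OF True]) simp
   also have "... = ennreal ((2 * r / b)^2) * (J x)^2"
    using r b by (simp only: power_mult_distrib) (simp add: ennreal_power)
   finally show ?thesis using True by simp
  qed simp
 qed
 also have "... = ennreal ((2 * r / b)^2) * (NNINT x. indicator ?B x * (J x)^2)"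
  by (rule nn_integral_cmult) measurable
 also have "... <= ennreal ((2 * r / b)^2) * (2 * ((ennreal b)^2 * ennreal (\<tau>^2) * 2 ^ CARD('n) * ennreal G2
   + ennreal b * (ennreal (1 / \<tau> ^ CARD('n)) * ennreal G1)^2))"
  using J2 unfolding bm e1 e2 by (intro mult_left_mono) auto
 also have "... = ennreal ((2 * r / b)^2 * (2 * (b^2 * \<tau>^2 * 2 ^ CARD('n) * G2 + b * (1 / \<tau> ^ CARD('n) * G1)^2)))"
 proof -
  have 2: "(2::ennreal) = ennreal 2" by simp
  show ?thesis
   unfolding 2 using b G0 \<tau> r
   by (simp only: ennreal_power ennreal_mult[symmetric] ennreal_plus[symmetric] less_imp_le
     mult_nonneg_nonneg add_nonneg_nonneg zero_le_power zero_le_numeral zero_le_power2 divide_nonneg_nonneg zero_le_one)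
 qed
 also have "(2 * r / b)^2 * (2 * (b^2 * \<tau>^2 * 2 ^ CARD('n) * G2 + b * (1 / \<tau> ^ CARD('n) * G1)^2))
  = 8 * r^2 * (\<tau>^2 * 2 ^ CARD('n) * G2 + G1^2 / (\<tau> ^ CARD('n))^2 / b)"
  using b \<tau> by (simp add: power2_eq_square field_simps)
 finally show ?thesis
  unfolding G1_def[symmetric] G2_def[symmetric] A_def[symmetric]
  by (subst (asm) ennreal_le_iff) (use b G0 in \<open>auto intro!: mult_nonneg_nonneg add_nonneg_nonneg divide_nonneg_nonneg\<close>)
qed

lemma square_integrable_ball:
 fixes g :: "real^'n::finite => real"
 assumes [measurable]: "g \<in> borel_fns" and g2: "integrable lborel (%x. (g x)^2)"
  and 0: "!!x. x \<notin> ball x0 r ==> g x = 0"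
 shows "integrable lborel g"
proof (rule integrable_bound)
 show "integrable lborel (%x. in_ball x0 r x + (g x)^2)"
  using emeasure_lborel_ball_finite[of x0 r] by (intro integrable_add g2 integrable_real_indicator) auto
 show "AE x in lborel. norm (g x) <= norm (in_ball x0 r x + (g x)^2)"
 proof (rule AE_I2)
  fix x
  have "\<bar>g x\<bar> <= 1 + (g x)^2" using abs_prod_le_Young[of 1 "g x" 1] by simp
  then show "norm (g x) <= norm (in_ball x0 r x + (g x)^2)"
   using 0[of x] by (auto simp: indicator_def)
 qed
qed simp

text \<open>The Poincare inequality for a bounded function with a square integrable weak gradient, after
 subtraction of an affine function. Mollification costs a doubling of the ball.\<close>

lemma poincare_weak:
 fixes f :: "real^'n::finite => real" and g :: "'n => real^'n => real" and a :: "real^'n"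
 assumes f: "integrable lborel f" "!!x. \<bar>f x\<bar> <= M"
  and g: "!!i. integrable lborel (g i)" "!!i. integrable lborel (%x. (g i x)^2)"
  and w: "!!i. wpd \<Omega> i f (g i)" and sub: "ball x0 (2 * r) \<subseteq> \<Omega>"
  and r: "r > 0" and \<tau>: "0 < \<tau>" "\<tau> <= 1/2"
 defines "b \<equiv> measure lborel (ball x0 r)"
 shows "(LBINT x. in_ball x0 r x *
   (f x - a \<bullet> x - (LBINT y. in_ball x0 r y * (f y - a \<bullet> y)) / b)^2)
  <= 8 * r^2 * (\<tau>^2 * 2 ^ CARD('n) * (LBINT x. in_ball x0 (2 * r) x * (\<Sum>i\<in>UNIV. \<bar>g i x - a $ i\<bar>)^2)
   + (LBINT x. in_ball x0 (2 * r) x * (\<Sum>i\<in>UNIV. \<bar>g i x - a $ i\<bar>))^2 / (\<tau> ^ CARD('n))^2 / b)"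
proof -
 let ?B = "ball x0 r" and ?B2 = "ball x0 (2 * r)"
 have b: "b > 0" unfolding b_def using r content_ball_gt_0_iff[of x0 r] by simp
 have gm[measurable]: "g i \<in> borel_fns" for i using borel_measurable_integrable[OF g(1)] by simp
 have fm[measurable]: "f \<in> borel_fns" using borel_measurable_integrable[OF f(1)] by simp
 have [measurable]: "?B \<in> sets borel" "?B2 \<in> sets borel" by auto
 define \<gamma> where "\<gamma> x = indicator ?B2 x * (\<Sum>i\<in>UNIV. \<bar>g i x - a $ i\<bar>)" for x
 have \<gamma>m[measurable]: "\<gamma> \<in> borel_fns" unfolding \<gamma>_def[abs_def] by measurable
 have \<gamma>0: "\<gamma> x >= 0" for x unfolding \<gamma>_def by (intro mult_nonneg_nonneg sum_nonneg) auto
 have c2: "integrable lborel (%x. indicator ?B2 x * (c::real))" for c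
  using emeasure_lborel_ball_finite[of x0 "2 * r"] by (intro integrable_mult_left integrable_real_indicator) auto
 have \<gamma>sq: "(\<gamma> x)^2 = indicator ?B2 x * (\<Sum>i\<in>UNIV. \<bar>g i x - a $ i\<bar>)^2" for x
  by (simp add: \<gamma>_def indicator_def)
 have \<gamma>2: "integrable lborel (%x. (\<gamma> x)^2)"
 proof (rule integrable_bound)
  show "integrable lborel (%x. real CARD('n) * (\<Sum>i\<in>UNIV. indicator ?B2 x * (2 * (g i x)^2) + indicator ?B2 x * (2 * (a $ i)^2)))"
   by (intro integrable_mult_right integrable_sum integrable_add c2 integrable_ind g) auto
  show "AE x in lborel. norm ((\<gamma> x)^2) <= norm (real CARD('n) * (\<Sum>i\<in>UNIV. indicator ?B2 x * (2 * (g i x)^2) + indicator ?B2 x * (2 * (a $ i)^2)))"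
  proof (rule AE_I2)
   fix x
   have "(\<Sum>i\<in>UNIV. \<bar>g i x - a $ i\<bar>)^2 <= (\<Sum>i\<in>UNIV. \<bar>g i x - a $ i\<bar>^2) * real CARD('n)"
    by (rule sum_squared_le_sum_of_squares)
   also have "... <= (\<Sum>i\<in>UNIV. 2 * (g i x)^2 + 2 * (a $ i)^2) * real CARD('n)"
   proof (intro mult_right_mono sum_mono)
    fix i
    have "0 <= (g i x + a $ i)^2" by simp
    then show "\<bar>g i x - a $ i\<bar>^2 <= 2 * (g i x)^2 + 2 * (a $ i)^2" by (simp add: power2_eq_square algebra_simps)
   qed simp
   finally show "norm ((\<gamma> x)^2) <= norm (real CARD('n) * (\<Sum>i\<in>UNIV. indicator ?B2 x * (2 * (g i x)^2) + indicator ?B2 x * (2 * (a $ i)^2)))"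
    unfolding \<gamma>sq by (cases "x \<in> ?B2") (auto simp: mult.commute abs_of_nonneg sum_nonneg)
  qed
 qed measurable
 have \<gamma>1: "integrable lborel \<gamma>"
  by (rule square_integrable_ball[OF \<gamma>m \<gamma>2, of x0 "2 * r"]) (simp add: \<gamma>_def)
 \<comment> \<open>radii below \<open>r\<close>, so that mollification on the ball sees the doubled ball only\<close>
 define e where "e k = r / real (k + 2)" for k
 have e: "!!k. e k > 0" "!!k. e k < r" "e \<longlonglongrightarrow> 0"
  unfolding e_def by (rule harmonic_fractions[OF r])+
 define F where "F k x = conv f (rho (e k)) x - (a \<bullet> x + 0)" for k x
 have sF: "smooth (F k)" for k
  unfolding F_def by (intro smooth_diff smooth_mol[OF e(1) f(1)] smooth_affine_fun)
 define \<gamma>k where "\<gamma>k k = conv \<gamma> (rho (e k))" for k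
 have c\<gamma>: "continuous_on UNIV (\<gamma>k k)" for k
  unfolding \<gamma>k_def by (rule smooth_continuous[OF smooth_mol[OF e(1) \<gamma>1]])
 have \<gamma>k0: "0 <= \<gamma>k k x" for k x
  unfolding \<gamma>k_def conv_def by (intro integral_nonneg mult_nonneg_nonneg \<gamma>0 rho_nonneg[OF e(1)])
 have grad: "(\<Sum>i\<in>UNIV. \<bar>pd i (F k) x\<bar>) <= \<gamma>k k x" if x: "x \<in> ?B" for k x
 proof -
  have cb: "cball x (e k) \<subseteq> ?B2"
  proof
   fix y assume "y \<in> cball x (e k)"
   then show "y \<in> ?B2" using x e(2)[of k] dist_triangle[of x0 y x] by simp
  qed
  have Rt: "(%y. rho (e k) (x - y)) \<in> test_functions UNIV" by (rule rho_shift_test[OF e(1)]) simp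
  have Ri: "integrable lborel (%y. rho (e k) (x - y))" by (rule integrable_test[OF Rt])
  have R1: "(LBINT y. rho (e k) (x - y)) = 1"
   using lborel_integral_reflect[OF rho_borel[OF e(1)], of k x] rho_integral[OF e(1), of k] by (simp only:)
  have pdF: "pd i (F k) x = (LBINT y. (g i y - a $ i) * rho (e k) (x - y))" for i
  proof -
   have "pd i (F k) x = pd i (conv f (rho (e k))) x - a \<bullet> axis i 1"
    unfolding F_def dd_diff[OF smooth_mol[OF e(1) f(1)] smooth_affine_fun] dd_affine_fun ..
   also have "pd i (conv f (rho (e k))) x = conv (g i) (rho (e k)) x"
    by (rule pd_mol_weak[OF e(1) _ f(1) w]) (use cb sub in blast)
   also have "a \<bullet> axis i 1 = (LBINT y. a $ i * rho (e k) (x - y))"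
    by (simp add: inner_axis R1)
   finally show ?thesis
    unfolding conv_def
    using integral_diff[OF conv_rho_integrable(1)[OF e(1) g(1)] integrable_mult_right[OF Ri], of i k x "a $ i"]
    by (simp add: left_diff_distrib)
  qed
  have Gi: "integrable lborel (%y. (g i y - a $ i) * rho (e k) (x - y))" for i
   using integrable_diff[OF conv_rho_integrable(1)[OF e(1) g(1)] integrable_mult_right[OF Ri], of i k x "a $ i"]
   by (simp add: left_diff_distrib)
  have "(\<Sum>i\<in>UNIV. \<bar>pd i (F k) x\<bar>) <= (\<Sum>i\<in>UNIV. LBINT y. \<bar>(g i y - a $ i) * rho (e k) (x - y)\<bar>)"
   unfolding pdF by (intro sum_mono integral_abs_bound)
  also have "... = (LBINT y. (\<Sum>i\<in>UNIV. \<bar>(g i y - a $ i) * rho (e k) (x - y)\<bar>))"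
   using Gi by (intro integral_sum[symmetric] integrable_abs)
  also have "... = (LBINT y. \<gamma> y * rho (e k) (x - y))"
  proof (intro integral_cong refl)
   fix y
   show "(\<Sum>i\<in>UNIV. \<bar>(g i y - a $ i) * rho (e k) (x - y)\<bar>) = \<gamma> y * rho (e k) (x - y)"
   proof (cases "norm (x - y) < e k")
    case True
    then have "y \<in> cball x (e k)" by (simp add: dist_norm)
    then have "y \<in> ?B2" using cb by blast
    then show ?thesis by (simp add: \<gamma>_def abs_mult rho_nonneg[OF e(1)] sum_distrib_right)
   next
    case False
    then show ?thesis by (simp add: rho_eq_0[OF e(1)])
   qed
  qed
  finally show ?thesis unfolding \<gamma>k_def conv_def .
 qed
 define A where "A k = (LBINT y. indicator ?B y * F k y) / b" for k
 define A0 where "A0 = (LBINT y. indicator ?B y * (f y - a \<bullet> y)) / b"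
 define K where "K = 8 * r^2 * (\<tau>^2 * 2 ^ CARD('n) * (LBINT x. (\<gamma> x)^2) + (LBINT x. \<gamma> x)^2 / (\<tau> ^ CARD('n))^2 / b)"
 have step: "(LBINT x. indicator ?B x * (F k x - A k)^2) <= K" for k
 proof -
  have "(LBINT x. indicator ?B x * (F k x - A k)^2)
   <= 8 * r^2 * (\<tau>^2 * 2 ^ CARD('n) * (LBINT x. indicator ?B x * (\<gamma>k k x)^2)
   + (LBINT x. indicator ?B x * \<gamma>k k x)^2 / (\<tau> ^ CARD('n))^2 / b)"
   unfolding A_def b_def by (rule poincare_smooth[OF sF r \<tau> c\<gamma> grad \<gamma>k0])
  also have "... <= K"
   unfolding K_def
  proof (intro mult_left_mono add_mono divide_right_mono power_mono)
   have "(LBINT x. indicator ?B x * (\<gamma>k k x)^2) <= (LBINT x. indicator ?B x * conv (%x. (\<gamma> x)^2) (rho (e k)) x)"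
   proof (rule integral_mono)
    show "integrable lborel (%x. indicator ?B x * (\<gamma>k k x)^2)"
     by (intro integrable_ind_continuous continuous_intros c\<gamma>)
    show "integrable lborel (%x. indicator ?B x * conv (%x. (\<gamma> x)^2) (rho (e k)) x)"
     by (intro integrable_ind mol_L1[OF e(1) \<gamma>2]) simp
    show "indicator ?B x * (\<gamma>k k x)^2 <= indicator ?B x * conv (%x. (\<gamma> x)^2) (rho (e k)) x" for x
     unfolding \<gamma>k_def by (intro mult_left_mono mol_square_le[OF e(1) \<gamma>1 \<gamma>2]) simp
   qed
   also have "... <= (LBINT x. in_ball x0 (r + e k) x * (\<gamma> x)^2)"
    by (rule mol_integral_ball[OF e(1) \<gamma>2]) simp
   also have "... <= (LBINT x. (\<gamma> x)^2)"
    by (intro integral_mono integrable_ind \<gamma>2) (auto simp: indicator_def)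
   finally show "(LBINT x. indicator ?B x * (\<gamma>k k x)^2) <= (LBINT x. (\<gamma> x)^2)" .
   have "(LBINT x. indicator ?B x * \<gamma>k k x) <= (LBINT x. in_ball x0 (r + e k) x * \<gamma> x)"
    unfolding \<gamma>k_def by (rule mol_integral_ball[OF e(1) \<gamma>1 \<gamma>0])
   also have "... <= (LBINT x. \<gamma> x)"
    by (intro integral_mono integrable_ind \<gamma>1) (auto simp: indicator_def \<gamma>0)
   finally show "(LBINT x. indicator ?B x * \<gamma>k k x) <= (LBINT x. \<gamma> x)" .
   show "0 <= (LBINT x. indicator ?B x * \<gamma>k k x)"
    by (intro integral_nonneg) (simp add: \<gamma>k0)
  qed (use b in auto)
  finally show ?thesis .
 qed
 have lc: "continuous_on UNIV (%x. a \<bullet> x)" by (intro continuous_intros)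
 have fa: "integrable lborel (%y. indicator ?B y * (f y - a \<bullet> y))"
  using integrable_diff[OF integrable_ind[OF f(1), of ?B] integrable_ind_continuous[OF lc, of x0 r]]
  by (simp add: right_diff_distrib)
 have iB: "integrable lborel (indicator ?B :: real^'n => real)"
  using emeasure_lborel_ball_finite[of x0 r] by (intro integrable_real_indicator) auto
 define D where "D k = (LBINT x. \<bar>conv f (rho (e k)) x - f x\<bar>)" for k
 have D0: "D k >= 0" for k unfolding D_def by (intro integral_nonneg) simp
 have Dlim: "D \<longlonglongrightarrow> 0" unfolding D_def by (rule mol_tendsto_L1_seq[OF f(1) e(1,3)])
 have mi: "integrable lborel (%x. conv f (rho (e k)) x - f x)" for k
  by (intro integrable_diff mol_L1[OF e(1) f(1)] f(1))
 have AA: "\<bar>A k - A0\<bar> <= D k / b" for k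
 proof -
  have iF: "integrable lborel (%y. indicator ?B y * F k y)"
   by (rule integrable_ind_continuous[OF smooth_continuous[OF sF]])
  have "A k - A0 = ((LBINT y. indicator ?B y * F k y) - (LBINT y. indicator ?B y * (f y - a \<bullet> y))) / b"
   by (simp add: A_def A0_def diff_divide_distrib)
  also have "(LBINT y. indicator ?B y * F k y) - (LBINT y. indicator ?B y * (f y - a \<bullet> y))
   = (LBINT y. indicator ?B y * F k y - indicator ?B y * (f y - a \<bullet> y))"
   by (rule integral_diff[OF iF fa, symmetric])
  also have "... = (LBINT y. indicator ?B y * (conv f (rho (e k)) y - f y))"
   by (simp add: F_def algebra_simps)
  finally have eq: "A k - A0 = (LBINT y. indicator ?B y * (conv f (rho (e k)) y - f y)) / b" .
  have "\<bar>(LBINT y. indicator ?B y * (conv f (rho (e k)) y - f y))\<bar> <= (LBINT y. \<bar>indicator ?B y * (conv f (rho (e k)) y - f y)\<bar>)"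
   by (rule integral_abs_bound)
  also have "... <= D k" unfolding D_def
   by (intro integral_mono integrable_abs integrable_ind mi) (auto simp: indicator_def)
  finally show ?thesis unfolding eq using b by (simp add: divide_right_mono)
 qed
 define fk where "fk k x = indicator ?B x * (F k x - A k)" for k x
 define f0 where "f0 x = indicator ?B x * (f x - a \<bullet> x - A0)" for x
 have fk_int: "integrable lborel (fk k)" for k
  unfolding fk_def by (intro integrable_ind_continuous continuous_intros smooth_continuous[OF sF])
 have f0_int: "integrable lborel f0"
  using integrable_diff[OF fa integrable_mult_left[OF iB, of A0]]
  by (simp add: f0_def[abs_def] right_diff_distrib)
 have diff_bound: "\<bar>fk k x - f0 x\<bar> <= \<bar>conv f (rho (e k)) x - f x\<bar> + indicator ?B x * (D k / b)" for k x
 proof (cases "x \<in> ?B")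
  case True
  then have "fk k x - f0 x = (conv f (rho (e k)) x - f x) - (A k - A0)"
   by (simp add: fk_def f0_def F_def)
  then have "\<bar>fk k x - f0 x\<bar> <= \<bar>conv f (rho (e k)) x - f x\<bar> + \<bar>A k - A0\<bar>"
   by (metis abs_triangle_ineq4)
  then show ?thesis using True AA[of k] by simp
 qed (simp add: fk_def f0_def)
  obtain Z where Z: "!!k. \<bar>A k\<bar> <= Z" 
  proof -
   have "bounded (range D)" using Dlim by (rule convergent_imp_bounded)
   then obtain D1 where D1: "!!k. \<bar>D k\<bar> <= D1" unfolding bounded_iff by auto
   show ?thesis
   proof (rule that[of "\<bar>A0\<bar> + D1 / b"])
    fix k
    have "D k / b <= D1 / b" using D1[of k] b by (intro divide_right_mono) auto
    then show "\<bar>A k\<bar> <= \<bar>A0\<bar> + D1 / b" using AA[of k] by linarith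
   qed
  qed
  have lin: "\<bar>a \<bullet> x\<bar> <= norm a * (norm x0 + r)" if "x \<in> ?B" for x
  proof -
   have "norm x <= norm x0 + r" using that norm_triangle_ineq[of x0 "x - x0"] by (simp add: dist_norm norm_minus_commute)
   then have "norm a * norm x <= norm a * (norm x0 + r)" by (intro mult_left_mono) auto
   then show ?thesis using Cauchy_Schwarz_ineq2[of a x] by linarith
  qed
  have M0: "\<bar>conv f (rho (e k)) x\<bar> <= M" for k x by (rule mol_bounded[OF e(1) f])
 have limit: "(%k. LBINT x. indicator ?B x * (fk k x)^2) \<longlonglongrightarrow> (LBINT x. indicator ?B x * (f0 x)^2)"
 proof (rule L1_to_L2)
  show di: "integrable lborel (%x. fk k x - f0 x)" for k by (intro integrable_diff fk_int f0_int)
  have "(LBINT x. \<bar>fk k x - f0 x\<bar>) <= 2 * D k" for k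
  proof -
   have "(LBINT x. \<bar>fk k x - f0 x\<bar>) <= (LBINT x. \<bar>conv f (rho (e k)) x - f x\<bar> + indicator ?B x * (D k / b))"
    by (intro integral_mono integrable_abs di integrable_add mi integrable_mult_left iB diff_bound)
   also have "... = D k + (LBINT x. indicator ?B x * (D k / b))"
    unfolding D_def by (intro integral_add integrable_abs mi integrable_mult_left iB)
   also have "(LBINT x. indicator ?B x * (D k / b)) = b * (D k / b)"
    by (simp only: integral_mult_left_zero) (simp add: b_def)
   finally show ?thesis using b by simp
  qed
  then show "(%k. LBINT x. \<bar>fk k x - f0 x\<bar>) \<longlonglongrightarrow> 0"
   by (intro Lim_null_comparison[OF _ tendsto_mult_right_zero[OF Dlim, of 2]] always_eventually allI) simp
  show "?B \<in> sets lborel" by simp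
  show bk: "\<bar>fk k x\<bar> <= M + norm a * (norm x0 + r) + Z + \<bar>A0\<bar>" if "x \<in> ?B" for k x
   unfolding fk_def F_def using that lin[OF that] M0[of k x] Z[of k] by simp
  show b0: "\<bar>f0 x\<bar> <= M + norm a * (norm x0 + r) + Z + \<bar>A0\<bar>" if "x \<in> ?B" for x
   unfolding f0_def using that lin[OF that] f(2)[of x] Z[of 0] by simp
  show "integrable lborel (%x. indicator ?B x * (fk k x)^2)" for k
  proof -
   have "(%x. indicator ?B x * (fk k x)^2) = (%x. indicator ?B x * (F k x - A k)^2)" by (auto simp: fk_def indicator_def)
   then show ?thesis by (simp add: integrable_ind_continuous continuous_intros smooth_continuous[OF sF])
  qed
  show "integrable lborel (%x. indicator ?B x * (f0 x)^2)"
  proof (rule integrable_bounded_ball[where a=x0 and R=r and M="(M + norm a * (norm x0 + r) + Z + \<bar>A0\<bar>)^2"])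
   show "\<bar>indicator ?B x * (f0 x)^2\<bar> <= (M + norm a * (norm x0 + r) + Z + \<bar>A0\<bar>)^2" for x
    using power_mono[OF b0, of x 2] by (cases "x \<in> ?B") auto
   show "indicator ?B x * (f0 x)^2 = 0" if "x \<notin> cball x0 r" for x using that by (auto simp: indicator_def)
   have "f0 \<in> borel_fns" using borel_measurable_integrable[OF f0_int] by simp
   then show "(%x. indicator ?B x * (f0 x)^2) \<in> borel_fns"
    by (intro borel_measurable_times borel_measurable_indicator borel_measurable_power) auto
  qed
 qed
 have "(LBINT x. indicator ?B x * (f0 x)^2) <= K"
 proof (rule LIMSEQ_le_const2[OF limit], intro exI allI impI)
  fix k
  have "(%x. indicator ?B x * (fk k x)^2) = (%x. indicator ?B x * (F k x - A k)^2)" by (auto simp: fk_def indicator_def)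
  then show "(LBINT x. indicator ?B x * (fk k x)^2) <= K" using step[of k] by simp
 qed
 moreover have "(%x. indicator ?B x * (f0 x)^2) = (%x. indicator ?B x * (f x - a \<bullet> x - A0)^2)"
  by (auto simp: f0_def indicator_def)
 ultimately show ?thesis unfolding K_def A0_def \<gamma>sq unfolding \<gamma>_def by simp
qed

section \<open>Gehring's lemma\<close>

lemma measure_ball_scale:
 assumes "r >= 0"
 shows "measure lborel (ball (x::real^'n::finite) r) = unit_ball_vol (real CARD('n)) * r ^ CARD('n)"
 using content_ball[OF assms, of x] by simp

text \<open>Averages over small balls converge in \<open>L\<^sup>1\<close>, hence almost everywhere along a subsequence.
 This weak form of Lebesgue's differentiation theorem suffices for stopping-time arguments.\<close>

lemma ball_averages_AE:
 fixes f :: "real^'n::finite => real"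
 assumes f: "integrable lborel f"
 obtains s :: "nat => nat" where "strict_mono s"
  "AE x in lborel. (%k. (LBINT y. in_ball x ((1/2) ^ s k) y * f y)
    / (unit_ball_vol (real CARD('n)) * ((1/2) ^ s k) ^ CARD('n))) \<longlonglongrightarrow> f x"
proof -
 let ?\<omega> = "unit_ball_vol (real CARD('n))"
 have [measurable]: "f \<in> borel_fns" using borel_measurable_integrable[OF f] by simp
 define m where "m k = ?\<omega> * ((1/2) ^ k) ^ CARD('n)" for k :: nat
 have m: "m k > 0" for k unfolding m_def by simp
 define \<eta> where "\<eta> k z = in_ball 0 ((1/2) ^ k) z / m k" for k and z :: "real^'n"
 have \<eta>m: "\<eta> k \<in> borel_fns" for k
  unfolding \<eta>_def[abs_def] by (intro borel_measurable_divide borel_measurable_indicator) simp_all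
 have \<eta>0: "0 <= \<eta> k z" "\<eta> k z <= 1 / m k" for k z using m[of k] unfolding \<eta>_def by (auto simp: indicator_def)
 have \<eta>1: "(NNINT z. ennreal (\<eta> k z)) = 1" for k
 proof -
  have "(NNINT z. ennreal (\<eta> k z)) = (\<integral>\<^sup>+z. ennreal (1 / m k) * in_ball 0 ((1/2) ^ k) z \<partial>(lborel :: (real^'n) measure))"
   by (intro nn_integral_cong) (simp add: \<eta>_def indicator_def)
  also have "... = ennreal (1 / m k) * emeasure lborel (ball (0::real^'n) ((1/2) ^ k))"
   by (rule nn_integral_cmult_indicator) simp
  also have "emeasure lborel (ball (0::real^'n) ((1/2) ^ k)) = ennreal (m k)"
  proof -
   have "emeasure lborel (ball (0::real^'n) ((1/2) ^ k)) = ennreal (measure lborel (ball (0::real^'n) ((1/2) ^ k)))"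
    by (rule emeasure_eq_ennreal_measure) (use emeasure_lborel_ball_finite[of "0::real^'n" "(1/2)^k"] in auto)
   then show ?thesis by (simp add: measure_ball_scale m_def)
  qed
  also have "ennreal (1 / m k) * ennreal (m k) = 1"
   using m[of k] by (simp add: ennreal_mult[symmetric])
  finally show ?thesis .
 qed
 have conv_eq: "conv f (\<eta> k) x = (LBINT y. in_ball x ((1/2) ^ k) y * f y) / m k" for k x
 proof -
  have "conv f (\<eta> k) x = (LBINT y. in_ball x ((1/2) ^ k) y * f y / m k)"
   unfolding conv_def
   by (intro integral_cong refl) (auto simp: \<eta>_def indicator_def dist_norm norm_minus_commute)
  then show ?thesis by simp
 qed
 have small: "\<exists>k0. \<forall>k\<ge>k0. integrable lborel (conv f (\<eta> k)) \<and> (LBINT x. \<bar>conv f (\<eta> k) x - f x\<bar>) <= \<delta>" if \<delta>: "\<delta> > 0" for \<delta>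
 proof -
  obtain e where e: "e > 0" "!!z. norm z < e ==> (LBINT x. \<bar>f (x - z) - f x\<bar>) < \<delta>"
   by (rule L1_translation_continuous[OF f \<delta>]) (rule that)
  obtain k0 where k0: "(1/2::real) ^ k0 < e" using real_arch_pow_inv[OF e(1), of "1/2"] by auto
  show ?thesis
  proof (intro exI[of _ k0] allI impI)
   fix k assume "k0 <= k"
   have sm: "(LBINT x. \<bar>f (x - z) - f x\<bar>) <= \<delta>" if "\<eta> k z ~= 0" for z
   proof -
    have "norm z < (1/2) ^ k" using that by (auto simp: \<eta>_def indicator_def split: if_splits)
    also have "... <= (1/2) ^ k0" using \<open>k0 <= k\<close> by (intro power_decreasing) auto
    finally show ?thesis using e(2)[of z] k0 by simp
   qed
   show "integrable lborel (conv f (\<eta> k)) \<and> (LBINT x. \<bar>conv f (\<eta> k) x - f x\<bar>) <= \<delta>"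
    using approx_identity_L1[OF f \<eta>m \<eta>0 \<eta>1 sm] by blast
  qed
 qed
 obtain k1 where k1: "!!k. k >= k1 ==> integrable lborel (conv f (\<eta> k))" using small[of 1] by auto
 have "(%k. LBINT x. norm (conv f (\<eta> (k + k1)) x - f x)) \<longlonglongrightarrow> 0"
 proof (rule LIMSEQ_I)
  fix \<delta> :: real assume "\<delta> > 0"
  then obtain k0 where k0: "!!k. k >= k0 ==> (LBINT x. \<bar>conv f (\<eta> k) x - f x\<bar>) <= \<delta> / 2"
   using small[of "\<delta> / 2"] by auto
  have nn: "0 <= (LBINT x. \<bar>conv f (\<eta> (k + k1)) x - f x\<bar>)" for k by (rule integral_nonneg) simp
  show "\<exists>no. \<forall>n\<ge>no. norm ((LBINT x. norm (conv f (\<eta> (n + k1)) x - f x)) - 0) < \<delta>"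
  proof (intro exI[of _ k0] allI impI)
   fix k assume "k0 <= k"
   then show "norm ((LBINT x. norm (conv f (\<eta> (k + k1)) x - f x)) - 0) < \<delta>"
    using k0[of "k + k1"] nn[of k] \<open>\<delta> > 0\<close> by simp
  qed
 qed
 then obtain r where r: "strict_mono r" "AE x in lborel. (%k. conv f (\<eta> (r k + k1)) x - f x) \<longlonglongrightarrow> 0"
  using tendsto_L1_AE_subseq[of lborel "%k x. conv f (\<eta> (k + k1)) x - f x"] k1 f by auto
 show ?thesis
 proof (rule that[of "%k. r k + k1"])
  show "strict_mono (%k. r k + k1)" using r(1) by (auto simp: strict_mono_def)
  show "AE x in lborel. (%k. (LBINT y. in_ball x ((1/2) ^ (r k + k1)) y * f y)
    / (unit_ball_vol (real CARD('n)) * ((1/2) ^ (r k + k1)) ^ CARD('n))) \<longlonglongrightarrow> f x"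
   using r(2) unfolding conv_eq m_def by eventually_elim (rule LIM_zero_cancel)
 qed
qed

text \<open>A reverse Hoelder inequality on all balls whose \<open>2\<^sup>a\<close>-fold enlargement lies in \<open>ball 0 \<rho>\<close>. Its right-hand
 side contains the integral of \<open>g\<^sup>2\<close> with a factor that is small enough to be absorbed at a stopping ball.\<close>

locale reverse_hoelder =
 fixes g :: "real^'n::finite => real" and \<rho> A :: real and a n :: nat and \<omega> :: real
 assumes n: "n = CARD('n)" and \<omega>_eq: "\<omega> = unit_ball_vol (real n)" and gm[measurable]: "g \<in> borel_fns" and g0: "!!x. 0 <= g x"
  and g2: "integrable lborel (%x. (g x)^2)" and g_out: "!!x. x \<notin> ball 0 \<rho> ==> g x = 0"
  and \<rho>: "0 < \<rho>" "\<rho> <= 1" and A: "A > 0" and a: "a >= 1"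
  and RH: "!!x r. r > 0 ==> ball x (2 ^ a * r) \<subseteq> ball 0 \<rho> ==>
   (LBINT y. in_ball x r y * (g y)^2)
   <= 1 / (2 * (3 * 2 ^ a) ^ n) * (LBINT y. in_ball x (2 ^ a * r) y * (g y)^2)
    + A / r ^ n * (LBINT y. in_ball x (2 ^ a * r) y * g y)^2"
begin

definition d :: "real^'n => real" where "d x = \<rho> - norm x"

text \<open>Multiplying by a power of the distance to the boundary makes the stopping argument global.\<close>

definition h :: "real^'n => real" where "h x = (if x \<in> ball 0 \<rho> then sqrt (d x) ^ n * g x else 0)"

lemma dm[measurable]: "d \<in> borel_fns" unfolding d_def[abs_def] by measurable

lemma hm[measurable]: "h \<in> borel_fns"
proof -
 have "h = (%x. in_ball 0 \<rho> x * (sqrt (d x) ^ n * g x))"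
  by (auto simp: h_def indicator_def)
 moreover have "(%x. sqrt (d x) ^ n * g x) \<in> borel_fns" by measurable
 ultimately show ?thesis by (simp add: borel_measurable_times borel_measurable_indicator)
qed

lemma h0: "0 <= h x" unfolding h_def d_def using g0 by auto

lemma h_sq: "x \<in> ball 0 \<rho> ==> (h x)^2 = d x ^ n * (g x)^2"
 by (simp add: h_def d_def power_mult_distrib power_commutes flip: power_mult power_even_eq)
  (simp add: power_mult mult.commute[of n 2])

lemma h_out: "x \<notin> ball 0 \<rho> ==> h x = 0" by (simp add: h_def)

lemma h_sq_le: "(h x)^2 <= (g x)^2"
proof (cases "x \<in> ball 0 \<rho>")
 case True
 then have "0 <= d x" by (simp add: d_def)
 moreover have "d x <= 1" using \<rho> norm_ge_zero[of x] unfolding d_def by linarith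
 ultimately have "d x ^ n <= 1" by (intro power_le_one) auto
 then have "d x ^ n * (g x)^2 <= 1 * (g x)^2" by (intro mult_right_mono) auto
 then show ?thesis using h_sq[OF True] by simp
qed (simp add: h_out)

lemma h2: "integrable lborel (%x. (h x)^2)"
 by (rule integrable_bound[OF g2]) (use h_sq_le in auto)

lemma g1: "integrable lborel g" by (rule square_integrable_ball[OF gm g2 g_out])
lemma h1: "integrable lborel h" by (rule square_integrable_ball[OF hm h2 h_out])

lemma d_compare:
 assumes "x \<in> ball 0 \<rho>" "r <= d x / 2" "y \<in> ball x r"
 shows "y \<in> ball 0 \<rho>" "d x / 2 <= d y" "d y <= 3 / 2 * d x" "d x > 0"
proof -
 have "norm y <= norm x + norm (y - x)" "norm x <= norm y + norm (y - x)"
  using norm_triangle_ineq[of x "y - x"] norm_triangle_ineq[of y "x - y"] by (simp_all add: norm_minus_commute)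
 moreover have "norm (y - x) < r" using assms(3) by (simp add: dist_norm norm_minus_commute)
 ultimately show "d x / 2 <= d y" "d y <= 3 / 2 * d x" using assms unfolding d_def by simp_all
 show "d x > 0" using assms(1) by (simp add: d_def)
 then have "d y > 0" using \<open>d x / 2 <= d y\<close> by simp
 then show "y \<in> ball 0 \<rho>" by (simp add: d_def)
qed

text \<open>On balls that stay away from the boundary by half their distance, \<open>h\<close> and \<open>g\<close> are comparable up to the
 factor \<open>d\<^bsup>n/2\<^esup>\<close>, which varies by a bounded ratio only.\<close>

lemma h_ball_upper:
 assumes "x \<in> ball 0 \<rho>" "r <= d x / 2"
 shows "(LBINT y. in_ball x r y * (h y)^2)
  <= (3 / 2 * d x) ^ n * (LBINT y. in_ball x r y * (g y)^2)"
proof -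
 have "(LBINT y. in_ball x r y * (h y)^2)
  <= (LBINT y. (3 / 2 * d x) ^ n * (in_ball x r y * (g y)^2))"
 proof (rule integral_mono)
  show "in_ball x r y * (h y)^2 <= (3 / 2 * d x) ^ n * (in_ball x r y * (g y)^2)" for y
  proof (cases "y \<in> ball x r")
   case True
   note c = d_compare[OF assms True]
   have "d y ^ n <= (3 / 2 * d x) ^ n" using c by (intro power_mono) auto
   then show ?thesis using True h_sq[OF c(1)] by (simp add: mult_right_mono)
  qed simp
  show "integrable lborel (%y. in_ball x r y * (h y)^2)" by (intro integrable_ind h2) simp
  show "integrable lborel (%y. (3 / 2 * d x) ^ n * (in_ball x r y * (g y)^2))"
   by (intro integrable_mult_right integrable_ind g2) simp
 qed
 then show ?thesis by simp
qed

lemma h_ball_lower: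
 assumes "x \<in> ball 0 \<rho>" "r <= d x / 2"
 shows "(d x / 2) ^ n * (LBINT y. in_ball x r y * (g y)^2) <= (LBINT y. in_ball x r y * (h y)^2)"
  and "(d x / 2) ^ n * (LBINT y. in_ball x r y * g y)^2 <= (LBINT y. in_ball x r y * h y)^2"
proof -
 have "(LBINT y. (d x / 2) ^ n * (in_ball x r y * (g y)^2)) <= (LBINT y. in_ball x r y * (h y)^2)"
 proof (rule integral_mono)
  show "(d x / 2) ^ n * (in_ball x r y * (g y)^2) <= in_ball x r y * (h y)^2" for y
  proof (cases "y \<in> ball x r")
   case True
   note c = d_compare[OF assms True]
   have "(d x / 2) ^ n <= d y ^ n" using c by (intro power_mono) auto
   then show ?thesis using True h_sq[OF c(1)] by (simp add: mult_right_mono)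
  qed simp
  show "integrable lborel (%y. in_ball x r y * (h y)^2)" by (intro integrable_ind h2) simp
  show "integrable lborel (%y. (d x / 2) ^ n * (in_ball x r y * (g y)^2))"
   by (intro integrable_mult_right integrable_ind g2) simp
 qed
 then show "(d x / 2) ^ n * (LBINT y. in_ball x r y * (g y)^2) <= (LBINT y. in_ball x r y * (h y)^2)" by simp
 have dx: "d x > 0" using assms(1) by (simp add: d_def)
 have "(LBINT y. sqrt (d x / 2) ^ n * (in_ball x r y * g y)) <= (LBINT y. in_ball x r y * h y)"
 proof (rule integral_mono)
  show "sqrt (d x / 2) ^ n * (in_ball x r y * g y) <= in_ball x r y * h y" for y
  proof (cases "y \<in> ball x r")
   case True
   note c = d_compare[OF assms True]
   have "sqrt (d x / 2) ^ n <= sqrt (d y) ^ n" using c by (intro power_mono) auto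
   then show ?thesis using True c(1) g0[of y] by (simp add: h_def mult_right_mono)
  qed simp
  show "integrable lborel (%y. in_ball x r y * h y)" by (intro integrable_ind h1) simp
  show "integrable lborel (%y. sqrt (d x / 2) ^ n * (in_ball x r y * g y))"
   by (intro integrable_mult_right integrable_ind g1) simp
 qed
 then have "sqrt (d x / 2) ^ n * (LBINT y. in_ball x r y * g y) <= (LBINT y. in_ball x r y * h y)" by simp
 then have "(sqrt (d x / 2) ^ n * (LBINT y. in_ball x r y * g y))^2 <= (LBINT y. in_ball x r y * h y)^2"
  using dx by (intro power_mono mult_nonneg_nonneg integral_nonneg) (auto simp: g0)
 moreover have "(sqrt (d x / 2) ^ n)^2 = (d x / 2) ^ n"
  using dx by (simp add: power_mult[symmetric] mult.commute[of n 2] del: real_sqrt_divide) (simp add: power_mult del: real_sqrt_divide)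
 ultimately show "(d x / 2) ^ n * (LBINT y. in_ball x r y * g y)^2 <= (LBINT y. in_ball x r y * h y)^2"
  by (simp add: power_mult_distrib)
qed

text \<open>The distance to the boundary varies by a factor of \<open>3\<close> at most, which explains the factor \<open>3\<^sup>n\<close> in the small constant
 of the reverse Hoelder inequality.\<close>

lemma RH_h:
 assumes x: "x \<in> ball 0 \<rho>" and s: "s > 0" "2 ^ a * s <= d x / 2"
 shows "(LBINT y. in_ball x s y * (h y)^2)
  <= 1 / (2 * 2 ^ (a * n)) * (LBINT y. in_ball x (2 ^ a * s) y * (h y)^2)
   + 3 ^ n * A / s ^ n * (LBINT y. in_ball x (2 ^ a * s) y * h y)^2"
proof -
 define D where "D = d x"
 have D: "D > 0" using x by (simp add: D_def d_def)
 define G2 H2 G1 H1 where "G2 = (LBINT y. in_ball x (2 ^ a * s) y * (g y)^2)"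
  and "H2 = (LBINT y. in_ball x (2 ^ a * s) y * (h y)^2)"
  and "G1 = (LBINT y. in_ball x (2 ^ a * s) y * g y)"
  and "H1 = (LBINT y. in_ball x (2 ^ a * s) y * h y)"
 have sub: "ball x (2 ^ a * s) \<subseteq> ball 0 \<rho>" using d_compare(1)[OF x s(2)] by blast
 have "1 * s <= 2 ^ a * s" using s(1) by (intro mult_right_mono) auto
 then have s': "s <= d x / 2" using s(2) by simp
 have "(LBINT y. in_ball x s y * (h y)^2) <= (3 / 2 * D) ^ n * (LBINT y. in_ball x s y * (g y)^2)"
  unfolding D_def by (rule h_ball_upper[OF x s'])
 also have "... <= (3 / 2 * D) ^ n * (1 / (2 * (3 * 2 ^ a) ^ n) * G2 + A / s ^ n * G1^2)"
  unfolding G2_def G1_def using D by (intro mult_left_mono RH[OF s(1) sub]) auto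
 also have "... = 1 / (2 * 2 ^ (a * n)) * ((D / 2) ^ n * G2) + 3 ^ n * A / s ^ n * ((D / 2) ^ n * G1^2)"
  by (simp add: power_mult_distrib power_divide power_mult field_simps)
 also have "... <= 1 / (2 * 2 ^ (a * n)) * H2 + 3 ^ n * A / s ^ n * H1^2"
  unfolding D_def G2_def H2_def G1_def H1_def using A s(1)
  by (intro add_mono mult_left_mono h_ball_lower[OF x s(2)]) auto
 finally show ?thesis unfolding H2_def H1_def .
qed

abbreviation K :: real where "K \<equiv> 2 ^ a"
abbreviation J :: real where "J \<equiv> 2 ^ (a + 3)"

definition c1 :: real where "c1 = sqrt (\<omega> / (2 * 3 ^ n * A))"
definition \<theta> :: real where "\<theta> = min 1 (c1 / (2 * \<omega> * K ^ n))"
definition C2 :: real where "C2 = 2 * \<omega> * J ^ n / c1"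
definition C3 :: real where "C3 = (3 * J) ^ n / \<omega>"

lemma \<omega>: "\<omega> > 0" by (simp add: \<omega>_eq)

lemma ball_measure: "r >= 0 ==> measure lborel (ball (x::real^'n) r) = \<omega> * r ^ n"
 unfolding \<omega>_eq n by (rule measure_ball_scale)

lemma c1: "c1 > 0" unfolding c1_def using \<omega> A by simp
lemma \<theta>: "0 < \<theta>" "\<theta> <= 1" unfolding \<theta>_def using c1 \<omega> by auto
lemma C2: "C2 > 0" unfolding C2_def using c1 \<omega> by simp
lemma C3: "C3 > 0" unfolding C3_def using \<omega> by simp

abbreviation I0 :: real where "I0 \<equiv> (LBINT y. (g y)^2)"

text \<open>Among the dyadic radii at which the mean of \<open>h\<^sup>2\<close> exceeds \<open>\<mu>\<^sup>2\<close>, take the largest one that leaves room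
 for the enlargement by \<open>J\<close>. On larger balls the mean is at most \<open>\<mu>\<^sup>2\<close>: either by maximality, or because the
 radius is comparable to the distance \<open>d x\<close> from the boundary; in the latter case the weight in \<open>h\<close> cancels the
 volume of the ball, and \<open>C3 * I0 <= \<mu>^2\<close> applies.\<close>

lemma stopping_ball:
 assumes x: "x \<in> ball 0 \<rho>" and lam: "\<mu> > 0" "C3 * I0 <= \<mu>^2"
  and k1: "\<mu>^2 * \<omega> * ((1/2) ^ k1) ^ n < (LBINT y. in_ball x ((1/2) ^ k1) y * (h y)^2)" "J * (1/2) ^ k1 <= d x / 2"
 obtains s where "0 < s" "s <= 1" "J * s <= d x / 2"
  "\<mu>^2 * \<omega> * s ^ n < (LBINT y. in_ball x s y * (h y)^2)"
  "!!i. 1 <= i ==> i <= a + 3 ==> (LBINT y. in_ball x (2 ^ i * s) y * (h y)^2) <= \<mu>^2 * \<omega> * (2 ^ i * s) ^ n"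
proof -
 define P where "P k \<longleftrightarrow> \<mu>^2 * \<omega> * ((1/2) ^ k) ^ n < (LBINT y. in_ball x ((1/2) ^ k) y * (h y)^2) \<and> J * (1/2) ^ k <= d x / 2" for k :: nat
 \<comment> \<open>the largest admissible radius has the least exponent\<close>
 define k where "k = (LEAST k. P k)"
 have "P k1" unfolding P_def using k1 by blast
 then have Pk: "P k" unfolding k_def by (rule LeastI)
 have min: "\<not> P j" if "j < k" for j using that unfolding k_def by (rule not_less_Least)
 define s where "s = (1/2::real) ^ k"
 have s: "s > 0" "s <= 1" unfolding s_def by (auto intro: power_le_one)
 have "d x > 0" using x by (simp add: d_def)
 moreover have "d x <= 1" using \<rho> norm_ge_zero[of x] unfolding d_def by linarith
 ultimately have dx: "d x > 0" "d x <= 1" by auto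
 show ?thesis
 proof (rule that[OF s])
  show "J * s <= d x / 2" "\<mu>^2 * \<omega> * s ^ n < (LBINT y. in_ball x s y * (h y)^2)"
   using Pk unfolding P_def s_def by auto
  fix i :: nat assume i: "1 <= i" "i <= a + 3"
  have le: "2 ^ i * s <= J * s" using i(2) s(1) by (intro mult_right_mono power_increasing) auto
  then have le': "2 ^ i * s <= d x / 2" using \<open>J * s <= d x / 2\<close> by simp
  have "i <= k"
  proof (rule ccontr)
   assume "\<not> i <= k"
   then have "(2::real) ^ k <= 2 ^ i" by (intro power_increasing) auto
   then have "1 <= 2 ^ i * s" unfolding s_def by (simp add: power_one_over field_simps)
   then show False using le' dx by simp
  qed
  then have e: "2 ^ i * s = (1/2) ^ (k - i)"
   unfolding s_def by (simp add: power_one_over power_diff)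
  show "(LBINT y. in_ball x (2 ^ i * s) y * (h y)^2) <= \<mu>^2 * \<omega> * (2 ^ i * s) ^ n"
  proof (cases "J * (2 ^ i * s) <= d x / 2")
   case True
   have "\<not> P (k - i)" using i(1) \<open>i <= k\<close> by (intro min) simp
   then show ?thesis using True unfolding P_def e[symmetric] by simp
  next
   case False
   have "(LBINT y. in_ball x (2 ^ i * s) y * (h y)^2) <= (3 / 2 * d x) ^ n * (LBINT y. in_ball x (2 ^ i * s) y * (g y)^2)"
    by (rule h_ball_upper[OF x le'])
   also have "... <= (3 / 2 * d x) ^ n * I0"
    using dx by (intro mult_left_mono integral_mono integrable_ind g2) (auto simp: indicator_def)
   also have "... <= (3 * J * (2 ^ i * s)) ^ n * I0"
   proof (intro mult_right_mono power_mono integral_nonneg)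
    have "d x <= 2 * (J * (2 ^ i * s))" using False by linarith
    then show "3 / 2 * d x <= 3 * J * (2 ^ i * s)" by (simp only: mult.assoc)
   qed (use dx in auto)
   also have "... = C3 * I0 * \<omega> * (2 ^ i * s) ^ n"
    using \<omega> unfolding C3_def by (simp add: power_mult_distrib field_simps)
   also have "... <= \<mu>^2 * \<omega> * (2 ^ i * s) ^ n"
    using lam(2) \<omega> s(1) by (intro mult_right_mono) auto
   finally show ?thesis .
  qed
 qed
qed

text \<open>At a stopping ball the small term of the reverse Hoelder inequality is at most half the left-hand side, so
 that \<open>\<mu>\<close> is bounded by a multiple of the mean of \<open>h\<close>. The part where \<open>h \<le> \<theta> \<mu>\<close> contributes at most half
 of that mean and is discarded.\<close>

lemma stopping_estimate:
 assumes x: "x \<in> ball 0 \<rho>" and lam: "\<mu> > 0"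
  and s: "s > 0" "J * s <= d x / 2"
  and big: "\<mu>^2 * \<omega> * s ^ n < (LBINT y. in_ball x s y * (h y)^2)"
  and small: "(LBINT y. in_ball x (K * s) y * (h y)^2) <= \<mu>^2 * \<omega> * (K * s) ^ n"
   "(LBINT y. in_ball x (J * s) y * (h y)^2) <= \<mu>^2 * \<omega> * (J * s) ^ n"
 shows "(LBINT y. in_ball x (J * s) y * (h y)^2)
  <= C2 * \<mu> * (LBINT y. in_ball x (K * s) y * (indicator {y. \<theta> * \<mu> < h y} y * h y))"
proof -
 define H1 where "H1 = (LBINT y. in_ball x (K * s) y * h y)"
 define H1' where "H1' = (LBINT y. in_ball x (K * s) y * (indicator {y. \<theta> * \<mu> < h y} y * h y))"
 have H10: "H1 >= 0" unfolding H1_def by (intro integral_nonneg) (simp add: h0)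
 have "K * s <= J * s" using s(1) by (intro mult_right_mono power_increasing) auto
 then have Ks: "K * s <= d x / 2" using s(2) by simp
 have "\<mu>^2 * \<omega> * s ^ n < 1 / (2 * 2 ^ (a * n)) * (\<mu>^2 * \<omega> * (K * s) ^ n) + 3 ^ n * A / s ^ n * H1^2"
  using big RH_h[OF x s(1) Ks] mult_left_mono[OF small(1), of "1 / (2 * 2 ^ (a * n))"] unfolding H1_def by simp
 also have "1 / (2 * 2 ^ (a * n)) * (\<mu>^2 * \<omega> * (K * s) ^ n) = \<mu>^2 * \<omega> * s ^ n / 2"
  by (simp add: power_mult_distrib power_mult)
 finally have "\<mu>^2 * \<omega> * s ^ n / 2 < 3 ^ n * A / s ^ n * H1^2" by linarith
 then have "\<mu>^2 * \<omega> * s ^ n * s ^ n < 2 * 3 ^ n * A * H1^2"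
  using s(1) by (simp add: field_simps)
 then have "\<mu>^2 * (\<omega> / (2 * 3 ^ n * A)) * (s ^ n)^2 < H1^2"
  using A by (simp add: field_simps power2_eq_square)
 also have "\<mu>^2 * (\<omega> / (2 * 3 ^ n * A)) * (s ^ n)^2 = (c1 * \<mu> * s ^ n)^2"
  unfolding c1_def using A \<omega> by (simp add: power_mult_distrib del: real_sqrt_divide)
 finally have H1: "c1 * \<mu> * s ^ n < H1" using H10 by (rule power_less_imp_less_base)
 have bi: "integrable lborel (%y. in_ball x (K * s) y * (\<theta> * \<mu>))"
  using emeasure_lborel_ball_finite[of x "K * s"] by (intro integrable_mult_left integrable_real_indicator) auto
 have h1': "integrable lborel (%y. indicator {y. \<theta> * \<mu> < h y} y * h y)" by (intro integrable_ind h1) measurable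
 have i2: "integrable lborel (%y. in_ball x (K * s) y * (indicator {y. \<theta> * \<mu> < h y} y * h y))"
  by (intro integrable_ind h1') simp
 have "H1 <= (LBINT y. in_ball x (K * s) y * (\<theta> * \<mu>) + in_ball x (K * s) y * (indicator {y. \<theta> * \<mu> < h y} y * h y))"
  unfolding H1_def
 proof (rule integral_mono)
  show "integrable lborel (%y. in_ball x (K * s) y * h y)" by (intro integrable_ind h1) simp
  show "in_ball x (K * s) y * h y <= in_ball x (K * s) y * (\<theta> * \<mu>) + in_ball x (K * s) y * (indicator {y. \<theta> * \<mu> < h y} y * h y)" for y
   using \<theta>(1) lam by (auto simp: indicator_def)
 qed (intro integrable_add bi i2)
 also have "... = (LBINT y. in_ball x (K * s) y * (\<theta> * \<mu>)) + H1'"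
  unfolding H1'_def by (rule integral_add[OF bi i2])
 also have "(LBINT y. in_ball x (K * s) y * (\<theta> * \<mu>)) = \<omega> * (K * s) ^ n * (\<theta> * \<mu>)"
  using ball_measure[of "K * s" x] s(1) by (simp only: integral_mult_left_zero) simp
 also have "\<omega> * (K * s) ^ n * (\<theta> * \<mu>) <= c1 / 2 * \<mu> * s ^ n"
 proof -
  have "\<theta> <= c1 / (2 * \<omega> * K ^ n)" unfolding \<theta>_def by simp
  then have "\<omega> * (K * s) ^ n * \<mu> * \<theta> <= \<omega> * (K * s) ^ n * \<mu> * (c1 / (2 * \<omega> * K ^ n))"
   using \<omega> s(1) lam by (intro mult_left_mono) auto
  also have "... = c1 / 2 * \<mu> * s ^ n" using \<omega> by (simp add: power_mult_distrib field_simps)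
  finally show ?thesis by (simp add: mult_ac)
 qed
 finally have "c1 / 2 * \<mu> * s ^ n <= H1'" using H1 by simp
 then have key: "\<mu> * s ^ n <= 2 / c1 * H1'" using c1 by (simp add: field_simps)
 have "(LBINT y. in_ball x (J * s) y * (h y)^2) <= \<mu> * \<omega> * J ^ n * (\<mu> * s ^ n)"
  using small(2) by (simp add: power_mult_distrib power2_eq_square mult_ac)
 also have "... <= \<mu> * \<omega> * J ^ n * (2 / c1 * H1')"
  using lam \<omega> by (intro mult_left_mono key) auto
 also have "... = C2 * \<mu> * H1'" unfolding C2_def by simp
 finally show ?thesis unfolding H1'_def .
qed

end

context reverse_hoelder begin

text \<open>Points at which arbitrarily small dyadic balls have a mean of \<open>h\<^sup>2\<close> above \<open>\<mu>\<^sup>2\<close> for each level \<open>\<mu> < h x\<close>. Lebesgue's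
 theorem along a subsequence of radii gives this almost everywhere.\<close>

definition good :: "real^'n => bool" where
 "good x \<longleftrightarrow> (\<forall>\<mu>>0. \<mu> < h x --> (\<forall>k0. \<exists>k\<ge>k0.
  \<mu>^2 * \<omega> * ((1/2) ^ k) ^ n < (LBINT y. in_ball x ((1/2) ^ k) y * (h y)^2)))"

lemma AE_good: "AE x in lborel. good x"
proof -
 obtain s where s: "strict_mono s"
  "AE x in lborel. (%k. (LBINT y. in_ball x ((1/2) ^ s k) y * (h y)^2)
    / (unit_ball_vol (real CARD('n)) * ((1/2) ^ s k) ^ CARD('n))) \<longlonglongrightarrow> (h x)^2"
  by (rule ball_averages_AE[OF h2]) (rule that)
 from s(2) show ?thesis
 proof eventually_elim
  case (elim x)
  show ?case unfolding good_def
  proof (intro allI impI)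
   fix \<mu> :: real and k0 :: nat assume \<mu>: "0 < \<mu>" "\<mu> < h x"
   have "\<mu>^2 < (h x)^2" using \<mu> by (intro power_strict_mono) auto
   then have "\<forall>\<^sub>F k in sequentially. \<mu>^2 < (LBINT y. in_ball x ((1/2) ^ s k) y * (h y)^2)
    / (unit_ball_vol (real CARD('n)) * ((1/2) ^ s k) ^ CARD('n))"
    using elim by (intro order_tendstoD)
   then obtain k1 where k1: "!!k. k >= k1 ==> \<mu>^2 < (LBINT y. in_ball x ((1/2) ^ s k) y * (h y)^2)
    / (unit_ball_vol (real CARD('n)) * ((1/2) ^ s k) ^ CARD('n))"
    unfolding eventually_sequentially by blast
   define k where "k = max k0 k1"
   have "k0 <= s k" using seq_suble[OF s(1), of k] by (simp add: k_def)
   moreover have "\<mu>^2 < (LBINT y. in_ball x ((1/2) ^ s k) y * (h y)^2) / (\<omega> * ((1/2) ^ s k) ^ n)"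
    using k1[of k] unfolding \<omega>_eq n by (simp add: k_def)
   then have "\<mu>^2 * \<omega> * ((1/2) ^ s k) ^ n < (LBINT y. in_ball x ((1/2) ^ s k) y * (h y)^2)"
    using \<omega> by (simp add: pos_less_divide_eq mult.assoc)
   ultimately show "\<exists>k\<ge>k0. \<mu>^2 * \<omega> * ((1/2) ^ k) ^ n < (LBINT y. in_ball x ((1/2) ^ k) y * (h y)^2)"
    by blast
  qed
 qed
qed

text \<open>The superlevel set of \<open>h\<close> is covered by stopping balls; Vitali's lemma selects disjoint ones whose
 enlargements still cover. Summing the stopping estimate over them costs nothing on the right, where the
 balls are disjoint.\<close>

lemma good_lambda:
 assumes \<mu>: "\<mu> > 0" "C3 * I0 <= \<mu>^2"
 shows "(NNINT x. indicator {x. \<mu> < h x} x * ennreal ((h x)^2))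
  <= ennreal (C2 * \<mu>) * (NNINT x. indicator {x. \<theta> * \<mu> < h x} x * ennreal (h x))"
proof -
 define m2 where "m2 = density lborel (%x. ennreal ((h x)^2))"
 define m1 where "m1 = density lborel (%x. ennreal (indicator {x. \<theta> * \<mu> < h x} x * h x))"
 have sets[simp]: "sets m1 = sets borel" "sets m2 = sets borel" unfolding m1_def m2_def by auto
 have h1': "integrable lborel (%y. indicator {y. \<theta> * \<mu> < h y} y * h y)" by (intro integrable_ind h1) measurable
 have hm': "(%x. ennreal (indicator {x. \<theta> * \<mu> < h x} x * h x)) \<in> borel_measurable lborel" by measurable
 have m2e: "emeasure m2 B = ennreal (LBINT y. indicator B y * (h y)^2)" if B: "B \<in> sets borel" for B
 proof -
  have "emeasure m2 B = (NNINT y. ennreal ((h y)^2) * indicator B y)"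
   unfolding m2_def using B by (intro emeasure_density) auto
  also have "... = (NNINT y. ennreal (indicator B y * (h y)^2))"
   by (intro nn_integral_cong) (simp add: indicator_def)
  also have "... = ennreal (LBINT y. indicator B y * (h y)^2)"
   using B by (intro nn_integral_eq_integral integrable_ind h2) auto
  finally show ?thesis .
 qed
 have m1e: "emeasure m1 B = ennreal (LBINT y. indicator B y * (indicator {y. \<theta> * \<mu> < h y} y * h y))" if B: "B \<in> sets borel" for B
 proof -
  have "emeasure m1 B = (NNINT y. ennreal (indicator {x. \<theta> * \<mu> < h x} y * h y) * indicator B y)"
   unfolding m1_def using B hm' by (intro emeasure_density) auto
  also have "... = (NNINT y. ennreal (indicator B y * (indicator {y. \<theta> * \<mu> < h y} y * h y)))"
   by (intro nn_integral_cong) (simp add: indicator_def)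
  also have "... = ennreal (LBINT y. indicator B y * (indicator {y. \<theta> * \<mu> < h y} y * h y))"
   using B by (intro nn_integral_eq_integral integrable_ind h1') (auto simp: h0)
  finally show ?thesis .
 qed
 define E where "E = {x. \<mu> < h x \<and> good x}"
 have ex: "\<exists>s. 0 < s \<and> s <= 1 \<and> emeasure m2 (ball x (J * s)) <= ennreal (C2 * \<mu>) * emeasure m1 (ball x (K * s))"
  if x: "x \<in> E" for x
 proof -
  have xD: "x \<in> ball 0 \<rho>" using x h_out[of x] \<mu>(1) unfolding E_def by force
  have dx: "d x > 0" using xD by (simp add: d_def)
  obtain k0 where k0: "(1/2::real) ^ k0 < d x / (2 * J)"
   using real_arch_pow_inv[of "d x / (2 * J)" "1/2"] dx by auto
  obtain k1 where k1: "k1 >= k0"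
   "\<mu>^2 * \<omega> * ((1/2) ^ k1) ^ n < (LBINT y. in_ball x ((1/2) ^ k1) y * (h y)^2)"
   using x \<mu>(1) unfolding E_def good_def by blast
  have "(1/2::real) ^ k1 <= (1/2) ^ k0" using k1(1) by (intro power_decreasing) auto
  then have "(1/2::real) ^ k1 <= d x / (2 * J)" using k0 by linarith
  then have Jk: "J * (1/2) ^ k1 <= d x / 2" by (simp add: field_simps)
  obtain s where s: "0 < s" "s <= 1" "J * s <= d x / 2"
   "\<mu>^2 * \<omega> * s ^ n < (LBINT y. in_ball x s y * (h y)^2)"
   "!!i. 1 <= i ==> i <= a + 3 ==> (LBINT y. in_ball x (2 ^ i * s) y * (h y)^2) <= \<mu>^2 * \<omega> * (2 ^ i * s) ^ n"
   by (rule stopping_ball[OF xD \<mu> k1(2) Jk]) (rule that)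
  have sK: "(LBINT y. in_ball x (K * s) y * (h y)^2) <= \<mu>^2 * \<omega> * (K * s) ^ n"
   by (rule s(5)) (use a in auto)
  have sJ: "(LBINT y. in_ball x (J * s) y * (h y)^2) <= \<mu>^2 * \<omega> * (J * s) ^ n"
   by (rule s(5)) auto
  have "emeasure m2 (ball x (J * s)) <= ennreal (C2 * \<mu> * (LBINT y. in_ball x (K * s) y * (indicator {y. \<theta> * \<mu> < h y} y * h y)))"
   unfolding m2e[OF borel_open[OF open_ball]]
   by (intro ennreal_leI stopping_estimate[OF xD \<mu>(1) s(1,3,4) sK sJ])
  also have "... = ennreal (C2 * \<mu>) * emeasure m1 (ball x (K * s))"
   unfolding m1e[OF borel_open[OF open_ball]] using C2 \<mu>(1)
   by (intro ennreal_mult integral_nonneg) (auto simp: h0)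
  finally show ?thesis using s(1,2) by blast
 qed
 then obtain sr where sr: "!!x. x \<in> E ==> 0 < sr x" "!!x. x \<in> E ==> sr x <= 1"
  "!!x. x \<in> E ==> emeasure m2 (ball x (J * sr x)) <= ennreal (C2 * \<mu>) * emeasure m1 (ball x (K * sr x))"
  by metis
 have rad: "0 < K * sr x \<and> K * sr x <= K" if "x \<in> E" for x
  using sr(1,2)[OF that] by (auto intro: mult_left_le)
 have cov: "E \<subseteq> (\<Union>x\<in>E. ball x (K * sr x))" using rad by force
 obtain C where C: "countable C" "C \<subseteq> E"
  "pairwise (%i j. disjnt (ball i (K * sr i)) (ball j (K * sr j))) C" "E \<subseteq> (\<Union>i\<in>C. ball i (5 * (K * sr i)))"
  by (rule Vitali_covering_lemma_balls[where S=E and K=E and a="%x. x" and r="%x. K * sr x" and B=K]) (use rad that in auto)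
 define sel where "sel k = {c \<in> C. to_nat_on C c = k}" for k
 have sel1: "sel k = {} \<or> (\<exists>c\<in>C. sel k = {c})" for k
 proof (cases "sel k = {}")
  case False
  then obtain c where "c \<in> C" "to_nat_on C c = k" unfolding sel_def by blast
  then have "sel k = {c}" unfolding sel_def using inj_on_to_nat_on[OF C(1)] by (auto simp: inj_on_def)
  then show ?thesis using \<open>c \<in> C\<close> by blast
 qed simp
 define BJ where "BJ k = (\<Union>c\<in>sel k. ball c (J * sr c))" for k
 define BK where "BK k = (\<Union>c\<in>sel k. ball c (K * sr c))" for k
 have Bm: "BJ k \<in> sets borel" "BK k \<in> sets borel" for k unfolding BJ_def BK_def by (auto intro!: borel_open)
 have BB: "emeasure m2 (BJ k) <= ennreal (C2 * \<mu>) * emeasure m1 (BK k)" for k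
  using sel1[of k]
 proof
  assume "sel k = {}" then show ?thesis by (simp add: BJ_def)
 next
  assume "\<exists>c\<in>C. sel k = {c}"
  then obtain c where "c \<in> C" "sel k = {c}" by blast
  then show ?thesis using sr(3)[of c] C(2) by (auto simp: BJ_def BK_def)
 qed
 have disj: "disjoint_family BK"
  unfolding disjoint_family_on_def
 proof (intro ballI impI)
  fix k l :: nat assume "k ~= l"
  show "BK k \<inter> BK l = {}"
  proof (rule ccontr)
   assume "BK k \<inter> BK l ~= {}"
   then obtain c c' z where "c \<in> sel k" "c' \<in> sel l" "z \<in> ball c (K * sr c)" "z \<in> ball c' (K * sr c')"
    unfolding BK_def by blast
   moreover then have "c ~= c'" "c \<in> C" "c' \<in> C" using \<open>k ~= l\<close> unfolding sel_def by auto
   ultimately show False using C(3) unfolding pairwise_def disjnt_def by blast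
  qed
 qed
 have EJ: "E \<subseteq> (\<Union>k. BJ k)"
 proof
  fix x assume "x \<in> E"
  then obtain c where c: "c \<in> C" "x \<in> ball c (5 * (K * sr c))" using C(4) by blast
  have "5 * (K * sr c) <= J * sr c" using sr(1)[of c] c(1) C(2) by (auto simp: power_add)
  then have "x \<in> ball c (J * sr c)" using c(2) by simp
  moreover have "c \<in> sel (to_nat_on C c)" using c(1) by (simp add: sel_def)
  ultimately show "x \<in> (\<Union>k. BJ k)" unfolding BJ_def by blast
 qed
 have "(NNINT x. indicator {x. \<mu> < h x} x * ennreal ((h x)^2))
   <= (NNINT x. ennreal ((h x)^2) * indicator (\<Union>k. BJ k) x)"
 proof (rule nn_integral_mono_AE)
  show "AE x in lborel. indicator {x. \<mu> < h x} x * ennreal ((h x)^2) <= ennreal ((h x)^2) * indicator (\<Union>k. BJ k) x"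
   using AE_good
  proof eventually_elim
   case (elim x)
   have "x \<in> (\<Union>k. BJ k)" if "\<mu> < h x" using EJ elim that unfolding E_def by blast
   then show ?case by (auto simp: indicator_def)
  qed
 qed
 also have "... = emeasure m2 (\<Union>k. BJ k)"
  unfolding m2_def using Bm by (intro emeasure_density[symmetric]) auto
 also have "... <= (\<Sum>k. emeasure m2 (BJ k))"
  by (intro emeasure_subadditive_countably) (use Bm in auto)
 also have "... <= (\<Sum>k. ennreal (C2 * \<mu>) * emeasure m1 (BK k))"
  by (intro suminf_le BB) auto
 also have "... = ennreal (C2 * \<mu>) * (\<Sum>k. emeasure m1 (BK k))"
  by (rule ennreal_suminf_cmult)
 also have "(\<Sum>k. emeasure m1 (BK k)) = emeasure m1 (\<Union>k. BK k)"
  by (intro suminf_emeasure disj) (use Bm in auto)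
 also have "... <= emeasure m1 (space m1)"
  by (rule emeasure_space)
 also have "... = (NNINT x. ennreal (indicator {x. \<theta> * \<mu> < h x} x * h x))"
  unfolding m1_def by (subst emeasure_density[OF hm']) (auto intro!: nn_integral_cong simp: indicator_def)
 also have "... = (NNINT x. indicator {x. \<theta> * \<mu> < h x} x * ennreal (h x))"
  by (intro nn_integral_cong) (simp add: indicator_def)
 finally show ?thesis by (simp add: mult_left_mono)
qed

text \<open>Integrating the level set estimate against \<open>\<delta> \<mu>\<^bsup>\<delta>-1\<^esup> d\<mu>\<close>. Truncation at height \<open>N\<close> makes
 the integrals finite, so that for small \<open>\<delta>\<close> the right-hand side can be absorbed.\<close>

lemma truncated_higher_integrability:
 assumes \<delta>: "0 < \<delta>" "\<delta> <= 1" "C2 * \<delta> <= \<theta>^2 / 2" and l0: "l0 > 0" "C3 * I0 <= l0^2" and N: "l0 < N"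
 shows "(NNINT x. ennreal ((h x)^2 * min (h x) N powr \<delta>)) <= ennreal (2 * l0 powr \<delta> * (LBINT x. (h x)^2))"
proof -
 have N0: "N > 0" using l0(1) N by simp
 define \<phi> where "\<phi> x = min (h x) N" for x
 have [measurable]: "\<phi> \<in> borel_fns" unfolding \<phi>_def[abs_def] by measurable
 have \<phi>: "0 <= \<phi> x" "\<phi> x <= h x" "\<phi> x <= N" for x unfolding \<phi>_def using h0[of x] N0 by auto
 have Yi: "integrable lborel (%x. (h x)^2 * \<phi> x powr \<delta>)"
 proof (rule integrable_mult_bounded[OF h2])
  show "(%x. \<phi> x powr \<delta>) \<in> borel_measurable lborel" by measurable
  show "\<bar>\<phi> x powr \<delta>\<bar> <= N powr \<delta>" for x using powr_mono2[of \<delta> "\<phi> x" N] \<phi>[of x] \<delta> by simp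
 qed
 define Y where "Y = (LBINT x. (h x)^2 * \<phi> x powr \<delta>)"
 define H where "H = (LBINT x. (h x)^2)"
 have H0: "H >= 0" unfolding H_def by (intro integral_nonneg) simp
 have Y0: "Y >= 0" unfolding Y_def by (intro integral_nonneg) simp
 let ?w = "%\<mu>. ennreal (\<delta> * \<mu> powr (\<delta> - 1)) * indicator {l0..N} \<mu>"
 have FTC: "(NNINT \<mu>. ennreal (\<delta> * \<mu> powr (\<delta> - 1)) * indicator {l0..b} \<mu>) = ennreal (b powr \<delta> - l0 powr \<delta>)" if "l0 <= b" for b
 proof (rule nn_integral_FTC_Icc)
  show "((%\<mu>. \<mu> powr \<delta>) has_real_derivative \<delta> * \<mu> powr (\<delta> - 1)) (at \<mu>)" if "\<mu> \<in> {l0..b}" for \<mu>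
   using that l0(1) by (auto intro!: derivative_eq_intros)
 qed (use that \<delta> in auto)
 have lower: "ennreal ((h x)^2 * \<phi> x powr \<delta>) <= ennreal (l0 powr \<delta> * (h x)^2)
   + (NNINT \<mu>. ?w \<mu> * (indicator {x. \<mu> < h x} x * ennreal ((h x)^2)))" for x
 proof (cases "l0 < \<phi> x")
  case False
  then have "\<phi> x powr \<delta> <= l0 powr \<delta>" using \<phi>(1)[of x] \<delta> by (intro powr_mono2) auto
  then have "(h x)^2 * \<phi> x powr \<delta> <= l0 powr \<delta> * (h x)^2" by (subst mult.commute) (intro mult_right_mono, auto)
  then have "ennreal ((h x)^2 * \<phi> x powr \<delta>) <= ennreal (l0 powr \<delta> * (h x)^2)" by (rule ennreal_leI)
  then show ?thesis by (rule order_trans) simp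
 next
  case True
  have "ennreal ((h x)^2 * \<phi> x powr \<delta>) = ennreal (l0 powr \<delta> * (h x)^2 + (\<phi> x powr \<delta> - l0 powr \<delta>) * (h x)^2)"
   by (simp add: algebra_simps)
  also have "... = ennreal (l0 powr \<delta> * (h x)^2) + ennreal (\<phi> x powr \<delta> - l0 powr \<delta>) * ennreal ((h x)^2)"
   using True l0(1) \<delta> powr_mono2[of \<delta> l0 "\<phi> x"] by (subst ennreal_plus) (auto simp: ennreal_mult)
  finally have split: "ennreal ((h x)^2 * \<phi> x powr \<delta>)
   = ennreal (l0 powr \<delta> * (h x)^2) + ennreal (\<phi> x powr \<delta> - l0 powr \<delta>) * ennreal ((h x)^2)" .
  have "ennreal (\<phi> x powr \<delta> - l0 powr \<delta>) * ennreal ((h x)^2)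
    = (NNINT \<mu>. ennreal (\<delta> * \<mu> powr (\<delta> - 1)) * indicator {l0..\<phi> x} \<mu> * ennreal ((h x)^2))"
   using True by (subst FTC[symmetric]) (auto intro!: nn_integral_multc[symmetric])
  also have "... <= (NNINT \<mu>. ?w \<mu> * (indicator {x. \<mu> < h x} x * ennreal ((h x)^2)))"
  proof (rule nn_integral_mono_AE)
   have "AE \<mu> in lborel. \<mu> ~= \<phi> x" by (rule AE_lborel_singleton)
   then show "AE \<mu> in lborel. ennreal (\<delta> * \<mu> powr (\<delta> - 1)) * indicator {l0..\<phi> x} \<mu> * ennreal ((h x)^2)
    <= ?w \<mu> * (indicator {x. \<mu> < h x} x * ennreal ((h x)^2))"
   proof eventually_elim
    case (elim \<mu>)
    then show ?case using \<phi>(2,3)[of x] by (auto simp: indicator_def)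
   qed
  qed
  finally show ?thesis unfolding split by (rule add_left_mono)
 qed
 have upper: "(NNINT \<mu>. ?w \<mu> * (ennreal (C2 * \<mu>) * (indicator {x. \<theta> * \<mu> < h x} x * ennreal (h x))))
   <= ennreal (1 / 2 * ((h x)^2 * \<phi> x powr \<delta>))" for x
 proof -
  define m where "m = \<phi> x / \<theta>"
  have m0: "m >= 0" unfolding m_def using \<phi>(1)[of x] \<theta> by simp
  have "(NNINT \<mu>. ?w \<mu> * (ennreal (C2 * \<mu>) * (indicator {x. \<theta> * \<mu> < h x} x * ennreal (h x))))
   <= (NNINT \<mu>. ennreal (C2 * \<delta> * m powr \<delta> * h x) * indicator {0..m} \<mu>)"
  proof (rule nn_integral_mono)
   fix \<mu> :: real
   show "?w \<mu> * (ennreal (C2 * \<mu>) * (indicator {x. \<theta> * \<mu> < h x} x * ennreal (h x)))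
    <= ennreal (C2 * \<delta> * m powr \<delta> * h x) * indicator {0..m} \<mu>"
   proof (cases "l0 <= \<mu> \<and> \<mu> <= N \<and> \<theta> * \<mu> < h x")
    case True
    then have \<mu>: "\<mu> > 0" using l0(1) by simp
    have "\<theta> * \<mu> <= \<mu>" using \<theta> \<mu> by (simp add: mult_left_le_one_le)
    then have "\<theta> * \<mu> <= \<phi> x" using True unfolding \<phi>_def by auto
    then have \<mu>m: "\<mu> <= m" unfolding m_def using \<theta> by (simp add: field_simps)
    have "\<mu> powr (\<delta> - 1) * \<mu> = \<mu> powr \<delta>" using \<mu> by (simp add: powr_diff)
    also have "... <= m powr \<delta>" using \<mu> \<mu>m \<delta> by (intro powr_mono2) auto
    finally have pw: "\<mu> powr (\<delta> - 1) * \<mu> <= m powr \<delta>" .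
    have "ennreal (\<delta> * \<mu> powr (\<delta> - 1)) * (ennreal (C2 * \<mu>) * ennreal (h x)) = ennreal (C2 * \<delta> * (\<mu> powr (\<delta> - 1) * \<mu>) * h x)"
     using \<delta> C2 \<mu> h0[of x] by (simp add: ennreal_mult[symmetric] mult_ac)
    also have "... <= ennreal (C2 * \<delta> * m powr \<delta> * h x)"
     using C2 \<delta> h0[of x] by (intro ennreal_leI mult_right_mono mult_left_mono pw) auto
    finally show ?thesis using True \<mu> \<mu>m by simp
   next
    case False
    then have "indicator {l0..N} \<mu> = (0::ennreal) \<or> indicator {x. \<theta> * \<mu> < h x} x = (0::ennreal)"
     by (auto simp: indicator_def)
    then show ?thesis by auto
   qed
  qed
  also have "... = ennreal (C2 * \<delta> * m powr \<delta> * h x) * ennreal m"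
   using m0 by (subst nn_integral_cmult_indicator) auto
  also have "... = ennreal (C2 * \<delta> * m powr \<delta> * h x * m)"
   using C2 \<delta> h0[of x] m0 by (intro ennreal_mult[symmetric]) auto
  also have "... <= ennreal (1 / 2 * ((h x)^2 * \<phi> x powr \<delta>))"
  proof (rule ennreal_leI)
   have "m powr \<delta> = \<phi> x powr \<delta> / \<theta> powr \<delta>" unfolding m_def using \<phi>(1)[of x] \<theta> by (simp add: powr_divide)
   also have "... <= \<phi> x powr \<delta> / \<theta>"
   proof (rule divide_left_mono)
    have "\<theta> powr 1 <= \<theta> powr \<delta>" using \<theta> \<delta> by (intro powr_mono') auto
    then show "\<theta> <= \<theta> powr \<delta>" using \<theta> by simp
   qed (use \<theta> in auto)
   finally have mp: "m powr \<delta> <= \<phi> x powr \<delta> / \<theta>" .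
   have "C2 * \<delta> * m powr \<delta> * h x * m <= C2 * \<delta> * (\<phi> x powr \<delta> / \<theta>) * h x * (h x / \<theta>)"
    using C2 \<delta> h0[of x] m0 \<phi>[of x] \<theta> unfolding m_def[symmetric]
    by (intro mult_mono mult_left_mono mult_right_mono mp mult_nonneg_nonneg) (auto simp: m_def divide_right_mono)
   also have "... = (C2 * \<delta> / \<theta>^2) * ((h x)^2 * \<phi> x powr \<delta>)" by (simp add: power2_eq_square)
   also have "... <= 1 / 2 * ((h x)^2 * \<phi> x powr \<delta>)"
    using \<delta>(3) \<theta> by (intro mult_right_mono) (auto simp: pos_divide_le_eq)
   finally show "C2 * \<delta> * m powr \<delta> * h x * m <= 1 / 2 * ((h x)^2 * \<phi> x powr \<delta>)" .
  qed
  finally show ?thesis .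
 qed
 have wm[measurable]: "?w \<in> borel_fns" by measurable
 have "ennreal Y = (NNINT x. ennreal ((h x)^2 * \<phi> x powr \<delta>))"
  unfolding Y_def by (rule nn_integral_eq_integral[OF Yi, symmetric]) simp
 also have "... <= (NNINT x. ennreal (l0 powr \<delta> * (h x)^2)
   + (NNINT \<mu>. ?w \<mu> * (indicator {x. \<mu> < h x} x * ennreal ((h x)^2))))"
  by (intro nn_integral_mono lower)
 also have "... = (NNINT x. ennreal (l0 powr \<delta> * (h x)^2))
   + (NNINT x. (NNINT \<mu>. ?w \<mu> * (indicator {x. \<mu> < h x} x * ennreal ((h x)^2))))"
  by (rule nn_integral_add) measurable
 also have "(NNINT x. ennreal (l0 powr \<delta> * (h x)^2)) = ennreal (l0 powr \<delta> * H)"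
  unfolding H_def using h2 by (subst nn_integral_eq_integral) auto
 finally have split: "ennreal Y <= ennreal (l0 powr \<delta> * H)
   + (NNINT x. (NNINT \<mu>. ?w \<mu> * (indicator {x. \<mu> < h x} x * ennreal ((h x)^2))))" .
 have "(NNINT x. (NNINT \<mu>. ?w \<mu> * (indicator {x. \<mu> < h x} x * ennreal ((h x)^2))))
  = (NNINT \<mu>. (NNINT x. ?w \<mu> * (indicator {x. \<mu> < h x} x * ennreal ((h x)^2))))"
  by (rule lborel_pair.Fubini') measurable
 also have "... = (NNINT \<mu>. ?w \<mu> * (NNINT x. indicator {x. \<mu> < h x} x * ennreal ((h x)^2)))"
  by (intro nn_integral_cong nn_integral_cmult) measurable
 also have "... <= (NNINT \<mu>. ?w \<mu> * (ennreal (C2 * \<mu>) * (NNINT x. indicator {x. \<theta> * \<mu> < h x} x * ennreal (h x))))"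
 proof (rule nn_integral_mono)
  fix \<mu> :: real
  show "?w \<mu> * (NNINT x. indicator {x. \<mu> < h x} x * ennreal ((h x)^2))
   <= ?w \<mu> * (ennreal (C2 * \<mu>) * (NNINT x. indicator {x. \<theta> * \<mu> < h x} x * ennreal (h x)))"
  proof (cases "l0 <= \<mu>")
   case True
   then have "l0^2 <= \<mu>^2" using l0(1) by (intro power_mono) auto
   then have "C3 * I0 <= \<mu>^2" using l0(2) by simp
   then show ?thesis using True l0(1) by (intro mult_left_mono good_lambda) auto
  qed simp
 qed
 also have "... = (NNINT \<mu>. (NNINT x. ?w \<mu> * (ennreal (C2 * \<mu>) * (indicator {x. \<theta> * \<mu> < h x} x * ennreal (h x)))))"
  by (intro nn_integral_cong, subst nn_integral_cmult, measurable, subst nn_integral_cmult, measurable)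
 also have "... = (NNINT x. (NNINT \<mu>. ?w \<mu> * (ennreal (C2 * \<mu>) * (indicator {x. \<theta> * \<mu> < h x} x * ennreal (h x)))))"
  by (rule lborel_pair.Fubini') measurable
 also have "... <= (NNINT x. ennreal (1 / 2 * ((h x)^2 * \<phi> x powr \<delta>)))"
  by (intro nn_integral_mono upper)
 also have "... = ennreal (Y / 2)"
  unfolding Y_def using Yi by (subst nn_integral_eq_integral) auto
 finally have "ennreal Y <= ennreal (l0 powr \<delta> * H) + ennreal (Y / 2)"
  by (rule order_trans[OF split add_left_mono])
 also have "... = ennreal (l0 powr \<delta> * H + Y / 2)" using H0 Y0 by (simp add: ennreal_plus)
 finally have "Y <= l0 powr \<delta> * H + Y / 2" using H0 Y0 by (subst (asm) ennreal_le_iff) auto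
 then have "Y <= 2 * l0 powr \<delta> * H" by simp
 then have "ennreal Y <= ennreal (2 * l0 powr \<delta> * H)" by (rule ennreal_leI)
 then show ?thesis
  unfolding Y_def H_def \<phi>_def[symmetric] by (subst nn_integral_eq_integral[OF Yi]) auto
qed

text \<open>Fatou's lemma removes the truncation, and \<open>h\<close> dominates \<open>g\<close> away from the boundary.\<close>

lemma higher_integrability:
 assumes \<delta>: "0 < \<delta>" "\<delta> <= 1" "C2 * \<delta> <= \<theta>^2 / 2" and \<rho>': "0 < \<rho>'" "\<rho>' < \<rho>"
 shows "(NNINT x. in_ball 0 \<rho>' x * ennreal (g x powr (2 + \<delta>)))
  <= ennreal (2 * C3 powr (\<delta> / 2) / (sqrt (\<rho> - \<rho>') ^ n) powr (2 + \<delta>) * I0 powr ((2 + \<delta>) / 2))"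
proof -
 have I00: "I0 >= 0" by (intro integral_nonneg) simp
 have HI: "(LBINT x. (h x)^2) <= I0" by (intro integral_mono h2 g2 h_sq_le)
 \<comment> \<open>any positive level is admissible if \<open>g\<close> vanishes\<close>
 define l0 where "l0 = (if I0 = 0 then 1 else sqrt (C3 * I0))"
 have l0: "l0 > 0" "C3 * I0 <= l0^2" using I00 C3 by (auto simp: l0_def mult_nonneg_nonneg less_le)
 have H: "(NNINT x. ennreal (h x powr (2 + \<delta>))) <= ennreal (2 * l0 powr \<delta> * I0)"
 proof -
  have "(NNINT x. ennreal (h x powr (2 + \<delta>)))
   <= (NNINT x. liminf (%k. ennreal ((h x)^2 * min (h x) (l0 + 1 + real k) powr \<delta>)))"
  proof (rule nn_integral_mono)
   fix x
   have "\<forall>\<^sub>F k in sequentially. ennreal (h x powr (2 + \<delta>)) <= ennreal ((h x)^2 * min (h x) (l0 + 1 + real k) powr \<delta>)"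
   proof -
    obtain k0 where "h x < real k0" using reals_Archimedean2 by blast
    show ?thesis
     using eventually_ge_at_top[of k0]
    proof eventually_elim
     case (elim k)
     then have "h x < real k" using \<open>h x < real k0\<close> by linarith
     then have "min (h x) (l0 + 1 + real k) = h x" using l0(1) by simp
     moreover have "h x powr (2 + \<delta>) = (h x)^2 * h x powr \<delta>" using h0[of x] by (simp add: powr_add)
     ultimately show ?case by simp
    qed
   qed
   then show "ennreal (h x powr (2 + \<delta>)) <= liminf (%k. ennreal ((h x)^2 * min (h x) (l0 + 1 + real k) powr \<delta>))"
    by (rule Liminf_bounded)
  qed
  also have "... <= liminf (%k. NNINT x. ennreal ((h x)^2 * min (h x) (l0 + 1 + real k) powr \<delta>))"
   by (rule nn_integral_liminf) measurable
  also have "... <= ennreal (2 * l0 powr \<delta> * (LBINT x. (h x)^2))"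
   by (intro Liminf_le always_eventually allI truncated_higher_integrability \<delta> l0) auto
  also have "... <= ennreal (2 * l0 powr \<delta> * I0)" by (intro ennreal_leI mult_left_mono HI) auto
  finally show ?thesis .
 qed
 define q where "q = sqrt (\<rho> - \<rho>') ^ n"
 have q: "q > 0" unfolding q_def using \<rho>' by simp
 have "(NNINT x. in_ball 0 \<rho>' x * ennreal (g x powr (2 + \<delta>)))
  <= (NNINT x. ennreal (1 / q powr (2 + \<delta>)) * ennreal (h x powr (2 + \<delta>)))"
 proof (rule nn_integral_mono)
  fix x
  show "in_ball 0 \<rho>' x * ennreal (g x powr (2 + \<delta>)) <= ennreal (1 / q powr (2 + \<delta>)) * ennreal (h x powr (2 + \<delta>))"
  proof (cases "x \<in> ball 0 \<rho>'")
   case True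
   then have xD: "x \<in> ball 0 \<rho>" and dx: "\<rho> - \<rho>' <= d x" using \<rho>' by (auto simp: d_def)
   have "q <= sqrt (d x) ^ n" unfolding q_def using dx \<rho>' by (intro power_mono) auto
   then have "q * g x <= h x" using xD g0[of x] by (simp add: h_def mult_right_mono)
   then have "(q * g x) powr (2 + \<delta>) <= h x powr (2 + \<delta>)"
    using q g0[of x] \<delta>(1) by (intro powr_mono2) auto
   then have "q powr (2 + \<delta>) * g x powr (2 + \<delta>) <= h x powr (2 + \<delta>)"
    using q g0[of x] by (simp add: powr_mult)
   then have "g x powr (2 + \<delta>) <= 1 / q powr (2 + \<delta>) * h x powr (2 + \<delta>)"
    using q by (simp add: field_simps)
   then show ?thesis using True q by (simp add: ennreal_mult[symmetric] ennreal_leI)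
  qed simp
 qed
 also have "... = ennreal (1 / q powr (2 + \<delta>)) * (NNINT x. ennreal (h x powr (2 + \<delta>)))"
  by (rule nn_integral_cmult) measurable
 also have "... <= ennreal (1 / q powr (2 + \<delta>)) * ennreal (2 * l0 powr \<delta> * I0)"
  by (intro mult_left_mono H) simp
 also have "... = ennreal (1 / q powr (2 + \<delta>) * (2 * l0 powr \<delta> * I0))"
  using I00 by (intro ennreal_mult[symmetric]) auto
 also have "1 / q powr (2 + \<delta>) * (2 * l0 powr \<delta> * I0) = 2 * C3 powr (\<delta> / 2) / q powr (2 + \<delta>) * I0 powr ((2 + \<delta>) / 2)"
 proof (cases "I0 = 0")
  case False
  have I: "I0 > 0" by (rule order.not_eq_order_implies_strict[OF False[symmetric] I00])
  have "l0 = (C3 * I0) powr (1 / 2)"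
   unfolding l0_def using I C3 by (simp only: False if_False powr_half_sqrt mult_nonneg_nonneg less_imp_le)
  then have "l0 powr \<delta> = (C3 * I0) powr (\<delta> / 2)" by (simp only: powr_powr times_divide_eq_left mult_1_left)
  also have "... = C3 powr (\<delta> / 2) * I0 powr (\<delta> / 2)"
   by (rule powr_mult)
  finally have l: "l0 powr \<delta> = C3 powr (\<delta> / 2) * I0 powr (\<delta> / 2)" .
  have "(2 + \<delta>) / 2 = \<delta> / 2 + 1" by simp
  then have "I0 powr ((2 + \<delta>) / 2) = I0 powr (\<delta> / 2) * I0"
   by (simp only: powr_add powr_one[OF less_imp_le[OF I]])
  moreover have "1 / Q * (2 * (a * b) * c) = 2 * a / Q * (b * c)" for Q a b c :: real by simp
  ultimately show ?thesis by (simp only: l)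
 qed simp
 finally show ?thesis unfolding q_def .
qed

end

text \<open>The exponent and the constant depend on the coefficients of the reverse Hoelder inequality only.\<close>

lemma gehring:
 fixes A :: real and a :: nat
 assumes A: "A > 0"
 obtains \<delta> c where "\<delta> > 0" "c >= 0"
  "!!(g :: real^'n::finite => real) \<rho> \<rho>'. reverse_hoelder g \<rho> A a CARD('n) (unit_ball_vol (real CARD('n))) ==> 0 < \<rho>' ==> \<rho>' < \<rho> ==>
   (NNINT x. in_ball 0 \<rho>' x * ennreal (g x powr (2 + \<delta>)))
    <= ennreal (c / (sqrt (\<rho> - \<rho>') ^ CARD('n)) powr (2 + \<delta>) * (LBINT x. (g x)^2) powr ((2 + \<delta>) / 2))"
proof -
 let ?n = "CARD('n)" and ?\<omega> = "unit_ball_vol (real CARD('n))"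
 define t k2 k3 where "t = reverse_hoelder.\<theta> A a ?n ?\<omega>" and "k2 = reverse_hoelder.C2 A a ?n ?\<omega>" and "k3 = reverse_hoelder.C3 a ?n ?\<omega>"
 define \<delta> where "\<delta> = (if t = 0 then 1 else min 1 (t^2 / (2 * (\<bar>k2\<bar> + 1))))"
 have \<delta>: "\<delta> > 0" "\<delta> <= 1" unfolding \<delta>_def by auto
 show ?thesis
 proof (rule that[of \<delta> "2 * k3 powr (\<delta> / 2)"])
  fix g :: "real^'n => real" and \<rho> \<rho>' :: real
  assume rh: "reverse_hoelder g \<rho> A a ?n ?\<omega>" and \<rho>': "0 < \<rho>'" "\<rho>' < \<rho>"
  interpret reverse_hoelder g \<rho> A a ?n ?\<omega> by (rule rh)
  have t0: "t > 0" unfolding t_def by (rule \<theta>(1))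
  have "k2 * \<delta> <= (\<bar>k2\<bar> + 1) * (t^2 / (2 * (\<bar>k2\<bar> + 1)))"
   using \<delta> t0 unfolding \<delta>_def by (intro mult_mono) auto
  also have "... = t^2 / 2" by (simp add: add_pos_nonneg divide_simps)
  finally have "k2 * \<delta> <= t^2 / 2" .
  then show "(NNINT x. in_ball 0 \<rho>' x * ennreal (g x powr (2 + \<delta>)))
    <= ennreal (2 * k3 powr (\<delta> / 2) / (sqrt (\<rho> - \<rho>') ^ ?n) powr (2 + \<delta>) * (LBINT x. (g x)^2) powr ((2 + \<delta>) / 2))"
   unfolding k2_def k3_def t_def by (rule higher_integrability[OF \<delta> _ \<rho>'])
 qed (use \<delta> in auto)
qed

section \<open>The reverse Hoelder inequality for all derivatives up to order three\<close>

abbreviation multi :: "nat => 'n list set" where "multi k \<equiv> {is. length is <= k}"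

lemma finite_multi: "finite (multi k :: 'n::finite list set)"
 using finite_lists_length_le[of "UNIV :: 'n set" k] by simp

lemma integral_ind_mono:
 fixes f g :: "real^'n::finite => real"
 assumes "integrable lborel f" "integrable lborel g" "!!x. x \<in> A ==> f x <= g x" "!!x. 0 <= g x" "A \<subseteq> B"
  "A \<in> sets borel" "B \<in> sets borel"
 shows "(LBINT x. indicator A x * f x) <= (LBINT x. indicator B x * g x)"
 by (intro integral_mono integrable_ind) (use assms in \<open>auto simp: indicator_def\<close>)

lemma square_of_integral_ball:
 fixes f :: "real^'n::finite => real"
 assumes [measurable]: "f \<in> borel_fns" and f2: "integrable lborel (%x. in_ball x0 r x * (f x)^2)"
  and f1: "integrable lborel (%x. in_ball x0 r x * f x)" and r: "r > 0"
 shows "(LBINT x. in_ball x0 r x * f x)^2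
  <= measure lborel (ball x0 r) * (LBINT x. in_ball x0 r x * (f x)^2)"
proof -
 define b where "b = measure lborel (ball x0 r)"
 have b: "b > 0" unfolding b_def using r content_ball_gt_0_iff[of x0 r] by simp
 define k where "k x = in_ball x0 r x / b" for x
 have ki: "integrable lborel k"
  unfolding k_def using emeasure_lborel_ball_finite[of x0 r] by (intro integrable_divide integrable_real_indicator) auto
 have k1: "(LBINT x. k x) = 1" using b unfolding k_def by (simp add: b_def)
 have e1: "(%x. f x * k x) = (%x. in_ball x0 r x * f x / b)" by (auto simp: k_def)
 have e2: "(%x. (f x)^2 * k x) = (%x. in_ball x0 r x * (f x)^2 / b)" by (auto simp: k_def)
 have "(LBINT x. f x * k x)^2 <= (LBINT x. (f x)^2 * k x)"
 proof (rule weighted_square_Jensen[OF ki _ k1])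
  show "0 <= k x" for x using b by (simp add: k_def)
  show "integrable lborel (%x. f x * k x)" unfolding e1 by (intro integrable_divide f1)
  show "integrable lborel (%x. (f x)^2 * k x)" unfolding e2 by (intro integrable_divide f2)
 qed
 then have "((LBINT x. in_ball x0 r x * f x) / b)^2 <= (LBINT x. in_ball x0 r x * (f x)^2) / b"
  unfolding e1 e2 by simp
 then have "(LBINT x. in_ball x0 r x * f x)^2 / b / b <= (LBINT x. in_ball x0 r x * (f x)^2) / b"
  by (simp add: power_divide power2_eq_square)
 then show ?thesis unfolding b_def[symmetric] using b by (simp add: field_simps)
qed

lemma affine_bounded_ball:
 assumes "x \<in> ball x0 r"
 shows "\<bar>a \<bullet> x + c\<bar> <= norm a * (norm x0 + r) + \<bar>c\<bar>"
proof -
 have "norm x <= norm x0 + r" using assms norm_triangle_ineq[of x0 "x - x0"] by (simp add: dist_norm norm_minus_commute)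
 then have "norm a * norm x <= norm a * (norm x0 + r)" by (intro mult_left_mono) auto
 then show ?thesis using Cauchy_Schwarz_ineq2[of a x] by linarith
qed

lemma square_integrable_ball_minus:
 fixes f :: "real^'n::finite => real"
 assumes fm: "f \<in> borel_fns" and f: "!!x. \<bar>f x\<bar> <= M"
 shows "integrable lborel (%x. in_ball x0 r x * (f x - (a \<bullet> x + c))^2)"
proof (rule integrable_bounded_ball[where a=x0 and R=r and M="(M + (norm a * (norm x0 + r) + \<bar>c\<bar>))^2"])
 have "\<bar>f x - (a \<bullet> x + c)\<bar>^2 <= (M + (norm a * (norm x0 + r) + \<bar>c\<bar>))^2" if "x \<in> ball x0 r" for x
  using f[of x] affine_bounded_ball[OF that, of a c] by (intro power_mono) linarith+
 then show "\<bar>in_ball x0 r x * (f x - (a \<bullet> x + c))^2\<bar> <= (M + (norm a * (norm x0 + r) + \<bar>c\<bar>))^2" for x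
  by (cases "x \<in> ball x0 r") auto
 show "in_ball x0 r x * (f x - (a \<bullet> x + c))^2 = 0" if "x \<notin> cball x0 r" for x
  using that by (auto simp: indicator_def)
 have "(%x. a \<bullet> x + c) \<in> borel_fns"
  by (rule smooth_borel_measurable[OF smooth_affine_fun])
 then show "(%x. in_ball x0 r x * (f x - (a \<bullet> x + c))^2) \<in> borel_fns"
  using fm by (intro borel_measurable_times borel_measurable_indicator borel_measurable_power borel_measurable_diff) simp_all
qed

text \<open>A family of functions that behaves like the derivatives of order at most three of a single
 function. Derivatives of order three are controlled by the Caccioppoli inequality, lower ones
 by the Poincare inequality.\<close>

locale derivative_family =
 fixes D :: "'n::finite list => real^'n => real" and \<rho> M C S :: real
 assumes S: "S = real (card (multi 3 :: 'n list set))"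
  and \<rho>: "0 < \<rho>" "\<rho> <= 1" and C: "C >= 0"
  and Dm: "!!is. length is <= 3 ==> D is \<in> borel_fns"
  and D2: "!!is. length is <= 3 ==> integrable lborel (%x. (D is x)^2)"
  and D1: "!!is. length is <= 3 ==> integrable lborel (D is)"
  and Db: "!!is x. length is <= 2 ==> \<bar>D is x\<bar> <= M"
  and Dw: "!!is k. length is <= 2 ==> wpd (ball 0 \<rho>) k (D is) (D (is @ [k]))"
  and Dsym: "!!i j x. D [i, j] x = D [j, i] x"
  and Dcacc: "!!i j m x0 r a c. r > 0 ==> ball x0 (3 * r) \<subseteq> ball 0 \<rho> ==>
   (LBINT x. in_ball x0 r x * (D [i, j, m] x)^2)
     <= C * ((\<Sum>l\<in>UNIV. LBINT x. in_ball x0 (3 * r) x * (D [l, m] x - a $ l)^2) / r^2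
      + (LBINT x. in_ball x0 (3 * r) x * (D [m] x - (a \<bullet> x + c))^2) / r ^ 4)"
begin

definition T :: "real^'n => real" where
 "T x = in_ball 0 \<rho> x * (\<Sum>is\<in>multi 3. \<bar>D is x\<bar>)"

lemma Tm[measurable]: "T \<in> borel_fns"
 unfolding T_def[abs_def]
 by (intro borel_measurable_times borel_measurable_indicator borel_measurable_sum borel_measurable_abs Dm) auto

lemma T0: "0 <= T x" unfolding T_def by (intro mult_nonneg_nonneg sum_nonneg) (auto simp: S)

lemma T_out: "x \<notin> ball 0 \<rho> ==> T x = 0" by (simp add: T_def)

lemma D_le_T: "length is <= 3 ==> x \<in> ball 0 \<rho> ==> \<bar>D is x\<bar> <= T x"
 unfolding T_def using member_le_sum[of "is" "multi 3" "%is. \<bar>D is x\<bar>"] finite_multi[of 3, where 'n='n] by simp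

lemma gradient_le_T:
 assumes "length is <= 2" "x \<in> ball 0 \<rho>"
 shows "(\<Sum>k\<in>UNIV. \<bar>D (is @ [k]) x\<bar>) <= T x"
proof -
 have "(\<Sum>k\<in>UNIV. \<bar>D (is @ [k]) x\<bar>) = (\<Sum>js\<in>(%k. is @ [k]) ` UNIV. \<bar>D js x\<bar>)"
  by (subst sum.reindex) (auto simp: inj_on_def)
 also have "... <= (\<Sum>js\<in>multi 3. \<bar>D js x\<bar>)"
  using assms(1) by (intro sum_mono2 finite_multi) auto
 finally show ?thesis using assms(2) by (simp add: T_def)
qed

lemma T_square_le: "(T x)^2 <= in_ball 0 \<rho> x * (S * (\<Sum>is\<in>multi 3. (D is x)^2))"
proof (cases "x \<in> ball 0 \<rho>")
 case True
 then show ?thesis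
  using sum_squared_le_sum_of_squares[of "%is. \<bar>D is x\<bar>" "multi 3"] by (simp add: T_def S mult.commute)
qed (simp add: T_def)

lemma sumD2: "integrable lborel (%x. S * (\<Sum>is\<in>multi 3. (D is x)^2))"
 by (intro integrable_mult_right integrable_sum D2) simp

lemma T2: "integrable lborel (%x. (T x)^2)"
proof (rule integrable_bound)
 show "integrable lborel (%x. in_ball 0 \<rho> x * (S * (\<Sum>is\<in>multi 3. (D is x)^2)))"
  by (rule integrable_ind[OF sumD2]) simp
 show "AE x in lborel. norm ((T x)^2) <= norm (in_ball 0 \<rho> x * (S * (\<Sum>is\<in>multi 3. (D is x)^2)))"
  using T_square_le by (intro AE_I2) (auto intro: order_trans[OF _ abs_ge_self])
qed measurable

lemma T1: "integrable lborel T"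
 by (rule square_integrable_ball[OF Tm T2 T_out])

lemma T_integral_square_le: "(LBINT x. (T x)^2) <= S * (\<Sum>is\<in>multi 3. LBINT x. (D is x)^2)"
proof -
 have "(LBINT x. (T x)^2) <= (LBINT x. S * (\<Sum>is\<in>multi 3. (D is x)^2))"
 proof (rule integral_mono[OF T2 sumD2])
  have "0 <= S * (\<Sum>is\<in>multi 3. (D is x)^2)" for x by (intro mult_nonneg_nonneg sum_nonneg) (auto simp: S)
  then show "(T x)^2 <= S * (\<Sum>is\<in>multi 3. (D is x)^2)" for x
   using T_square_le[of x] by (cases "x \<in> ball 0 \<rho>") (auto simp: order_trans)
 qed
 also have "... = S * (\<Sum>is\<in>multi 3. LBINT x. (D is x)^2)"
  by (simp add: integral_sum D2)
 finally show ?thesis .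
qed

lemma poincare_D:
 assumes l: "length is <= 2" and s: "s > 0" and sub: "ball x0 (2 * s) \<subseteq> ball 0 \<rho>" and \<tau>: "0 < \<tau>" "\<tau> <= 1/2"
 defines "b \<equiv> measure lborel (ball x0 s)"
 shows "(LBINT x. in_ball x0 s x * (D is x - (LBINT y. in_ball x0 s y * D is y) / b)^2)
  <= 8 * s^2 * (\<tau>^2 * 2 ^ CARD('n) * (LBINT x. in_ball x0 (2 * s) x * (T x)^2)
   + (LBINT x. in_ball x0 (2 * s) x * T x)^2 / (\<tau> ^ CARD('n))^2 / b)"
proof -
 have l3: "length (is @ [k]) <= 3" for k using l by simp
 have l3': "length is <= 3" using l by simp
 have b: "b > 0" unfolding b_def using s content_ball_gt_0_iff[of x0 s] by simp
 have ng: "0 <= (\<Sum>k\<in>UNIV. \<bar>D (is @ [k]) x\<bar>)" for x by (intro sum_nonneg) auto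
 have i1: "integrable lborel (%x. in_ball x0 (2 * s) x * (\<Sum>k\<in>UNIV. \<bar>D (is @ [k]) x\<bar>))"
  by (intro integrable_ind integrable_sum integrable_abs D1 l3) simp
 have gm: "(%x. \<Sum>k\<in>UNIV. \<bar>D (is @ [k]) x\<bar>) \<in> borel_fns"
  by (intro borel_measurable_sum borel_measurable_abs Dm l3)
 have i2: "integrable lborel (%x. in_ball x0 (2 * s) x * (\<Sum>k\<in>UNIV. \<bar>D (is @ [k]) x\<bar>)^2)"
 proof (rule integrable_bound[OF T2])
  show "(%x. in_ball x0 (2 * s) x * (\<Sum>k\<in>UNIV. \<bar>D (is @ [k]) x\<bar>)^2) \<in> borel_measurable lborel"
   using gm by (intro borel_measurable_times borel_measurable_indicator borel_measurable_power) simp_all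
  have "in_ball x0 (2 * s) x * (\<Sum>k\<in>UNIV. \<bar>D (is @ [k]) x\<bar>)^2 <= (T x)^2" for x
   using power_mono[OF gradient_le_T[OF l] ng, of x 2] sub by (auto simp: indicator_def)
  then show "AE x in lborel. norm (in_ball x0 (2 * s) x * (\<Sum>k\<in>UNIV. \<bar>D (is @ [k]) x\<bar>)^2) <= norm ((T x)^2)"
   by (intro AE_I2) (simp add: abs_mult)
 qed
 have "(LBINT x. in_ball x0 s x * (D is x - 0 \<bullet> x - (LBINT y. in_ball x0 s y * (D is y - 0 \<bullet> y)) / b)^2)
  <= 8 * s^2 * (\<tau>^2 * 2 ^ CARD('n) * (LBINT x. in_ball x0 (2 * s) x * (\<Sum>k\<in>UNIV. \<bar>D (is @ [k]) x - (0::real^'n) $ k\<bar>)^2)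
   + (LBINT x. in_ball x0 (2 * s) x * (\<Sum>k\<in>UNIV. \<bar>D (is @ [k]) x - (0::real^'n) $ k\<bar>))^2 / (\<tau> ^ CARD('n))^2 / b)"
  unfolding b_def
  by (rule poincare_weak[OF D1[OF l3'] Db[OF l] D1[OF l3] D2[OF l3] Dw[OF l] sub s \<tau>])
 also have "... <= 8 * s^2 * (\<tau>^2 * 2 ^ CARD('n) * (LBINT x. in_ball x0 (2 * s) x * (T x)^2)
   + (LBINT x. in_ball x0 (2 * s) x * T x)^2 / (\<tau> ^ CARD('n))^2 / b)"
 proof (intro mult_left_mono add_mono divide_right_mono power_mono integral_nonneg)
  show "(LBINT x. in_ball x0 (2 * s) x * (\<Sum>k\<in>UNIV. \<bar>D (is @ [k]) x - (0::real^'n) $ k\<bar>)^2)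
   <= (LBINT x. in_ball x0 (2 * s) x * (T x)^2)"
  proof (rule integral_mono)
   show "in_ball x0 (2 * s) x * (\<Sum>k\<in>UNIV. \<bar>D (is @ [k]) x - (0::real^'n) $ k\<bar>)^2 <= in_ball x0 (2 * s) x * (T x)^2" for x
    using power_mono[OF gradient_le_T[OF l] ng, of x 2] sub by (auto simp: indicator_def)
  qed (use i2 integrable_ind[OF T2] in auto)
  show "(LBINT x. in_ball x0 (2 * s) x * (\<Sum>k\<in>UNIV. \<bar>D (is @ [k]) x - (0::real^'n) $ k\<bar>))
   <= (LBINT x. in_ball x0 (2 * s) x * T x)"
  proof (rule integral_mono)
   show "in_ball x0 (2 * s) x * (\<Sum>k\<in>UNIV. \<bar>D (is @ [k]) x - (0::real^'n) $ k\<bar>) <= in_ball x0 (2 * s) x * T x" for x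
    using gradient_le_T[OF l, of x] sub by (auto simp: indicator_def)
  qed (use i1 integrable_ind[OF T1] in auto)
 qed (use b in \<open>auto intro: sum_nonneg\<close>)
 finally show ?thesis by simp
qed

lemma T_ball_mono:
 assumes "s <= t"
 shows "(LBINT x. in_ball x0 s x * (T x)^2) <= (LBINT x. in_ball x0 t x * (T x)^2)"
  "(LBINT x. in_ball x0 s x * T x)^2 <= (LBINT x. in_ball x0 t x * T x)^2"
proof -
 have sub: "ball x0 s \<subseteq> ball x0 t" using assms by (rule subset_ball)
 show "(LBINT x. in_ball x0 s x * (T x)^2) <= (LBINT x. in_ball x0 t x * (T x)^2)"
  by (rule integral_ind_mono[OF T2 T2 _ _ sub]) auto
 show "(LBINT x. in_ball x0 s x * T x)^2 <= (LBINT x. in_ball x0 t x * T x)^2"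
  by (intro power_mono integral_ind_mono[OF T1 T1 _ _ sub] integral_nonneg) (auto simp: T0)
qed

text \<open>The affine function in the Caccioppoli inequality is fitted to the first derivative: its slope is
 the mean of the Hessian on a larger ball.\<close>

lemma third_order_bound:
 assumes r: "r > 0" and sub: "ball x0 (16 * r) \<subseteq> ball 0 \<rho>" and \<tau>: "0 < \<tau>" "\<tau> <= 1/2"
 defines "b \<equiv> measure lborel (ball x0 r)"
 shows "(LBINT x. in_ball x0 r x * (D [i, j, m] x)^2)
  <= C * (512 * real CARD('n) * (1 + 256 * real CARD('n) * 8 ^ CARD('n))) *
   (\<tau>^2 * 2 ^ CARD('n) * (LBINT x. in_ball x0 (16 * r) x * (T x)^2)
   + (LBINT x. in_ball x0 (16 * r) x * T x)^2 / (\<tau> ^ CARD('n))^2 / b)"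
proof -
 let ?n = "real CARD('n)"
 \<comment> \<open>the slope is the mean of the gradient of the first derivative, and \<open>c\<close> makes the mean vanish\<close>
 define a :: "real^'n" where "a = (\<chi> l. (LBINT y. in_ball x0 (8 * r) y * D [m, l] y) / measure lborel (ball x0 (8 * r)))"
 define b4 where "b4 = measure lborel (ball x0 (4 * r))"
 define c where "c = (LBINT y. in_ball x0 (4 * r) y * (D [m] y - a \<bullet> y)) / b4"
 define V where "V l = (LBINT x. in_ball x0 (8 * r) x * (D [m, l] x - a $ l)^2)" for l
 define E where "E = \<tau>^2 * 2 ^ CARD('n) * (LBINT x. in_ball x0 (16 * r) x * (T x)^2)
   + (LBINT x. in_ball x0 (16 * r) x * T x)^2 / (\<tau> ^ CARD('n))^2 / b"
 have b: "b > 0" unfolding b_def using r content_ball_gt_0_iff[of x0 r] by simp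
 have b4: "b4 > 0" unfolding b4_def using r content_ball_gt_0_iff[of x0 "4 * r"] by simp
 have b8: "measure lborel (ball x0 (8 * r)) = 2 ^ CARD('n) * b4"
 proof -
  have "(8 * r) ^ CARD('n) = (2 * (4 * r)) ^ CARD('n)" by simp
  also have "... = 2 ^ CARD('n) * (4 * r) ^ CARD('n)" by (rule power_mult_distrib)
  finally show ?thesis unfolding b4_def using r by (simp only: measure_ball_scale mult.left_commute less_imp_le mult_nonneg_nonneg zero_le_numeral)
 qed
 have b8b: "b <= measure lborel (ball x0 (8 * r))"
  unfolding b_def using r by (simp add: measure_ball_scale power_mono)
 have V0: "V l >= 0" for l unfolding V_def by (intro integral_nonneg) simp
 have sub3: "ball x0 (3 * r) \<subseteq> ball 0 \<rho>" and sub8: "ball x0 (8 * r) \<subseteq> ball 0 \<rho>"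
  using sub r subset_ball[of "3 * r" "16 * r" x0] subset_ball[of "8 * r" "16 * r" x0] by auto
 have Vint: "integrable lborel (%x. in_ball x0 s x * (D [m, l] x - a $ l)^2)" for l s
  using square_integrable_ball_minus[OF Dm Db, of "[m, l]" x0 s 0 "a $ l"] by simp
 have Vle: "V l <= 512 * r^2 * E" for l
 proof -
  have e: "2 * (8 * r) = 16 * r" by simp
  have "V l <= 8 * (8 * r)^2 * (\<tau>^2 * 2 ^ CARD('n) * (LBINT x. in_ball x0 (16 * r) x * (T x)^2)
   + (LBINT x. in_ball x0 (16 * r) x * T x)^2 / (\<tau> ^ CARD('n))^2 / measure lborel (ball x0 (8 * r)))"
   using poincare_D[of "[m, l]" "8 * r" x0 \<tau>] r sub \<tau> unfolding V_def a_def e by simp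
  also have "... <= 8 * (8 * r)^2 * E"
   unfolding E_def using b8b b less_le_trans[OF b b8b] by (intro mult_left_mono add_mono divide_left_mono mult_pos_pos order_refl) simp_all
  finally show ?thesis by (simp add: power2_eq_square)
 qed
 have pm: "(LBINT x. in_ball x0 (4 * r) x * (D [m] x - (a \<bullet> x + c))^2)
  <= 256 * 8 ^ CARD('n) * ?n * r^2 * (\<Sum>l\<in>UNIV. V l)"
 proof -
  define \<gamma> where "\<gamma> x = (\<Sum>k\<in>UNIV. \<bar>D [m, k] x - a $ k\<bar>)" for x
  have \<gamma>m: "\<gamma> \<in> borel_fns" unfolding \<gamma>_def[abs_def]
   by (intro borel_measurable_sum borel_measurable_abs borel_measurable_diff Dm borel_measurable_const) simp
  have \<gamma>sq: "(\<gamma> x)^2 <= ?n * (\<Sum>k\<in>UNIV. (D [m, k] x - a $ k)^2)" for x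
   unfolding \<gamma>_def using sum_squared_le_sum_of_squares[of "%k. \<bar>D [m, k] x - a $ k\<bar>" UNIV] by (simp add: mult.commute)
  have sumint: "integrable lborel (%x. ?n * (\<Sum>k\<in>UNIV. in_ball x0 s x * (D [m, k] x - a $ k)^2))" for s
   by (intro integrable_mult_right integrable_sum Vint)
  have \<gamma>le: "in_ball x0 s x * (\<gamma> x)^2 <= ?n * (\<Sum>k\<in>UNIV. in_ball x0 s x * (D [m, k] x - a $ k)^2)" for x s
   using \<gamma>sq[of x] by (cases "x \<in> ball x0 s") auto
  have \<gamma>2: "integrable lborel (%x. in_ball x0 s x * (\<gamma> x)^2)" for s
  proof (rule integrable_bound[OF sumint[of s]])
   show "(%x. in_ball x0 s x * (\<gamma> x)^2) \<in> borel_measurable lborel"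
    using \<gamma>m by (intro borel_measurable_times borel_measurable_indicator borel_measurable_power) simp_all
   show "AE x in lborel. norm (in_ball x0 s x * (\<gamma> x)^2) <= norm (?n * (\<Sum>k\<in>UNIV. in_ball x0 s x * (D [m, k] x - a $ k)^2))"
   proof (rule AE_I2)
    fix x
    have "0 <= in_ball x0 s x * (\<gamma> x)^2" by simp
    then show "norm (in_ball x0 s x * (\<gamma> x)^2) <= norm (?n * (\<Sum>k\<in>UNIV. in_ball x0 s x * (D [m, k] x - a $ k)^2))"
     unfolding real_norm_def using \<gamma>le[of s x] by linarith
   qed
  qed
  have \<gamma>1: "integrable lborel (%x. in_ball x0 s x * \<gamma> x)" for s
  proof (rule square_integrable_ball[of _ x0 s])
   show "(%x. in_ball x0 s x * \<gamma> x) \<in> borel_fns"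
    using \<gamma>m by (intro borel_measurable_times borel_measurable_indicator) simp_all
   have "(%x. (in_ball x0 s x * \<gamma> x)^2) = (%x. in_ball x0 s x * (\<gamma> x)^2)"
    by (auto simp: indicator_def)
   then show "integrable lborel (%x. (in_ball x0 s x * \<gamma> x)^2)" using \<gamma>2[of s] by simp
  qed simp
  define G2 where "G2 = (LBINT x. in_ball x0 (8 * r) x * (\<gamma> x)^2)"
  have G20: "G2 >= 0" unfolding G2_def by (intro integral_nonneg) simp
  have G1: "(LBINT x. in_ball x0 (8 * r) x * \<gamma> x)^2 <= 2 ^ CARD('n) * b4 * G2"
   unfolding G2_def using square_of_integral_ball[OF \<gamma>m \<gamma>2 \<gamma>1, of "8 * r"] r b8 by simp
  have G2V: "G2 <= ?n * (\<Sum>l\<in>UNIV. V l)"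
  proof -
   have "G2 <= (LBINT x. ?n * (\<Sum>k\<in>UNIV. in_ball x0 (8 * r) x * (D [m, k] x - a $ k)^2))"
    unfolding G2_def by (intro integral_mono \<gamma>2 sumint \<gamma>le)
   also have "... = ?n * (\<Sum>l\<in>UNIV. V l)"
    unfolding V_def by (simp only: integral_mult_right_zero integral_sum Vint)
   finally show ?thesis .
  qed
  have "(LBINT x. in_ball x0 (4 * r) x * (D [m] x - a \<bullet> x - c)^2)
   <= 8 * (4 * r)^2 * ((1/2)^2 * 2 ^ CARD('n) * (LBINT x. in_ball x0 (2 * (4 * r)) x * (\<Sum>k\<in>UNIV. \<bar>D ([m] @ [k]) x - a $ k\<bar>)^2)
   + (LBINT x. in_ball x0 (2 * (4 * r)) x * (\<Sum>k\<in>UNIV. \<bar>D ([m] @ [k]) x - a $ k\<bar>))^2 / ((1/2) ^ CARD('n))^2 / b4)"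
   unfolding c_def b4_def
   by (rule poincare_weak[OF D1 Db D1 D2 Dw]) (use sub8 r in auto)
  also have "... = 8 * (4 * r)^2 * ((1/2)^2 * 2 ^ CARD('n) * G2
   + (LBINT x. in_ball x0 (8 * r) x * \<gamma> x)^2 / ((1/2) ^ CARD('n))^2 / b4)"
   by (simp add: G2_def \<gamma>_def)
  also have "... <= 8 * (4 * r)^2 * ((1/2)^2 * 2 ^ CARD('n) * G2 + (2 ^ CARD('n) * b4 * G2) / ((1/2) ^ CARD('n))^2 / b4)"
   using b4 by (intro mult_left_mono add_mono divide_right_mono G1) auto
  also have "(2 ^ CARD('n) * b4 * G2) / ((1/2) ^ CARD('n))^2 / b4 = 8 ^ CARD('n) * G2"
  proof -
   have "(8::real) ^ CARD('n) = 2 ^ CARD('n) * (2 ^ CARD('n))^2"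
    by (simp add: power2_eq_square power_mult_distrib[symmetric])
   then show ?thesis using b4 by (simp add: power_one_over power_divide field_simps)
  qed
  also have "(1/2)^2 * 2 ^ CARD('n) * G2 <= 8 ^ CARD('n) * G2"
  proof (rule mult_right_mono[OF _ G20])
   have "(2::real) ^ CARD('n) <= 8 ^ CARD('n)" by (intro power_mono) auto
   moreover have "(0::real) <= 8 ^ CARD('n)" by simp
   ultimately show "(1/2)^2 * 2 ^ CARD('n) <= (8::real) ^ CARD('n)" unfolding power2_eq_square by linarith
  qed
  finally have "(LBINT x. in_ball x0 (4 * r) x * (D [m] x - a \<bullet> x - c)^2) <= 8 * (4 * r)^2 * (8 ^ CARD('n) * G2 + 8 ^ CARD('n) * G2)"
   by (simp add: mult_left_mono)
  also have "... = 256 * 8 ^ CARD('n) * r^2 * G2" by (simp add: power2_eq_square)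
  also have "... <= 256 * 8 ^ CARD('n) * r^2 * (?n * (\<Sum>l\<in>UNIV. V l))"
   by (intro mult_left_mono G2V) auto
  finally show ?thesis by (simp add: algebra_simps)
 qed
 have "(LBINT x. in_ball x0 r x * (D [i, j, m] x)^2)
  <= C * ((\<Sum>l\<in>UNIV. LBINT x. in_ball x0 (3 * r) x * (D [l, m] x - a $ l)^2) / r^2
      + (LBINT x. in_ball x0 (3 * r) x * (D [m] x - (a \<bullet> x + c))^2) / r ^ 4)"
  by (rule Dcacc[OF r sub3])
 also have "... <= C * ((\<Sum>l\<in>UNIV. V l) / r^2 + (256 * 8 ^ CARD('n) * ?n * r^2 * (\<Sum>l\<in>UNIV. V l)) / r ^ 4)"
 proof (intro mult_left_mono[OF _ C] add_mono divide_right_mono sum_mono)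
  fix l
  have "ball x0 (3 * r) \<subseteq> ball x0 (8 * r)" using r by (intro subset_ball) simp
  then show "(LBINT x. in_ball x0 (3 * r) x * (D [l, m] x - a $ l)^2) <= V l"
   unfolding V_def Dsym[of l m] by (intro integral_mono Vint) (auto simp: indicator_def)
  have "ball x0 (3 * r) \<subseteq> ball x0 (4 * r)" using r by (intro subset_ball) simp
  then have "(LBINT x. in_ball x0 (3 * r) x * (D [m] x - (a \<bullet> x + c))^2) <= (LBINT x. in_ball x0 (4 * r) x * (D [m] x - (a \<bullet> x + c))^2)"
   by (intro integral_mono square_integrable_ball_minus[OF Dm Db]) (auto simp: indicator_def)
  then show "(LBINT x. in_ball x0 (3 * r) x * (D [m] x - (a \<bullet> x + c))^2) <= 256 * 8 ^ CARD('n) * ?n * r^2 * (\<Sum>l\<in>UNIV. V l)"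
   using pm by linarith
 qed auto
 also have "... = C * (1 + 256 * ?n * 8 ^ CARD('n)) * ((\<Sum>l\<in>UNIV. V l) / r^2)"
  using r by (simp add: power2_eq_square power4_eq_xxxx field_simps)
 also have "... <= C * (1 + 256 * ?n * 8 ^ CARD('n)) * (?n * (512 * E))"
 proof (intro mult_left_mono)
  have "(\<Sum>l\<in>UNIV. V l) <= (\<Sum>l\<in>(UNIV :: 'n set). 512 * r^2 * E)" by (intro sum_mono Vle)
  then show "(\<Sum>l\<in>UNIV. V l) / r^2 <= ?n * (512 * E)" using r by (simp add: field_simps)
 qed (use C in auto)
 also have "... = C * (512 * ?n * (1 + 256 * ?n * 8 ^ CARD('n))) * E" by (simp only: mult_ac)
 finally show ?thesis unfolding E_def .
qed

text \<open>Split off the mean: the oscillation is bounded by the Poincare inequality, the mean by the \<open>L\<^sup>1\<close> norm.\<close>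

lemma low_order_bound:
 assumes l: "length is <= 2" and r: "r > 0" and sub: "ball x0 (16 * r) \<subseteq> ball 0 \<rho>" and \<tau>: "0 < \<tau>" "\<tau> <= 1/2"
 defines "b \<equiv> measure lborel (ball x0 r)"
 shows "(LBINT x. in_ball x0 r x * (D is x)^2)
  <= 16 * (\<tau>^2 * 2 ^ CARD('n) * (LBINT x. in_ball x0 (16 * r) x * (T x)^2)
   + (LBINT x. in_ball x0 (16 * r) x * T x)^2 / (\<tau> ^ CARD('n))^2 / b)
   + 2 * (LBINT x. in_ball x0 (16 * r) x * T x)^2 / b"
proof -
 define c where "c = (LBINT y. in_ball x0 r y * D is y) / b"
 have b: "b > 0" unfolding b_def using r content_ball_gt_0_iff[of x0 r] by simp
 have sub2: "ball x0 (2 * r) \<subseteq> ball 0 \<rho>" and sub1: "ball x0 r \<subseteq> ball 0 \<rho>"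
  using sub r subset_ball[of "2 * r" "16 * r" x0] subset_ball[of r "16 * r" x0] by auto
 have "x0 \<in> ball x0 r" using r by simp
 then have "x0 \<in> ball 0 \<rho>" using sub1 by blast
 have r1: "r <= 1"
 proof -
  define k :: 'n where "k = undefined"
  have "x0 + (3 / 2 * r) *R axis k 1 \<in> ball x0 (2 * r)" "x0 - (3 / 2 * r) *R axis k 1 \<in> ball x0 (2 * r)"
   using r by (auto simp: dist_norm)
  then have "x0 + (3 / 2 * r) *R axis k 1 \<in> ball 0 \<rho>" "x0 - (3 / 2 * r) *R axis k 1 \<in> ball 0 \<rho>" using sub2 by blast+
  then have "norm (x0 + (3 / 2 * r) *R axis k 1) < \<rho>" "norm (x0 - (3 / 2 * r) *R axis k 1) < \<rho>" by auto
  moreover have "norm ((3 * r) *R (axis k 1 :: real^'n)) <= norm (x0 + (3 / 2 * r) *R axis k 1) + norm (x0 - (3 / 2 * r) *R axis k 1)"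
   using norm_triangle_ineq4[of "x0 + (3 / 2 * r) *R axis k 1" "x0 - (3 / 2 * r) *R axis k 1"]
   by (simp add: algebra_simps flip: scaleR_add_left)
  moreover have "norm ((3 * r) *R (axis k 1 :: real^'n)) = 3 * r" using r by simp
  ultimately show ?thesis using \<rho> by linarith
 qed
 have l3: "length is <= 3" using l by simp
 have iB: "integrable lborel (%x. in_ball x0 r x * (2 * c^2))"
  using emeasure_lborel_ball_finite[of x0 r] by (intro integrable_mult_left integrable_real_indicator) auto
 have ic: "integrable lborel (%x. in_ball x0 r x * (D is x - c)^2)"
  using square_integrable_ball_minus[OF Dm[OF l3] Db[OF l], of x0 r 0 c] by simp
 have "(LBINT x. in_ball x0 r x * (D is x)^2)
  <= (LBINT x. 2 * (in_ball x0 r x * (D is x - c)^2) + in_ball x0 r x * (2 * c^2))"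
 proof (rule integral_mono)
  show "integrable lborel (%x. in_ball x0 r x * (D is x)^2)" by (intro integrable_ind D2 l3) simp
  show "integrable lborel (%x. 2 * (in_ball x0 r x * (D is x - c)^2) + in_ball x0 r x * (2 * c^2))"
   by (intro integrable_add integrable_mult_right ic iB)
  fix x
  have "0 <= (D is x - 2 * c)^2" by simp
  then have "(D is x)^2 <= 2 * (D is x - c)^2 + 2 * c^2" by (simp add: power2_eq_square algebra_simps)
  then show "in_ball x0 r x * (D is x)^2 <= 2 * (in_ball x0 r x * (D is x - c)^2) + in_ball x0 r x * (2 * c^2)"
   by (auto simp: indicator_def)
 qed
 also have "... = 2 * (LBINT x. in_ball x0 r x * (D is x - c)^2) + (LBINT x. in_ball x0 r x * (2 * c^2))"
  by (subst integral_add[OF integrable_mult_right[OF ic] iB]) (simp only: integral_mult_right_zero)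
 also have "(LBINT x. in_ball x0 r x * (2 * c^2)) = b * (2 * c^2)"
  by (simp only: integral_mult_left_zero) (simp add: b_def)
 also have "b * (2 * c^2) <= 2 * (LBINT x. in_ball x0 (16 * r) x * T x)^2 / b"
 proof -
  have "\<bar>(LBINT y. in_ball x0 r y * D is y)\<bar> <= (LBINT y. \<bar>in_ball x0 r y * D is y\<bar>)"
   by (rule integral_abs_bound)
  also have "... <= (LBINT y. in_ball x0 (16 * r) y * T y)"
  proof (rule integral_mono)
   show "integrable lborel (%y. \<bar>in_ball x0 r y * D is y\<bar>)" by (intro integrable_abs integrable_ind D1 l3) simp
   show "integrable lborel (%y. in_ball x0 (16 * r) y * T y)" by (intro integrable_ind T1) simp
   show "\<bar>in_ball x0 r y * D is y\<bar> <= in_ball x0 (16 * r) y * T y" for y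
    using D_le_T[OF l3, of y] sub1 T0[of y] subset_ball[of r "16 * r" x0] r by (auto simp: indicator_def)
  qed
  finally have "\<bar>(LBINT y. in_ball x0 r y * D is y)\<bar>^2 <= (LBINT y. in_ball x0 (16 * r) y * T y)^2"
   by (intro power_mono) auto
  then have "2 * (LBINT y. in_ball x0 r y * D is y)^2 / b <= 2 * (LBINT y. in_ball x0 (16 * r) y * T y)^2 / b"
   using b by (intro divide_right_mono mult_left_mono) auto
  moreover have "b * (2 * c^2) = 2 * (LBINT y. in_ball x0 r y * D is y)^2 / b"
   unfolding c_def using b by (simp add: power2_eq_square field_simps)
  ultimately show ?thesis by simp
 qed
 also have "2 * (LBINT x. in_ball x0 r x * (D is x - c)^2)
  <= 2 * (8 * r^2 * (\<tau>^2 * 2 ^ CARD('n) * (LBINT x. in_ball x0 (2 * r) x * (T x)^2)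
   + (LBINT x. in_ball x0 (2 * r) x * T x)^2 / (\<tau> ^ CARD('n))^2 / b))"
  unfolding c_def b_def by (intro mult_left_mono poincare_D[OF l r sub2 \<tau>]) simp
 also have "... <= 2 * (8 * 1 * (\<tau>^2 * 2 ^ CARD('n) * (LBINT x. in_ball x0 (16 * r) x * (T x)^2)
   + (LBINT x. in_ball x0 (16 * r) x * T x)^2 / (\<tau> ^ CARD('n))^2 / b))"
 proof (intro mult_left_mono mult_mono add_mono divide_right_mono T_ball_mono)
  show "r^2 <= 1" using r r1 by (simp add: power_le_one)
 qed (use r b in \<open>auto intro!: add_nonneg_nonneg mult_nonneg_nonneg divide_nonneg_nonneg integral_nonneg\<close>)
 finally show ?thesis by simp
qed

text \<open>The factor of the first term is small with \<open>\<tau>\<close>, which is chosen later according to the dimension.\<close>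

lemma reverse_hoelder_T:
 assumes r: "r > 0" and sub: "ball x0 (16 * r) \<subseteq> ball 0 \<rho>" and \<tau>: "0 < \<tau>" "\<tau> <= 1/2"
 defines "Q \<equiv> C * (512 * real CARD('n) * (1 + 256 * real CARD('n) * 8 ^ CARD('n))) + 16"
 shows "(LBINT x. in_ball x0 r x * (T x)^2)
  <= S^2 * Q * \<tau>^2 * 2 ^ CARD('n) * (LBINT x. in_ball x0 (16 * r) x * (T x)^2)
  + S^2 * (Q / (\<tau> ^ CARD('n))^2 + 2) / unit_ball_vol (real CARD('n)) / r ^ CARD('n)
    * (LBINT x. in_ball x0 (16 * r) x * T x)^2"
proof -
 define b where "b = measure lborel (ball x0 r)"
 have b: "b > 0" unfolding b_def using r content_ball_gt_0_iff[of x0 r] by simp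
 have beq: "b = unit_ball_vol (real CARD('n)) * r ^ CARD('n)" unfolding b_def using r by (simp add: measure_ball_scale)
 define t2 where "t2 = (LBINT x. in_ball x0 (16 * r) x * (T x)^2)"
 define t1 where "t1 = (LBINT x. in_ball x0 (16 * r) x * T x)"
 have t20: "t2 >= 0" unfolding t2_def by (intro integral_nonneg) simp
 define E where "E = \<tau>^2 * 2 ^ CARD('n) * t2 + t1^2 / (\<tau> ^ CARD('n))^2 / b"
 have E0: "E >= 0" unfolding E_def using t20 b by (intro add_nonneg_nonneg mult_nonneg_nonneg divide_nonneg_nonneg) auto
 define B where "B = Q * E + 2 * t1^2 / b"
 have Cn: "0 <= C * (512 * real CARD('n) * (1 + 256 * real CARD('n) * 8 ^ CARD('n)))" using C by simp
 have each: "(LBINT x. in_ball x0 r x * (D is x)^2) <= B" if l: "length is <= 3" for "is"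
 proof (cases "length is <= 2")
  case True
  have "(LBINT x. in_ball x0 r x * (D is x)^2) <= 16 * E + 2 * t1^2 / b"
   unfolding E_def t1_def t2_def b_def by (rule low_order_bound[OF True r sub \<tau>])
  also have "... <= B" unfolding B_def Q_def using E0 Cn by (intro add_right_mono mult_right_mono) auto
  finally show ?thesis .
 next
  case False
  then have "length is = 3" using l by simp
  then obtain i j m where "is": "is = [i, j, m]" by (auto simp: numeral_3_eq_3 length_Suc_conv)
  have "(LBINT x. in_ball x0 r x * (D is x)^2) <= C * (512 * real CARD('n) * (1 + 256 * real CARD('n) * 8 ^ CARD('n))) * E"
   unfolding "is" E_def t1_def t2_def b_def by (rule third_order_bound[OF r sub \<tau>])
  also have "... <= Q * E" unfolding Q_def using E0 by (intro mult_right_mono) auto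
  also have "... <= B" unfolding B_def using b by simp
  finally show ?thesis .
 qed
 have "(LBINT x. in_ball x0 r x * (T x)^2) <= (LBINT x. S * (\<Sum>is\<in>multi 3. in_ball x0 r x * (D is x)^2))"
 proof (rule integral_mono)
  show "integrable lborel (%x. in_ball x0 r x * (T x)^2)" by (intro integrable_ind T2) simp
  show "integrable lborel (%x. S * (\<Sum>is\<in>multi 3. in_ball x0 r x * (D is x)^2))"
   by (intro integrable_mult_right integrable_sum integrable_ind D2) auto
  have nn: "0 <= S * (\<Sum>is\<in>multi 3. (D is x)^2)" for x by (intro mult_nonneg_nonneg sum_nonneg) (auto simp: S)
  show "in_ball x0 r x * (T x)^2 <= S * (\<Sum>is\<in>multi 3. in_ball x0 r x * (D is x)^2)" for x
  proof (cases "x \<in> ball x0 r")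
   case True
   then show ?thesis using T_square_le[of x] nn[of x] by (cases "x \<in> ball 0 \<rho>") auto
  qed simp
 qed
 also have "... = S * (\<Sum>is\<in>multi 3. LBINT x. in_ball x0 r x * (D is x)^2)"
 proof -
  have "integrable lborel (%x. in_ball x0 r x * (D is x)^2)" if "is \<in> multi 3" for "is"
   using that by (intro integrable_ind D2) auto
  then show ?thesis by (simp only: integral_mult_right_zero integral_sum)
 qed
 also have "... <= S * (\<Sum>is\<in>(multi 3 :: 'n list set). B)"
  by (intro mult_left_mono sum_mono each) (auto simp: S)
 also have "... = S^2 * B" by (simp add: power2_eq_square S)
 also have "... = S^2 * Q * \<tau>^2 * 2 ^ CARD('n) * t2 + S^2 * (Q / (\<tau> ^ CARD('n))^2 + 2) / b * t1^2"
  unfolding B_def E_def by (simp add: algebra_simps add_divide_distrib)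
 also have "... = S^2 * Q * \<tau>^2 * 2 ^ CARD('n) * t2 + S^2 * (Q / (\<tau> ^ CARD('n))^2 + 2) / unit_ball_vol (real CARD('n)) / r ^ CARD('n) * t1^2"
  unfolding beq by simp
 finally show ?thesis unfolding t1_def t2_def .
qed

end

section \<open>The nonlinearity\<close>

lemma subspace_sym_mats: "subspace (sym_mats :: (real^'n::finite^'n) set)"
 unfolding subspace_def sym_mats_def by (auto simp: transpose_def vec_eq_iff)

lemma sym_matsD: "\<sigma> \<in> sym_mats ==> \<sigma> $ i $ j = \<sigma> $ j $ i"
 unfolding sym_mats_def transpose_def by (auto simp: vec_eq_iff)

lemma sym_unit_sym_mats: "sym_unit i j \<in> (sym_mats :: (real^'n::finite^'n) set)"
 unfolding sym_mats_def sym_unit_def by (auto simp: transpose_def vec_eq_iff axis_def)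

lemma sym_unit_expansion:
 fixes \<sigma> :: "real^'n::finite^'n"
 assumes "\<sigma> \<in> sym_mats"
 shows "\<sigma> = (\<Sum>(k, l)\<in>UNIV. (\<sigma> $ k $ l) *R sym_unit k l)"
proof -
 have "(\<Sum>(k, l)\<in>UNIV. (\<sigma> $ k $ l) *R sym_unit k l) $ i $ j = \<sigma> $ i $ j" for i j
 proof -
  have "(\<Sum>(k, l)\<in>UNIV. (\<sigma> $ k $ l) *R sym_unit k l) $ i $ j
    = (\<Sum>k\<in>UNIV. \<Sum>l\<in>UNIV. \<sigma> $ k $ l * (sym_unit k l $ i $ j))"
   by (simp add: sum.cartesian_product UNIV_Times_UNIV[symmetric] split_def del: UNIV_Times_UNIV)
  also have "... = (\<Sum>k\<in>UNIV. \<Sum>l\<in>UNIV. (if k = i then if l = j then \<sigma> $ k $ l / 2 else 0 else 0)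
    + (if k = j then if l = i then \<sigma> $ k $ l / 2 else 0 else 0))"
   by (intro sum.cong refl) (auto simp: sym_unit_def axis_def)
  also have "... = (\<Sum>k\<in>UNIV. (if k = i then \<sigma> $ k $ j / 2 else 0)) + (\<Sum>k\<in>UNIV. (if k = j then \<sigma> $ k $ i / 2 else 0))"
   unfolding sum.distrib[symmetric] by (intro sum.cong refl) (auto simp: sum.distrib)
  also have "... = \<sigma> $ i $ j" using sym_matsD[OF assms, of i j] by simp
  finally show ?thesis .
 qed
 then show ?thesis by (simp add: vec_eq_iff)
qed

lemma smooth_on_dd: "smooth_on V U f ==> v \<in> V ==> smooth_on V U (dd v f)"
 unfolding smooth_on_def dderivs_dd by simp

lemma norm_matrix_square:
 fixes \<sigma> :: "real^'n::finite^'m::finite"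
 shows "(norm \<sigma>)^2 = (\<Sum>i\<in>UNIV. \<Sum>j\<in>UNIV. (\<sigma> $ i $ j)^2)"
 by (simp add: norm_vec_def L2_set_def sum_nonneg)

locale smooth_matrix_function =
 fixes U :: "(real^'n::finite^'n) set" and F :: "real^'n^'n => real"
 assumes convex: "convex U" and openin: "openin (top_of_set sym_mats) U"
  and smooth_F: "smooth_on sym_mats U F" and bdd: "bdd_above (b_values U F)"
begin

lemma U_sym: "\<xi> \<in> U ==> \<xi> \<in> sym_mats"
 using openin openin_imp_subset by blast

lemma diff_sym: "\<xi> \<in> U ==> \<zeta> \<in> U ==> \<zeta> - \<xi> \<in> sym_mats"
 using U_sym subspace_diff[OF subspace_sym_mats] by blast

lemma segment: "\<xi> \<in> U ==> \<zeta> \<in> U ==> 0 <= t ==> t <= 1 ==> \<xi> + t *R (\<zeta> - \<xi>) \<in> U"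
 using convexD_alt[OF convex, of \<xi> \<zeta> t] by (simp add: algebra_simps)

lemma smooth_F1: "smooth_on sym_mats U (F1 F i j)"
 unfolding F1_def using smooth_on_dd[OF smooth_F sym_unit_sym_mats] by simp

lemma dd_F1:
 assumes "\<xi> \<in> U" "\<sigma> \<in> sym_mats"
 shows "dd \<sigma> (F1 F i j) \<xi> = (\<Sum>k\<in>UNIV. \<Sum>l\<in>UNIV. F2 F i j k l \<xi> * \<sigma> $ k $ l)"
proof -
 have "dd \<sigma> (F1 F i j) \<xi> = dd (\<Sum>kl\<in>UNIV. (\<sigma> $ fst kl $ snd kl) *R sym_unit (fst kl) (snd kl)) (F1 F i j) \<xi>"
  using sym_unit_expansion[OF assms(2)] by (simp add: split_def)
 also have "... = (\<Sum>kl\<in>UNIV. \<sigma> $ fst kl $ snd kl * dd (sym_unit (fst kl) (snd kl)) (F1 F i j) \<xi>)"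
  by (rule dd_sum_direction[OF smooth_F1 subspace_sym_mats openin assms(1) sym_unit_sym_mats])
 also have "... = (\<Sum>k\<in>UNIV. \<Sum>l\<in>UNIV. F2 F i j k l \<xi> * \<sigma> $ k $ l)"
  by (simp add: sum.cartesian_product UNIV_Times_UNIV[symmetric] split_def F2_def mult.commute del: UNIV_Times_UNIV)
 finally show ?thesis .
qed

lemma F1_DERIV:
 assumes "\<xi> \<in> U" "\<zeta> \<in> U" "0 <= t" "t <= 1"
 shows "((%t. F1 F i j (\<xi> + t *R (\<zeta> - \<xi>))) has_field_derivative
  (\<Sum>k\<in>UNIV. \<Sum>l\<in>UNIV. F2 F i j k l (\<xi> + t *R (\<zeta> - \<xi>)) * (\<zeta> - \<xi>) $ k $ l)) (at t)"
proof -
 have U: "\<xi> + t *R (\<zeta> - \<xi>) \<in> U" by (rule segment[OF assms])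
 show ?thesis
  using smooth_on_DERIV_at[OF smooth_F1 U diff_sym[OF assms(1,2)], of "[]" i j] dd_F1[OF U diff_sym[OF assms(1,2)]]
  by simp
qed

text \<open>The bound on the coefficients controls the second derivatives: take both Hessian arguments equal.\<close>

lemma F2_le_b_sup:
 assumes "\<xi> \<in> U" shows "\<bar>F2 F i j k l \<xi>\<bar> <= b_sup U F"
 unfolding b_sup_def
proof (rule cSup_upper[OF _ bdd])
 have "b_coeff F i j k l \<xi> \<xi> = F2 F i j k l \<xi>" by (simp add: b_coeff_def)
 then show "\<bar>F2 F i j k l \<xi>\<bar> \<in> b_values U F"
  unfolding b_values_def using assms by (metis (mono_tags, lifting) mem_Collect_eq)
qed

lemma F1_Lipschitz:
 assumes "\<xi> \<in> U" "\<zeta> \<in> U"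
 shows "\<bar>F1 F i j \<zeta> - F1 F i j \<xi>\<bar> <= b_sup U F * (\<Sum>k\<in>UNIV. \<Sum>l\<in>UNIV. \<bar>\<zeta> $ k $ l - \<xi> $ k $ l\<bar>)"
proof -
 obtain t where t: "0 < t" "t < 1" "F1 F i j (\<xi> + 1 *R (\<zeta> - \<xi>)) - F1 F i j (\<xi> + 0 *R (\<zeta> - \<xi>))
   = (1 - 0) * (\<Sum>k\<in>UNIV. \<Sum>l\<in>UNIV. F2 F i j k l (\<xi> + t *R (\<zeta> - \<xi>)) * (\<zeta> - \<xi>) $ k $ l)"
  using MVT2[of 0 1, OF _ F1_DERIV[OF assms]] by auto
 have U: "\<xi> + t *R (\<zeta> - \<xi>) \<in> U" using t by (intro segment assms) auto
 have "\<bar>F1 F i j \<zeta> - F1 F i j \<xi>\<bar> = \<bar>\<Sum>k\<in>UNIV. \<Sum>l\<in>UNIV. F2 F i j k l (\<xi> + t *R (\<zeta> - \<xi>)) * (\<zeta> - \<xi>) $ k $ l\<bar>"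
  using t(3) by simp
 also have "... <= (\<Sum>k\<in>UNIV. \<Sum>l\<in>UNIV. \<bar>F2 F i j k l (\<xi> + t *R (\<zeta> - \<xi>)) * (\<zeta> - \<xi>) $ k $ l\<bar>)"
  by (intro order_trans[OF sum_abs] sum_mono sum_abs)
 also have "... <= (\<Sum>k\<in>UNIV. \<Sum>l\<in>UNIV. b_sup U F * \<bar>\<zeta> $ k $ l - \<xi> $ k $ l\<bar>)"
  using F2_le_b_sup[OF U] by (intro sum_mono) (auto simp: abs_mult intro!: mult_right_mono)
 finally show ?thesis by (simp add: sum_distrib_left)
qed

text \<open>The derivative along the segment from \<open>\<xi>\<close> to \<open>\<zeta>\<close> of the pairing of \<open>F\<^sup>i\<^sup>j\<close> with \<open>\<zeta> - \<xi>\<close> is the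
 quadratic form of the convexity hypothesis; the sign \<open>s\<close> covers concave functions as well.\<close>

lemma F1_monotone:
 assumes conv: "!!\<xi> \<sigma>. \<xi> \<in> U ==> \<sigma> \<in> sym_mats ==>
   s * (\<Sum>i\<in>UNIV. \<Sum>j\<in>UNIV. \<Sum>k\<in>UNIV. \<Sum>l\<in>UNIV. F2 F i j k l \<xi> * \<sigma> $ i $ j * \<sigma> $ k $ l) >= \<Lambda> * (norm \<sigma>)^2"
  and U: "\<xi> \<in> U" "\<zeta> \<in> U"
 shows "(\<Sum>i\<in>UNIV. \<Sum>j\<in>UNIV. s * (F1 F i j \<zeta> - F1 F i j \<xi>) * (\<zeta> $ i $ j - \<xi> $ i $ j))
  >= \<Lambda> * (\<Sum>i\<in>UNIV. \<Sum>j\<in>UNIV. (\<zeta> $ i $ j - \<xi> $ i $ j)^2)"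
proof -
 define \<sigma> where "\<sigma> = \<zeta> - \<xi>"
 have \<sigma>: "\<sigma> \<in> sym_mats" unfolding \<sigma>_def by (rule diff_sym[OF U])
 define \<phi> where "\<phi> t = (\<Sum>i\<in>UNIV. \<Sum>j\<in>UNIV. s * \<sigma> $ i $ j * F1 F i j (\<xi> + t *R (\<zeta> - \<xi>)))" for t
 define \<phi>' where "\<phi>' t = (\<Sum>i\<in>UNIV. \<Sum>j\<in>UNIV. s * \<sigma> $ i $ j *
   (\<Sum>k\<in>UNIV. \<Sum>l\<in>UNIV. F2 F i j k l (\<xi> + t *R (\<zeta> - \<xi>)) * (\<zeta> - \<xi>) $ k $ l))" for t
 have D: "(\<phi> has_field_derivative \<phi>' t) (at t)" if "0 <= t" "t <= 1" for t
  unfolding \<phi>_def[abs_def] \<phi>'_def by (intro DERIV_sum DERIV_cmult F1_DERIV U that)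
 obtain t where t: "0 < t" "t < 1" "\<phi> 1 - \<phi> 0 = (1 - 0) * \<phi>' t"
  using MVT2[of 0 1, OF _ D] by auto
 have UU: "\<xi> + t *R (\<zeta> - \<xi>) \<in> U" using t by (intro segment U) auto
 have "\<Lambda> * (norm \<sigma>)^2 <= \<phi>' t"
  using conv[OF UU \<sigma>] unfolding \<phi>'_def \<sigma>_def[symmetric] by (simp add: sum_distrib_left mult_ac)
 also have "\<phi>' t = \<phi> 1 - \<phi> 0" using t(3) by simp
 also have "... = (\<Sum>i\<in>UNIV. \<Sum>j\<in>UNIV. s * (F1 F i j \<zeta> - F1 F i j \<xi>) * (\<zeta> $ i $ j - \<xi> $ i $ j))"
  unfolding \<phi>_def sum_subtractf[symmetric] by (intro sum.cong refl) (simp add: \<sigma>_def algebra_simps)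
 finally show ?thesis by (simp add: norm_matrix_square \<sigma>_def)
qed

lemma openin_eventually:
 assumes "\<xi> \<in> U" "\<sigma> \<in> sym_mats"
 shows "\<forall>\<^sub>F t in nhds (0::real). \<xi> + t *R \<sigma> \<in> U"
proof -
 obtain T where T: "open T" "U = sym_mats \<inter> T" using openin by (auto simp: openin_open)
 have "((%t::real. \<xi> + t *R \<sigma>) \<longlongrightarrow> \<xi> + 0 *R \<sigma>) (nhds 0)" by (intro tendsto_intros filterlim_ident)
 then have "\<forall>\<^sub>F t in nhds (0::real). \<xi> + t *R \<sigma> \<in> T"
  by (rule topological_tendstoD) (use T assms(1) in auto)
 then show ?thesis
  using T(2) U_sym[OF assms(1)] assms(2)
  by (auto elim!: eventually_mono intro!: subspace_add[OF subspace_sym_mats] subspace_scale[OF subspace_sym_mats])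
qed

text \<open>Only derivatives inside \<open>U\<close> are known to exist, hence the localization near \<open>\<xi>\<close>.\<close>

lemma F2_uminus:
 assumes \<xi>: "\<xi> \<in> U"
 shows "F2 (%\<xi>. - F \<xi>) i j k l \<xi> = - F2 F i j k l \<xi>"
proof -
 have F1: "F1 (%\<xi>. - F \<xi>) i j \<zeta> = - F1 F i j \<zeta>" if "\<zeta> \<in> U" for \<zeta>
  using DERIV_minus[OF smooth_on_DERIV[OF smooth_F that sym_unit_sym_mats[of i j], of "[]"]]
  unfolding F1_def dderivs.simps by (auto intro: DERIV_imp_deriv)
 have "((%t. - F1 F i j (\<xi> + t *R sym_unit k l)) has_field_derivative - F2 F i j k l \<xi>) (at 0)"
  using DERIV_minus[OF smooth_on_DERIV[OF smooth_F1 \<xi> sym_unit_sym_mats[of k l], of "[]" i j]] unfolding F2_def by simp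
 moreover have "\<forall>\<^sub>F t in nhds (0::real). - F1 F i j (\<xi> + t *R sym_unit k l) = F1 (%\<xi>. - F \<xi>) i j (\<xi> + t *R sym_unit k l)"
  using openin_eventually[OF \<xi> sym_unit_sym_mats[of k l]] by eventually_elim (simp add: F1)
 ultimately have "((%t. F1 (%\<xi>. - F \<xi>) i j (\<xi> + t *R sym_unit k l)) has_field_derivative - F2 F i j k l \<xi>) (at 0)"
  by (subst (asm) DERIV_cong_ev[OF refl _ refl])
 then show ?thesis unfolding F2_def dderivs.simps by (rule DERIV_imp_deriv)
qed

text \<open>In the concave case the monotone field is \<open>-F\<^sup>i\<^sup>j\<close>; the weak equation does not see the sign.\<close>

lemma monotone_field:
 assumes "uniformly_convex_on \<Lambda> U F \<or> uniformly_concave_on \<Lambda> U F"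
 obtains s :: real where "\<bar>s\<bar> = 1"
  "!!\<xi> \<zeta>. \<xi> \<in> U ==> \<zeta> \<in> U ==> (\<Sum>i\<in>UNIV. \<Sum>j\<in>UNIV. s * (F1 F i j \<zeta> - F1 F i j \<xi>) * (\<zeta> $ i $ j - \<xi> $ i $ j))
   >= \<Lambda> * (\<Sum>i\<in>UNIV. \<Sum>j\<in>UNIV. (\<zeta> $ i $ j - \<xi> $ i $ j)^2)"
 using assms
proof
 assume c: "uniformly_convex_on \<Lambda> U F"
 show ?thesis
  by (rule that[of 1], simp, rule F1_monotone) (use c in \<open>auto simp: uniformly_convex_on_def\<close>)
next
 assume c: "uniformly_concave_on \<Lambda> U F"
 have "\<Lambda> * (norm \<sigma>)^2 <= (-1) * (\<Sum>i\<in>UNIV. \<Sum>j\<in>UNIV. \<Sum>k\<in>UNIV. \<Sum>l\<in>UNIV. F2 F i j k l \<xi> * \<sigma> $ i $ j * \<sigma> $ k $ l)"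
  if "\<xi> \<in> U" "\<sigma> \<in> sym_mats" for \<xi> \<sigma>
  using c that unfolding uniformly_concave_on_def uniformly_convex_on_def
  by (auto simp: F2_uminus[OF that(1)] sum_negf)
 then show ?thesis by (intro that[of "-1"] F1_monotone) auto
qed

end

section \<open>Representatives of weak derivatives\<close>

text \<open>Sobolev functions are Lebesgue measurable on a domain, while the estimates are about Borel functions on the
 whole space. This lemma transfers integrals between the two settings.\<close>

lemma lebesgue_on_representative:
 fixes F f :: "real^'n::finite => real"
 assumes \<Omega>: "\<Omega> \<in> sets borel" and f: "f \<in> borel_fns" and ae: "AE x in lebesgue_on \<Omega>. F x = f x"
  and out: "!!x. x \<notin> \<Omega> ==> f x = 0"
 shows "F \<in> borel_measurable (lebesgue_on \<Omega>)" "(LINT x|lebesgue_on \<Omega>. F x) = (LBINT x. f x)"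
  "integrable (lebesgue_on \<Omega>) F \<longleftrightarrow> integrable lborel f"
proof -
 have \<Omega>l: "\<Omega> \<inter> space lebesgue \<in> sets lebesgue" using \<Omega> by auto
 have fl: "f \<in> borel_measurable lborel" using f by simp
 have fl': "f \<in> borel_measurable lebesgue" using fl by (rule measurable_completion)
 have ae': "AE x in lebesgue. f x = indicator \<Omega> x *R F x"
  using ae unfolding AE_restrict_space_iff[OF \<Omega>l]
  by eventually_elim (auto simp: out indicator_def)
 have m: "(%x. indicator \<Omega> x *R F x) \<in> borel_measurable lebesgue"
  by (rule borel_measurable_AE[OF fl' ae'])
 then show "F \<in> borel_measurable (lebesgue_on \<Omega>)"
  unfolding borel_measurable_restrict_space_iff[OF \<Omega>l] .
 have "(LINT x|lebesgue_on \<Omega>. F x) = (LINT x|lebesgue. indicator \<Omega> x *R F x)"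
  by (rule integral_restrict_space[OF \<Omega>l])
 also have "... = (LINT x|lebesgue. f x)"
  by (intro integral_cong_AE m fl') (use ae' in eventually_elim, simp)
 also have "... = (LBINT x. f x)" by (rule integral_completion[OF fl])
 finally show "(LINT x|lebesgue_on \<Omega>. F x) = (LBINT x. f x)" .
 have "integrable (lebesgue_on \<Omega>) F \<longleftrightarrow> integrable lebesgue (%x. indicator \<Omega> x *R F x)"
  by (rule integrable_restrict_space[OF \<Omega>l])
 also have "... \<longleftrightarrow> integrable lebesgue f"
  by (intro integrable_cong_AE m fl') (use ae' in eventually_elim, simp)
 also have "... \<longleftrightarrow> integrable lborel f" by (rule integrable_completion[OF fl])
 finally show "integrable (lebesgue_on \<Omega>) F \<longleftrightarrow> integrable lborel f" .
qed

lemma borel_representative: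
 fixes F :: "real^'n::finite => real"
 assumes \<Omega>: "\<Omega> \<in> sets borel" and F: "F \<in> borel_measurable (lebesgue_on \<Omega>)"
 obtains f where "f \<in> borel_fns" "AE x in lebesgue_on \<Omega>. F x = f x" "!!x. x \<notin> \<Omega> ==> f x = 0"
proof -
 have \<Omega>l: "\<Omega> \<inter> space lebesgue \<in> sets lebesgue" using \<Omega> by auto
 have "(%x. indicator \<Omega> x *R F x) \<in> borel_measurable lebesgue"
  using F unfolding borel_measurable_restrict_space_iff[OF \<Omega>l] .
 then obtain g where g: "g \<in> borel_measurable lborel" "AE x in lborel. indicator \<Omega> x *R F x = g x"
  using completion_ex_borel_measurable_real by blast
 show ?thesis
 proof (rule that[of "%x. indicator \<Omega> x * g x"])
  show "(%x. indicator \<Omega> x * g x) \<in> borel_fns"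
   using g(1) \<Omega> by (intro borel_measurable_times borel_measurable_indicator) simp_all
  show "AE x in lebesgue_on \<Omega>. F x = indicator \<Omega> x * g x"
   unfolding AE_restrict_space_iff[OF \<Omega>l] using AE_completion[OF g(2)]
   by eventually_elim (auto simp: indicator_def)
 qed simp
qed

lemma bounded_borel_representative:
 fixes F :: "real^'n::finite => real"
 assumes \<Omega>: "\<Omega> \<in> sets borel" and F: "F \<in> borel_measurable (lebesgue_on \<Omega>)" and M: "AE x in lebesgue_on \<Omega>. \<bar>F x\<bar> <= M"
 obtains f where "f \<in> borel_fns" "AE x in lebesgue_on \<Omega>. F x = f x" "!!x. x \<notin> \<Omega> ==> f x = 0" "!!x. \<bar>f x\<bar> <= \<bar>M\<bar>"
proof -
 obtain g where g: "g \<in> borel_fns" "AE x in lebesgue_on \<Omega>. F x = g x" "!!x. x \<notin> \<Omega> ==> g x = 0"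
  by (rule borel_representative[OF \<Omega> F]) (rule that)
 show ?thesis
 proof (rule that[of "%x. max (- \<bar>M\<bar>) (min \<bar>M\<bar> (g x))"])
  show "(%x. max (- \<bar>M\<bar>) (min \<bar>M\<bar> (g x))) \<in> borel_fns"
   using g(1) by (intro borel_measurable_max borel_measurable_min) auto
  show "AE x in lebesgue_on \<Omega>. F x = max (- \<bar>M\<bar>) (min \<bar>M\<bar> (g x))"
   using g(2) M by eventually_elim auto
 qed (use g(3) in auto)
qed

text \<open>The difference of two candidates is orthogonal to all test functions supported in small balls, and countably
 many such balls cover the domain.\<close>

lemma weak_deriv_unique:
 fixes f :: "real^'n::finite => real"
 assumes \<Omega>: "open \<Omega>" and g1: "is_weak_deriv \<Omega> is f g1" and g2: "is_weak_deriv \<Omega> is f g2"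
 shows "AE x in lebesgue_on \<Omega>. g1 x = g2 x"
proof -
 define h where "h x = g1 x - g2 x" for x
 have hi: "integrable (lebesgue_on K) h" if "compact K" "K \<subseteq> \<Omega>" for K
  using g1 g2 that unfolding is_weak_deriv_def locally_integrable_def h_def by auto
 have gi: "integrable (lebesgue_on K) g1" "integrable (lebesgue_on K) g2" if "compact K" "K \<subseteq> \<Omega>" for K
  using g1 g2 that unfolding is_weak_deriv_def locally_integrable_def by auto
 have \<Omega>l: "\<Omega> \<inter> space lebesgue \<in> sets lebesgue" using \<Omega> by auto
 have loc: "AE y in lebesgue. y \<in> ball x r --> h y = 0" if sub: "cball x r \<subseteq> \<Omega>" for x r
 proof -
  have Kb: "cball x r \<in> sets borel" by simp
  have Kl: "cball x r \<inter> space lebesgue \<in> sets lebesgue" by simp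
  obtain k where k: "k \<in> borel_fns" "AE y in lebesgue_on (cball x r). h y = k y" "!!y. y \<notin> cball x r ==> k y = 0"
   by (rule borel_representative[OF Kb borel_measurable_integrable[OF hi[OF compact_cball sub]]]) (rule that)
  have ki: "integrable lborel k"
   using lebesgue_on_representative(3)[OF Kb k] hi[OF compact_cball sub] by simp
  have "AE y in lborel. y \<in> ball x r --> k y = 0"
  proof (rule fundamental_lemma[OF ki open_ball])
   fix \<phi> :: "real^'n => real" assume \<phi>: "\<phi> \<in> test_functions (ball x r)"
   have \<phi>': "\<phi> \<in> test_functions \<Omega>" by (rule test_functions_mono[OF \<phi>]) (use sub in auto)
   have \<phi>0: "\<phi> y = 0" if "y \<notin> cball x r" for y
    using test_functionsD(3)[OF \<phi>] closure_subset[of "{x. \<phi> x ~= 0}"] that by fastforce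
   have red: "(LINT y|lebesgue_on \<Omega>. g y * \<phi> y) = (LINT y|lebesgue_on (cball x r). g y * \<phi> y)" for g :: "real^'n => real"
    unfolding integral_restrict_space[OF \<Omega>l] integral_restrict_space[OF Kl]
    using sub \<phi>0 by (intro integral_cong refl) (auto simp: indicator_def)
   have \<phi>m: "\<phi> \<in> borel_measurable (lebesgue_on (cball x r))"
    using test_functions_borel[OF \<phi>] by (intro measurable_restrict_space1 measurable_completion) simp
   obtain B where B: "!!y. \<bar>\<phi> y\<bar> <= B" using test_functions_bounded[OF \<phi>] by blast
   have int: "integrable (lebesgue_on (cball x r)) (%y. g y * \<phi> y)"
    if g: "integrable (lebesgue_on (cball x r)) g" for g
    by (rule integrable_mult_bounded[OF g \<phi>m B])
   have "(LBINT y. k y * \<phi> y) = (LINT y|lebesgue_on (cball x r). h y * \<phi> y)"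
   proof (rule lebesgue_on_representative(2)[OF Kb, symmetric])
    show "(%y. k y * \<phi> y) \<in> borel_fns"
     using k(1) test_functions_borel[OF \<phi>] by (intro borel_measurable_times)
    show "AE y in lebesgue_on (cball x r). h y * \<phi> y = k y * \<phi> y"
     using k(2) by eventually_elim simp
   qed (use k(3) in simp)
   also have "... = (LINT y|lebesgue_on (cball x r). g1 y * \<phi> y) - (LINT y|lebesgue_on (cball x r). g2 y * \<phi> y)"
    unfolding h_def left_diff_distrib
    by (rule integral_diff) (intro int gi compact_cball sub)+
   also have "... = 0"
    unfolding red[symmetric] using g1 g2 \<phi>' unfolding is_weak_deriv_def by simp
   finally show "(LBINT y. k y * \<phi> y) = 0" .
  qed
  then have "AE y in lebesgue. y \<in> ball x r --> k y = 0" by (rule AE_completion)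
  moreover have "AE y in lebesgue. y \<in> cball x r --> h y = k y"
   using k(2) unfolding AE_restrict_space_iff[OF Kl] .
  ultimately show ?thesis by eventually_elim auto
 qed
 have "\<forall>x\<in>\<Omega>. \<exists>r>0. cball x r \<subseteq> \<Omega>" using \<Omega> unfolding open_contains_cball by blast
 then obtain r where r: "!!x. x \<in> \<Omega> ==> r x > 0 \<and> cball x (r x) \<subseteq> \<Omega>" by metis
 obtain \<B> where \<B>: "\<B> \<subseteq> (%x. ball x (r x)) ` \<Omega>" "countable \<B>" "\<Union>\<B> = (\<Union>x\<in>\<Omega>. ball x (r x))"
  by (rule Lindelof[of "(%x. ball x (r x)) ` \<Omega>"]) auto
 have "AE y in lebesgue. \<forall>B\<in>\<B>. y \<in> B --> h y = 0"
  unfolding AE_ball_countable[OF \<B>(2)] using \<B>(1) r loc by blast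
 then show ?thesis
  unfolding AE_restrict_space_iff[OF \<Omega>l]
 proof eventually_elim
  case (elim y)
  show ?case
  proof
   assume "y \<in> \<Omega>"
   then have "y \<in> \<Union>\<B>" unfolding \<B>(3) using r[of y] by force
   then show "g1 y = g2 y" using elim by (auto simp: h_def)
  qed
 qed
qed

section \<open>The interior estimate for bounded solutions\<close>

lemma list_le_3_cases:
 assumes "length is <= 3"
 obtains "is = []" | i where "is = [i]" | i j where "is = [i, j]" | i j k where "is = [i, j, k]"
proof -
 consider "length is = 0" | "length is = 1" | "length is = 2" | "length is = 3" using assms by linarith
 then show ?thesis
  by cases (use that in \<open>auto simp: numeral_3_eq_3 numeral_2_eq_2 length_Suc_conv\<close>)
qed

text \<open>The conclusion for representatives: \<open>D\<close> lists the derivatives of \<open>u\<close> of order at most three on a ball,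
 where \<open>p\<close> and \<open>v\<close> are those of order one and two. The norm on the right is a global one of order two.\<close>

definition interior_estimate ::
 "(real^'n::finite => real) => ('n => real^'n => real) => ('n => 'n => real^'n => real) => real => real => real => bool" where
 "interior_estimate u p v d q k \<longleftrightarrow> (\<exists>D. D [] = u \<and> (\<forall>i. D [i] = p i) \<and> (\<forall>i j. D [i, j] = v i j)
  \<and> (\<forall>is. length is <= 3 --> D is \<in> borel_fns \<and> integrable lborel (D is)
     \<and> integrable lborel (%x. in_ball 0 (1 - 2 * d / 3) x * \<bar>D is x\<bar> powr q))
  \<and> (\<forall>is l. length is <= 2 --> wpd (ball 0 (1 - d / 3)) l (D is) (D (is @ [l])))
  \<and> (\<Sum>is\<in>multi 3. LBINT x. in_ball 0 (1 - 2 * d / 3) x * \<bar>D is x\<bar> powr q) powr (1 / q)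
    <= k * sqrt (\<Sum>is\<in>multi 2. LBINT x. (D is x)^2))"

text \<open>The exponent \<open>q\<close> and the constants are fixed before the solution; this is the uniformity that the
 theorem asserts.\<close>

lemma interior_estimate_uniform:
 fixes \<Lambda> L :: real
 assumes \<Lambda>: "\<Lambda> > 0" and L: "L >= 0"
 obtains q and k :: "real => real" where "q > 2" "!!d. k d >= 0"
  "!!(u :: real^'n::finite => real) p v W M d. double_divergence u p v W M \<Lambda> L ==> 0 < d ==> d <= 1 ==>
   interior_estimate u p v d q (k d)"
proof -
 obtain C and C' :: "real => real" where C: "C >= 0" and C': "!!\<rho>. C' \<rho> >= 0"
  and G: "!!(u :: real^'n => real) p v W M \<rho>.
  double_divergence u p v W M \<Lambda> L ==> 0 < \<rho> ==> \<rho> < 1 ==>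
  \<exists>G. \<forall>m i j. G m i j \<in> borel_fns \<and> integrable lborel (%x. (G m i j x)^2)
   \<and> (\<forall>x. x \<notin> ball 0 \<rho> --> G m i j x = 0) \<and> wpd (ball 0 \<rho>) m (v i j) (G m i j)
   \<and> (LBINT x. (G m i j x)^2) <= C' \<rho> * ((\<Sum>i\<in>UNIV. LBINT x. (v i m x)^2) + (LBINT x. (p m x)^2))
   \<and> (\<forall>x0 r a c. r > 0 --> ball x0 (3 * r) \<subseteq> ball 0 \<rho> -->
     (LBINT x. in_ball x0 r x * (G m i j x)^2)
     <= C * ((\<Sum>i\<in>UNIV. LBINT x. in_ball x0 (3 * r) x * (v i m x - a $ i)^2) / r^2
      + (LBINT x. in_ball x0 (3 * r) x * (p m x - (a \<bullet> x + c))^2) / r ^ 4))"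
  by (rule third_derivatives[OF \<Lambda> L]) (rule that)
 let ?n = "CARD('n)" and ?\<omega> = "unit_ball_vol (real CARD('n))"
 define S where "S = real (card (multi 3 :: 'n list set))"
 have S: "S > 0" unfolding S_def using finite_multi[of 3, where 'n='n] by (auto simp: card_gt_0_iff intro!: exI[of _ "[]"])
 define Q where "Q = C * (512 * real ?n * (1 + 256 * real ?n * 8 ^ ?n)) + 16"
 have Q: "Q > 0" unfolding Q_def using C by (intro add_nonneg_pos mult_nonneg_nonneg) auto
 \<comment> \<open>the factor required in Gehring's lemma for the enlargement \<open>16 = 2\<^sup>4\<close>\<close>
 define \<kappa> where "\<kappa> = (1 :: real) / (2 * (3 * 2 ^ 4) ^ ?n)"
 have \<kappa>: "\<kappa> > 0" unfolding \<kappa>_def by simp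
 define \<tau> where "\<tau> = min (1 / 2) (sqrt (\<kappa> / (S^2 * Q * 2 ^ ?n)))"
 have \<tau>: "0 < \<tau>" "\<tau> <= 1 / 2" unfolding \<tau>_def using \<kappa> S Q by auto
 have \<tau>\<kappa>: "S^2 * Q * \<tau>^2 * 2 ^ ?n <= \<kappa>"
 proof -
  have "\<tau>^2 <= (sqrt (\<kappa> / (S^2 * Q * 2 ^ ?n)))^2" using \<tau> by (intro power_mono) (auto simp: \<tau>_def)
  also have "... = \<kappa> / (S^2 * Q * 2 ^ ?n)" using \<kappa> S Q by simp
  finally have "\<tau>^2 * (S^2 * Q * 2 ^ ?n) <= \<kappa>" using S Q by (subst (asm) pos_le_divide_eq) auto
  then show ?thesis by (simp add: mult_ac)
 qed
 define A where "A = S^2 * (Q / (\<tau> ^ ?n)^2 + 2) / ?\<omega>"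
 have A: "A > 0" unfolding A_def using S Q \<tau> by (intro divide_pos_pos mult_pos_pos add_pos_pos) auto
 obtain \<delta> c where \<delta>: "\<delta> > 0" and c: "c >= 0" and geh: "!!(g :: real^'n => real) \<rho> \<rho>'.
   reverse_hoelder g \<rho> A 4 ?n ?\<omega> ==> 0 < \<rho>' ==> \<rho>' < \<rho> ==>
   (NNINT x. in_ball 0 \<rho>' x * ennreal (g x powr (2 + \<delta>)))
    <= ennreal (c / (sqrt (\<rho> - \<rho>') ^ ?n) powr (2 + \<delta>) * (LBINT x. (g x)^2) powr ((2 + \<delta>) / 2))"
  by (rule gehring[OF A, of 4]) (rule that)
 define q where "q = 2 + \<delta>"
 have q: "q > 2" using \<delta> by (simp add: q_def)
 define e where "e d = c / (sqrt (d / 3) ^ ?n) powr q" for d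
 have e: "e d >= 0" for d unfolding e_def using c by simp
 define B where "B d = S^2 * (1 + C' (1 - d / 3) * (real ?n + 1))" for d
 have B: "B d >= 0" for d unfolding B_def using C' by (intro mult_nonneg_nonneg add_nonneg_nonneg) auto
 show ?thesis
 proof (rule that[of q "%d. (S * e d) powr (1 / q) * sqrt (B d)"])
  fix u :: "real^'n => real" and p v W M and d :: real
  assume dd: "double_divergence u p v W M \<Lambda> L" and d: "0 < d" "d <= 1"
  interpret double_divergence u p v W M \<Lambda> L by (rule dd)
  define \<rho> where "\<rho> = 1 - d / 3"
  define \<rho>' where "\<rho>' = 1 - 2 * d / 3"
  have \<rho>: "0 < \<rho>" "\<rho> < 1" "0 < \<rho>'" "\<rho>' < \<rho>" "\<rho> - \<rho>' = d / 3" using d by (auto simp: \<rho>_def \<rho>'_def)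
  obtain G where Gm: "!!m i j. G m i j \<in> borel_fns" and G2: "!!m i j. integrable lborel (%x. (G m i j x)^2)"
   and G0: "!!m i j x. x \<notin> ball 0 \<rho> ==> G m i j x = 0" and Gw: "!!m i j. wpd (ball 0 \<rho>) m (v i j) (G m i j)"
   and Gi: "!!m i j. (LBINT x. (G m i j x)^2) <= C' \<rho> * ((\<Sum>i\<in>UNIV. LBINT x. (v i m x)^2) + (LBINT x. (p m x)^2))"
   and Gc: "!!m i j x0 r a c. r > 0 ==> ball x0 (3 * r) \<subseteq> ball 0 \<rho> ==>
     (LBINT x. in_ball x0 r x * (G m i j x)^2)
     <= C * ((\<Sum>i\<in>UNIV. LBINT x. in_ball x0 (3 * r) x * (v i m x - a $ i)^2) / r^2
      + (LBINT x. in_ball x0 (3 * r) x * (p m x - (a \<bullet> x + c))^2) / r ^ 4)"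
   using G[OF dd \<rho>(1,2)] by blast
  define D where "D is = (case is of [] => u | [i] => p i | [i, j] => v i j | [i, j, m] => G m i j | _ => (%_. 0))" for "is"
  have D[simp]: "D [] = u" "D [i] = p i" "D [i, j] = v i j" "D [i, j, m] = G m i j" for i j m
   by (simp_all add: D_def)
  have sq: "integrable lborel (%x. (f x)^2)"
   if f: "f \<in> borel_fns" "!!x. \<bar>f x\<bar> <= M" "!!x. x \<notin> ball 0 1 ==> f x = 0" for f :: "real^'n => real"
  proof (rule integrable_bounded_ball[where a=0 and R=1 and M="M^2"])
   show "\<bar>(f x)^2\<bar> <= M^2" for x using power_mono[OF f(2)[of x], of 2] by simp
   show "(f x)^2 = 0" if "x \<notin> cball 0 1" for x using that f(3)[of x] by simp
  qed (use f(1) in measurable)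
  have wm: "wpd (ball 0 \<rho>) i f g" if "wpd (ball 0 1) i f g" for i f g
   using that test_functions_mono[of _ "ball 0 \<rho>" "ball 0 1"] \<rho> unfolding wpd_def by (auto simp: subset_ball)
  interpret T: derivative_family D \<rho> M C S
  proof
   fix "is" :: "'n list" assume l: "length is <= 3"
   from l show "D is \<in> borel_fns" by (cases rule: list_le_3_cases) (auto simp: borel Gm)
   from l show "integrable lborel (%x. (D is x)^2)" by (cases rule: list_le_3_cases) (auto intro!: sq simp: borel bound outside G2)
   from l show "integrable lborel (D is)"
    by (cases rule: list_le_3_cases) (auto simp: integrable_all intro: square_integrable_ball[OF Gm G2 G0])
  next
   fix "is" :: "'n list" and x assume l: "length is <= 2"
   then have "length is <= 3" by simp
   then show "\<bar>D is x\<bar> <= M" by (cases rule: list_le_3_cases) (use l bound in auto)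
  next
   fix "is" :: "'n list" and k assume l: "length is <= 2"
   then have "length is <= 3" by simp
   then show "wpd (ball 0 \<rho>) k (D is) (D (is @ [k]))"
    by (cases rule: list_le_3_cases) (use l weak Gw in \<open>auto intro: wm\<close>)
  next
   show "D [i, j] x = D [j, i] x" for i j x using sym[of i j x] by simp
  qed (use \<rho> C Gc in \<open>auto simp: S_def\<close>)
  have rh: "reverse_hoelder T.T \<rho> A 4 ?n ?\<omega>"
  proof
   fix x :: "real^'n" and r :: real assume r: "r > 0" "ball x (2 ^ 4 * r) \<subseteq> ball 0 \<rho>"
   have "(LBINT y. in_ball x r y * (T.T y)^2)
    <= S^2 * Q * \<tau>^2 * 2 ^ ?n * (LBINT y. in_ball x (16 * r) y * (T.T y)^2)
    + A / r ^ ?n * (LBINT y. in_ball x (16 * r) y * T.T y)^2"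
    unfolding A_def Q_def using r by (intro T.reverse_hoelder_T \<tau>) auto
   also have "... <= \<kappa> * (LBINT y. in_ball x (16 * r) y * (T.T y)^2)
    + A / r ^ ?n * (LBINT y. in_ball x (16 * r) y * T.T y)^2"
    by (intro add_right_mono mult_right_mono \<tau>\<kappa> integral_nonneg) simp
   finally show "(LBINT y. in_ball x r y * (T.T y)^2)
    <= 1 / (2 * (3 * 2 ^ 4) ^ ?n) * (LBINT y. in_ball x (2 ^ 4 * r) y * (T.T y)^2)
    + A / r ^ ?n * (LBINT y. in_ball x (2 ^ 4 * r) y * T.T y)^2"
    by (simp add: \<kappa>_def)
  qed (use \<rho> A T.T0 T.T2 T.T_out in auto)
  define I0 where "I0 = (LBINT x. (T.T x)^2)"
  define N where "N = (\<Sum>is\<in>(multi 2 :: 'n list set). LBINT x. (D is x)^2)"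
  have I0: "I0 >= 0" unfolding I0_def by (intro integral_nonneg) simp
  have nonneg: "0 <= (LBINT x. (D is x)^2)" for "is" by (intro integral_nonneg) simp
  have N: "N >= 0" unfolding N_def by (intro sum_nonneg nonneg)
  have le_N: "(LBINT x. (D is x)^2) <= N" if "length is <= 2" for "is"
   unfolding N_def by (rule member_le_sum) (use that nonneg finite_multi in auto)
  have "(LBINT x. (D is x)^2) <= (1 + C' \<rho> * (real ?n + 1)) * N" if l: "length is <= 3" for "is"
  proof (cases "length is <= 2")
   case True
   have "1 * N <= (1 + C' \<rho> * (real ?n + 1)) * N" using C'[of \<rho>] N by (intro mult_right_mono) auto
   then show ?thesis using le_N[OF True] by simp
  next
   case False
   from l obtain i j m where "is = [i, j, m]" by (cases rule: list_le_3_cases) (use False in auto)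
   then have "(LBINT x. (D is x)^2) <= C' \<rho> * ((\<Sum>i\<in>UNIV. LBINT x. (v i m x)^2) + (LBINT x. (p m x)^2))"
    using Gi by simp
   also have "... <= C' \<rho> * ((\<Sum>i\<in>(UNIV :: 'n set). N) + N)"
    using le_N[of "[_, m]"] le_N[of "[m]"] by (intro mult_left_mono add_mono sum_mono C') auto
   also have "... <= (1 + C' \<rho> * (real ?n + 1)) * N" using N by (simp add: algebra_simps)
   finally show ?thesis .
  qed
  then have "(\<Sum>is\<in>(multi 3 :: 'n list set). LBINT x. (D is x)^2) <= (\<Sum>is\<in>(multi 3 :: 'n list set). (1 + C' \<rho> * (real ?n + 1)) * N)"
   by (intro sum_mono) auto
  then have "S * (\<Sum>is\<in>multi 3. LBINT x. (D is x)^2) <= S * (S * ((1 + C' \<rho> * (real ?n + 1)) * N))"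
   using S by (intro mult_left_mono) (auto simp: S_def)
  then have I0N: "I0 <= B d * N"
   using T.T_integral_square_le unfolding I0_def B_def \<rho>_def[symmetric] by (simp add: power2_eq_square mult_ac)
  define R where "R = e d * I0 powr (q / 2)"
  have R: "R >= 0" unfolding R_def using e by simp
  have nn: "(NNINT x. in_ball 0 \<rho>' x * ennreal (T.T x powr q)) <= ennreal R"
   using geh[OF rh \<rho>(3,4)] unfolding R_def e_def I0_def q_def \<rho>(5) by simp
  have est: "integrable lborel (%x. in_ball 0 \<rho>' x * \<bar>D is x\<bar> powr q) \<and>
    (LBINT x. in_ball 0 \<rho>' x * \<bar>D is x\<bar> powr q) <= R" if l: "length is <= 3" for "is"
  proof -
   have Dis: "D is \<in> borel_fns" by (rule T.Dm[OF l])
   have le: "(NNINT x. ennreal (in_ball 0 \<rho>' x * \<bar>D is x\<bar> powr q)) <= ennreal R"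
   proof (rule order_trans[OF nn_integral_mono nn])
    show "ennreal (in_ball 0 \<rho>' x * \<bar>D is x\<bar> powr q) <= in_ball 0 \<rho>' x * ennreal (T.T x powr q)" for x
    proof (cases "x \<in> ball 0 \<rho>'")
     case True
     then have "\<bar>D is x\<bar> <= T.T x" using \<rho> by (intro T.D_le_T l) auto
     then have "\<bar>D is x\<bar> powr q <= T.T x powr q" using q by (intro powr_mono2) auto
     then show ?thesis using True by (simp add: ennreal_leI)
    qed simp
   qed
   have m: "(%x. in_ball 0 \<rho>' x * \<bar>D is x\<bar> powr q) \<in> borel_measurable lborel"
    using Dis by (intro borel_measurable_times borel_measurable_indicator powr_real_measurable borel_measurable_abs borel_measurable_const) simp_all
   have int: "integrable lborel (%x. in_ball 0 \<rho>' x * \<bar>D is x\<bar> powr q)"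
    by (rule integrableI_nonneg[OF m]) (use le in \<open>auto intro: le_less_trans\<close>)
   have "ennreal (LBINT x. in_ball 0 \<rho>' x * \<bar>D is x\<bar> powr q) <= ennreal R"
    using le by (subst (asm) nn_integral_eq_integral[OF int]) auto
   then show ?thesis using int R by (simp only: ennreal_le_iff simp_thms)
  qed
  have "(\<Sum>is\<in>(multi 3 :: 'n list set). LBINT x. in_ball 0 \<rho>' x * \<bar>D is x\<bar> powr q) <= (\<Sum>is\<in>(multi 3 :: 'n list set). R)"
   using est by (intro sum_mono) auto
  also have "... = S * R" by (simp add: S_def)
  finally have "(\<Sum>is\<in>(multi 3 :: 'n list set). LBINT x. in_ball 0 \<rho>' x * \<bar>D is x\<bar> powr q) powr (1 / q) <= (S * R) powr (1 / q)"
   using q by (intro powr_mono2 sum_nonneg integral_nonneg) auto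
  also have "(S * R) powr (1 / q) = (S * e d) powr (1 / q) * sqrt I0"
  proof -
   have "(S * R) powr (1 / q) = (S * e d) powr (1 / q) * (I0 powr (q / 2)) powr (1 / q)"
    unfolding R_def mult.assoc[symmetric] by (rule powr_mult)
   also have "(I0 powr (q / 2)) powr (1 / q) = I0 powr (1 / 2)" using q by (simp add: powr_powr)
   also have "... = sqrt I0" by (rule powr_half_sqrt[OF I0])
   finally show ?thesis .
  qed
  also have "... <= (S * e d) powr (1 / q) * (sqrt (B d) * sqrt N)"
   using I0N by (intro mult_left_mono) (auto simp flip: real_sqrt_mult)
  finally show "interior_estimate u p v d q ((S * e d) powr (1 / q) * sqrt (B d))"
   unfolding interior_estimate_def \<rho>'_def[symmetric] \<rho>_def[symmetric] N_def using est T.Dm T.D1 T.Dw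
   by (intro exI[of _ D]) (auto simp: mult.assoc)
 qed (use q B in auto)
qed

section \<open>From Sobolev functions to Borel representatives and back\<close>

lemma partials_Cons: "partials (i # is) f = pd i (partials is f)"
 by (simp add: partials_def dderivs.simps)

lemma partials_snoc: "partials (is @ [i]) f = partials is (pd i f)"
 by (simp add: partials_def dderivs_dd)

lemma test_functions_partials: "\<phi> \<in> test_functions \<Omega> ==> partials is \<phi> \<in> test_functions \<Omega>"
proof (induction "is")
 case Nil then show ?case by (simp add: partials_def)
next
 case (Cons i "is") then show ?case by (simp add: partials_Cons test_functions_dd)
qed

lemma test_functions_outside: "\<phi> \<in> test_functions \<Omega> ==> x \<notin> \<Omega> ==> \<phi> x = 0"
 using test_functionsD(3)[of \<phi> \<Omega>] closure_subset[of "{x. \<phi> x ~= 0}"] by blast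

lemma LINT_test_function:
 fixes F f :: "real^'n::finite => real"
 assumes \<Omega>: "open \<Omega>" and \<psi>: "\<psi> \<in> test_functions \<Omega>" and f: "f \<in> borel_fns"
  and ae: "AE x in lebesgue_on \<Omega>. F x = f x"
 shows "(LINT x|lebesgue_on \<Omega>. F x * \<psi> x) = (LBINT x. f x * \<psi> x)"
proof (rule lebesgue_on_representative(2))
 show "\<Omega> \<in> sets borel" using \<Omega> by simp
 show "(%x. f x * \<psi> x) \<in> borel_fns"
  using f test_functions_borel[OF \<psi>] by (rule borel_measurable_times)
 show "AE x in lebesgue_on \<Omega>. F x * \<psi> x = f x * \<psi> x" using ae by eventually_elim simp
qed (use test_functions_outside[OF \<psi>] in simp)

lemma AE_lebesgue_on_lborel:
 fixes P :: "real^'n::finite => bool"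
 assumes "open \<Omega>"
 shows "(AE x in lebesgue_on \<Omega>. P x) \<longleftrightarrow> (AE x in lborel. x \<in> \<Omega> --> P x)"
proof -
 have "\<Omega> \<inter> space lebesgue \<in> sets lebesgue" using assms by auto
 then show ?thesis by (simp add: AE_restrict_space_iff AE_completion_iff)
qed

lemma is_weak_deriv_weak_deriv: "is_weak_deriv \<Omega> is f g ==> is_weak_deriv \<Omega> is f (weak_deriv \<Omega> is f)"
 unfolding weak_deriv_def by (rule someI[where P="is_weak_deriv \<Omega> is f"])

text \<open>A solution as in the statement, after modification on a null set. Values of the Hessian on an
 exceptional null set are replaced by a fixed element of \<open>U\<close>, so that symmetry, the Lipschitz bound
 and monotonicity hold at every pair of points.\<close>

lemma solution_representative:
 fixes u :: "real^'n::finite => real"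
 assumes F: "smooth_matrix_function U F"
  and cc: "uniformly_convex_on \<Lambda> U F \<or> uniformly_concave_on \<Lambda> U F"
  and u: "u \<in> sobolev 2 \<infinity> (ball 0 1)"
  and hess: "AE x in lebesgue_on (ball 0 1). weak_hessian (ball 0 1) u x \<in> U"
  and eq: "!!\<eta>. \<eta> \<in> test_functions (ball 0 1) ==> (LINT x|lebesgue_on (ball 0 1).
   (\<Sum>i\<in>UNIV. \<Sum>j\<in>UNIV. F1 F i j (weak_hessian (ball 0 1) u x) * partials [i, j] \<eta> x)) = 0"
 obtains w p v W M where "double_divergence w p v W M \<Lambda> (b_sup U F)" "0 <= b_sup U F"
  "AE x in lebesgue_on (ball 0 1). u x = w x"
  "AE x in lebesgue_on (ball 0 1). weak_deriv (ball 0 1) [] u x = w x"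
  "!!i. AE x in lebesgue_on (ball 0 1). weak_deriv (ball 0 1) [i] u x = p i x"
  "!!i j. AE x in lebesgue_on (ball 0 1). weak_deriv (ball 0 1) [i, j] u x = v i j x"
proof -
 interpret smooth_matrix_function U F by (rule F)
 let ?B = "ball (0::real^'n) 1" and ?n = "real CARD('n)"
 let ?w = "%is. weak_deriv ?B is u"
 have Bb: "?B \<in> sets borel" by simp
 have wd: "is_weak_deriv ?B is u (?w is)" if l: "length is <= 2" for "is"
  using u l unfolding sobolev_def by (auto intro: is_weak_deriv_weak_deriv)
 have "\<forall>is\<in>multi 2. \<exists>fm. fst fm \<in> borel_fns \<and> (AE x in lebesgue_on ?B. ?w is x = fst fm x)
   \<and> (\<forall>x. x \<notin> ?B --> fst fm x = 0) \<and> (\<forall>x. \<bar>fst fm x\<bar> <= snd fm)"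
 proof
  fix "is" :: "'n list" assume "is \<in> multi 2"
  then have l: "length is <= 2" by simp
  obtain g where g: "g \<in> Lp_space \<infinity> ?B" "is_weak_deriv ?B is u g" using u l unfolding sobolev_def by blast
  have gm: "g \<in> borel_measurable (lebesgue_on ?B)" using g(1) unfolding Lp_space_def by simp
  obtain m where m: "AE x in lebesgue_on ?B. \<bar>g x\<bar> <= m" using g(1) unfolding Lp_space_def by auto
  obtain f where f: "f \<in> borel_fns" "AE x in lebesgue_on ?B. g x = f x" "!!x. x \<notin> ?B ==> f x = 0" "!!x. \<bar>f x\<bar> <= \<bar>m\<bar>"
   by (rule bounded_borel_representative[OF Bb gm m]) (rule that)
  have "AE x in lebesgue_on ?B. ?w is x = f x"
   using weak_deriv_unique[OF open_ball wd[OF l] g(2)] f(2) by eventually_elim simp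
  then show "\<exists>fm. fst fm \<in> borel_fns \<and> (AE x in lebesgue_on ?B. ?w is x = fst fm x)
   \<and> (\<forall>x. x \<notin> ?B --> fst fm x = 0) \<and> (\<forall>x. \<bar>fst fm x\<bar> <= snd fm)" by (intro exI[of _ "(f, \<bar>m\<bar>)"]) (simp add: f)
 qed
 from bchoice[OF this] obtain fm where fm: "\<forall>is\<in>multi 2. fst (fm is) \<in> borel_fns
   \<and> (AE x in lebesgue_on ?B. ?w is x = fst (fm is) x)
   \<and> (\<forall>x. x \<notin> ?B --> fst (fm is) x = 0) \<and> (\<forall>x. \<bar>fst (fm is) x\<bar> <= snd (fm is))" ..
 define R m where "R is = fst (fm is)" and "m is = snd (fm is)" for "is"
 have R: "!!is. length is <= 2 ==> R is \<in> borel_fns"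
  "!!is. length is <= 2 ==> AE x in lebesgue_on ?B. ?w is x = R is x"
  "!!is x. length is <= 2 ==> x \<notin> ?B ==> R is x = 0" "!!is x. length is <= 2 ==> \<bar>R is x\<bar> <= m is"
  using fm by (simp_all add: R_def m_def)
 have aeu: "AE x in lebesgue_on ?B. u x = R [] x"
 proof -
  have "is_weak_deriv ?B [] u u"
   using wd[of "[]"] unfolding is_weak_deriv_def by (simp add: partials_def)
  then have "AE x in lebesgue_on ?B. u x = ?w [] x" by (rule weak_deriv_unique[OF open_ball]) (rule wd, simp)
  moreover have "AE x in lebesgue_on ?B. ?w [] x = R [] x" by (rule R(2)) simp
  ultimately show ?thesis by eventually_elim simp
 qed
 have aeU: "AE x in lborel. x \<in> ?B --> (\<chi> i j. R [i, j] x) \<in> U"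
 proof -
  have "AE x in lebesgue_on ?B. \<forall>i j. ?w [i, j] x = R [i, j] x"
   unfolding AE_all_countable by (intro allI R(2)) simp
  with hess have "AE x in lebesgue_on ?B. (\<chi> i j. R [i, j] x) \<in> U"
   by eventually_elim (simp add: weak_hessian_def)
  then show ?thesis unfolding AE_lebesgue_on_lborel[OF open_ball] .
 qed
 then obtain N where N: "{x. \<not> (x \<in> ?B --> (\<chi> i j. R [i, j] x) \<in> U)} \<subseteq> N" "N \<in> null_sets lborel"
  unfolding eventually_ae_filter by auto
 have Ns: "N \<in> sets borel" using N(2) by (auto simp: null_sets_def)
 have "U ~= {}"
 proof
  assume "U = {}"
  then have "?B \<subseteq> N" using N(1) by auto
  then have "emeasure lborel ?B = 0" using N(2) by (metis Bb null_setsD1 null_sets_subset sets_lborel)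
  then show False using content_ball_gt_0_iff[of "0::real^'n" 1] by (simp add: measure_def)
 qed
 then obtain u0 where u0: "u0 \<in> U" by blast
 \<comment> \<open>a representative of the Hessian with values in \<open>U\<close> everywhere\<close>
 define Z where "Z x = (if x \<in> ?B - N then (\<chi> i j. R [i, j] x) else u0)" for x
 have ZU: "Z x \<in> U" for x using N(1) u0 by (auto simp: Z_def)
 have Zc: "Z x $ i $ j = (if x \<in> ?B - N then R [i, j] x else u0 $ i $ j)" for x i j by (simp add: Z_def)
 have Zcm: "(%x. Z x $ i $ j) \<in> borel_fns" for i j
  unfolding Zc using R(1)[of "[i, j]"] Ns by (intro measurable_If_set) auto
 have Zm: "Z \<in> borel_fns"
  unfolding borel_measurable_euclidean_space[of Z]
 proof
  fix b :: "real^'n^'n" assume "b \<in> Basis"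
  then obtain i j where "b = axis i (axis j 1)" by (auto simp: Basis_vec_def)
  then show "(%x. Z x \<bullet> b) \<in> borel_fns" using Zcm[of i j] by (simp add: inner_axis)
 qed
 define V where "V i j x = F1 F i j (Z x)" for i j x
 have Vm: "V i j \<in> borel_fns" for i j
 proof -
  have "continuous_on U (F1 F i j)"
   using smooth_F1[of i j] unfolding smooth_on_def by (metis dderivs.simps(1) empty_iff list.set(1) subsetI)
  then have "F1 F i j \<in> borel_measurable (restrict_space borel U)" by (rule borel_measurable_continuous_on_restrict)
  moreover have "Z \<in> borel \<rightarrow>\<^sub>M restrict_space borel U" using Zm ZU by (intro measurable_restrict_space2) auto
  ultimately show ?thesis unfolding V_def[abs_def] by (rule measurable_compose[rotated])
 qed
 obtain s where s: "\<bar>s\<bar> = 1" and mono: "!!\<xi> \<zeta>. \<xi> \<in> U ==> \<zeta> \<in> U ==>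
   (\<Sum>i\<in>UNIV. \<Sum>j\<in>UNIV. s * (F1 F i j \<zeta> - F1 F i j \<xi>) * (\<zeta> $ i $ j - \<xi> $ i $ j))
   >= \<Lambda> * (\<Sum>i\<in>UNIV. \<Sum>j\<in>UNIV. (\<zeta> $ i $ j - \<xi> $ i $ j)^2)"
  by (rule monotone_field[OF cc]) (rule that)
 have L: "0 <= b_sup U F" using F2_le_b_sup[OF u0, of undefined undefined undefined undefined] by linarith
 define v where "v i j x = (if x \<in> ?B then Z x $ i $ j else 0)" for i j x
 define W where "W i j x = (if x \<in> ?B then s * V i j x else 0)" for i j x
 define M1 where "M1 = (\<Sum>is\<in>(multi 2 :: 'n list set). \<bar>m is\<bar>) + (\<Sum>i\<in>UNIV. \<Sum>j\<in>UNIV. \<bar>u0 $ i $ j\<bar>)"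
 have m_le: "\<bar>R is x\<bar> <= M1" if "length is <= 2" for "is" x
 proof -
  have "\<bar>m is\<bar> <= (\<Sum>is\<in>(multi 2 :: 'n list set). \<bar>m is\<bar>)"
   using that by (intro member_le_sum finite_multi) auto
  moreover have "0 <= (\<Sum>i\<in>UNIV. \<Sum>j\<in>UNIV. \<bar>u0 $ i $ j\<bar>)" by (intro sum_nonneg) simp
  ultimately show ?thesis using R(4)[OF that, of x] unfolding M1_def by linarith
 qed
 have u0_le: "\<bar>u0 $ i $ j\<bar> <= M1" for i j
 proof -
  have "\<bar>u0 $ i $ j\<bar> <= (\<Sum>j\<in>UNIV. \<bar>u0 $ i $ j\<bar>)" by (rule member_le_sum) auto
  also have "... <= (\<Sum>i\<in>UNIV. \<Sum>j\<in>UNIV. \<bar>u0 $ i $ j\<bar>)"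
   by (rule member_le_sum[of i UNIV "%i. \<Sum>j\<in>UNIV. \<bar>u0 $ i $ j\<bar>"]) (auto intro: sum_nonneg)
  also have "... <= M1" unfolding M1_def by (simp add: sum_nonneg)
  finally show ?thesis .
 qed
 have Z_le: "\<bar>Z x $ i $ j\<bar> <= M1" for x i j using m_le[of "[i, j]"] u0_le by (simp add: Zc)
 have M1: "0 <= M1" using m_le[of "[]" 0] by simp
 define M where "M = M1 + (\<Sum>i\<in>UNIV. \<Sum>j\<in>UNIV. \<bar>V i j 0\<bar>) + b_sup U F * (?n * (?n * (2 * M1)))"
 have V_nonneg: "0 <= (\<Sum>i\<in>UNIV. \<Sum>j\<in>UNIV. \<bar>V i j 0\<bar>)" by (intro sum_nonneg) simp
 have LM: "0 <= b_sup U F * (?n * (?n * (2 * M1)))" using L M1 by simp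
 have M1M: "M1 <= M" unfolding M_def using V_nonneg LM by linarith
 have V_le: "\<bar>V i j x\<bar> <= M" for i j x
 proof -
  have "\<bar>V i j x - V i j 0\<bar> <= b_sup U F * (\<Sum>k\<in>UNIV. \<Sum>l\<in>UNIV. \<bar>Z x $ k $ l - Z 0 $ k $ l\<bar>)"
   unfolding V_def by (rule F1_Lipschitz[OF ZU ZU])
  also have "... <= b_sup U F * (\<Sum>k\<in>(UNIV :: 'n set). \<Sum>l\<in>(UNIV :: 'n set). 2 * M1)"
  proof (intro mult_left_mono[OF _ L] sum_mono)
   show "\<bar>Z x $ k $ l - Z 0 $ k $ l\<bar> <= 2 * M1" for k l using Z_le[of x k l] Z_le[of 0 k l] by linarith
  qed
  finally have 1: "\<bar>V i j x - V i j 0\<bar> <= b_sup U F * (?n * (?n * (2 * M1)))" by simp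
  have "\<bar>V i j 0\<bar> <= (\<Sum>j\<in>UNIV. \<bar>V i j 0\<bar>)" by (rule member_le_sum[of j UNIV "%j. \<bar>V i j 0\<bar>"]) auto
  also have "... <= (\<Sum>i\<in>UNIV. \<Sum>j\<in>UNIV. \<bar>V i j 0\<bar>)"
   by (rule member_le_sum[of i UNIV "%i. \<Sum>j\<in>UNIV. \<bar>V i j 0\<bar>"]) (auto intro: sum_nonneg)
  finally show ?thesis using 1 M1 unfolding M_def by linarith
 qed
 have aev: "AE x in lebesgue_on ?B. ?w [i, j] x = v i j x" for i j
 proof -
  have "AE x in lborel. x \<notin> N" using N(2) by (rule AE_not_in)
  then have "AE x in lebesgue_on ?B. x \<notin> N" unfolding AE_lebesgue_on_lborel[OF open_ball] by eventually_elim simp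
  moreover have "AE x in lebesgue_on ?B. x \<in> ?B" unfolding AE_lebesgue_on_lborel[OF open_ball] by simp
  moreover have "AE x in lebesgue_on ?B. ?w [i, j] x = R [i, j] x" by (rule R(2)) simp
  ultimately show ?thesis by eventually_elim (simp add: v_def Zc)
 qed
 have vm: "v i j \<in> borel_fns" for i j
  unfolding v_def[abs_def] using Zcm[of i j] by (intro measurable_If_set) auto
 have weak_test: "(LBINT x. R [] x * partials is \<phi> x) = (- 1) ^ length is * (LBINT x. f x * \<phi> x)"
  if l: "length is <= 2" and f: "f \<in> borel_fns" "AE x in lebesgue_on ?B. ?w is x = f x"
   and \<phi>: "\<phi> \<in> test_functions ?B" for "is" f \<phi>
  using wd[OF l] \<phi> unfolding is_weak_deriv_def
   LINT_test_function[OF open_ball \<phi> f, symmetric]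
   LINT_test_function[OF open_ball test_functions_partials[OF \<phi>] R(1)[of "[]", simplified] aeu, symmetric]
  by simp
 have dd: "double_divergence (R []) (%i. R [i]) v W M \<Lambda> (b_sup U F)"
 proof
  show "v i j x = v j i x" for i j x unfolding v_def using sym_matsD[OF U_sym[OF ZU]] by simp
  show "W i j \<in> borel_fns" for i j
   unfolding W_def[abs_def] using Vm[of i j] by (intro measurable_If_set borel_measurable_times) auto
  show "\<bar>W i j x\<bar> <= M" for i j x using V_le[of i j x] s M1 M1M by (auto simp: W_def abs_mult)
  show "\<bar>v i j x\<bar> <= M" for i j x using Z_le[of x i j] M1 M1M by (auto simp: v_def)
  show "\<bar>R [] x\<bar> <= M" "\<bar>R [i] x\<bar> <= M" for i x using m_le[of "[]" x] m_le[of "[i]" x] M1M by auto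
  show "wpd ?B i (R []) (R [i])" for i
   unfolding wpd_def using weak_test[of "[i]", OF _ R(1,2)] by (simp add: partials_1)
  show "wpd ?B j (R [i]) (v i j)" for i j
   unfolding wpd_def
  proof
   fix \<phi> assume \<phi>: "\<phi> \<in> test_functions ?B"
   have "(LBINT x. R [] x * partials [i, j] \<phi> x) = (LBINT x. v i j x * \<phi> x)"
    using weak_test[of "[i, j]", OF _ vm aev \<phi>] by simp
   moreover have "(LBINT x. R [] x * partials [i] (pd j \<phi>) x) = - (LBINT x. R [i] x * pd j \<phi> x)"
    using weak_test[of "[i]", OF _ R(1,2) test_functions_dd[OF \<phi>]] by simp
   ultimately show "(LBINT x. R [i] x * pd j \<phi> x) = - (LBINT x. v i j x * \<phi> x)"
    by (simp add: partials_1 partials_2)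
  qed
  show "(LBINT x. (\<Sum>i\<in>UNIV. \<Sum>j\<in>UNIV. W i j x * pd i (pd j \<eta>) x)) = 0" if \<eta>: "\<eta> \<in> test_functions ?B" for \<eta>
  proof -
   define f where "f x = (\<Sum>i\<in>UNIV. \<Sum>j\<in>UNIV. V i j x * pd i (pd j \<eta>) x)" for x
   have pt: "pd i (pd j \<eta>) \<in> test_functions ?B" for i j by (intro test_functions_dd \<eta>)
   have "AE x in lebesgue_on ?B. \<forall>i j. ?w [i, j] x = v i j x"
    unfolding AE_all_countable by (intro allI aev)
   moreover have "AE x in lebesgue_on ?B. x \<in> ?B" unfolding AE_lebesgue_on_lborel[OF open_ball] by simp
   ultimately have ae1: "AE x in lebesgue_on ?B. (\<Sum>i\<in>UNIV. \<Sum>j\<in>UNIV. F1 F i j (weak_hessian ?B u x) * partials [i, j] \<eta> x) = f x"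
   proof eventually_elim
    case (elim x)
    then have "weak_hessian ?B u x = Z x" by (simp add: weak_hessian_def v_def vec_eq_iff)
    then show ?case by (simp add: f_def V_def partials_2)
   qed
   have fm: "f \<in> borel_fns"
    unfolding f_def[abs_def] by (intro borel_measurable_sum borel_measurable_times Vm test_functions_borel[OF pt])
   have f0: "f x = 0" if "x \<notin> ?B" for x
    unfolding f_def using test_functions_outside[OF pt that] by simp
   have "(LBINT x. f x) = 0"
    using lebesgue_on_representative(2)[OF Bb fm ae1 f0] eq[OF \<eta>] by (rule trans[OF sym])
   moreover have "(\<Sum>i\<in>UNIV. \<Sum>j\<in>UNIV. W i j x * pd i (pd j \<eta>) x) = s * f x" for x
   proof (cases "x \<in> ?B")
    case True
    then show ?thesis unfolding f_def by (simp add: W_def sum_distrib_left mult_ac)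
   next
    case False
    then show ?thesis unfolding f_def by (simp add: test_functions_outside[OF pt False])
   qed
   ultimately show ?thesis by simp
  qed
  show "\<bar>W i j x - W i j y\<bar> <= b_sup U F * (\<Sum>k\<in>UNIV. \<Sum>l\<in>UNIV. \<bar>v k l x - v k l y\<bar>)" if "x \<in> ?B" "y \<in> ?B" for x y i j
  proof -
   have "\<bar>W i j x - W i j y\<bar> = \<bar>s * (V i j x - V i j y)\<bar>" using that by (simp add: W_def algebra_simps)
   also have "... = \<bar>V i j x - V i j y\<bar>" using s by (simp add: abs_mult)
   also have "... <= b_sup U F * (\<Sum>k\<in>UNIV. \<Sum>l\<in>UNIV. \<bar>Z x $ k $ l - Z y $ k $ l\<bar>)"
    unfolding V_def by (rule F1_Lipschitz[OF ZU ZU])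
   finally show ?thesis using that by (simp add: v_def)
  qed
  show "\<Lambda> * (\<Sum>i\<in>UNIV. \<Sum>j\<in>UNIV. (v i j x - v i j y)^2)
   <= (\<Sum>i\<in>UNIV. \<Sum>j\<in>UNIV. (W i j x - W i j y) * (v i j x - v i j y))" if "x \<in> ?B" "y \<in> ?B" for x y
   using mono[OF ZU[of y] ZU[of x]] that by (simp add: v_def W_def V_def right_diff_distrib)
 qed (auto simp: R vm v_def W_def)
 show ?thesis
  by (rule that[OF dd L aeu]) (use R(2) aev in auto)
qed

text \<open>Iterated first order weak derivatives are weak derivatives of higher order.\<close>

lemma wpd_family_partials:
 fixes D :: "'n::finite list => real^'n => real"
 assumes D: "!!is l. length is < k ==> wpd \<Omega> l (D is) (D (is @ [l]))"
 shows "length is <= k ==> \<phi> \<in> test_functions \<Omega> ==>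
  (LBINT x. D [] x * partials is \<phi> x) = (- 1) ^ length is * (LBINT x. D is x * \<phi> x)"
proof (induction "is" arbitrary: \<phi> rule: rev_induct)
 case Nil then show ?case by (simp add: partials_def)
next
 case (snoc l "is")
 have "(LBINT x. D [] x * partials (is @ [l]) \<phi> x) = (- 1) ^ length is * (LBINT x. D is x * pd l \<phi> x)"
  unfolding partials_snoc using snoc.prems by (intro snoc.IH test_functions_dd) auto
 also have "(LBINT x. D is x * pd l \<phi> x) = - (LBINT x. D (is @ [l]) x * \<phi> x)"
  using D[of "is" l] snoc.prems unfolding wpd_def by simp
 finally show ?case by simp
qed

text \<open>Inside the unit ball the distance to the sphere is \<open>1 - |x|\<close>; compactness makes the infimum positive.\<close>

lemma INF_infdist_sphere:
 fixes \<Omega>' :: "(real^'n::finite) set"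
 assumes \<Omega>': "\<Omega>' ~= {}" "compact (closure \<Omega>')" "closure \<Omega>' \<subseteq> ball 0 1"
 defines "d \<equiv> (INF x\<in>\<Omega>'. infdist x (frontier (ball 0 1)))"
 shows "0 < d" "d <= 1" "\<Omega>' \<subseteq> cball 0 (1 - d)"
proof -
 have fr: "frontier (ball (0::real^'n) 1) = sphere 0 1" by simp
 have ne: "sphere (0::real^'n) 1 ~= {}" by simp
 have lower: "1 - norm x <= infdist x (sphere 0 1)" for x :: "real^'n"
  unfolding infdist_notempty[OF ne]
 proof (rule cINF_greatest[OF ne])
  fix y :: "real^'n" assume "y \<in> sphere 0 1"
  then show "1 - norm x <= dist x y" using norm_triangle_ineq2[of y x] by (simp add: dist_norm norm_minus_commute)
 qed
 have upper: "infdist x (sphere 0 1) <= 1 - norm x" if "norm x < 1" for x :: "real^'n"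
 proof (cases "x = 0")
  case True
  obtain y :: "real^'n" where "y \<in> sphere 0 1" using ne by blast
  then show ?thesis using infdist_le[of y "sphere 0 1" x] True by simp
 next
  case False
  define y where "y = (1 / norm x) *R x"
  have "y \<in> sphere 0 1" using False by (simp add: y_def)
  then have "infdist x (sphere 0 1) <= dist x y" by (rule infdist_le)
  also have "x - y = (1 - 1 / norm x) *R x" by (simp add: y_def algebra_simps)
  then have "dist x y = \<bar>1 - 1 / norm x\<bar> * norm x" by (simp add: dist_norm)
  also have "... = 1 - norm x" using False that by (simp add: abs_if field_simps)
  finally show ?thesis .
 qed
 have bdd: "bdd_below ((%x. infdist x (sphere 0 1)) ` \<Omega>')" by (rule bdd_belowI2[of _ 0]) (simp add: infdist_nonneg)
 have in_ball: "norm x < 1" if "x \<in> \<Omega>'" for x using \<Omega>'(3) closure_subset that by force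
 have dle: "d <= 1 - norm x" if "x \<in> \<Omega>'" for x
  using cINF_lower[OF bdd that] upper[OF in_ball[OF that]] unfolding d_def fr by linarith
 obtain z where z: "z \<in> \<Omega>'" using \<Omega>'(1) by blast
 show "d <= 1" using dle[OF z] norm_ge_zero[of z] by linarith
 show "\<Omega>' \<subseteq> cball 0 (1 - d)" using dle by force
 have "closure \<Omega>' ~= {}" using \<Omega>'(1) by simp
 from continuous_attains_sup[OF \<Omega>'(2) this continuous_on_norm[OF continuous_on_id]]
 obtain y where y: "y \<in> closure \<Omega>'" "!!x. x \<in> closure \<Omega>' ==> norm x <= norm y" by blast
 have "1 - norm y <= d"
  unfolding d_def fr
 proof (rule cINF_greatest[OF \<Omega>'(1)])
  fix x assume "x \<in> \<Omega>'"
  then have "norm x <= norm y" using y(2) closure_subset by blast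
  then show "1 - norm y <= infdist x (sphere 0 1)" using lower[of x] by linarith
 qed
 moreover have "norm y < 1" using y(1) \<Omega>'(3) by auto
 ultimately show "0 < d" by linarith
qed

lemma sobolev_norm_representative:
 fixes u :: "real^'n::finite => real"
 assumes "open \<Omega>" and D: "!!is. length is <= k ==> D is \<in> borel_fns"
  "!!is. length is <= k ==> AE x in lebesgue_on \<Omega>. weak_deriv \<Omega> is u x = D is x" and q: "q > 0"
 shows "sobolev_norm k q \<Omega> u = (\<Sum>is\<in>multi k. LBINT x. indicator \<Omega> x * \<bar>D is x\<bar> powr q) powr (1 / q)"
proof -
 have "(LINT x|lebesgue_on \<Omega>. \<bar>weak_deriv \<Omega> is u x\<bar> powr q) = (LBINT x. indicator \<Omega> x * \<bar>D is x\<bar> powr q)"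
  if l: "length is <= k" for "is"
 proof (rule lebesgue_on_representative(2))
  show "\<Omega> \<in> sets borel" using \<open>open \<Omega>\<close> by simp
  then show "(%x. indicator \<Omega> x * \<bar>D is x\<bar> powr q) \<in> borel_fns"
   using D(1)[OF l] by (intro borel_measurable_times borel_measurable_indicator powr_real_measurable borel_measurable_abs borel_measurable_const) simp_all
  have "AE x in lebesgue_on \<Omega>. x \<in> \<Omega>" unfolding AE_lebesgue_on_lborel[OF \<open>open \<Omega>\<close>] by simp
  with D(2)[OF l] show "AE x in lebesgue_on \<Omega>. \<bar>weak_deriv \<Omega> is u x\<bar> powr q = indicator \<Omega> x * \<bar>D is x\<bar> powr q"
   by eventually_elim simp
 qed simp
 then show ?thesis unfolding sobolev_norm_def by simp
qed

text \<open>Translation of the estimate for representatives into Sobolev norms, by uniqueness of weak derivatives.\<close>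

lemma interior_estimate_sobolev:
 fixes u :: "real^'n::finite => real"
 assumes est: "interior_estimate w p v d q k" and q: "q > 2" and k: "k >= 0" and d: "0 < d"
  and out: "!!x. x \<notin> ball 0 1 ==> w x = 0" "!!i x. x \<notin> ball 0 1 ==> p i x = 0" "!!i j x. x \<notin> ball 0 1 ==> v i j x = 0"
  and li: "locally_integrable (ball 0 1) u" and aeu: "AE x in lebesgue_on (ball 0 1). u x = w x"
  and ae: "AE x in lebesgue_on (ball 0 1). weak_deriv (ball 0 1) [] u x = w x"
   "!!i. AE x in lebesgue_on (ball 0 1). weak_deriv (ball 0 1) [i] u x = p i x"
   "!!i j. AE x in lebesgue_on (ball 0 1). weak_deriv (ball 0 1) [i, j] u x = v i j x"
  and \<Omega>': "open \<Omega>'" "\<Omega>' \<subseteq> cball 0 (1 - d)"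
 shows "u \<in> sobolev 3 (ennreal q) \<Omega>'" "sobolev_norm 3 q \<Omega>' u <= k * sobolev_norm 2 2 (ball 0 1) u"
proof -
 let ?\<rho> = "1 - d / 3" and ?\<rho>' = "1 - 2 * d / 3" and ?B = "ball (0::real^'n) 1"
 obtain D where D0: "D [] = w" "!!i. D [i] = p i" "!!i j. D [i, j] = v i j"
  and Dm: "!!is. length is <= 3 ==> D is \<in> borel_fns" and D1: "!!is. length is <= 3 ==> integrable lborel (D is)"
  and Dq: "!!is. length is <= 3 ==> integrable lborel (%x. in_ball 0 ?\<rho>' x * \<bar>D is x\<bar> powr q)"
  and Dw: "!!is l. length is <= 2 ==> wpd (ball 0 ?\<rho>) l (D is) (D (is @ [l]))"
  and De: "(\<Sum>is\<in>multi 3. LBINT x. in_ball 0 ?\<rho>' x * \<bar>D is x\<bar> powr q) powr (1 / q)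
    <= k * sqrt (\<Sum>is\<in>multi 2. LBINT x. (D is x)^2)"
  using est unfolding interior_estimate_def by blast
 have sub: "\<Omega>' \<subseteq> ball 0 ?\<rho>'" "\<Omega>' \<subseteq> ball 0 ?\<rho>" "\<Omega>' \<subseteq> ?B" using \<Omega>'(2) d by force+
 have \<Omega>'b: "\<Omega>' \<in> sets borel" using \<Omega>'(1) by simp
 have aeu': "AE x in lebesgue_on \<Omega>'. u x = D [] x"
  using aeu unfolding AE_lebesgue_on_lborel[OF open_ball] AE_lebesgue_on_lborel[OF \<Omega>'(1)] D0
  by eventually_elim (use sub in auto)
 have aeD: "AE x in lebesgue_on ?B. weak_deriv ?B is u x = D is x" if "length is <= 2" for "is"
 proof -
  have "length is <= 3" using that by simp
  then show ?thesis by (cases rule: list_le_3_cases) (use ae D0 that in auto)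
 qed
 have D_out: "D is x = 0" if "length is <= 2" "x \<notin> ?B" for "is" x
 proof -
  have "length is <= 3" using that by simp
  then show ?thesis by (cases rule: list_le_3_cases) (use out D0 that in auto)
 qed
 have wdD: "is_weak_deriv \<Omega>' is u (D is)" if l: "length is <= 3" for "is"
  unfolding is_weak_deriv_def
 proof (intro conjI ballI)
  show "locally_integrable \<Omega>' u" using li sub(3) unfolding locally_integrable_def by blast
  show "locally_integrable \<Omega>' (D is)"
   unfolding locally_integrable_def
  proof (intro allI impI)
   fix K :: "(real^'n) set" assume "compact K \<and> K \<subseteq> \<Omega>'"
   then have K: "K \<in> sets borel" by (simp add: borel_compact)
   have "AE x in lebesgue_on K. D is x = indicator K x * D is x"
    by (rule AE_I2) (simp add: space_restrict_space)
   moreover have "(%x. indicator K x * D is x) \<in> borel_fns"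
    using Dm[OF l] K by (intro borel_measurable_times borel_measurable_indicator) simp_all
   ultimately show "integrable (lebesgue_on K) (D is)"
    using lebesgue_on_representative(3)[OF K, of "%x. indicator K x * D is x"] integrable_ind[OF D1[OF l], of K] K by simp
  qed
  fix \<phi> assume \<phi>: "\<phi> \<in> test_functions \<Omega>'"
  have \<phi>\<rho>: "\<phi> \<in> test_functions (ball 0 ?\<rho>)" by (rule test_functions_mono[OF \<phi> sub(2)])
  have "(LINT x|lebesgue_on \<Omega>'. u x * partials is \<phi> x) = (LBINT x. D [] x * partials is \<phi> x)"
   by (rule LINT_test_function[OF \<Omega>'(1) test_functions_partials[OF \<phi>] Dm aeu']) simp
  also have "... = (- 1) ^ length is * (LBINT x. D is x * \<phi> x)"
   by (rule wpd_family_partials[where k=3, OF _ l \<phi>\<rho>]) (rule Dw, simp)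
  also have "(LBINT x. D is x * \<phi> x) = (LINT x|lebesgue_on \<Omega>'. D is x * \<phi> x)"
   by (rule LINT_test_function[OF \<Omega>'(1) \<phi> Dm[OF l], symmetric]) simp
  finally show "(LINT x|lebesgue_on \<Omega>'. u x * partials is \<phi> x) = (- 1) ^ length is * (LINT x|lebesgue_on \<Omega>'. D is x * \<phi> x)" .
 qed
 have qm: "(%x. indicator \<Omega>' x * \<bar>D is x\<bar> powr q) \<in> borel_fns" if l: "length is <= 3" for "is"
  using Dm[OF l] \<Omega>'b by (intro borel_measurable_times borel_measurable_indicator powr_real_measurable borel_measurable_abs borel_measurable_const) simp_all
 have le: "indicator \<Omega>' x * \<bar>D is x\<bar> powr q <= in_ball 0 ?\<rho>' x * \<bar>D is x\<bar> powr q" for "is" x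
  using sub(1) by (intro mult_right_mono) (auto simp: indicator_def)
 have qi: "integrable lborel (%x. indicator \<Omega>' x * \<bar>D is x\<bar> powr q)" if l: "length is <= 3" for "is"
  by (rule integrable_bound[OF Dq[OF l]]) (use qm[OF l] le in \<open>auto intro!: AE_I2\<close>)
 have DLp: "D is \<in> Lp_space (ennreal q) \<Omega>'" if l: "length is <= 3" for "is"
 proof -
  have 1: "AE x in lebesgue_on \<Omega>'. \<bar>D is x\<bar> powr q = indicator \<Omega>' x * \<bar>D is x\<bar> powr q"
   by (rule AE_I2) (simp add: space_restrict_space)
  have "integrable (lebesgue_on \<Omega>') (%x. \<bar>D is x\<bar> powr q)"
   using lebesgue_on_representative(3)[OF \<Omega>'b qm[OF l] 1] qi[OF l] by simp
  moreover have "D is \<in> borel_measurable (lebesgue_on \<Omega>')"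
   using Dm[OF l] by (intro measurable_restrict_space1 measurable_completion) simp
  ultimately show ?thesis using q unfolding Lp_space_def by simp
 qed
 show "u \<in> sobolev 3 (ennreal q) \<Omega>'" unfolding sobolev_def using DLp wdD by blast
 have aeD': "AE x in lebesgue_on \<Omega>'. weak_deriv \<Omega>' is u x = D is x" if l: "length is <= 3" for "is"
  by (rule weak_deriv_unique[OF \<Omega>'(1) is_weak_deriv_weak_deriv[OF wdD[OF l]] wdD[OF l]])
 have "sobolev_norm 3 q \<Omega>' u = (\<Sum>is\<in>multi 3. LBINT x. indicator \<Omega>' x * \<bar>D is x\<bar> powr q) powr (1 / q)"
  using q by (intro sobolev_norm_representative \<Omega>' Dm aeD') auto
 also have "... <= (\<Sum>is\<in>multi 3. LBINT x. in_ball 0 ?\<rho>' x * \<bar>D is x\<bar> powr q) powr (1 / q)"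
  using q by (intro powr_mono2 sum_mono integral_mono qi Dq le sum_nonneg integral_nonneg) auto
 also note De
 also have "sqrt (\<Sum>is\<in>multi 2. LBINT x. (D is x)^2) = sobolev_norm 2 2 ?B u"
 proof -
  have "(LBINT x. (D is x)^2) = (LBINT x. indicator ?B x * \<bar>D is x\<bar> powr 2)" if "length is <= 2" for "is"
   using D_out[OF that] by (intro integral_cong refl) (auto simp: indicator_def)
  then have "(\<Sum>is\<in>multi 2. LBINT x. (D is x)^2) = (\<Sum>is\<in>multi 2. LBINT x. indicator ?B x * \<bar>D is x\<bar> powr 2)"
   by (intro sum.cong refl) auto
  moreover have "sobolev_norm 2 2 ?B u = (\<Sum>is\<in>multi 2. LBINT x. indicator ?B x * \<bar>D is x\<bar> powr 2) powr (1 / 2)"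
   by (intro sobolev_norm_representative open_ball Dm aeD) auto
  moreover have "0 <= (\<Sum>is\<in>multi 2. LBINT x. indicator ?B x * \<bar>D is x\<bar> powr 2)"
   by (intro sum_nonneg integral_nonneg) auto
  ultimately show ?thesis by (simp add: powr_half_sqrt)
 qed
 finally show "sobolev_norm 3 q \<Omega>' u <= k * sobolev_norm 2 2 ?B u" .
qed

theorem proposition1p1:
  assumes "CARD('n::finite) \<ge> 2"
  shows "\<exists>C :: real \<Rightarrow> real \<Rightarrow> real \<Rightarrow> real.
    \<forall>(\<Lambda> :: real) (U :: (real^'n^'n) set) (F :: real^'n^'n \<Rightarrow> real) (u :: real^'n \<Rightarrow> real).
      \<Lambda> > 0 \<longrightarrow>
      convex U \<longrightarrow> openin (top_of_set sym_mats) U \<longrightarrow>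
      smooth_on sym_mats U F \<longrightarrow>
      (uniformly_convex_on \<Lambda> U F \<or> uniformly_concave_on \<Lambda> U F) \<longrightarrow>
      bdd_above (b_values U F) \<longrightarrow>
      u \<in> sobolev 2 \<infinity> (ball 0 1) \<longrightarrow>
      (AE x in lebesgue_on (ball 0 1). weak_hessian (ball 0 1) u x \<in> U) \<longrightarrow>
      (\<forall>\<eta>\<in>test_functions (ball 0 1).
         (LINT x|lebesgue_on (ball 0 1).
            (\<Sum>i\<in>UNIV. \<Sum>j\<in>UNIV. F1 F i j (weak_hessian (ball 0 1) u x) * partials [i, j] \<eta> x)) = 0) \<longrightarrow>
      (\<exists>p\<^sub>0 :: real. p\<^sub>0 > 2 \<and>
        (\<forall>\<Omega>'. open \<Omega>' \<and> compact (closure \<Omega>') \<and> closure \<Omega>' \<subseteq> ball 0 1 \<longrightarrow>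
           u \<in> sobolev 3 (ennreal p\<^sub>0) \<Omega>' \<and>
           sobolev_norm 3 p\<^sub>0 \<Omega>' u
             \<le> C \<Lambda> (b_sup U F) (INF x\<in>\<Omega>'. infdist x (frontier (ball 0 1)))
                * sobolev_norm 2 2 (ball 0 1) u))"
proof -
 have "\<exists>q k. \<Lambda> > 0 --> L >= 0 --> q > 2 \<and> (\<forall>d. k d >= 0) \<and>
   (\<forall>(u :: real^'n => real) p v W M d. double_divergence u p v W M \<Lambda> L --> 0 < d --> d <= 1 -->
    interior_estimate u p v d q (k d))" for \<Lambda> L :: real
 proof (cases "\<Lambda> > 0 \<and> L >= 0")
  case True
  then have "\<Lambda> > 0" "L >= 0" by auto
  from interior_estimate_uniform[OF this, where 'n='n] show ?thesis by metis
 qed auto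
 then obtain q k where q: "!!\<Lambda> L :: real. \<Lambda> > 0 ==> L >= 0 ==> q \<Lambda> L > 2"
  and k: "!!\<Lambda> L d :: real. \<Lambda> > 0 ==> L >= 0 ==> k \<Lambda> L d >= 0"
  and est: "!!\<Lambda> L (u :: real^'n => real) p v W M d. \<Lambda> > 0 ==> L >= 0 ==> double_divergence u p v W M \<Lambda> L ==>
   0 < d ==> d <= 1 ==> interior_estimate u p v d (q \<Lambda> L) (k \<Lambda> L d)"
  by metis
 show ?thesis
 proof (intro exI[of _ k] allI impI)
  fix \<Lambda> :: real and U :: "(real^'n^'n) set" and F :: "real^'n^'n => real" and u :: "real^'n => real"
  assume \<Lambda>: "\<Lambda> > 0" and U: "convex U" "openin (top_of_set sym_mats) U" "smooth_on sym_mats U F"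
   and conv: "uniformly_convex_on \<Lambda> U F \<or> uniformly_concave_on \<Lambda> U F" and bdd: "bdd_above (b_values U F)"
   and u: "u \<in> sobolev 2 \<infinity> (ball 0 1)" and hess: "AE x in lebesgue_on (ball 0 1). weak_hessian (ball 0 1) u x \<in> U"
   and eq: "\<forall>\<eta>\<in>test_functions (ball 0 1). (LINT x|lebesgue_on (ball 0 1).
      (\<Sum>i\<in>UNIV. \<Sum>j\<in>UNIV. F1 F i j (weak_hessian (ball 0 1) u x) * partials [i, j] \<eta> x)) = 0"
  have smf: "smooth_matrix_function U F" by unfold_locales (use U bdd in auto)
  have eq': "(LINT x|lebesgue_on (ball 0 1).
      (\<Sum>i\<in>UNIV. \<Sum>j\<in>UNIV. F1 F i j (weak_hessian (ball 0 1) u x) * partials [i, j] \<eta> x)) = 0"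
   if "\<eta> \<in> test_functions (ball 0 1)" for \<eta> using eq that by blast
  obtain w p v W M where dd: "double_divergence w p v W M \<Lambda> (b_sup U F)" and L: "0 <= b_sup U F"
   and ae: "AE x in lebesgue_on (ball 0 1). u x = w x"
   "AE x in lebesgue_on (ball 0 1). weak_deriv (ball 0 1) [] u x = w x"
   "!!i. AE x in lebesgue_on (ball 0 1). weak_deriv (ball 0 1) [i] u x = p i x"
   "!!i j. AE x in lebesgue_on (ball 0 1). weak_deriv (ball 0 1) [i, j] u x = v i j x"
   by (rule solution_representative[OF smf conv u hess eq']) (assumption, rule that)
  interpret double_divergence w p v W M \<Lambda> "b_sup U F" by (rule dd)
  have "\<exists>g. is_weak_deriv (ball 0 1) [] u g" using u unfolding sobolev_def by (auto dest!: spec[of _ "[]"])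
  then have li: "locally_integrable (ball 0 1) u" unfolding is_weak_deriv_def by blast
  let ?q = "q \<Lambda> (b_sup U F)" and ?k = "k \<Lambda> (b_sup U F)"
  show "\<exists>p\<^sub>0 :: real. p\<^sub>0 > 2 \<and>
    (\<forall>\<Omega>'. open \<Omega>' \<and> compact (closure \<Omega>') \<and> closure \<Omega>' \<subseteq> ball 0 1 -->
     u \<in> sobolev 3 (ennreal p\<^sub>0) \<Omega>' \<and>
     sobolev_norm 3 p\<^sub>0 \<Omega>' u <= ?k (INF x\<in>\<Omega>'. infdist x (frontier (ball 0 1))) * sobolev_norm 2 2 (ball 0 1) u)"
  proof (intro exI[of _ ?q] conjI[OF q[OF \<Lambda> L]] allI impI)
   fix \<Omega>' :: "(real^'n) set" assume \<Omega>': "open \<Omega>' \<and> compact (closure \<Omega>') \<and> closure \<Omega>' \<subseteq> ball 0 1"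
   let ?d = "INF x\<in>\<Omega>'. infdist x (frontier (ball 0 1))"
   have main: "u \<in> sobolev 3 (ennreal ?q) \<Omega>'" "sobolev_norm 3 ?q \<Omega>' u <= ?k d * sobolev_norm 2 2 (ball 0 1) u"
    if d: "0 < d" "d <= 1" "\<Omega>' \<subseteq> cball 0 (1 - d)" for d
    using interior_estimate_sobolev[OF est[OF \<Lambda> L dd d(1,2)] q[OF \<Lambda> L] k[OF \<Lambda> L] d(1) outside(1-3) li ae _ d(3)] \<Omega>' by auto
   show "u \<in> sobolev 3 (ennreal ?q) \<Omega>' \<and> sobolev_norm 3 ?q \<Omega>' u <= ?k ?d * sobolev_norm 2 2 (ball 0 1) u"
   proof (cases "\<Omega>' = {}")
    case True
    have "sobolev_norm 3 ?q \<Omega>' u = 0"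
     unfolding sobolev_norm_def True by (simp add: integral_restrict_space)
    moreover have "0 <= ?k ?d * sobolev_norm 2 2 (ball 0 1) u"
     unfolding sobolev_norm_def by (intro mult_nonneg_nonneg k \<Lambda> L powr_ge_zero)
    ultimately show ?thesis using main(1)[of 1] True by simp
   next
    case False
    then show ?thesis using main[OF INF_infdist_sphere] \<Omega>' by blast
   qed
  qed
 qed
qed

end
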